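(* Let $L$ be a lattice of signature $(2,n)$ with $n\ge3$, let $\Gamma$ be a finite-index subgroup of $\mathrm O^+(L)$, and let $\lambda=(\lambda_1\ge\cdots\ge\lambda_n\ge0)$ be a partition with ${}^t\lambda_1+{}^t\lambda_2\le n$. When $k<0$ ($k\in\mathbb Z$), we have $M_{\lambda,k}(\Gamma)=0$. Moreover, $M_{\lambda,0}(\Gamma)=0$ when $\lambda\ne1,\det$.
   Context: A lattice is a free $\mathbb Z$-module of finite rank with a nondegenerate symmetric bilinear form $(\cdot,\cdot)$ with values in $\mathbb Z$; $L_F=L\otimes_{\mathbb Z}F$. $\mathcal D$ is a fixed connected component of $\{[\omega]\in\mathbb P(L_{\mathbb C}) : (\omega,\omega)=0,\ (\omega,\bar\omega)>0\}$; $\mathrm O^+(L)$ is the subgroup of $\mathrm O(L)$ preserving $\mathcal D$. Over $\mathcal D$: $\mathcal L\subset L_{\mathbb C}\otimes\mathcal O_{\mathcal D}$ is the tautological line bundle (fiber $\mathbb C\omega$ at $[\omega]$) and $\mathcal E=\mathcal L^\perp/\mathcal L$ (fiber $\omega^\perp/\mathbb C\omega$) with its induced nondegenerate quadratic form. For a partition $\lambda$ as in the claim (${}^t\lambda$ the transpose), $d=|\lambda|$ and an $n$-dimensional complex quadratic space $V$, $V^{[d]}\subset V^{\otimes d}$ is the intersection of the kernels of all contractions $V^{\otimes d}\to V^{\otimes (d-2)}$ and $V_\lambda=c_\lambda\cdot V^{[d]}$, where $c_\lambda=b_\lambda a_\lambda$ is the Young symmetrizer of the column canonical tableau ($a_\lambda$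 the sum over the row subgroup, $b_\lambda$ the signed sum over the column subgroup); $V_\lambda$ is the irreducible representation of $\mathrm O(V)$ labelled by $\lambda$. $\lambda=1$ means $(0)$, $\lambda=\det$ means $(1^n)$. Applying this fiberwise to $\mathcal E$ gives $\mathcal E_\lambda$, and $\mathcal E_{\lambda,k}=\mathcal E_\lambda\otimes\mathcal L^{\otimes k}$. $M_{\lambda,k}(\Gamma)$ is the space of $\Gamma$-invariant holomorphic sections of $\mathcal E_{\lambda,k}$ over $\mathcal D$. *)

theory Defs
  imports "HOL-Analysis.Analysis" "HOL-Algebra.Coset" "HOL-Library.Function_Algebras"
begin

section \<open>Lattices\<close>

text \<open>
  A lattice is given by a \<open>\<int>\<close>-basis, indexed by the finite type \<open>'m\<close>, and the Gram matrix \<open>G\<close> of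
  its form with respect to this basis.  Thus \<open>L\<close> is \<open>int ^ 'm\<close>, and \<open>L\<^sub>F\<close> is \<open>F ^ 'm\<close> with the form
  \<open>bil (map_matrix of_int G)\<close>.
\<close>

definition bil :: "'a::comm_ring_1 ^ 'm ^ 'm \<Rightarrow> 'a ^ 'm \<Rightarrow> 'a ^ 'm \<Rightarrow> 'a" where
  "bil A u v = (\<Sum>i\<in>UNIV. \<Sum>j\<in>UNIV. u $ i * A $ i $ j * v $ j)"

definition lattice_gram :: "int ^ 'm ^ 'm \<Rightarrow> bool" where
  "lattice_gram G \<longleftrightarrow> transpose G = G \<and> (\<forall>u. (\<forall>v. bil G u v = 0) \<longrightarrow> u = 0)"

abbreviation real_gram :: "int ^ 'm ^ 'm \<Rightarrow> real ^ 'm ^ 'm" where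
  "real_gram \<equiv> map_matrix of_int"

abbreviation cpx_gram :: "int ^ 'm ^ 'm \<Rightarrow> complex ^ 'm ^ 'm" where
  "cpx_gram \<equiv> map_matrix of_int"

definition has_signature :: "int ^ 'm ^ 'm \<Rightarrow> nat \<Rightarrow> nat \<Rightarrow> bool" where
  "has_signature G p q \<longleftrightarrow>
     (\<exists>e :: 'm \<Rightarrow> real ^ 'm. inj e \<and> independent (range e) \<and>
        (\<forall>i j. i \<noteq> j \<longrightarrow> bil (real_gram G) (e i) (e j) = 0) \<and>
        card {i. bil (real_gram G) (e i) (e i) > 0} = p \<and>
        card {i. bil (real_gram G) (e i) (e i) < 0} = q)"

section \<open>The type IV domain and the orthogonal groups\<close>

definition line :: "complex ^ 'm \<Rightarrow> (complex ^ 'm) set" where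
  "line \<omega> = vec.span {\<omega>}"

text \<open>The projective space of lines, with the quotient topology from the nonzero vectors.\<close>

definition proj_top :: "(complex ^ 'm) set topology" where
  "proj_top = topology (\<lambda>U. U \<subseteq> line ` (- {0}) \<and> open {\<omega>. \<omega> \<noteq> 0 \<and> line \<omega> \<in> U})"

lemma openin_proj_top:
  fixes U :: "(complex ^ 'm) set set"
  shows "openin proj_top U \<longleftrightarrow> U \<subseteq> line ` (- {0}) \<and> open {\<omega>. \<omega> \<noteq> 0 \<and> line \<omega> \<in> U}"
proof -
  have "istopology (\<lambda>U :: (complex ^ 'm) set set.
          U \<subseteq> line ` (- {0}) \<and> open {\<omega>. \<omega> \<noteq> 0 \<and> line \<omega> \<in> U})"
  proof (unfold istopology_def, intro conjI allI impI)
    fix S T :: "(complex ^ 'm) set set"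
    assume S: "S \<subseteq> line ` (- {0}) \<and> open {\<omega>. \<omega> \<noteq> 0 \<and> line \<omega> \<in> S}"
      and T: "T \<subseteq> line ` (- {0}) \<and> open {\<omega>. \<omega> \<noteq> 0 \<and> line \<omega> \<in> T}"
    then show "S \<inter> T \<subseteq> line ` (- {0})" by blast
    have "{\<omega>. \<omega> \<noteq> 0 \<and> line \<omega> \<in> S \<inter> T} =
        {\<omega>. \<omega> \<noteq> 0 \<and> line \<omega> \<in> S} \<inter> {\<omega>. \<omega> \<noteq> 0 \<and> line \<omega> \<in> T}" by blast
    then show "open {\<omega>. \<omega> \<noteq> 0 \<and> line \<omega> \<in> S \<inter> T}" using S T by (simp add: open_Int)
  next
    fix K :: "(complex ^ 'm) set set set"
    assume K: "\<forall>U\<in>K. U \<subseteq> line ` (- {0}) \<and> open {\<omega>. \<omega> \<noteq> 0 \<and> line \<omega> \<in> U}"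
    then show "\<Union>K \<subseteq> line ` (- {0})" by blast
    have "{\<omega>. \<omega> \<noteq> 0 \<and> line \<omega> \<in> \<Union>K} = (\<Union>U\<in>K. {\<omega>. \<omega> \<noteq> 0 \<and> line \<omega> \<in> U})" by blast
    then show "open {\<omega>. \<omega> \<noteq> 0 \<and> line \<omega> \<in> \<Union>K}" using K by (simp add: open_UN)
  qed
  then show ?thesis by (simp add: proj_top_def topology_inverse')
qed

definition conj_vec :: "complex ^ 'm \<Rightarrow> complex ^ 'm" where
  "conj_vec v = (\<chi> i. cnj (v $ i))"

text \<open>\<open>(\<omega>, \<omega>\<bar>)\<close> is a real number because the Gram matrix is real and symmetric.\<close>

definition period_points :: "int ^ 'm ^ 'm \<Rightarrow> (complex ^ 'm) set set" where
  "period_points G = line ` {\<omega>. bil (cpx_gram G) \<omega> \<omega> = 0 \<and>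
      Re (bil (cpx_gram G) \<omega> (conj_vec \<omega>)) > 0}"

definition type_IV_domain :: "int ^ 'm ^ 'm \<Rightarrow> (complex ^ 'm) set set \<Rightarrow> bool" where
  "type_IV_domain G D \<longleftrightarrow>
     D \<in> connected_components_of (subtopology proj_top (period_points G))"

definition act :: "int ^ 'm ^ 'm \<Rightarrow> complex ^ 'm \<Rightarrow> complex ^ 'm" where
  "act g v = map_matrix of_int g *v v"

definition O_lattice :: "int ^ 'm ^ 'm \<Rightarrow> (int ^ 'm ^ 'm) set" where
  "O_lattice G = {g. invertible g \<and> (\<forall>u v. bil G (g *v u) (g *v v) = bil G u v)}"

definition O_plus :: "int ^ 'm ^ 'm \<Rightarrow> (complex ^ 'm) set set \<Rightarrow> (int ^ 'm ^ 'm) monoid" where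
  "O_plus G D = \<lparr>carrier = {g \<in> O_lattice G. (\<lambda>l. act g ` l) ` D = D},
                 monoid.mult = (**), one = mat 1\<rparr>"

section \<open>Tensors\<close>

text \<open>
  A tensor of degree \<open>d\<close> on \<open>\<complex> ^ 'm\<close> is the function sending a multi-index of length \<open>d\<close> to the
  corresponding coordinate, extended by 0 to lists of other lengths.
\<close>

type_synonym 'm tensor = "'m list \<Rightarrow> complex"

definition tscale :: "complex \<Rightarrow> 'm tensor \<Rightarrow> 'm tensor" where
  "tscale c T = (\<lambda>x. c * T x)"

global_interpretation tensor: vector_space tscale
  by unfold_locales (auto simp: tscale_def fun_eq_iff algebra_simps)

definition pure :: "(complex ^ 'm) list \<Rightarrow> 'm tensor" where
  "pure v = (\<lambda>x. if length x = length v then \<Prod>p<length v. v ! p $ (x ! p) else 0)"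

definition tensor_power :: "nat \<Rightarrow> (complex ^ 'm) set \<Rightarrow> 'm tensor set" where
  "tensor_power d W = tensor.span {pure v | v. length v = d \<and> set v \<subseteq> W}"

definition tensor_map :: "complex ^ 'm ^ 'm \<Rightarrow> 'm tensor \<Rightarrow> 'm tensor" where
  "tensor_map A T =
     (\<lambda>x. \<Sum>y | length y = length x. (\<Prod>p<length x. A $ (x ! p) $ (y ! p)) * T y)"

text \<open>
  The place permutation that moves the factor in slot \<open>p\<close> to slot \<open>\<sigma> p\<close>; this is a left action.
\<close>

definition tensor_perm :: "(nat \<Rightarrow> nat) \<Rightarrow> 'm tensor \<Rightarrow> 'm tensor" where
  "tensor_perm \<sigma> T = (\<lambda>x. T (permute_list \<sigma> x))"

text \<open>
  The contraction of slots \<open>i < j\<close> by the bilinear form with Gram matrix \<open>A\<close>; the list inside is \<open>x\<close>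
  with \<open>a\<close> and \<open>b\<close> inserted such that they end up at positions \<open>i\<close> and \<open>j\<close>.
\<close>

definition contraction ::
  "complex ^ 'm ^ 'm \<Rightarrow> nat \<Rightarrow> nat \<Rightarrow> 'm tensor \<Rightarrow> 'm tensor" where
  "contraction A i j T = (\<lambda>x. \<Sum>a\<in>UNIV. \<Sum>b\<in>UNIV.
     A $ a $ b * T (take i x @ [a] @ take (j - i - 1) (drop i x) @ [b] @ drop (j - 1) x))"

section \<open>Partitions and Young symmetrizers\<close>

definition partition_of_length :: "nat \<Rightarrow> nat list \<Rightarrow> bool" where
  "partition_of_length n lam \<longleftrightarrow> length lam = n \<and> sorted_wrt (\<ge>) lam"

text \<open>Columns are numbered from 0, so \<open>transposed lam j\<close> is the \<open>(j + 1)\<close>-st part of the transpose.\<close>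

definition transposed :: "nat list \<Rightarrow> nat \<Rightarrow> nat" where
  "transposed lam j = card {i. i < length lam \<and> j < lam ! i}"

text \<open>
  The column canonical tableau is filled column by column, from the leftmost column on and each
  column from top to bottom; \<open>col_tableau lam ! p\<close> is the cell (row, column) containing the
  \<open>(p + 1)\<close>-st entry.
\<close>

definition col_tableau :: "nat list \<Rightarrow> (nat \<times> nat) list" where
  "col_tableau lam =
     concat (map (\<lambda>j. map (\<lambda>i. (i, j)) [0..<transposed lam j]) [0..<Max (set (0 # lam))])"

definition row_subgroup :: "nat list \<Rightarrow> (nat \<Rightarrow> nat) set" where
  "row_subgroup lam = {\<sigma>. \<sigma> permutes {..<sum_list lam} \<and>
     (\<forall>p<sum_list lam. fst (col_tableau lam ! \<sigma> p) = fst (col_tableau lam ! p))}"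

definition col_subgroup :: "nat list \<Rightarrow> (nat \<Rightarrow> nat) set" where
  "col_subgroup lam = {\<sigma>. \<sigma> permutes {..<sum_list lam} \<and>
     (\<forall>p<sum_list lam. snd (col_tableau lam ! \<sigma> p) = snd (col_tableau lam ! p))}"

definition young_a :: "nat list \<Rightarrow> 'm tensor \<Rightarrow> 'm tensor" where
  "young_a lam T = (\<Sum>\<sigma>\<in>row_subgroup lam. tensor_perm \<sigma> T)"

definition young_b :: "nat list \<Rightarrow> 'm tensor \<Rightarrow> 'm tensor" where
  "young_b lam T = (\<Sum>\<sigma>\<in>col_subgroup lam. tscale (of_int (sign \<sigma>)) (tensor_perm \<sigma> T))"

definition young_c :: "nat list \<Rightarrow> 'm tensor \<Rightarrow> 'm tensor" where
  "young_c lam T = young_b lam (young_a lam T)"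

section \<open>The representations \<open>V\<^sub>\<lambda>\<close>\<close>

text \<open>
  The quadratic space is a subquotient \<open>V = W / R\<close>, where \<open>W\<close> is a subspace of \<open>\<complex> ^ 'm\<close> and \<open>R \<subseteq> W\<close>
  is contained in the radical of the restriction to \<open>W\<close> of the form with Gram matrix \<open>A\<close>.  Its
  tensor power of degree \<open>d\<close> is \<open>W\<^sup>\<otimes>\<^sup>d / N\<^sub>d\<close>, where \<open>N\<^sub>d\<close> (\<open>tensor_null d W R\<close>) is spanned by the
  pure tensors in vectors of \<open>W\<close> with a factor in \<open>R\<close>.  Elements of the quotient are cosets.
\<close>

definition tensor_null ::
  "nat \<Rightarrow> (complex ^ 'm) set \<Rightarrow> (complex ^ 'm) set \<Rightarrow> 'm tensor set" where
  "tensor_null d W R =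
     tensor.span {pure v | v. length v = d \<and> set v \<subseteq> W \<and> set v \<inter> R \<noteq> {}}"

definition tensor_coset ::
  "nat \<Rightarrow> (complex ^ 'm) set \<Rightarrow> (complex ^ 'm) set \<Rightarrow> 'm tensor \<Rightarrow> 'm tensor set" where
  "tensor_coset d W R T = (+) T ` tensor_null d W R"

text \<open>
  Representatives in \<open>W\<^sup>\<otimes>\<^sup>d\<close> of the elements of \<open>V\<^sup>[\<^sup>d\<^sup>]\<close>: a contraction of the class of \<open>T\<close> vanishes
  iff the contraction of \<open>T\<close> lies in \<open>N\<^sub>d\<^sub>-\<^sub>2\<close>.
\<close>

definition traceless ::
  "complex ^ 'm ^ 'm \<Rightarrow> nat \<Rightarrow> (complex ^ 'm) set \<Rightarrow> (complex ^ 'm) set \<Rightarrow> 'm tensor set" where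
  "traceless A d W R = {T \<in> tensor_power d W.
     \<forall>i j. i < j \<and> j < d \<longrightarrow> contraction A i j T \<in> tensor_null (d - 2) W R}"

definition orth_rep ::
  "complex ^ 'm ^ 'm \<Rightarrow> nat list \<Rightarrow> (complex ^ 'm) set \<Rightarrow> (complex ^ 'm) set
     \<Rightarrow> 'm tensor set set" where
  "orth_rep A lam W R =
     (\<lambda>T. tensor_coset (sum_list lam) W R (young_c lam T)) ` traceless A (sum_list lam) W R"

section \<open>Automorphic vector bundles and modular forms\<close>

definition perp :: "int ^ 'm ^ 'm \<Rightarrow> (complex ^ 'm) set \<Rightarrow> (complex ^ 'm) set" where
  "perp G l = {v. \<forall>w\<in>l. bil (cpx_gram G) v w = 0}"

definition E_fibre :: "int ^ 'm ^ 'm \<Rightarrow> nat list \<Rightarrow> (complex ^ 'm) set \<Rightarrow> 'm tensor set set" where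
  "E_fibre G lam l = orth_rep (cpx_gram G) lam (perp G l) l"

text \<open>
  For a line \<open>l\<close>, an element of \<open>\<E>\<^sub>\<lambda>\<^sub>,\<^sub>l \<otimes> l\<^sup>\<otimes>\<^sup>k\<close> with \<open>k \<in> \<int>\<close> is encoded as the function \<open>\<phi>\<close> on the
  nonzero vectors of \<open>l\<close> such that it equals \<open>\<phi> \<omega> \<otimes> \<omega>\<^sup>\<otimes>\<^sup>k\<close> for every such \<open>\<omega>\<close>.  These are the
  functions that are homogeneous of degree \<open>-k\<close>.
\<close>

definition Ek_fibre ::
  "int ^ 'm ^ 'm \<Rightarrow> nat list \<Rightarrow> int \<Rightarrow> (complex ^ 'm) set
     \<Rightarrow> (complex ^ 'm \<Rightarrow> 'm tensor set) set" where
  "Ek_fibre G lam k l = {\<phi> \<in> (l - {0}) \<rightarrow>\<^sub>E E_fibre G lam l.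
     \<forall>\<omega>\<in>l - {0}. \<forall>t. t \<noteq> 0 \<longrightarrow> \<phi> (t *s \<omega>) = tscale (t powi (- k)) ` \<phi> \<omega>}"

definition holomorphic_several_on :: "(complex ^ 'm \<Rightarrow> complex) \<Rightarrow> (complex ^ 'm) set \<Rightarrow> bool" where
  "holomorphic_several_on f U \<longleftrightarrow>
     (\<forall>x\<in>U. \<exists>f'. (f has_derivative f') (at x) \<and> (\<forall>c v. f' (c *s v) = c * f' v))"

text \<open>
  A section over \<open>D\<close> is the same as its homogeneous pullback to the cone \<open>\<Union>D - {0}\<close>, a complex
  submanifold of \<open>\<complex> ^ 'm\<close>.  It is holomorphic iff locally on the cone it lifts along
  \<open>(\<L>\<^sup>\<bottom>)\<^sup>\<otimes>\<^sup>d \<rightarrow> \<E>\<^sup>\<otimes>\<^sup>d\<close> to a holomorphic tensor-valued function; the latter extends to an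
  open subset of \<open>\<complex> ^ 'm\<close>.
\<close>

definition holomorphic_section ::
  "int ^ 'm ^ 'm \<Rightarrow> (complex ^ 'm) set set \<Rightarrow> nat list
     \<Rightarrow> ((complex ^ 'm) set \<Rightarrow> complex ^ 'm \<Rightarrow> 'm tensor set) \<Rightarrow> bool" where
  "holomorphic_section G D lam s \<longleftrightarrow>
     (\<forall>\<omega>\<^sub>0\<in>\<Union>D - {0}. \<exists>U T. open U \<and> \<omega>\<^sub>0 \<in> U \<and>
        (\<forall>x. holomorphic_several_on (\<lambda>\<omega>. T \<omega> x) U) \<and>
        (\<forall>l\<in>D. \<forall>\<omega>\<in>l - {0}. \<omega> \<in> U \<longrightarrow>
           T \<omega> \<in> tensor_power (sum_list lam) (perp G l) \<and>
           s l \<omega> = tensor_coset (sum_list lam) (perp G l) l (T \<omega>)))"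

definition modular_forms ::
  "int ^ 'm ^ 'm \<Rightarrow> (complex ^ 'm) set set \<Rightarrow> nat list \<Rightarrow> int \<Rightarrow> (int ^ 'm ^ 'm) set
     \<Rightarrow> ((complex ^ 'm) set \<Rightarrow> complex ^ 'm \<Rightarrow> 'm tensor set) set" where
  "modular_forms G D lam k \<Gamma> = {s \<in> (\<Pi>\<^sub>E l\<in>D. Ek_fibre G lam k l).
     holomorphic_section G D lam s \<and>
     (\<forall>g\<in>\<Gamma>. \<forall>l\<in>D. \<forall>\<omega>\<in>l - {0}.
        s (act g ` l) (act g \<omega>) = tensor_map (map_matrix of_int g) ` s l \<omega>)}"

definition zero_section ::
  "int ^ 'm ^ 'm \<Rightarrow> (complex ^ 'm) set set \<Rightarrow> nat list
     \<Rightarrow> (complex ^ 'm) set \<Rightarrow> complex ^ 'm \<Rightarrow> 'm tensor set" where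
  "zero_section G D lam =
     (\<lambda>l\<in>D. \<lambda>\<omega>\<in>l - {0}. tensor_coset (sum_list lam) (perp G l) l 0)"

end

theory Submission
  imports Defs "HOL-Complex_Analysis.Complex_Analysis" "HOL-Number_Theory.Number_Theory"
begin

text \<open>
  A modular form \<open>s\<close> is studied through the numbers \<open>F \<omega> u\<close>, the contraction of a representative of
  \<open>s\<close> at \<open>\<omega>\<close> with vectors \<open>u\<^sub>0, \<dots>, u\<^sub>d\<^sub>-\<^sub>1\<close> orthogonal to \<open>\<omega>\<close>.  They are multilinear in \<open>u\<close>,
  homogeneous of degree \<open>-k\<close> in \<open>\<omega>\<close>, invariant under \<open>\<Gamma>\<close>, and they determine \<open>s\<close>.

  Let \<open>a, b\<close> be an orthonormal basis of a positive plane with \<open>[a + i b]\<close> in the domain, and let \<open>c\<close>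
  be orthogonal to it with \<open>(c, c) = -1\<close>.  The complexified span of \<open>a, b, c\<close> meets the domain in the
  disc of the points \<open>\<omega>(z) = (a + i b) + 2 z c + z\<^sup>2 (a - i b)\<close> with \<open>\<bar>z\<bar> < 1\<close>, and
  \<open>v(z) = c + z (a - i b)\<close> is orthogonal to \<open>\<omega>(z)\<close>.  If each \<open>u\<^sub>p\<close> is either \<open>v(z)\<close> or a fixed vector
  orthogonal to \<open>a, b, c\<close>, then \<open>z \<mapsto> F \<omega>(z) u\<close> is holomorphic.  On the other hand \<open>\<omega>(z)\<close> is
  \<open>1 - \<bar>z\<bar>\<^sup>2\<close> times the vector \<open>a\<^sub>z + i b\<^sub>z\<close> of another such frame, whose third vector \<open>c\<^sub>z\<close> is congruent
  to \<open>v(z)\<close> modulo \<open>\<omega>(z)\<close>.  So this holomorphic function is \<open>(1 - \<bar>z\<bar>\<^sup>2)\<^sup>-\<^sup>k\<close> times a function of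
  frames whose absolute value is invariant under \<open>\<Gamma>\<close>.

  Suppose that the span of \<open>a, b, c\<close> is the real span of an anisotropic ternary sublattice.  Then a
  subgroup of \<open>\<Gamma>\<close> acts on the disc with compact quotient (\<open>compact_quotient\<close>), so the function of frames attains the
  maximum \<open>M\<close> of its absolute value, and the centre of the disc may be placed there.  If \<open>k < 0\<close>, the
  maximum principle on \<open>\<bar>z\<bar> \<le> 1/2\<close> gives \<open>M \<le> 3/4 M\<close>, hence \<open>M = 0\<close>.  If \<open>k = 0\<close>, the holomorphic
  function attains its maximum inside the disc and is constant (\<open>F_rational\<close>).  Since \<open>n \<ge> 3\<close>, the rank
  is at least 5, and a suitable congruence modulo the square of a prime forces three lattice vectors
  to span an anisotropic sublattice (\<open>anisotropic_residues\<close>).  A congruence does not obstruct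
  approximation, so these discs are dense, and both conclusions hold for all frames by continuity
  (\<open>F_all_frames\<close>).  This settles \<open>k < 0\<close>.

  For \<open>k = 0\<close> it follows that \<open>F\<close> is invariant under all boosts in planes spanned by \<open>a\<close> and a
  negative vector.  Three boosts along the sides of a geodesic triangle compose to a rotation, so the
  coordinates \<open>\<Phi>\<close> of \<open>s\<close> at \<open>a + i b\<close> in an orthonormal basis of the negative space form a rotation
  invariant tensor of degree \<open>d\<close> (\<open>rotation_invariance\<close>); it is also traceless.  Combining both
  properties, the sum of \<open>\<Phi>\<close> over the transpositions of one slot with all others is \<open>-(n - 1) \<Phi>\<close>.
  Choose a nonzero tensor with these properties that is antisymmetric in a set of slots of maximal
  size \<open>r\<close>; then \<open>r \<le> n\<close>.  By maximality the transpositions of an outer slot with these \<open>r\<close> slots sum to the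
  identity on it, and counting gives \<open>d - r = r (r - n)\<close>, that is \<open>d = r = n\<close> as \<open>d > 0\<close>
  (\<open>invariants_vanish\<close>).  If \<open>d = n\<close> and \<open>\<lambda>\<close> is not \<open>(1\<^sup>n)\<close>, some row of \<open>\<lambda>\<close> has at least two cells,
  and the row symmetrizer kills the alternating part.  So \<open>\<Phi> = 0\<close>.
\<close>

(* The dollar sign is the component of a vector throughout. *)
no_notation fps_nth (infixl \<open>$\<close> 75)

section \<open>Traceless rotation invariants\<close>

abbreviation slot_swap :: "nat \<Rightarrow> nat \<Rightarrow> nat \<Rightarrow> nat" where
  "slot_swap \<equiv> Transposition.transpose"

text \<open>The hypothesis \<open>rot\<close> says that the infinitesimal rotation in the plane of two basis vectors
  kills the tensor.  Apply it to \<open>I\<close> with the entry in slot \<open>p\<close> replaced by \<open>a\<close> and sum over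
  \<open>a \<noteq> I p\<close>: the slot \<open>p\<close> contributes \<open>(n - 1) \<Phi> I\<close>, and a slot \<open>r\<close> contributes a transposition, after
  the trace over \<open>p, r\<close> has been used when \<open>I r = I p\<close>.\<close>

lemma sum_transpose_from_rotation_invariance:
  fixes \<Phi> :: "(nat \<Rightarrow> nat) \<Rightarrow> complex"
  assumes trace: "\<And>I p q. \<lbrakk>p < d; q < d; p \<noteq> q; \<forall>r<d. I r < n\<rbrakk> \<Longrightarrow> (\<Sum>k<n. \<Phi> (I(p := k, q := k))) = 0"
    and rot: "\<And>I a b. \<lbrakk>a < n; b < n; a \<noteq> b; \<forall>r<d. I r < n\<rbrakk> \<Longrightarrow>
        (\<Sum>p<d. if I p = a then \<Phi> (I(p := b)) else 0) = (\<Sum>p<d. if I p = b then \<Phi> (I(p := a)) else 0)"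
    and p: "p < d" and I: "\<forall>r<d. I r < n"
  shows "(\<Sum>q\<in>{..<d} - {p}. \<Phi> (I \<circ> slot_swap p q)) = - (of_nat n - 1) * \<Phi> I"
proof -
  define i where "i = I p"
  have i: "i < n" using I p by (simp add: i_def)
  have one: "\<Phi> I + (\<Sum>r\<in>{..<d} - {p}. if I r = a then \<Phi> (I(p := a, r := i)) else 0)
      = (\<Sum>r\<in>{..<d} - {p}. if I r = i then \<Phi> (I(p := a, r := a)) else 0)"
    if a: "a \<in> {..<n} - {i}" for a
  proof -
    define J where "J = I(p := a)"
    have J: "\<forall>r<d. J r < n" using I a by (simp add: J_def)
    have "(\<Sum>r<d. if J r = a then \<Phi> (J(r := i)) else 0) = (\<Sum>r<d. if J r = i then \<Phi> (J(r := a)) else 0)"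
      using rot[OF _ i _ J, of a] a by auto
    moreover have "(\<Sum>r<d. if J r = a then \<Phi> (J(r := i)) else 0)
        = \<Phi> I + (\<Sum>r\<in>{..<d} - {p}. if I r = a then \<Phi> (I(p := a, r := i)) else 0)"
    proof -
      have "(\<Sum>r<d. if J r = a then \<Phi> (J(r := i)) else 0)
        = (if J p = a then \<Phi> (J(p := i)) else 0) + (\<Sum>r\<in>{..<d} - {p}. if J r = a then \<Phi> (J(r := i)) else 0)"
        using p by (intro sum.remove) auto
      also have "J(p := i) = I" by (auto simp: J_def i_def)
      also have "(\<Sum>r\<in>{..<d} - {p}. if J r = a then \<Phi> (J(r := i)) else 0)
          = (\<Sum>r\<in>{..<d} - {p}. if I r = a then \<Phi> (I(p := a, r := i)) else 0)"
        by (intro sum.cong) (auto simp: J_def)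
      finally show ?thesis by (simp add: J_def)
    qed
    moreover have "(\<Sum>r<d. if J r = i then \<Phi> (J(r := a)) else 0)
        = (\<Sum>r\<in>{..<d} - {p}. if I r = i then \<Phi> (I(p := a, r := a)) else 0)"
    proof -
      have "(\<Sum>r<d. if J r = i then \<Phi> (J(r := a)) else 0)
        = (if J p = i then \<Phi> (J(p := a)) else 0) + (\<Sum>r\<in>{..<d} - {p}. if J r = i then \<Phi> (J(r := a)) else 0)"
        using p by (intro sum.remove) auto
      also have "(\<Sum>r\<in>{..<d} - {p}. if J r = i then \<Phi> (J(r := a)) else 0)
          = (\<Sum>r\<in>{..<d} - {p}. if I r = i then \<Phi> (I(p := a, r := a)) else 0)"
        by (intro sum.cong) (auto simp: J_def)
      finally show ?thesis using a by (simp add: J_def)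
    qed
    ultimately show ?thesis by simp
  qed
  have "(\<Sum>a\<in>{..<n} - {i}. \<Phi> I + (\<Sum>r\<in>{..<d} - {p}. if I r = a then \<Phi> (I(p := a, r := i)) else 0))
      = (\<Sum>a\<in>{..<n} - {i}. \<Sum>r\<in>{..<d} - {p}. if I r = i then \<Phi> (I(p := a, r := a)) else 0)"
    using one by (intro sum.cong) auto
  then have total: "of_nat (n - 1) * \<Phi> I
        + (\<Sum>r\<in>{..<d} - {p}. \<Sum>a\<in>{..<n} - {i}. if I r = a then \<Phi> (I(p := a, r := i)) else 0)
      = (\<Sum>r\<in>{..<d} - {p}. \<Sum>a\<in>{..<n} - {i}. if I r = i then \<Phi> (I(p := a, r := a)) else 0)"
    unfolding sum.distrib sum_constant
      sum.swap[of "\<lambda>a r. if I r = a then \<Phi> (I(p := a, r := i)) else 0"]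
      sum.swap[of "\<lambda>a r. if I r = i then \<Phi> (I(p := a, r := a)) else 0"]
    using i by simp
  have slot: "(\<Sum>a\<in>{..<n} - {i}. if I r = a then \<Phi> (I(p := a, r := i)) else 0)
        - (\<Sum>a\<in>{..<n} - {i}. if I r = i then \<Phi> (I(p := a, r := a)) else 0) = \<Phi> (I \<circ> slot_swap p r)"
    if r: "r \<in> {..<d} - {p}" for r
  proof (cases "I r = i")
    case True
    have "(\<Sum>k<n. \<Phi> (I(p := k, r := k))) = 0" using trace[of p r I] p r I by auto
    moreover have "(\<Sum>k<n. \<Phi> (I(p := k, r := k))) = \<Phi> (I(p := i, r := i)) + (\<Sum>a\<in>{..<n} - {i}. \<Phi> (I(p := a, r := a)))"
      using i by (intro sum.remove) auto
    moreover have "I(p := i, r := i) = I \<circ> slot_swap p r"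
    proof
      fix x
      show "(I(p := i, r := i)) x = (I \<circ> slot_swap p r) x"
        using True i_def by (cases "x = p"; cases "x = r") auto
    qed
    moreover have "(\<Sum>a\<in>{..<n} - {i}. if I r = a then \<Phi> (I(p := a, r := i)) else 0) = 0"
      using True by (intro sum.neutral) auto
    ultimately show ?thesis using True by (simp add: neg_eq_iff_add_eq_0 add.commute)
  next
    case False
    have "(\<Sum>a\<in>{..<n} - {i}. if I r = a then \<Phi> (I(p := a, r := i)) else 0) = \<Phi> (I(p := I r, r := i))"
      using False I r by (subst sum.delta') auto
    moreover have "I(p := I r, r := i) = I \<circ> slot_swap p r"
      by (auto simp: fun_eq_iff i_def Transposition.transpose_def)
    ultimately show ?thesis using False by simp
  qed
  have "(\<Sum>r\<in>{..<d} - {p}. \<Phi> (I \<circ> slot_swap p r))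
      = (\<Sum>r\<in>{..<d} - {p}. (\<Sum>a\<in>{..<n} - {i}. if I r = a then \<Phi> (I(p := a, r := i)) else 0)
        - (\<Sum>a\<in>{..<n} - {i}. if I r = i then \<Phi> (I(p := a, r := a)) else 0))"
    using slot by (intro sum.cong) auto
  also have "\<dots> = - of_nat (n - 1) * \<Phi> I"
    using total by (simp add: sum_subtractf eq_neg_iff_add_eq_0 add.commute algebra_simps)
  finally show ?thesis using i by (simp add: of_nat_diff)
qed

definition antisymmetric_in :: "nat \<Rightarrow> nat \<Rightarrow> nat set \<Rightarrow> ((nat \<Rightarrow> nat) \<Rightarrow> complex) \<Rightarrow> bool" where
  "antisymmetric_in d n S \<Phi> \<longleftrightarrow> (\<forall>p\<in>S. \<forall>q\<in>S. \<forall>I. p \<noteq> q \<longrightarrow> (\<forall>r<d. I r < n) \<longrightarrow> \<Phi> (I \<circ> slot_swap p q) = - \<Phi> I)"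

text \<open>Antisymmetric slots carry distinct indices, and there are only \<open>n\<close> of them.\<close>

lemma antisymmetric_in_card:
  assumes "antisymmetric_in d n S \<Phi>" "S \<subseteq> {..<d}" "\<forall>r<d. I r < n" "\<Phi> I \<noteq> 0"
  shows "card S \<le> n"
proof -
  have "inj_on I S"
  proof (rule inj_onI, rule ccontr)
    fix p q assume pq: "p \<in> S" "q \<in> S" "I p = I q" "p \<noteq> q"
    then have "\<Phi> (I \<circ> slot_swap p q) = - \<Phi> I" using assms by (simp add: antisymmetric_in_def)
    moreover have "I \<circ> slot_swap p q = I" using pq by (auto simp: fun_eq_iff Transposition.transpose_def)
    ultimately show False using assms(4) by simp
  qed
  then have "card S = card (I ` S)" by (simp add: card_image)
  also have "\<dots> \<le> card {..<n}" using assms by (intro card_mono) auto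
  finally show ?thesis by simp
qed

lemma transpose_conj:
  assumes "p \<notin> {a, b}"
  shows "slot_swap a b \<circ> slot_swap p q = slot_swap p (slot_swap a b q) \<circ> slot_swap a b"
  using assms by (auto simp: fun_eq_iff Transposition.transpose_def)

text \<open>Up to a factor this is the projection onto antisymmetry in one more slot.\<close>

lemma antisymmetric_in_extend:
  assumes anti: "antisymmetric_in d n S \<Phi>" and S: "S \<subseteq> {..<d}" and p: "p < d" "p \<notin> S"
  shows "antisymmetric_in d n (insert p S) (\<lambda>I. \<Phi> I - (\<Sum>q\<in>S. \<Phi> (I \<circ> slot_swap p q)))"
proof -
  have fin: "finite S" using S finite_subset by blast
  have ok: "\<forall>r<d. (I \<circ> slot_swap a b) r < n" if "\<forall>r<d. I r < n" "a < d" "b < d" for I a b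
    using that by (auto simp: Transposition.transpose_def)
  have A: "\<Phi> (I \<circ> slot_swap a b) = - \<Phi> I" if "a \<in> S" "b \<in> S" "a \<noteq> b" "\<forall>r<d. I r < n" for a b I
    using anti that by (simp add: antisymmetric_in_def)
  define \<Psi> where "\<Psi> = (\<lambda>I. \<Phi> I - (\<Sum>q\<in>S. \<Phi> (I \<circ> slot_swap p q)))"
  have old: "\<Psi> (I \<circ> slot_swap a b) = - \<Psi> I" if ab: "a \<in> S" "b \<in> S" "a \<noteq> b" and I: "\<forall>r<d. I r < n" for a b I
  proof -
    have bij: "bij_betw (slot_swap a b) S S"
      using ab by (auto simp: bij_betw_def inj_on_def Transposition.transpose_def image_def split: if_splits)
    have "\<Phi> (I \<circ> slot_swap a b \<circ> slot_swap p q) = - \<Phi> (I \<circ> slot_swap p (slot_swap a b q))" if "q \<in> S" for q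
    proof -
      have "I \<circ> slot_swap a b \<circ> slot_swap p q = I \<circ> slot_swap p (slot_swap a b q) \<circ> slot_swap a b"
        using transpose_conj[of p a b q] p ab by (metis comp_assoc empty_iff insert_iff)
      moreover have "\<forall>r<d. (I \<circ> slot_swap p (slot_swap a b q)) r < n"
        using ok[OF I p(1)] S that ab by (auto simp: Transposition.transpose_def subset_iff)
      ultimately show ?thesis using A[OF ab] by (metis)
    qed
    then have "(\<Sum>q\<in>S. \<Phi> (I \<circ> slot_swap a b \<circ> slot_swap p q)) = - (\<Sum>q\<in>S. \<Phi> (I \<circ> slot_swap p (slot_swap a b q)))"
      by (simp add: sum_negf)
    also have "(\<Sum>q\<in>S. \<Phi> (I \<circ> slot_swap p (slot_swap a b q))) = (\<Sum>q\<in>S. \<Phi> (I \<circ> slot_swap p q))"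
      using sum.reindex_bij_betw[OF bij, of "\<lambda>q. \<Phi> (I \<circ> slot_swap p q)"] by simp
    finally show ?thesis using A[OF ab I] by (simp add: \<Psi>_def comp_def)
  qed
  have new: "\<Psi> (I \<circ> slot_swap p a) = - \<Psi> I" if a: "a \<in> S" and I: "\<forall>r<d. I r < n" for a I
  proof -
    have "\<Phi> (I \<circ> slot_swap p a \<circ> slot_swap p q) = - \<Phi> (I \<circ> slot_swap p q)" if q: "q \<in> S - {a}" for q
    proof -
      have "slot_swap p a \<circ> slot_swap p q = slot_swap p q \<circ> slot_swap q a"
        using a p q by (auto simp: fun_eq_iff Transposition.transpose_def)
      then have "I \<circ> slot_swap p a \<circ> slot_swap p q = I \<circ> slot_swap p q \<circ> slot_swap q a"
        by (metis comp_assoc)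
      moreover have "\<forall>r<d. (I \<circ> slot_swap p q) r < n" using ok[OF I p(1)] S q by auto
      ultimately show ?thesis using A[of q a] q a by (metis DiffE singletonI)
    qed
    then have "(\<Sum>q\<in>S - {a}. \<Phi> (I \<circ> slot_swap p a \<circ> slot_swap p q)) = - (\<Sum>q\<in>S - {a}. \<Phi> (I \<circ> slot_swap p q))"
      by (simp add: sum_negf)
    moreover have "I \<circ> slot_swap p a \<circ> slot_swap p a = I" by (simp add: comp_assoc)
    ultimately show ?thesis using fin a by (simp add: \<Psi>_def sum.remove)
  qed
  have "slot_swap a p = slot_swap p a" for a :: nat by (rule transpose_commute)
  then show ?thesis
    using old new by (fold \<Psi>_def) (auto simp: antisymmetric_in_def)
qed

text \<open>Take an element of \<open>M\<close> that is antisymmetric in a set \<open>S\<close> of \<open>r\<close> slots, with \<open>r\<close> maximal.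
  For \<open>p\<close> outside \<open>S\<close>, its antisymmetrisation with respect to \<open>p\<close> vanishes by maximality, so that the
  transpositions of \<open>p\<close> with the slots in \<open>S\<close> sum to the identity.  Summing \<open>jm\<close> over \<open>p \<in> S\<close> then
  gives \<open>d - r = r (r - n)\<close>.\<close>

lemma invariants_vanish:
  fixes M :: "((nat \<Rightarrow> nat) \<Rightarrow> complex) set"
  assumes diff: "\<And>\<Phi> \<Psi>. \<Phi> \<in> M \<Longrightarrow> \<Psi> \<in> M \<Longrightarrow> (\<lambda>I. \<Phi> I - \<Psi> I) \<in> M"
    and swap: "\<And>\<Phi> p q. \<Phi> \<in> M \<Longrightarrow> p < d \<Longrightarrow> q < d \<Longrightarrow> (\<lambda>I. \<Phi> (I \<circ> slot_swap p q)) \<in> M"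
    and jm: "\<And>\<Phi> p I. \<Phi> \<in> M \<Longrightarrow> p < d \<Longrightarrow> \<forall>r<d. I r < n \<Longrightarrow>
        (\<Sum>q\<in>{..<d} - {p}. \<Phi> (I \<circ> slot_swap p q)) = - (of_nat n - 1) * \<Phi> I"
    and noalt: "\<And>\<Phi> I. \<Phi> \<in> M \<Longrightarrow> d = n \<Longrightarrow> antisymmetric_in d n {..<d} \<Phi> \<Longrightarrow> \<forall>r<d. I r < n \<Longrightarrow> \<Phi> I = 0"
    and d: "d > 0" and \<Phi>0: "\<Phi>0 \<in> M" and I0: "\<forall>r<d. I0 r < n"
  shows "\<Phi>0 I0 = 0"
proof (rule ccontr)
  assume nz: "\<Phi>0 I0 \<noteq> 0"
  define P where "P = (\<lambda>r. \<exists>S \<Phi> I. S \<subseteq> {..<d} \<and> card S = r \<and> \<Phi> \<in> M \<and> antisymmetric_in d n S \<Phi> \<and> (\<forall>r<d. I r < n) \<and> \<Phi> I \<noteq> 0)"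
  have P0: "P 0" unfolding P_def
    by (rule exI[of _ "{}"]) (use nz \<Phi>0 I0 in \<open>auto simp: antisymmetric_in_def\<close>)
  have bound: "\<forall>r. P r \<longrightarrow> r \<le> d"
    unfolding P_def by (metis card_lessThan card_mono finite_lessThan)
  define r where "r = Greatest P"
  have "P r" unfolding r_def by (rule GreatestI_nat[of P, OF P0]) (use bound in auto)
  then obtain S \<Phi> I where S: "S \<subseteq> {..<d}" and cS: "card S = r" and M: "\<Phi> \<in> M"
    and anti: "antisymmetric_in d n S \<Phi>" and I: "\<forall>r<d. I r < n" and ne: "\<Phi> I \<noteq> 0"
    unfolding P_def by blast
  have notP: "\<not> P (Suc r)"
    using Greatest_le_nat[of P "Suc r" d] bound by (auto simp: r_def)
  have fin: "finite S" using S finite_subset by blast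
  have rn: "r \<le> n" using antisymmetric_in_card[OF anti S I ne] cS by simp
  have rd: "r \<le> d" using bound \<open>P r\<close> by blast
  have sumM: "(\<lambda>I. \<Sum>q\<in>Q. \<Phi> (I \<circ> slot_swap p q)) \<in> M" if "finite Q" "Q \<subseteq> {..<d}" "p < d" for Q p
    using that
  proof (induction Q rule: finite_induct)
    case empty
    show ?case using diff[OF M M] by simp
  next
    case (insert x Q)
    have z: "(\<lambda>I. 0) \<in> M" using diff[OF M M] by simp
    have "(\<lambda>I. 0 - \<Phi> (I \<circ> slot_swap p x)) \<in> M"
      using diff[OF z swap[OF M, of p x]] insert.prems by simp
    moreover have "(\<lambda>I. \<Sum>q\<in>Q. \<Phi> (I \<circ> slot_swap p q)) \<in> M"
      by (rule insert.IH) (use insert.prems in auto)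
    ultimately have "(\<lambda>I. (\<Sum>q\<in>Q. \<Phi> (I \<circ> slot_swap p q)) - (0 - \<Phi> (I \<circ> slot_swap p x))) \<in> M"
      using diff by blast
    moreover have "(\<Sum>q\<in>Q. \<Phi> (I \<circ> slot_swap p q)) - (0 - \<Phi> (I \<circ> slot_swap p x))
        = (\<Sum>q\<in>insert x Q. \<Phi> (I \<circ> slot_swap p q))" for I
      using insert.hyps by simp
    ultimately show ?case by (simp only:)
  qed
  have eq1: "(\<Sum>q\<in>S. \<Phi> (I \<circ> slot_swap p q)) = \<Phi> I" if p: "p \<in> {..<d} - S" for p
  proof (rule ccontr)
    assume neq: "(\<Sum>q\<in>S. \<Phi> (I \<circ> slot_swap p q)) \<noteq> \<Phi> I"
    have "P (Suc r)" unfolding P_def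
    proof (intro exI conjI)
      show "insert p S \<subseteq> {..<d}" using S p by auto
      show "card (insert p S) = Suc r" using fin p cS by simp
      show "(\<lambda>I. \<Phi> I - (\<Sum>q\<in>S. \<Phi> (I \<circ> slot_swap p q))) \<in> M"
        using diff[OF M sumM[OF fin S]] p by simp
      show "antisymmetric_in d n (insert p S) (\<lambda>I. \<Phi> I - (\<Sum>q\<in>S. \<Phi> (I \<circ> slot_swap p q)))"
        using antisymmetric_in_extend[OF anti S] p by simp
      show "\<forall>r<d. I r < n" by (fact I)
      show "\<Phi> I - (\<Sum>q\<in>S. \<Phi> (I \<circ> slot_swap p q)) \<noteq> 0" using neq by simp
    qed
    then show False using notP by blast
  qed
  have split: "(\<Sum>q\<in>{..<d} - {p}. \<Phi> (I \<circ> slot_swap p q))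
      = - (of_nat r - 1) * \<Phi> I + (\<Sum>q\<in>{..<d} - S. \<Phi> (I \<circ> slot_swap p q))" if p: "p \<in> S" for p
  proof -
    have "{..<d} - {p} = (S - {p}) \<union> ({..<d} - S)" using S p by auto
    then have "(\<Sum>q\<in>{..<d} - {p}. \<Phi> (I \<circ> slot_swap p q)) = (\<Sum>q\<in>S - {p}. \<Phi> (I \<circ> slot_swap p q)) + (\<Sum>q\<in>{..<d} - S. \<Phi> (I \<circ> slot_swap p q))"
      using fin by (simp only:) (rule sum.union_disjoint, auto)
    also have "(\<Sum>q\<in>S - {p}. \<Phi> (I \<circ> slot_swap p q)) = (\<Sum>q\<in>S - {p}. - \<Phi> I)"
      using anti I p by (intro sum.cong) (auto simp: antisymmetric_in_def)
    also have "\<dots> = - (of_nat r - 1) * \<Phi> I"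
    proof -
      have "r > 0" using p fin cS by (auto simp: card_gt_0_iff)
      then show ?thesis using p fin cS by (simp add: of_nat_diff algebra_simps)
    qed
    finally show ?thesis .
  qed
  have "(\<Sum>p\<in>S. - (of_nat n - 1) * \<Phi> I) = (\<Sum>p\<in>S. \<Sum>q\<in>{..<d} - {p}. \<Phi> (I \<circ> slot_swap p q))"
    using jm[OF M _ I] S by (intro sum.cong) auto
  also have "\<dots> = (\<Sum>p\<in>S. - (of_nat r - 1) * \<Phi> I) + (\<Sum>p\<in>S. \<Sum>q\<in>{..<d} - S. \<Phi> (I \<circ> slot_swap p q))"
    using split by (simp add: sum.distrib)
  also have "(\<Sum>p\<in>S. \<Sum>q\<in>{..<d} - S. \<Phi> (I \<circ> slot_swap p q)) = (\<Sum>q\<in>{..<d} - S. \<Sum>p\<in>S. \<Phi> (I \<circ> slot_swap q p))"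
    by (subst sum.swap) (simp add: transpose_commute)
  also have "\<dots> = of_nat (d - r) * \<Phi> I"
    using eq1 S fin cS by (simp add: card_Diff_subset)
  finally have "of_nat r * (- (of_nat n - 1)) * \<Phi> I = (of_nat r * (- (of_nat r - 1)) + (of_nat d - of_nat r)) * \<Phi> I"
    using rd cS by (simp add: of_nat_diff algebra_simps)
  then have "of_nat r * (- (of_nat n - 1)) = of_nat r * (- (of_nat r - 1)) + (of_nat d - of_nat r :: complex)"
    using ne by simp
  then have "of_int (int r * (- (int n - 1))) = (of_int (int r * (- (int r - 1)) + (int d - int r)) :: complex)"
    by simp
  then have "int r * (- (int n - 1)) = int r * (- (int r - 1)) + (int d - int r)"
    using of_int_eq_iff by blast
  then have eq: "int d - int r = int r * (int r - int n)" by (simp add: algebra_simps)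
  moreover have "int r * (int r - int n) \<le> 0" using rn by (simp add: mult_nonneg_nonpos)
  ultimately have "d = r" using rd by simp
  then have "r = n" using eq d by simp
  have "S = {..<d}" using S cS \<open>d = r\<close> by (simp add: card_subset_eq)
  then show False using noalt[OF M _ _ I] anti ne \<open>d = r\<close> \<open>r = n\<close> by simp
qed

section \<open>Pairings of tensors\<close>

lemma bil_matrix_vector: "bil A u v = (\<Sum>i\<in>UNIV. u $ i * (A *v v) $ i)"
  by (simp add: bil_def matrix_vector_mult_def sum_distrib_left mult.assoc)

lemma bil_add_left: "bil A (u + u') v = bil A u v + bil A u' v"
  and bil_add_right: "bil A u (v + v') = bil A u v + bil A u v'"
  and bil_diff_left: "bil A (u - u') v = bil A u v - bil A u' v"
  and bil_diff_right: "bil A u (v - v') = bil A u v - bil A u v'"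
  and bil_scale_left: "bil A (c *s u) v = c * bil A u v"
  and bil_scale_right: "bil A u (c *s v) = c * bil A u v"
  and bil_zero_left [simp]: "bil A 0 v = 0"
  and bil_zero_right [simp]: "bil A u 0 = 0"
  by (simp_all add: bil_def algebra_simps sum.distrib sum_subtractf sum_distrib_left)

lemma bil_minus_left: "bil A (- u) v = - bil A u v"
  and bil_minus_right: "bil A u (- v) = - bil A u v"
  by (simp_all add: bil_def sum_negf)

lemma bil_sum_left: "bil A (\<Sum>i\<in>S. f i) v = (\<Sum>i\<in>S. bil A (f i) v)"
  by (induction S rule: infinite_finite_induct) (auto simp: bil_add_left)

lemma bil_sum_right: "bil A v (\<Sum>i\<in>S. f i) = (\<Sum>i\<in>S. bil A v (f i))"
  by (induction S rule: infinite_finite_induct) (auto simp: bil_add_right)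

lemma bil_commute:
  assumes "transpose A = A"
  shows "bil A u v = bil A v u"
proof -
  have A: "A $ i $ j = A $ j $ i" for i j
    using assms by (metis Finite_Cartesian_Product.transpose_def vec_lambda_beta)
  show ?thesis unfolding bil_def
    by (subst sum.swap) (intro sum.cong refl, simp add: A mult.commute mult.left_commute)
qed

text \<open>The distributive law, with multi-indices written as lists.\<close>

lemma sum_lists_prod:
  fixes f :: "nat \<Rightarrow> 'b \<Rightarrow> 'c::comm_semiring_1"
  assumes "finite S"
  shows "(\<Sum>x | set x \<subseteq> S \<and> length x = d. \<Prod>p<d. f p (x ! p)) = (\<Prod>p<d. \<Sum>a\<in>S. f p a)"
proof (induction d arbitrary: f)
  case 0
  have "{x :: 'b list. set x \<subseteq> S \<and> x = []} = {[]}" by auto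
  then show ?case by simp
next
  case (Suc d)
  have fin: "finite {x. set x \<subseteq> S \<and> length x = d}" by (rule finite_lists_length_eq[OF assms])
  have eq: "{x. set x \<subseteq> S \<and> length x = Suc d} = (\<lambda>(a, x). a # x) ` (S \<times> {x. set x \<subseteq> S \<and> length x = d})"
    by (auto simp: length_Suc_conv image_iff)
  have "(\<Sum>x | set x \<subseteq> S \<and> length x = Suc d. \<Prod>p<Suc d. f p (x ! p))
      = (\<Sum>(a, x)\<in>S \<times> {x. set x \<subseteq> S \<and> length x = d}. \<Prod>p<Suc d. f p ((a # x) ! p))"
    unfolding eq by (subst sum.reindex) (auto simp: inj_on_def case_prod_beta)
  also have "\<dots> = (\<Sum>(a, x)\<in>S \<times> {x. set x \<subseteq> S \<and> length x = d}. f 0 a * (\<Prod>p<d. f (Suc p) (x ! p)))"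
    by (intro sum.cong) (auto simp: prod.lessThan_Suc_shift simp del: prod.lessThan_Suc)
  also have "\<dots> = (\<Sum>a\<in>S. f 0 a) * (\<Sum>x | set x \<subseteq> S \<and> length x = d. \<Prod>p<d. f (Suc p) (x ! p))"
    by (simp add: sum_product sum.cartesian_product)
  also have "\<dots> = (\<Prod>p<Suc d. \<Sum>a\<in>S. f p a)"
    using Suc[of "\<lambda>p. f (Suc p)"] by (simp add: prod.lessThan_Suc_shift del: prod.lessThan_Suc)
  finally show ?case .
qed

lemma sum_lists_prod_UNIV:
  fixes f :: "nat \<Rightarrow> 'm::finite \<Rightarrow> 'c::comm_semiring_1"
  shows "(\<Sum>x | length x = d. \<Prod>p<d. f p (x ! p)) = (\<Prod>p<d. \<Sum>a\<in>UNIV. f p a)"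
  using sum_lists_prod[of UNIV f d] by simp

lemma sum_fun_apply: "(\<Sum>i\<in>S. f i) x = (\<Sum>i\<in>S. f i x)"
  by (induction S rule: infinite_finite_induct) auto

text \<open>The contraction with \<open>d\<close> vectors, written with \<open>A *v u p\<close> so that it makes sense for all
  functions on multi-indices.\<close>

definition pairing :: "nat \<Rightarrow> complex ^ 'm ^ 'm \<Rightarrow> 'm tensor \<Rightarrow> (nat \<Rightarrow> complex ^ 'm) \<Rightarrow> complex" where
  "pairing d A T u = (\<Sum>x | length x = d. T x * (\<Prod>p<d. (A *v u p) $ (x ! p)))"

lemma pairing_add: "pairing d A (T + T') u = pairing d A T u + pairing d A T' u"
  by (simp add: pairing_def plus_fun_def algebra_simps sum.distrib)

lemma pairing_zero [simp]: "pairing d A 0 u = 0"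
  by (simp add: pairing_def zero_fun_def)

lemma pairing_tscale: "pairing d A (tscale c T) u = c * pairing d A T u"
  by (simp add: pairing_def tscale_def sum_distrib_left mult.assoc)

lemma pairing_sum: "pairing d A (\<Sum>i\<in>S. f i) u = (\<Sum>i\<in>S. pairing d A (f i) u)"
  unfolding pairing_def sum_fun_apply sum_distrib_right by (rule sum.swap)

lemma pairing_cong: "(\<And>p. p < d \<Longrightarrow> u p = u' p) \<Longrightarrow> pairing d A T u = pairing d A T u'"
  by (simp add: pairing_def)

lemma pairing_pure:
  assumes "length v = d"
  shows "pairing d A (pure v) u = (\<Prod>p<d. bil A (v ! p) (u p))"
proof -
  have "pairing d A (pure v) u = (\<Sum>x | length x = d. \<Prod>p<d. v ! p $ (x ! p) * (A *v u p) $ (x ! p))"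
    unfolding pairing_def using assms by (intro sum.cong) (auto simp: pure_def prod.distrib)
  also have "\<dots> = (\<Prod>p<d. bil A (v ! p) (u p))"
    by (simp add: sum_lists_prod_UNIV[where f = "\<lambda>p a. v ! p $ a * (A *v u p) $ a"] bil_matrix_vector)
  finally show ?thesis .
qed

text \<open>For tensors in vectors of \<open>W\<close>, only the functionals that the arguments induce on \<open>W\<close> matter.\<close>

lemma pairing_eq_if_bil_eq:
  assumes T: "T \<in> tensor_power d W"
    and eq: "\<And>p w. p < d \<Longrightarrow> w \<in> W \<Longrightarrow> bil A w (u p) = bil A w (u' p)"
  shows "pairing d A T u = pairing d A T u'"
  using T unfolding tensor_power_def
proof (induction rule: tensor.span_induct)
  case base
  show ?case by (auto simp: tensor.subspace_def pairing_add pairing_tscale)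
next
  case (step T)
  then obtain v where v: "T = pure v" "length v = d" "set v \<subseteq> W" by blast
  then have "bil A (v ! p) (u p) = bil A (v ! p) (u' p)" if "p < d" for p
    using eq that by (metis nth_mem subset_iff)
  then show ?case using v by (simp add: pairing_pure)
qed

lemma pairing_null:
  assumes T: "T \<in> tensor_null d W R"
    and u: "\<And>p r. p < d \<Longrightarrow> r \<in> R \<Longrightarrow> bil A r (u p) = 0"
  shows "pairing d A T u = 0"
  using T unfolding tensor_null_def
proof (induction rule: tensor.span_induct)
  case base
  show ?case by (auto simp: tensor.subspace_def pairing_add pairing_tscale)
next
  case (step T)
  then obtain v where v: "T = pure v" "length v = d" "set v \<inter> R \<noteq> {}" by blast
  then obtain p where p: "p < d" "v ! p \<in> R" by (auto simp: in_set_conv_nth)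
  then have "bil A (v ! p) (u p) = 0" using u by blast
  then show ?case using v p by (auto simp: pairing_pure)
qed

lemma subspace_tensor_null: "tensor.subspace (tensor_null d W R)"
  unfolding tensor_null_def by (rule tensor.subspace_span)

lemma pure_Nil: "pure [] x = (if x = [] then 1 else 0)"
  by (auto simp: pure_def)

lemma pure_Cons: "pure (a # v) x = (case x of [] \<Rightarrow> 0 | i # y \<Rightarrow> a $ i * pure v y)"
  by (cases x) (auto simp: pure_def prod.lessThan_Suc_shift simp del: prod.lessThan_Suc)

lemma pure_append:
  "length x = length v \<Longrightarrow> pure (v @ w) (x @ y) = pure v x * pure w y"
proof (induction v arbitrary: x)
  case (Cons a v)
  then show ?case by (cases x) (auto simp: pure_Cons)
qed (simp add: pure_Nil)

lemma pure_slot_diff: "pure (xs @ (a - b) # ys) = pure (xs @ a # ys) - pure (xs @ b # ys)"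
proof (induction xs)
  case Nil
  show ?case by (rule ext) (auto simp: pure_Cons algebra_simps split: list.split)
next
  case (Cons w xs)
  show ?case by (rule ext) (auto simp: pure_Cons Cons algebra_simps split: list.split)
qed

text \<open>Replace the factors one slot at a time; each difference has a factor in \<open>R\<close>.\<close>

lemma pure_replace_slots:
  assumes v: "length v = d" "set v \<subseteq> W" and \<pi>: "\<And>w. w \<in> W \<Longrightarrow> \<pi> w \<in> W \<and> w - \<pi> w \<in> R" and RW: "R \<subseteq> W"
  shows "pure v - pure (map \<pi> v) \<in> tensor_null d W R"
proof -
  define K where "K j = pure v - pure (take j (map \<pi> v) @ drop j v)" for j
  have "K j \<in> tensor_null d W R" if "j \<le> d" for j
    using that
  proof (induction j)
    case 0
    have "K 0 = 0" by (simp add: K_def)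
    then show ?case using tensor.subspace_0[OF subspace_tensor_null] by metis
  next
    case (Suc j)
    let ?xs = "take j (map \<pi> v)" and ?ys = "drop (Suc j) v" and ?w = "v ! j"
    have j: "j < length v" using Suc.prems v by simp
    have w: "?w \<in> W" using j v(2) nth_mem by blast
    have "set ?xs \<subseteq> W"
    proof
      fix x assume "x \<in> set ?xs"
      then have "x \<in> \<pi> ` set v" by (metis in_set_takeD list.set_map)
      then show "x \<in> W" using v(2) \<pi> by blast
    qed
    moreover have "set ?ys \<subseteq> W" using v(2) by (auto dest!: in_set_dropD)
    ultimately have "pure (?xs @ (?w - \<pi> ?w) # ?ys) \<in> tensor_null d W R"
      unfolding tensor_null_def using \<pi>[OF w] RW j v
      by (intro tensor.span_base CollectI exI[of _ "?xs @ (?w - \<pi> ?w) # ?ys"]) auto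
    moreover have "take j (map \<pi> v) @ drop j v = ?xs @ ?w # ?ys"
      using j by (simp add: Cons_nth_drop_Suc)
    moreover have "take (Suc j) (map \<pi> v) @ drop (Suc j) v = ?xs @ \<pi> ?w # ?ys"
      using j by (simp add: take_Suc_conv_app_nth)
    ultimately have "pure (take j (map \<pi> v) @ drop j v) - pure (take (Suc j) (map \<pi> v) @ drop (Suc j) v) \<in> tensor_null d W R"
      by (simp add: pure_slot_diff)
    then have "K j + (pure (take j (map \<pi> v) @ drop j v) - pure (take (Suc j) (map \<pi> v) @ drop (Suc j) v)) \<in> tensor_null d W R"
      using Suc by (intro tensor.subspace_add[OF subspace_tensor_null]) auto
    moreover have "K j + (pure (take j (map \<pi> v) @ drop j v) - pure (take (Suc j) (map \<pi> v) @ drop (Suc j) v)) = K (Suc j)"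
      by (simp add: K_def)
    ultimately show ?case by (simp only:)
  qed
  from this[of d] show ?thesis using v by (simp add: K_def)
qed

text \<open>The vectors \<open>c k\<close> represent an orthonormal basis, up to the sign, of the quotient of \<open>W\<close> by
  \<open>R\<close>.  A tensor is congruent modulo \<open>tensor_null\<close> to its expansion in this basis, whose coefficients
  are the pairings.\<close>

lemma tensor_null_if_pairings_vanish:
  fixes c :: "nat \<Rightarrow> complex ^ 'm"
  assumes T: "T \<in> tensor_power d W"
    and W: "vec.subspace W" and RW: "R \<subseteq> W"
    and c: "\<And>k. k < n \<Longrightarrow> c k \<in> W"
    and proj: "\<And>w. w \<in> W \<Longrightarrow> w + (\<Sum>k<n. bil A w (c k) *s c k) \<in> R"
    and van: "\<And>I. (\<forall>p<d. I p < n) \<Longrightarrow> pairing d A T (\<lambda>p. c (I p)) = 0"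
  shows "T \<in> tensor_null d W R"
proof -
  define X where "X = {x. set x \<subseteq> {..<n} \<and> length x = d}"
  have finX: "finite X" unfolding X_def by (rule finite_lists_length_eq) simp
  define \<pi> where "\<pi> w = (\<Sum>k<n. (- bil A w (c k)) *s c k)" for w
  define E where "E T = (\<Sum>x\<in>X. tscale ((- 1) ^ d * pairing d A T (\<lambda>p. c (x ! p))) (pure (map c x)))" for T
  have E_add: "E (T + T') = E T + E T'" for T T'
    by (simp add: E_def pairing_add sum.distrib tensor.scale_left_distrib algebra_simps)
  have E_scale: "E (tscale a T) = tscale a (E T)" for a T
    by (simp add: E_def pairing_tscale tensor.scale_sum_right mult.left_commute)
  have E0: "E 0 = 0" by (simp add: E_def)
  have \<pi>: "\<pi> w \<in> W \<and> w - \<pi> w \<in> R" if "w \<in> W" for w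
  proof
    show "\<pi> w \<in> W" unfolding \<pi>_def
      using c by (intro vec.subspace_sum[OF W] vec.subspace_scale[OF W]) auto
    have "w - \<pi> w = w + (\<Sum>k<n. bil A w (c k) *s c k)"
      by (simp add: \<pi>_def sum_negf)
    then show "w - \<pi> w \<in> R" using proj[OF that] by (simp only:)
  qed
  have E_pure: "E (pure v) = pure (map \<pi> v)" if v: "length v = d" for v
  proof
    fix y
    have E: "E (pure v) y = (\<Sum>x\<in>X. (\<Prod>p<d. - bil A (v ! p) (c (x ! p))) * pure (map c x) y)"
      unfolding E_def sum_fun_apply
      by (intro sum.cong refl) (simp add: tscale_def pairing_pure[OF v] prod_uminus)
    show "E (pure v) y = pure (map \<pi> v) y"
    proof (cases "length y = d")
      case True
      have "E (pure v) y = (\<Sum>x\<in>X. \<Prod>p<d. - bil A (v ! p) (c (x ! p)) * c (x ! p) $ (y ! p))"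
        unfolding E X_def by (intro sum.cong refl) (auto simp: pure_def True simp flip: prod.distrib)
      also have "\<dots> = (\<Prod>p<d. \<Sum>k<n. - bil A (v ! p) (c k) * c k $ (y ! p))"
        unfolding X_def by (rule sum_lists_prod[where f = "\<lambda>p k. - bil A (v ! p) (c k) * c k $ (y ! p)"]) simp
      also have "\<dots> = pure (map \<pi> v) y"
        using True v by (simp add: pure_def \<pi>_def)
      finally show ?thesis .
    next
      case False
      then have "pure (map c x) y = 0" if "x \<in> X" for x using that by (auto simp: pure_def X_def)
      then have "E (pure v) y = 0" unfolding E by (intro sum.neutral) auto
      then show ?thesis using False v by (auto simp: pure_def)
    qed
  qed
  have "tensor.subspace {T. T - E T \<in> tensor_null d W R}"
  proof (rule tensor.subspaceI)
    show "0 \<in> {T. T - E T \<in> tensor_null d W R}"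
      using tensor.subspace_0[OF subspace_tensor_null] by (simp add: E0)
  next
    fix T T' assume "T \<in> {T. T - E T \<in> tensor_null d W R}" "T' \<in> {T. T - E T \<in> tensor_null d W R}"
    then have "(T - E T) + (T' - E T') \<in> tensor_null d W R"
      using tensor.subspace_add[OF subspace_tensor_null] by blast
    moreover have "T + T' - E (T + T') = (T - E T) + (T' - E T')" by (simp add: E_add)
    ultimately show "T + T' \<in> {T. T - E T \<in> tensor_null d W R}" by (simp only: mem_Collect_eq)
  next
    fix a T assume "T \<in> {T. T - E T \<in> tensor_null d W R}"
    then have "tscale a (T - E T) \<in> tensor_null d W R"
      using tensor.subspace_scale[OF subspace_tensor_null] by blast
    moreover have "tscale a T - E (tscale a T) = tscale a (T - E T)"
      by (simp add: E_scale tensor.scale_right_diff_distrib)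
    ultimately show "tscale a T \<in> {T. T - E T \<in> tensor_null d W R}" by (simp only: mem_Collect_eq)
  qed
  moreover have "{pure v |v. length v = d \<and> set v \<subseteq> W} \<subseteq> {T. T - E T \<in> tensor_null d W R}"
    using pure_replace_slots[OF _ _ \<pi> RW] E_pure by auto
  ultimately have "T - E T \<in> tensor_null d W R"
    using T tensor.span_minimal unfolding tensor_power_def by blast
  moreover have "E T = 0" unfolding E_def
  proof (rule sum.neutral, safe)
    fix x assume x: "x \<in> X"
    then have "pairing d A T (\<lambda>p. c (x ! p)) = 0"
      by (intro van) (auto simp: X_def subset_iff)
    then show "tscale ((- 1) ^ d * pairing d A T (\<lambda>p. c (x ! p))) (pure (map c x)) = 0" by simp
  qed
  ultimately show ?thesis by simp
qed

text \<open>The hypothesis says that \<open>g\<close> is an isometry.\<close>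

lemma pairing_tensor_map:
  assumes g: "transpose g ** A ** g = A"
  shows "pairing d A (tensor_map g T) (\<lambda>p. g *v u p) = pairing d A T u"
proof -
  have gA: "(\<Sum>a\<in>UNIV. g $ a $ b * (A *v (g *v w)) $ a) = (A *v w) $ b" for b w
  proof -
    have "(\<Sum>a\<in>UNIV. g $ a $ b * (A *v (g *v w)) $ a) = (transpose g *v (A *v (g *v w))) $ b"
      unfolding Finite_Cartesian_Product.transpose_def matrix_vector_mult_def[of "\<chi> i j. g $ j $ i"] by simp
    also have "transpose g *v (A *v (g *v w)) = A *v w"
      using g by (simp add: matrix_vector_mul_assoc matrix_mul_assoc)
    finally show ?thesis .
  qed
  have "pairing d A (tensor_map g T) (\<lambda>p. g *v u p)
      = (\<Sum>x | length x = d. \<Sum>y | length y = d. T y * (\<Prod>p<d. g $ (x ! p) $ (y ! p) * (A *v (g *v u p)) $ (x ! p)))"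
    unfolding pairing_def tensor_map_def
    by (intro sum.cong refl) (simp add: sum_distrib_right sum_distrib_left prod.distrib mult_ac)
  also have "\<dots> = (\<Sum>y | length y = d. T y * (\<Sum>x | length x = d. \<Prod>p<d. g $ (x ! p) $ (y ! p) * (A *v (g *v u p)) $ (x ! p)))"
    by (subst sum.swap) (simp add: sum_distrib_left)
  also have "\<dots> = (\<Sum>y | length y = d. T y * (\<Prod>p<d. (A *v u p) $ (y ! p)))"
    by (simp add: gA sum_lists_prod_UNIV[where f = "\<lambda>p a. g $ a $ (y ! p) * (A *v (g *v u p)) $ a" for y :: "'a list"])
  finally show ?thesis by (simp add: pairing_def)
qed

lemma permute_list_bij:
  assumes "\<sigma> permutes {..<d}"
  shows "bij_betw (permute_list \<sigma>) {x :: 'a list. length x = d} {x. length x = d}"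
proof (rule bij_betw_byWitness[where f' = "permute_list (inv_into UNIV \<sigma>)"])
  have i: "inv_into UNIV \<sigma> permutes {..<d}" using assms by (rule permutes_inv)
  show "\<forall>x\<in>{x :: 'a list. length x = d}. permute_list (inv_into UNIV \<sigma>) (permute_list \<sigma> x) = x"
    using assms i by (auto simp: permute_list_compose[symmetric] permutes_inv_o)
  show "\<forall>x\<in>{x :: 'a list. length x = d}. permute_list \<sigma> (permute_list (inv_into UNIV \<sigma>) x) = x"
    using assms i by (auto simp: permute_list_compose[symmetric] permutes_inv_o)
qed auto

lemma pairing_tensor_perm:
  assumes \<sigma>: "\<sigma> permutes {..<d}"
  shows "pairing d A (tensor_perm \<sigma> T) u = pairing d A T (u \<circ> \<sigma>)"
proof -
  have "(\<Prod>p<d. (A *v u p) $ (x ! p)) = (\<Prod>p<d. (A *v u (\<sigma> p)) $ (permute_list \<sigma> x ! p))" if "length x = d" for x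
    using prod.permute[OF \<sigma>, of "\<lambda>p. (A *v u p) $ (x ! p)"] \<sigma> that
    by (simp add: permute_list_nth)
  then have "pairing d A (tensor_perm \<sigma> T) u
      = (\<Sum>x | length x = d. T (permute_list \<sigma> x) * (\<Prod>p<d. (A *v u (\<sigma> p)) $ (permute_list \<sigma> x ! p)))"
    by (simp add: pairing_def tensor_perm_def)
  also have "\<dots> = (\<Sum>x | length x = d. T x * (\<Prod>p<d. (A *v u (\<sigma> p)) $ (x ! p)))"
    using sum.reindex_bij_betw[OF permute_list_bij[OF \<sigma>], of "\<lambda>x. T x * (\<Prod>p<d. (A *v u (\<sigma> p)) $ (x ! p))"] by simp
  finally show ?thesis by (simp add: pairing_def)
qed

lemma pairing_young_c:
  "pairing (sum_list lam) A (young_c lam T) u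
    = (\<Sum>\<sigma>\<in>col_subgroup lam. of_int (sign \<sigma>) * (\<Sum>\<tau>\<in>row_subgroup lam. pairing (sum_list lam) A T (u \<circ> \<sigma> \<circ> \<tau>)))"
proof -
  have "pairing (sum_list lam) A (tensor_perm \<sigma> (young_a lam T)) u
      = (\<Sum>\<tau>\<in>row_subgroup lam. pairing (sum_list lam) A T (u \<circ> \<sigma> \<circ> \<tau>))" if "\<sigma> \<in> col_subgroup lam" for \<sigma>
  proof -
    have "pairing (sum_list lam) A (tensor_perm \<sigma> (young_a lam T)) u = pairing (sum_list lam) A (young_a lam T) (u \<circ> \<sigma>)"
      using that by (intro pairing_tensor_perm) (simp add: col_subgroup_def)
    also have "\<dots> = (\<Sum>\<tau>\<in>row_subgroup lam. pairing (sum_list lam) A T (u \<circ> \<sigma> \<circ> \<tau>))"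
      unfolding young_a_def pairing_sum
      by (intro sum.cong refl pairing_tensor_perm) (simp add: row_subgroup_def)
    finally show ?thesis .
  qed
  then show ?thesis
    unfolding young_c_def young_b_def pairing_sum pairing_tscale by (intro sum.cong) auto
qed

section \<open>Lattices of signature (2, n)\<close>

lemma det_map_matrix_of_int:
  "det (map_matrix of_int M :: 'a::comm_ring_1 ^ 'm ^ 'm) = of_int (det M)"
  by (simp add: det_def map_matrix_def)

lemma bil_map_of_int:
  "bil (map_matrix of_int M) (\<chi> i. of_int (u $ i)) (\<chi> i. of_int (v $ i)) = (of_int (bil M u v) :: 'a::comm_ring_1)"
  by (simp add: bil_def map_matrix_def)

lemma symmetric_map_matrix:
  "transpose M = M \<Longrightarrow> transpose (map_matrix f M) = map_matrix f M"
  by (simp add: Finite_Cartesian_Product.transpose_def map_matrix_def vec_eq_iff)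

text \<open>Rational vectors are turned into lattice vectors by a positive multiple.\<close>

lemma clear_denominators:
  fixes u :: "rat ^ 'm"
  obtains N :: int and w :: "int ^ 'm" where "N > 0" "\<And>i. of_int N * u $ i = of_int (w $ i)"
proof -
  define q where "q i = snd (quotient_of (u $ i))" for i
  define p where "p i = fst (quotient_of (u $ i))" for i
  define N where "N = (\<Prod>i\<in>UNIV. q i)"
  have q: "q i > 0" for i unfolding q_def by (rule quotient_of_denom_pos') 
  have pq: "u $ i = of_int (p i) / of_int (q i)" for i
    unfolding p_def q_def by (rule quotient_of_div) simp
  have "of_int N * u $ i = of_int ((\<chi> i. p i * (\<Prod>j\<in>UNIV - {i}. q j)) $ i)" for i
  proof -
    have "N = q i * (\<Prod>j\<in>UNIV - {i}. q j)"
      unfolding N_def by (rule prod.remove) auto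
    moreover have "(of_int (q i) :: rat) \<noteq> 0" using q[of i] by simp
    ultimately show ?thesis unfolding pq[of i] by (simp add: field_simps)
  qed
  moreover have "N > 0" unfolding N_def using q by (intro prod_pos) auto
  ultimately show ?thesis using that by blast
qed

text \<open>The hypothesis of nondegeneracy concerns integral vectors only; a rational vector in the radical
  has an integral multiple.\<close>

lemma lattice_gram_det:
  assumes "lattice_gram G"
  shows "det G \<noteq> 0"
proof
  assume 0: "det G = 0"
  let ?A = "map_matrix of_int G :: rat ^ 'a ^ 'a"
  have "det ?A = 0" using 0 by (simp add: det_map_matrix_of_int)
  then have "\<not> invertible ?A" by (simp add: invertible_det_nz)
  then obtain u where u: "?A *v u = 0" "u \<noteq> 0"
    using matrix_left_invertible_ker[of ?A] invertible_left_inverse[of ?A] by blast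
  obtain N w where N: "N > 0" "\<And>i. of_int N * u $ i = of_int (w $ i)"
    using clear_denominators by blast
  have w: "(\<chi> i. of_int (w $ i)) = of_int N *s u" using N(2) by (simp add: vec_eq_iff)
  have "(of_int (bil G v w) :: rat) = 0" for v
  proof -
    have "(of_int (bil G v w) :: rat) = bil ?A (\<chi> i. of_int (v $ i)) (of_int N *s u)"
      by (simp add: bil_map_of_int flip: w)
    also have "\<dots> = 0" unfolding bil_scale_right using u by (simp add: bil_matrix_vector)
    finally show ?thesis .
  qed
  then have "bil G w v = 0" for v
    using bil_commute[of G] assms by (metis lattice_gram_def of_int_eq_0_iff)
  then have "w = 0" using assms by (simp add: lattice_gram_def)
  then have "of_int N *s u = 0" using w by (simp add: vec_eq_iff)
  then show False using u N(1) by simp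
qed

lemma gram_nondegenerate:
  fixes u :: "'a::field_char_0 ^ 'm"
  assumes "lattice_gram G" and z: "\<And>v. bil (map_matrix of_int G) v u = 0"
  shows "u = 0"
proof -
  let ?A = "map_matrix of_int G :: 'a ^ 'm ^ 'm"
  have "det ?A \<noteq> 0" using lattice_gram_det[OF assms(1)] by (simp add: det_map_matrix_of_int)
  then have "invertible ?A" by (simp add: invertible_det_nz)
  moreover have "?A *v u = 0"
  proof (rule vec_eq_iff[THEN iffD2], rule allI)
    fix i
    have "bil ?A (axis i 1) u = (?A *v u) $ i"
      by (simp add: bil_matrix_vector axis_def if_distrib[of "\<lambda>x. x * _"] cong: if_cong)
    then show "(?A *v u) $ i = 0 $ i" using z by simp
  qed
  ultimately show ?thesis using matrix_left_invertible_ker[of ?A] invertible_left_inverse[of ?A] by blast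
qed

lemma orthogonal_independent:
  fixes A :: "'a::field ^ 'm ^ 'm"
  assumes fin: "finite S" and orth: "\<And>x y. x \<in> S \<Longrightarrow> y \<in> S \<Longrightarrow> x \<noteq> y \<Longrightarrow> bil A x y = 0"
    and nz: "\<And>x. x \<in> S \<Longrightarrow> bil A x x \<noteq> 0"
  shows "vec.independent S"
  unfolding vec.dependent_finite[OF fin]
proof safe
  fix u v assume sum: "(\<Sum>v\<in>S. u v *s v) = 0" and v: "v \<in> S" "u v \<noteq> 0"
  have "0 = (\<Sum>x\<in>S. u x * bil A x v)"
    using arg_cong[OF sum, of "\<lambda>x. bil A x v"] by (simp add: bil_sum_left bil_scale_left)
  also have "\<dots> = u v * bil A v v + (\<Sum>x\<in>S - {v}. u x * bil A x v)"
    by (rule sum.remove[OF fin v(1)])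
  also have "(\<Sum>x\<in>S - {v}. u x * bil A x v) = 0"
    using orth v by (intro sum.neutral) auto
  finally show False using nz[OF v(1)] v(2) by simp
qed

text \<open>Gram--Schmidt: while the orthogonal complement is nonzero it is again nondegenerate, hence
  contains a vector of nonzero norm.\<close>

lemma extend_orthogonal:
  fixes A :: "'a::field_char_0 ^ 'm ^ 'm"
  assumes sym: "transpose A = A" and nondeg: "\<And>u. (\<And>v. bil A v u = 0) \<Longrightarrow> u = 0"
    and fin: "finite S" and orth: "\<And>x y. x \<in> S \<Longrightarrow> y \<in> S \<Longrightarrow> x \<noteq> y \<Longrightarrow> bil A x y = 0"
    and nz: "\<And>x. x \<in> S \<Longrightarrow> bil A x x \<noteq> 0" and card: "card S < CARD('m)"
  shows "\<exists>v. (\<forall>x\<in>S. bil A v x = 0) \<and> bil A v v \<noteq> 0"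
proof (rule ccontr)
  assume "\<not> ?thesis"
  then have iso: "bil A v v = 0" if "\<forall>x\<in>S. bil A v x = 0" for v using that by blast
  define P where "P t = t - (\<Sum>e\<in>S. (bil A t e / bil A e e) *s e)" for t
  have P: "bil A (P t) x = 0" if x: "x \<in> S" for t x
  proof -
    have "bil A (P t) x = bil A t x - (\<Sum>e\<in>S. bil A t e / bil A e e * bil A e x)"
      by (simp add: P_def bil_diff_left bil_sum_left bil_scale_left)
    also have "(\<Sum>e\<in>S. bil A t e / bil A e e * bil A e x)
        = bil A t x / bil A x x * bil A x x + (\<Sum>e\<in>S - {x}. bil A t e / bil A e e * bil A e x)"
      by (rule sum.remove[OF fin x])
    also have "(\<Sum>e\<in>S - {x}. bil A t e / bil A e e * bil A e x) = 0"
      using orth x by (intro sum.neutral) auto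
    finally show ?thesis using nz[OF x] by simp
  qed
  have PP: "bil A (P r) (P t) = 0" for r t
  proof -
    have "bil A (P r + P t) (P r + P t) = 0" by (rule iso) (simp add: bil_add_left P)
    moreover have "bil A (P r) (P r) = 0" "bil A (P t) (P t) = 0" by (simp_all add: iso P)
    ultimately have "2 * bil A (P r) (P t) = 0"
      using bil_commute[OF sym, of "P t" "P r"] by (simp add: bil_add_left bil_add_right)
    then show ?thesis by simp
  qed
  have "P t = 0" for t
  proof (rule nondeg)
    fix r
    have "bil A r (P t) = bil A (P r) (P t) + (\<Sum>e\<in>S. (bil A r e / bil A e e) * bil A e (P t))"
      by (simp add: P_def[of r] bil_diff_left bil_sum_left bil_scale_left)
    also have "(\<Sum>e\<in>S. (bil A r e / bil A e e) * bil A e (P t)) = 0"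
      using P bil_commute[OF sym, of _ "P t"] by (intro sum.neutral) auto
    also have "bil A (P r) (P t) + 0 = 0" using PP by simp
    finally show "bil A r (P t) = 0" .
  qed
  then have "t = (\<Sum>e\<in>S. (bil A t e / bil A e e) *s e)" for t
    by (simp add: P_def)
  then have "t \<in> vec.span S" for t
    by (metis (no_types, lifting) vec.span_base vec.span_scale vec.span_sum)
  then have "vec.span S = UNIV" by blast
  then have "vec.dim (UNIV :: ('a ^ 'm) set) \<le> card S"
    using vec.dim_le_card[of UNIV S] fin by blast
  then show False using card unfolding vec_dim_card by simp
qed

definition cvec :: "real ^ 'm \<Rightarrow> complex ^ 'm" where
  "cvec x = (\<chi> i. of_real (x $ i))"

lemma cvec_add: "cvec (x + y) = cvec x + cvec y"
  and cvec_diff: "cvec (x - y) = cvec x - cvec y"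
  and cvec_scale: "cvec (r *\<^sub>R x) = of_real r *s cvec x"
  and cvec_zero [simp]: "cvec 0 = 0"
  and cvec_minus: "cvec (- x) = - cvec x"
  by (simp_all add: cvec_def vec_eq_iff)

lemma cvec_sum: "cvec (\<Sum>i\<in>S. f i) = (\<Sum>i\<in>S. cvec (f i))"
  by (induction S rule: infinite_finite_induct) (auto simp: cvec_add)

lemma bil_scaleR_left: "bil A (r *\<^sub>R u) v = r * bil A u v"
  and bil_scaleR_right: "bil A u (r *\<^sub>R v) = r * bil A u v"
  for A :: "real ^ 'm ^ 'm"
  using bil_scale_left[of A r u v] bil_scale_right[of A u r v] by (simp_all add: scalar_mult_eq_scaleR)

lemma bil_cvec: "bil (cpx_gram G) (cvec x) (cvec y) = of_real (bil (real_gram G) x y)"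
  by (simp add: bil_def cvec_def map_matrix_def)

locale lattice_2_n =
  fixes G :: "int ^ 'm ^ 'm" and n :: nat
  assumes gram: "lattice_gram G" and sig: "has_signature G 2 n"
begin

abbreviation B :: "real ^ 'm \<Rightarrow> real ^ 'm \<Rightarrow> real" where "B \<equiv> bil (real_gram G)"
abbreviation C :: "complex ^ 'm \<Rightarrow> complex ^ 'm \<Rightarrow> complex" where "C \<equiv> bil (cpx_gram G)"

lemma sym_real: "transpose (real_gram G) = real_gram G"
  and sym_cpx: "transpose (cpx_gram G) = cpx_gram G"
  using gram by (auto simp: lattice_gram_def intro: symmetric_map_matrix)

lemma B_commute: "B x y = B y x" by (rule bil_commute[OF sym_real])
lemma C_commute: "C x y = C y x" by (rule bil_commute[OF sym_cpx])

lemma B_nondegenerate: "(\<And>v. B v u = 0) \<Longrightarrow> u = 0"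
  by (rule gram_nondegenerate[OF gram])

text \<open>The span of \<open>e1, e2\<close> is a maximal positive subspace; all later uses of the signature go through
  this description of its orthogonal complement.\<close>

lemma signature_basis:
  obtains e1 e2 where "CARD('m) = n + 2"
    and "\<And>x. B x e1 = 0 \<Longrightarrow> B x e2 = 0 \<Longrightarrow> x \<noteq> 0 \<Longrightarrow> B x x < 0"
proof -
  obtain e :: "'m \<Rightarrow> real ^ 'm" where inj: "inj e" and ind: "independent (range e)"
    and orth: "\<And>i j. i \<noteq> j \<Longrightarrow> B (e i) (e j) = 0"
    and pos: "card {i. B (e i) (e i) > 0} = 2" and neg: "card {i. B (e i) (e i) < 0} = n"
    using sig unfolding has_signature_def by blast
  have "card (range e) = CARD('m)" using inj by (simp add: card_image)
  then have "UNIV \<subseteq> span (range e)"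
    using card_ge_dim_independent[OF _ ind, of UNIV] by simp
  then have sp: "\<exists>u. x = (\<Sum>i\<in>UNIV. u i *\<^sub>R e i)" for x
  proof -
    have "x \<in> span (range e)" using \<open>UNIV \<subseteq> span (range e)\<close> by blast
    then obtain u where "x = (\<Sum>v\<in>range e. u v *\<^sub>R v)" by (auto simp: span_finite)
    then have "x = (\<Sum>i\<in>UNIV. (u \<circ> e) i *\<^sub>R e i)" using inj by (simp add: sum.reindex)
    then show ?thesis by (rule exI[of _ "u \<circ> e"])
  qed
  have coeff: "B (\<Sum>i\<in>UNIV. u i *\<^sub>R e i) (e j) = u j * B (e j) (e j)" for u j
  proof -
    have "B (\<Sum>i\<in>UNIV. u i *\<^sub>R e i) (e j) = (\<Sum>i\<in>UNIV. u i * B (e i) (e j))"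
      by (simp add: bil_sum_left bil_scaleR_left)
    also have "\<dots> = u j * B (e j) (e j) + (\<Sum>i\<in>UNIV - {j}. u i * B (e i) (e j))"
      by (rule sum.remove) auto
    also have "(\<Sum>i\<in>UNIV - {j}. u i * B (e i) (e j)) = 0"
      using orth by (intro sum.neutral) auto
    finally show ?thesis by simp
  qed
  have nz: "B (e i) (e i) \<noteq> 0" for i
  proof
    assume 0: "B (e i) (e i) = 0"
    have "B x (e i) = 0" for x
      using sp[of x] coeff[of _ i] 0 by auto
    then have "e i = 0" by (rule B_nondegenerate)
    moreover have "e i \<noteq> 0" using ind by (metis dependent_zero rangeI)
    ultimately show False by blast
  qed
  have "(UNIV :: 'm set) = {i. B (e i) (e i) > 0} \<union> {i. B (e i) (e i) < 0}"
    using nz by (auto simp: neq_iff)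
  then have card: "CARD('m) = n + 2"
    using card_Un_disjoint[of "{i. B (e i) (e i) > 0}" "{i. B (e i) (e i) < 0}"] pos neg
    by (metis (mono_tags, lifting) Int_emptyI add.commute finite mem_Collect_eq order_less_asym)
  obtain i1 i2 where i: "{i. B (e i) (e i) > 0} = {i1, i2}"
    using pos by (auto simp: card_2_iff)
  have "B x x < 0" if x: "B x (e i1) = 0" "B x (e i2) = 0" "x \<noteq> 0" for x
  proof -
    obtain u where u: "x = (\<Sum>i\<in>UNIV. u i *\<^sub>R e i)" using sp by blast
    have "B x x = (\<Sum>i\<in>UNIV. u i * B x (e i))"
      by (subst (2) u) (simp add: bil_sum_right bil_scaleR_right)
    also have "\<dots> = (\<Sum>i\<in>UNIV. (u i)\<^sup>2 * B (e i) (e i))"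
      using coeff u by (simp add: power2_eq_square mult.assoc)
    finally have xx: "B x x = (\<Sum>i\<in>UNIV. (u i)\<^sup>2 * B (e i) (e i))" .
    have u0: "u i = 0" if "B (e i) (e i) > 0" for i
    proof -
      have "i = i1 \<or> i = i2" using i that by blast
      then have "B x (e i) = 0" using x by auto
      then show ?thesis using coeff[of u i] u nz[of i] by simp
    qed
    then have le: "(u i)\<^sup>2 * B (e i) (e i) \<le> 0" for i
      using nz[of i] by (cases "B (e i) (e i) > 0") (auto intro: mult_nonneg_nonpos)
    have "\<exists>i. u i \<noteq> 0"
    proof (rule ccontr)
      assume "\<nexists>i. u i \<noteq> 0"
      then have "x = 0" unfolding u by (intro sum.neutral) simp
      then show False using x(3) by blast
    qed
    then obtain j where j: "u j \<noteq> 0" by blast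
    then have "(u j)\<^sup>2 * B (e j) (e j) < 0"
      using u0[of j] nz[of j] by (intro mult_pos_neg) (auto simp: neq_iff)
    moreover have "B x x = (u j)\<^sup>2 * B (e j) (e j) + (\<Sum>i\<in>UNIV - {j}. (u i)\<^sup>2 * B (e i) (e i))"
      unfolding xx by (rule sum.remove) auto
    moreover have "(\<Sum>i\<in>UNIV - {j}. (u i)\<^sup>2 * B (e i) (e i)) \<le> 0"
      using le by (intro sum_nonpos) auto
    ultimately show ?thesis by linarith
  qed
  then show ?thesis using that card by blast
qed

lemma card_m: "CARD('m) = n + 2"
  using signature_basis by metis

definition pos_frame :: "real ^ 'm \<Rightarrow> real ^ 'm \<Rightarrow> bool" where
  "pos_frame a b \<longleftrightarrow> B a a = 1 \<and> B b b = 1 \<and> B a b = 0"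

text \<open>Inertia: otherwise \<open>a, b, x\<close> would span a positive semidefinite space of dimension three, which
  meets the negative definite complement of \<open>e1, e2\<close>.\<close>

lemma negative_complement:
  assumes a: "pos_frame a b" and x: "B x a = 0" "B x b = 0" "x \<noteq> 0"
  shows "B x x < 0"
proof (rule ccontr)
  assume "\<not> B x x < 0"
  then have xx: "B x x \<ge> 0" by simp
  obtain e1 e2 where e: "\<And>y. B y e1 = 0 \<Longrightarrow> B y e2 = 0 \<Longrightarrow> y \<noteq> 0 \<Longrightarrow> B y y < 0"
    using signature_basis by metis
  define p q r where "p = B b e1 * B x e2 - B x e1 * B b e2"
    and "q = B x e1 * B a e2 - B a e1 * B x e2" and "r = B a e1 * B b e2 - B b e1 * B a e2"
  have key: False if k: "\<alpha> * B a e1 + \<beta> * B b e1 + \<gamma> * B x e1 = 0" "\<alpha> * B a e2 + \<beta> * B b e2 + \<gamma> * B x e2 = 0"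
      "\<alpha> \<noteq> 0 \<or> \<beta> \<noteq> 0 \<or> \<gamma> \<noteq> 0" for \<alpha> \<beta> \<gamma>
  proof -
    define y where "y = \<alpha> *\<^sub>R a + \<beta> *\<^sub>R b + \<gamma> *\<^sub>R x"
    have ye: "B y e1 = 0" "B y e2 = 0" using k by (simp_all add: y_def bil_add_left bil_scaleR_left)
    have yy: "B y y = \<alpha>\<^sup>2 + \<beta>\<^sup>2 + \<gamma>\<^sup>2 * B x x"
      using a x B_commute[of a x] B_commute[of b x] B_commute[of b a]
      by (simp add: y_def pos_frame_def bil_add_left bil_add_right bil_scaleR_left bil_scaleR_right power2_eq_square)
    have "\<gamma>\<^sup>2 * B x x \<ge> 0" using xx by simp
    then have "B y y \<ge> 0" unfolding yy by (smt (verit) zero_le_power2)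
    then have y0: "y = 0" using e[OF ye] by fastforce
    have "B y a = \<alpha>" "B y b = \<beta>"
      using a x B_commute[of b a] by (simp_all add: y_def pos_frame_def bil_add_left bil_scaleR_left)
    then have "\<alpha> = 0" "\<beta> = 0" using y0 by simp_all
    then show False using y0 k(3) x(3) by (simp add: y_def)
  qed
  show False
  proof (cases "p = 0 \<and> q = 0 \<and> r = 0")
    case False
    show False by (rule key[of p q r]) (use False in \<open>auto simp: p_def q_def r_def algebra_simps\<close>)
  next
    case True
    show False
    proof (cases "B a e1 = 0 \<and> B a e2 = 0")
      case True
      show False by (rule key[of 1 0 0]) (use True in auto)
    next
      case f: False
      show False
      proof (cases "B a e1 = 0")
        case True
        show False by (rule key[of "B b e2" "- B a e2" 0]) (use f True \<open>p = 0 \<and> q = 0 \<and> r = 0\<close> in \<open>auto simp: r_def algebra_simps\<close>)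
      next
        case False
        show False by (rule key[of "B b e1" "- B a e1" 0]) (use False \<open>p = 0 \<and> q = 0 \<and> r = 0\<close> in \<open>auto simp: r_def algebra_simps\<close>)
      qed
    qed
  qed
qed

text \<open>The orthogonal projection of a positive plane to the plane of \<open>e1, e2\<close> is injective, so that its
  determinant does not vanish.\<close>

lemma plane_not_in_complement:
  assumes e: "\<And>x. B x e1 = 0 \<Longrightarrow> B x e2 = 0 \<Longrightarrow> x \<noteq> 0 \<Longrightarrow> B x x < 0" and a: "pos_frame a b"
  shows "B a e1 * B b e2 - B b e1 * B a e2 \<noteq> 0"
proof
  assume d: "B a e1 * B b e2 - B b e1 * B a e2 = 0"
  have key: "\<alpha> = 0 \<and> \<beta> = 0" if k: "\<alpha> * B a e1 + \<beta> * B b e1 = 0" "\<alpha> * B a e2 + \<beta> * B b e2 = 0" for \<alpha> \<beta>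
  proof -
    define y where "y = \<alpha> *\<^sub>R a + \<beta> *\<^sub>R b"
    have ye: "B y e1 = 0" "B y e2 = 0" using k by (simp_all add: y_def bil_add_left bil_scaleR_left)
    have yy: "B y y = \<alpha>\<^sup>2 + \<beta>\<^sup>2"
      using a B_commute[of b a]
      by (simp add: y_def pos_frame_def bil_add_left bil_add_right bil_scaleR_left bil_scaleR_right power2_eq_square)
    then have "B y y \<ge> 0" by simp
    then have "y = 0" using e[OF ye] by fastforce
    then show ?thesis using yy by (simp add: sum_power2_eq_zero_iff)
  qed
  have "B b e1 = 0" "B a e1 = 0" using key[of "B b e1" "- B a e1"] d by (simp_all add: algebra_simps)
  moreover have "B b e2 = 0" "B a e2 = 0" using key[of "B b e2" "- B a e2"] d by (simp_all add: algebra_simps)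
  ultimately show False using key[of 1 1] by simp
qed

text \<open>An orthonormal basis, for the negated form, of the complement of the plane.  It is indexed by
  natural numbers because the tensor coordinates are functions of the index.\<close>

definition neg_basis :: "real ^ 'm \<Rightarrow> real ^ 'm \<Rightarrow> (nat \<Rightarrow> real ^ 'm) \<Rightarrow> bool" where
  "neg_basis a b c \<longleftrightarrow> (\<forall>k<n. B (c k) a = 0 \<and> B (c k) b = 0 \<and> (\<forall>l<n. B (c k) (c l) = (if k = l then - 1 else 0)))"

lemma neg_basis_expand:
  assumes a: "pos_frame a b" and c: "neg_basis a b c"
  shows "x = B x a *\<^sub>R a + B x b *\<^sub>R b - (\<Sum>k<n. B x (c k) *\<^sub>R c k)"
proof -
  let ?S = "{a, b} \<union> c ` {..<n}"
  have ac: "B (c k) a = 0" "B (c k) b = 0" "B a (c k) = 0" "B b (c k) = 0" "B (c k) (c k) = - 1" if "k < n" for k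
    using c that B_commute[of a "c k"] B_commute[of b "c k"] by (auto simp: neg_basis_def)
  have ab: "B a a = 1" "B b b = 1" "B a b = 0" "B b a = 0"
    using a B_commute[of b a] by (auto simp: pos_frame_def)
  have cc: "B (c k) (c l) = 0" if "k < n" "l < n" "k \<noteq> l" for k l
    using c that by (auto simp: neg_basis_def)
  have inj: "inj_on c {..<n}" 
  proof (rule inj_onI, rule ccontr)
    fix k l assume "k \<in> {..<n}" "l \<in> {..<n}" "c k = c l" "k \<noteq> l"
    then show False using cc[of k l] ac(5)[of k] by simp
  qed
  have "a \<noteq> b" using ab by auto
  moreover have "a \<notin> c ` {..<n}" "b \<notin> c ` {..<n}" using ab ac by fastforce+
  ultimately have cardS: "card ?S = CARD('m)"
    using inj by (simp add: card_m card_image)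
  have ind: "vec.independent ?S"
  proof (rule orthogonal_independent[where A = "real_gram G"])
    fix x y assume "x \<in> ?S" "y \<in> ?S" "x \<noteq> y"
    then show "B x y = 0" using ab ac by (auto intro!: cc)
  next
    fix x assume "x \<in> ?S" then show "B x x \<noteq> 0" using ab ac by auto
  qed auto
  then have "UNIV \<subseteq> vec.span ?S"
    using vec.card_ge_dim_independent[of ?S UNIV] cardS unfolding vec_dim_card by simp
  define y where "y = x - (B x a *\<^sub>R a + B x b *\<^sub>R b - (\<Sum>k<n. B x (c k) *\<^sub>R c k))"
  have ya: "B a y = 0" "B b y = 0"
    using ab ac B_commute[of x a] B_commute[of x b]
    by (simp_all add: y_def bil_diff_right bil_add_right bil_scaleR_right bil_sum_right)
  have yc: "B (c l) y = 0" if l: "l < n" for l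
  proof -
    have "(\<Sum>k<n. B x (c k) * B (c l) (c k)) = B x (c l) * B (c l) (c l) + (\<Sum>k\<in>{..<n} - {l}. B x (c k) * B (c l) (c k))"
      using l by (intro sum.remove) auto
    also have "(\<Sum>k\<in>{..<n} - {l}. B x (c k) * B (c l) (c k)) = 0"
      using cc l by (intro sum.neutral) auto
    finally show ?thesis
      using ac[OF l] B_commute[of x "c l"]
      by (simp add: y_def bil_diff_right bil_add_right bil_scaleR_right bil_sum_right)
  qed
  have "B z y = 0" for z
  proof -
    have "z \<in> vec.span ?S" using \<open>UNIV \<subseteq> vec.span ?S\<close> by blast
    then show ?thesis
    proof (induction rule: vec.span_induct)
      case base
      show ?case by (auto simp: vec.subspace_def bil_add_left bil_scale_left)
    next
      case (step z)
      then show ?case using ya yc by auto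
    qed
  qed
  then have "y = 0" by (rule B_nondegenerate)
  then show ?thesis by (simp add: y_def)
qed

lemma neg_basis_exists:
  assumes a: "pos_frame a b"
  obtains c where "neg_basis a b c"
proof -
  have "\<exists>c. \<forall>k<j. B (c k) a = 0 \<and> B (c k) b = 0 \<and> (\<forall>l<j. B (c k) (c l) = (if k = l then - 1 else 0))" if "j \<le> n" for j
    using that
  proof (induction j)
    case (Suc j)
    then obtain c where c: "\<And>k. k < j \<Longrightarrow> B (c k) a = 0 \<and> B (c k) b = 0"
      "\<And>k l. k < j \<Longrightarrow> l < j \<Longrightarrow> B (c k) (c l) = (if k = l then - 1 else 0)" by fastforce
    let ?S = "{a, b} \<union> c ` {..<j}"
    have ab: "B a a = 1" "B b b = 1" "B a b = 0" "B b a = 0"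
      using a B_commute[of b a] by (auto simp: pos_frame_def)
    have ca: "B a (c k) = 0" "B b (c k) = 0" if "k < j" for k
      using c(1)[OF that] B_commute[of a "c k"] B_commute[of b "c k"] by auto
    have "\<exists>v. (\<forall>x\<in>?S. B v x = 0) \<and> B v v \<noteq> 0"
    proof (rule extend_orthogonal[OF sym_real B_nondegenerate])
      fix x y assume "x \<in> ?S" "y \<in> ?S" "x \<noteq> y"
      then show "B x y = 0" using ab ca c(1) by (auto simp: c(2))
    next
      fix x assume "x \<in> ?S" then show "B x x \<noteq> 0" using ab c by auto
    next
      have "card ?S \<le> card {a, b} + card (c ` {..<j})" by (rule card_Un_le)
      also have "\<dots> \<le> 2 + j" using card_image_le[of "{..<j}" c] by (intro add_mono) (auto simp: card_insert_if)
      finally show "card ?S < CARD('m)" using Suc.prems by (simp add: card_m)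
    qed auto
    then obtain v where v0: "\<forall>x\<in>?S. B v x = 0" "B v v \<noteq> 0" by blast
    then have v: "B v a = 0" "B v b = 0" "\<And>k. k < j \<Longrightarrow> B v (c k) = 0" by auto
    have "v \<noteq> 0" using v0(2) by auto
    then have "B v v < 0" using negative_complement[OF a v(1,2)] by blast
    define w where "w = (1 / sqrt (- B v v)) *\<^sub>R v"
    have w: "B w w = - 1"
      using \<open>B v v < 0\<close> by (simp add: w_def bil_scaleR_left bil_scaleR_right)
    have w': "B w a = 0" "B w b = 0" "\<And>k. k < j \<Longrightarrow> B w (c k) = 0"
      using v by (simp_all add: w_def bil_scaleR_left)
    then have w'': "\<And>k. k < j \<Longrightarrow> B (c k) w = 0" using B_commute by metis
    show ?case
      by (rule exI[of _ "c(j := w)"]) (use w w' w'' c in \<open>auto simp: less_Suc_eq\<close>)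
  qed auto
  from this[of n] show ?thesis using that by (auto simp: neg_basis_def)
qed

end

section \<open>Anisotropic ternary sublattices\<close>

lemma half_squares_inj:
  fixes p a c :: int
  assumes p: "prime p" "odd p" and a: "\<not> p dvd a"
  shows "inj_on (\<lambda>x. (c + a * x\<^sup>2) mod p) {0..(p - 1) div 2}"
proof (rule inj_onI)
  fix x y assume x: "x \<in> {0..(p - 1) div 2}" and y: "y \<in> {0..(p - 1) div 2}"
    and eq: "(c + a * x\<^sup>2) mod p = (c + a * y\<^sup>2) mod p"
  have "p dvd (c + a * x\<^sup>2) - (c + a * y\<^sup>2)" using eq by (simp add: mod_eq_dvd_iff)
  also have "(c + a * x\<^sup>2) - (c + a * y\<^sup>2) = a * ((x - y) * (x + y))"
    by (simp add: power2_eq_square algebra_simps)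
  finally have "p dvd (x - y) * (x + y)" using a p prime_dvd_mult_iff by blast
  then have "p dvd x - y \<or> p dvd x + y" using p prime_dvd_mult_iff by blast
  then show "x = y"
  proof
    assume d: "p dvd x - y"
    have "\<bar>x - y\<bar> < p" using x y p(2) by auto
    then have "x - y = 0" using d by (metis abs_of_pos dvd_imp_le_int leD linorder_not_less p(1) prime_gt_0_int)
    then show ?thesis by simp
  next
    assume d: "p dvd x + y"
    have "x + y < p" "0 \<le> x + y" using x y p(2) by auto
    then have "x + y = 0" using d zdvd_imp_le[of p "x + y"] by fastforce
    then show ?thesis using x y by auto
  qed
qed

text \<open>Pigeonhole: \<open>a x\<^sup>2\<close> and \<open>c - b y\<^sup>2\<close> take \<open>(p + 1) / 2\<close> residues each.\<close>

lemma binary_form_universal_mod_prime: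
  fixes p a b c :: int
  assumes p: "prime p" "odd p" and a: "\<not> p dvd a" and b: "\<not> p dvd b"
  obtains x y where "p dvd a * x\<^sup>2 + b * y\<^sup>2 - c"
proof -
  let ?S = "{0..(p - 1) div 2}"
  let ?X = "(\<lambda>x. (0 + a * x\<^sup>2) mod p) ` ?S" and ?Y = "(\<lambda>y. (c + (- b) * y\<^sup>2) mod p) ` ?S"
  have pp: "p > 0" using p prime_gt_0_int by blast
  obtain k where k: "p = 2 * k + 1" using p(2) by (auto elim: oddE)
  have cS: "card ?S = nat (k + 1)" using k by simp
  have cX: "card ?X = nat (k + 1)" using half_squares_inj[OF p a, of 0] cS by (simp only: card_image)
  have cY: "card ?Y = nat (k + 1)" 
    using half_squares_inj[OF p, of "- b" c] b cS by (simp add: card_image)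
  have "?X \<inter> ?Y \<noteq> {}"
  proof
    assume "?X \<inter> ?Y = {}"
    then have "card (?X \<union> ?Y) = card ?X + card ?Y" by (intro card_Un_disjoint) auto
    moreover have "card (?X \<union> ?Y) \<le> card {0..<p}" using pp by (intro card_mono) auto
    ultimately have "nat (k + 1) + nat (k + 1) \<le> nat p" unfolding cX cY by simp
    then show False using k pp by auto
  qed
  then obtain x y where "(0 + a * x\<^sup>2) mod p = (c + (- b) * y\<^sup>2) mod p" by blast
  then have "p dvd (0 + a * x\<^sup>2) - (c + (- b) * y\<^sup>2)" by (simp only: mod_eq_dvd_iff)
  then show ?thesis using that[of x y] by (simp add: algebra_simps)
qed

text \<open>At most \<open>(p + 1) / 2\<close> residues modulo \<open>p\<close> are squares.\<close>

lemma quadratic_nonresidue_exists: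
  fixes p :: int
  assumes p: "prime p" "odd p"
  obtains s where "\<And>x. \<not> p dvd x\<^sup>2 - s"
proof -
  let ?S = "{0..(p - 1) div 2}"
  have pp: "p > 0" using p prime_gt_0_int by blast
  obtain k where k: "p = 2 * k + 1" using p(2) by (auto elim: oddE)
  have "k \<noteq> 0" using k p(1) by auto
  then have k0: "k > 0" using k pp by auto
  have "card ((\<lambda>x. x\<^sup>2 mod p) ` ?S) \<le> card ?S" by (rule card_image_le) simp
  also have "\<dots> = nat (k + 1)" using k by simp
  also have "\<dots> < card {0..<p}" using k k0 by simp
  finally obtain s where s: "s \<in> {0..<p}" "s \<notin> (\<lambda>x. x\<^sup>2 mod p) ` ?S"
    by (metis card_mono finite_imageI finite_atLeastAtMost_int leD subsetI)
  have "\<not> p dvd x\<^sup>2 - s" for x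
  proof
    assume d: "p dvd x\<^sup>2 - s"
    define y where "y = (if x mod p \<le> k then x mod p else p - x mod p)"
    have r: "0 \<le> x mod p" "x mod p < p" using pp by auto
    have "y \<in> ?S" using r k by (auto simp: y_def)
    have "p dvd x - x mod p" by (simp add: minus_mod_eq_mult_div)
    then have "p dvd x - y \<or> p dvd x + y"
    proof (cases "x mod p \<le> k")
      case False
      have "x + y = (x - x mod p) + p" using False by (simp add: y_def)
      moreover have "p dvd (x - x mod p) + p" using \<open>p dvd x - x mod p\<close> by (intro dvd_add) auto
      ultimately have "p dvd x + y" by (simp only:)
      then show ?thesis by blast
    qed (simp add: y_def)
    then have "p dvd (x - y) * (x + y)" by auto
    moreover have "y\<^sup>2 - s = (x\<^sup>2 - s) - (x - y) * (x + y)" by (simp add: power2_eq_square algebra_simps)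
    ultimately have "p dvd y\<^sup>2 - s" using d by (metis dvd_diff)
    then have "y\<^sup>2 mod p = s mod p" by (simp add: mod_eq_dvd_iff)
    then have "s = y\<^sup>2 mod p" using s(1) by simp
    then show False using s(2) \<open>y \<in> ?S\<close> by blast
  qed
  then show ?thesis using that by blast
qed

text \<open>Modulo \<open>p\<close> the first two variables span a plane without isotropic vectors, and the third
  variable enters with a coefficient of \<open>p\<close>-adic valuation one.\<close>

lemma ternary_anisotropic:
  fixes p s \<alpha> \<beta> \<mu> \<kappa>1 \<kappa>2 \<gamma> :: int
  assumes p: "prime p" and s: "\<And>x. \<not> p dvd x\<^sup>2 - s" and \<alpha>: "\<not> p dvd \<alpha>" and \<beta>: "p dvd \<beta> + \<alpha> * s"
    and \<mu>: "p dvd \<mu>" and \<kappa>: "p dvd \<kappa>1" "p dvd \<kappa>2" and \<gamma>: "p dvd \<gamma>" "\<not> p\<^sup>2 dvd \<gamma>"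
    and zero: "\<alpha> * x\<^sup>2 + \<beta> * y\<^sup>2 + \<gamma> * z\<^sup>2 + 2 * (\<mu> * x * y + \<kappa>1 * x * z + \<kappa>2 * y * z) = 0"
  shows "x = 0 \<and> y = 0 \<and> z = 0"
  using zero
proof (induction "nat (\<bar>x\<bar> + \<bar>y\<bar> + \<bar>z\<bar>)" arbitrary: x y z rule: less_induct)
  case less
  note zero = less.prems
  obtain \<beta>' \<mu>' where \<beta>': "\<beta> + \<alpha> * s = p * \<beta>'" "\<mu> = p * \<mu>'" using \<beta> \<mu> by (metis dvdE)
  obtain \<kappa>1' \<kappa>2' where \<kappa>': "\<kappa>1 = p * \<kappa>1'" "\<kappa>2 = p * \<kappa>2'" using \<kappa> by (metis dvdE)
  obtain \<gamma>' where \<gamma>': "\<gamma> = p * \<gamma>'" using \<gamma>(1) by (elim dvdE)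
  have "\<alpha> * (x\<^sup>2 - s * y\<^sup>2) = - (\<beta> + \<alpha> * s) * y\<^sup>2 - \<gamma> * z\<^sup>2 - 2 * (\<mu> * x * y + \<kappa>1 * x * z + \<kappa>2 * y * z)"
    using zero by (simp add: algebra_simps)
  also have "\<dots> = p * (- \<beta>' * y\<^sup>2 - \<gamma>' * z\<^sup>2 - 2 * (\<mu>' * x * y + \<kappa>1' * x * z + \<kappa>2' * y * z))"
    unfolding \<beta>' \<kappa>' \<gamma>' by (simp add: algebra_simps)
  finally have "p dvd \<alpha> * (x\<^sup>2 - s * y\<^sup>2)" by simp
  then have d: "p dvd x\<^sup>2 - s * y\<^sup>2" using \<alpha> p prime_dvd_mult_iff by blast
  have "p dvd y"
  proof (rule ccontr)
    assume "\<not> p dvd y"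
    then have "coprime y p" using p prime_imp_coprime coprime_commute by blast
    then obtain w where "[y * w = 1] (mod p)" using cong_solve_coprime_int by blast
    then have w: "p dvd y * w - 1" by (simp add: cong_iff_dvd_diff)
    have "(x * w)\<^sup>2 - s = (x\<^sup>2 - s * y\<^sup>2) * w\<^sup>2 + s * ((y * w - 1) * (y * w + 1))"
      by (simp add: power2_eq_square algebra_simps)
    also have "p dvd \<dots>" using d w by (intro dvd_add dvd_mult dvd_mult2) auto
    finally show False using s by blast
  qed
  then obtain y' where y': "y = p * y'" by (elim dvdE)
  have "x\<^sup>2 = (x\<^sup>2 - s * y\<^sup>2) + s * y * y" by (simp add: power2_eq_square)
  also have "p dvd \<dots>" using d \<open>p dvd y\<close> by (intro dvd_add) auto
  finally have "p dvd x" using p prime_dvd_power by blast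
  then obtain x' where x': "x = p * x'" by (elim dvdE)
  have \<gamma>'n: "\<not> p dvd \<gamma>'" using \<gamma>(2) \<gamma>' by (simp add: power2_eq_square)
  have "p * (\<gamma>' * z\<^sup>2) = p * (p * - (\<alpha> * x'\<^sup>2 + \<beta> * y'\<^sup>2 + 2 * (\<mu> * x' * y' + \<kappa>1' * x' * z + \<kappa>2' * y' * z)))"
    using zero unfolding x' y' \<gamma>' \<kappa>' by (simp add: power2_eq_square algebra_simps)
  then have "\<gamma>' * z\<^sup>2 = p * - (\<alpha> * x'\<^sup>2 + \<beta> * y'\<^sup>2 + 2 * (\<mu> * x' * y' + \<kappa>1' * x' * z + \<kappa>2' * y' * z))"
    using p by auto
  then have "p dvd \<gamma>' * z\<^sup>2" by simp
  then have "p dvd z" using \<gamma>'n p prime_dvd_mult_iff prime_dvd_power by blast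
  then obtain z' where z': "z = p * z'" by (elim dvdE)
  have zero': "\<alpha> * x'\<^sup>2 + \<beta> * y'\<^sup>2 + \<gamma> * z'\<^sup>2 + 2 * (\<mu> * x' * y' + \<kappa>1 * x' * z' + \<kappa>2 * y' * z') = 0"
  proof -
    have "p\<^sup>2 * (\<alpha> * x'\<^sup>2 + \<beta> * y'\<^sup>2 + \<gamma> * z'\<^sup>2 + 2 * (\<mu> * x' * y' + \<kappa>1 * x' * z' + \<kappa>2 * y' * z')) = 0"
      using zero unfolding x' y' z' by (simp add: power2_eq_square algebra_simps)
    then show ?thesis using p by auto
  qed
  show ?case
  proof (cases "x = 0 \<and> y = 0 \<and> z = 0")
    case False
    then have pos: "\<bar>x'\<bar> + \<bar>y'\<bar> + \<bar>z'\<bar> > 0" using x' y' z' by auto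
    have "\<bar>x\<bar> + \<bar>y\<bar> + \<bar>z\<bar> = p * (\<bar>x'\<bar> + \<bar>y'\<bar> + \<bar>z'\<bar>)"
      using p prime_gt_0_int[of p] by (simp add: x' y' z' abs_mult algebra_simps)
    moreover have "p > 1" using p prime_gt_1_int by blast
    ultimately have "\<bar>x'\<bar> + \<bar>y'\<bar> + \<bar>z'\<bar> < \<bar>x\<bar> + \<bar>y\<bar> + \<bar>z\<bar>" using pos
      by (metis mult.commute mult.right_neutral mult_strict_left_mono)
    then have "x' = 0 \<and> y' = 0 \<and> z' = 0" by (intro less.hyps[OF _ zero']) auto
    then show ?thesis using x' y' z' by simp
  qed auto
qed

context lattice_2_n
begin

abbreviation Z :: "int ^ 'm \<Rightarrow> int ^ 'm \<Rightarrow> int" where "Z \<equiv> bil G"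

lemma Z_commute: "Z u v = Z v u"
  using gram by (intro bil_commute) (simp add: lattice_gram_def)

definition anisotropic_triple :: "int ^ 'm \<Rightarrow> int ^ 'm \<Rightarrow> int ^ 'm \<Rightarrow> bool" where
  "anisotropic_triple u v w \<longleftrightarrow> (\<forall>x y z. Z (x *s u + y *s v + z *s w) (x *s u + y *s v + z *s w) = 0 \<longrightarrow> x = 0 \<and> y = 0 \<and> z = 0)"

text \<open>An orthogonal basis over the rationals, cleared of denominators.\<close>

lemma integral_orthogonal_family:
  assumes "k \<le> CARD('m)"
  shows "\<exists>e :: nat \<Rightarrow> int ^ 'm. \<forall>i<k. Z (e i) (e i) \<noteq> 0 \<and> (\<forall>j<k. i \<noteq> j \<longrightarrow> Z (e i) (e j) = 0)"
  using assms
proof (induction k)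
  case (Suc k)
  then obtain e :: "nat \<Rightarrow> int ^ 'm" where e: "\<And>i. i < k \<Longrightarrow> Z (e i) (e i) \<noteq> 0"
      "\<And>i j. i < k \<Longrightarrow> j < k \<Longrightarrow> i \<noteq> j \<Longrightarrow> Z (e i) (e j) = 0" by auto
  let ?q = "\<lambda>u :: int ^ 'm. \<chi> i. rat_of_int (u $ i)" and ?A = "map_matrix rat_of_int G"
  let ?S = "(\<lambda>i. ?q (e i)) ` {..<k}"
  have "\<exists>v. (\<forall>x\<in>?S. bil ?A v x = 0) \<and> bil ?A v v \<noteq> 0"
  proof (rule extend_orthogonal)
    show "transpose ?A = ?A" using gram by (auto simp: lattice_gram_def intro: symmetric_map_matrix)
    show "u = 0" if "\<And>v. bil ?A v u = 0" for u using gram_nondegenerate[OF gram] that by blast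
    show "bil ?A x y = 0" if "x \<in> ?S" "y \<in> ?S" "x \<noteq> y" for x y
      using that by (auto simp: bil_map_of_int intro!: e(2))
    show "bil ?A x x \<noteq> 0" if "x \<in> ?S" for x using that e(1) by (auto simp: bil_map_of_int)
    show "card ?S < CARD('m)" using card_image_le[of "{..<k}" "\<lambda>i. ?q (e i)"] Suc.prems by simp
  qed simp
  then obtain v where v: "\<And>i. i < k \<Longrightarrow> bil ?A v (?q (e i)) = 0" "bil ?A v v \<noteq> 0" by auto
  obtain N w where N: "N > 0" "\<And>i. of_int N * v $ i = of_int (w $ i)" using clear_denominators by blast
  have w: "?q w = of_int N *s v" using N(2) by (simp add: vec_eq_iff)
  have "rat_of_int (Z w (e i)) = 0" if "i < k" for i
    unfolding bil_map_of_int[symmetric] w bil_scale_left using v(1)[OF that] by simp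
  then have "Z w (e i) = 0" if "i < k" for i using that by simp
  moreover have "rat_of_int (Z w w) \<noteq> 0"
    unfolding bil_map_of_int[symmetric] w bil_scale_left bil_scale_right using v(2) N(1) by simp
  ultimately show ?case
    using e Z_commute by (intro exI[of _ "e(k := w)"]) (auto simp: less_Suc_eq)
qed auto

text \<open>Let \<open>e 0, \<dots>, e 4\<close> be orthogonal with norms prime to \<open>p\<close>.  The vectors \<open>v1 = e 0\<close> and
  \<open>v2 = x e 1 + y e 2\<close> span a plane that is anisotropic modulo \<open>p\<close>: its discriminant is minus a nonresidue
  up to squares.  The vector \<open>f\<close> in the span of \<open>e 1, e 2\<close> is orthogonal to \<open>v2\<close>, and adding a
  combination of \<open>e 3, e 4\<close> and a multiple of \<open>p f\<close> yields \<open>v3\<close>, orthogonal to \<open>v1, v2\<close>, with norm of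
  valuation exactly one.  These properties depend on the vectors modulo \<open>p\<^sup>2\<close> only.  Five dimensions
  leave two spare vectors for \<open>v3\<close>; this is where \<open>n \<ge> 3\<close> enters.\<close>

lemma anisotropic_residues:
  assumes n: "n \<ge> 3"
  obtains p v1 v2 v3 where "p > 0"
    and "\<And>w1 w2 w3. anisotropic_triple (v1 + p *s w1) (v2 + p *s w2) (v3 + p *s w3)"
proof -
  obtain e :: "nat \<Rightarrow> int ^ 'm" where e: "\<forall>i<5. Z (e i) (e i) \<noteq> 0 \<and> (\<forall>j<5. i \<noteq> j \<longrightarrow> Z (e i) (e j) = 0)"
    using integral_orthogonal_family[of 5] n card_m by auto
  define a where "a i = Z (e i) (e i)" for i
  have a: "a i \<noteq> 0" if "i < 5" for i using e that by (simp add: a_def)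
  have orth: "Z (e i) (e j) = 0" if "i < 5" "j < 5" "i \<noteq> j" for i j using e that by simp
  obtain q :: nat where q: "prime q" "q > nat (2 + (\<Sum>i<5. \<bar>a i\<bar>))"
    using bigger_prime by blast
  define p where "p = int q"
  have p: "prime p" "odd p" 
  proof -
    have "(\<Sum>i<5. \<bar>a i\<bar>) \<ge> 0" by (intro sum_nonneg) auto
    then have "2 < q" using q(2) by linarith
    then show "prime p" "odd p" using q(1) prime_odd_nat[of q] by (auto simp: p_def)
  qed
  have pa: "\<not> p dvd a i" if "i < 5" for i
  proof
    assume "p dvd a i"
    then have "p \<le> \<bar>a i\<bar>" using dvd_imp_le_int[OF a[OF that], of p] by linarith
    also have "\<dots> \<le> (\<Sum>i<5. \<bar>a i\<bar>)" using that by (intro member_le_sum) auto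
    also have "\<dots> < p" using q(2) unfolding p_def by linarith
    finally show False by simp
  qed
  obtain s where s: "\<And>x. \<not> p dvd x\<^sup>2 - s" using quadratic_nonresidue_exists[OF p] by blast
  obtain x y where xy: "p dvd a 1 * x\<^sup>2 + a 2 * y\<^sup>2 - (- a 0 * s)"
    by (rule binary_form_universal_mod_prime[OF p, of "a 1" "a 2" "- a 0 * s"]) (simp_all add: pa)
  \<comment> \<open>the vector of the plane of \<open>e 1, e 2\<close> orthogonal to \<open>x e 1 + y e 2\<close>\<close>
  define f where "f = (- a 2 * y) *s e 1 + (a 1 * x) *s e 2"
  define N2 where "N2 = a 1 * x\<^sup>2 + a 2 * y\<^sup>2"
  have ff: "Z f f = a 1 * a 2 * N2"
    by (simp add: f_def N2_def bil_add_left bil_add_right bil_scale_left bil_scale_right orth power2_eq_square algebra_simps flip: a_def)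
  have "\<not> p dvd s" using s[of 0] by simp
  have N2: "p dvd N2 + a 0 * s" using xy by (simp add: N2_def)
  have "\<not> p dvd N2"
  proof
    assume "p dvd N2"
    then have "p dvd a 0 * s" using N2 by (metis dvd_add_right_iff)
    then show False using \<open>\<not> p dvd s\<close> pa[of 0] p(1) prime_dvd_mult_iff by auto
  qed
  then have pf: "\<not> p dvd Z f f" unfolding ff using pa[of 1] pa[of 2] p(1) by (simp add: prime_dvd_mult_iff)
  \<comment> \<open>the two spare vectors compensate the norm of \<open>f\<close> modulo \<open>p\<close>\<close>
  obtain y4 y5 where y45: "p dvd a 3 * y4\<^sup>2 + a 4 * y5\<^sup>2 - (- Z f f)"
    by (rule binary_form_universal_mod_prime[OF p, of "a 3" "a 4" "- Z f f"]) (simp_all add: pa)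
  define g where "g = f + y4 *s e 3 + y5 *s e 4"
  have fe: "Z f (e 0) = 0" "Z f (e 3) = 0" "Z f (e 4) = 0" "Z (e 3) f = 0" "Z (e 4) f = 0" "Z (e 0) f = 0"
    by (simp_all add: f_def bil_add_left bil_scale_left bil_add_right bil_scale_right orth)
  have gg: "Z g g = Z f f + a 3 * y4\<^sup>2 + a 4 * y5\<^sup>2"
    by (simp add: g_def bil_add_left bil_add_right bil_scale_left bil_scale_right orth fe power2_eq_square algebra_simps flip: a_def)
  have pg: "p dvd Z g g" using y45 by (simp add: gg algebra_simps)
  have gf: "Z g f = Z f f" by (simp add: g_def bil_add_left bil_scale_left fe)
  define v1 v2 where "v1 = e 0" and "v2 = x *s e 1 + y *s e 2"
  \<comment> \<open>adding \<open>p f\<close> changes the norm by \<open>2 p (f, f)\<close> modulo \<open>p\<^sup>2\<close>\<close>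
  obtain c where c: "\<not> p\<^sup>2 dvd Z (g + (c * p) *s f) (g + (c * p) *s f)"
  proof (cases "p\<^sup>2 dvd Z g g")
    case False
    then show ?thesis using that[of 0] by simp
  next
    case True
    have "\<not> p\<^sup>2 dvd Z (g + (1 * p) *s f) (g + (1 * p) *s f)"
    proof
      assume d: "p\<^sup>2 dvd Z (g + (1 * p) *s f) (g + (1 * p) *s f)"
      have "Z (g + (1 * p) *s f) (g + (1 * p) *s f) = Z g g + p\<^sup>2 * Z f f + p * (2 * Z f f)"
        using gf Z_commute[of f g] by (simp add: bil_add_left bil_add_right bil_scale_left bil_scale_right power2_eq_square algebra_simps)
      then have "p\<^sup>2 dvd p * (2 * Z f f)" using d True by (metis dvd_add_right_iff dvd_add_times_triv_right_iff dvd_triv_left)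
      then have "p dvd 2 * Z f f" using p(1) by (auto simp: power2_eq_square)
      then have "p dvd 2" using pf p(1) prime_dvd_mult_iff by blast
      then have "p \<le> 2" by (rule zdvd_imp_le) simp
      then have "p = 2" using prime_ge_2_int[OF p(1)] by simp
      then show False using p(2) by simp
    qed
    then show ?thesis using that by blast
  qed
  define v3 where "v3 = g + (c * p) *s f"
  have gram_v: "Z v1 v1 = a 0" "Z v2 v2 = N2" "Z v1 v2 = 0" "Z v1 v3 = 0" "Z v2 v3 = 0"
  proof -
    show "Z v1 v1 = a 0" by (simp add: v1_def a_def)
    show "Z v2 v2 = N2" by (simp add: v2_def N2_def bil_add_left bil_add_right bil_scale_left bil_scale_right orth power2_eq_square algebra_simps flip: a_def)
    show "Z v1 v2 = 0" by (simp add: v1_def v2_def bil_add_right bil_scale_right orth)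
    show "Z v1 v3 = 0" by (simp add: v1_def v3_def g_def bil_add_right bil_scale_right orth fe)
    have "Z v2 f = 0" by (simp add: v2_def f_def bil_add_left bil_add_right bil_scale_left bil_scale_right orth flip: a_def)
    then show "Z v2 v3 = 0" by (simp add: v3_def g_def v2_def bil_add_left bil_add_right bil_scale_left bil_scale_right orth algebra_simps)
  qed
  have "p dvd Z v3 v3"
  proof -
    have "Z v3 v3 = Z g g + p * (c * (2 * Z f f) + c * c * p * Z f f)"
      using gf Z_commute[of f g] by (simp add: v3_def bil_add_left bil_add_right bil_scale_left bil_scale_right algebra_simps)
    then show ?thesis using pg by simp
  qed
  have "anisotropic_triple (v1 + p\<^sup>2 *s w1) (v2 + p\<^sup>2 *s w2) (v3 + p\<^sup>2 *s w3)" for w1 w2 w3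
    unfolding anisotropic_triple_def
  proof (intro allI impI)
    fix x y z :: int
    let ?v1 = "v1 + p\<^sup>2 *s w1" and ?v2 = "v2 + p\<^sup>2 *s w2" and ?v3 = "v3 + p\<^sup>2 *s w3"
    assume 0: "Z (x *s ?v1 + y *s ?v2 + z *s ?v3) (x *s ?v1 + y *s ?v2 + z *s ?v3) = 0"
    have shift: "p\<^sup>2 dvd Z (u + p\<^sup>2 *s w) (u' + p\<^sup>2 *s w') - Z u u'" for u w u' w'
    proof -
      have "Z (u + p\<^sup>2 *s w) (u' + p\<^sup>2 *s w') - Z u u' = p\<^sup>2 * (Z u w' + Z w u' + p\<^sup>2 * Z w w')"
        by (simp add: bil_add_left bil_add_right bil_scale_left bil_scale_right algebra_simps)
      then show ?thesis by simp
    qed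
    have shift1: "p dvd Z (u + p\<^sup>2 *s w) (u' + p\<^sup>2 *s w') - Z u u'" for u w u' w'
      using shift[of u w u' w'] by (metis dvd_trans dvd_triv_left power2_eq_square)
    have sh: "p dvd Z (u + p\<^sup>2 *s w) (u' + p\<^sup>2 *s w') \<longleftrightarrow> p dvd Z u u'" for u w u' w'
      using shift1[of u w u' w'] by (metis diff_add_cancel dvd_add_right_iff)
    show "x = 0 \<and> y = 0 \<and> z = 0"
    proof (rule ternary_anisotropic[OF p(1) s])
      show "\<not> p dvd Z ?v1 ?v1" using sh[of v1 w1 v1 w1] pa[of 0] by (simp add: gram_v)
      have "Z ?v2 ?v2 + Z ?v1 ?v1 * s = (N2 + a 0 * s) + ((Z ?v2 ?v2 - Z v2 v2) + (Z ?v1 ?v1 - Z v1 v1) * s)"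
        by (simp add: gram_v algebra_simps)
      also have "p dvd \<dots>" by (rule dvd_add[OF N2 dvd_add[OF shift1 dvd_mult2[OF shift1]]])
      finally show "p dvd Z ?v2 ?v2 + Z ?v1 ?v1 * s" .
      show "p dvd Z ?v1 ?v2" "p dvd Z ?v1 ?v3" "p dvd Z ?v2 ?v3" by (simp_all only: sh gram_v dvd_0_right)
      show "p dvd Z ?v3 ?v3" using sh \<open>p dvd Z v3 v3\<close> by blast
      show "\<not> p\<^sup>2 dvd Z ?v3 ?v3"
        using shift[of v3 w3 v3 w3] c unfolding v3_def by (metis diff_add_cancel dvd_add_right_iff)
      show "Z ?v1 ?v1 * x\<^sup>2 + Z ?v2 ?v2 * y\<^sup>2 + Z ?v3 ?v3 * z\<^sup>2 + 2 * (Z ?v1 ?v2 * x * y + Z ?v1 ?v3 * x * z + Z ?v2 ?v3 * y * z) = 0"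
      proof -
        have "Z (x *s a1 + y *s a2 + z *s a3) (x *s a1 + y *s a2 + z *s a3) =
          Z a1 a1 * x\<^sup>2 + Z a2 a2 * y\<^sup>2 + Z a3 a3 * z\<^sup>2 + 2 * (Z a1 a2 * x * y + Z a1 a3 * x * z + Z a2 a3 * y * z)" for a1 a2 a3
          using Z_commute[of a2 a1] Z_commute[of a3 a1] Z_commute[of a3 a2]
          by (simp add: bil_add_left bil_add_right bil_scale_left bil_scale_right power2_eq_square algebra_simps)
        then show ?thesis using 0 by metis
      qed
    qed
  qed
  moreover have "p\<^sup>2 > 0" using p(1) prime_gt_0_int by simp
  ultimately show ?thesis using that by blast
qed

end

definition rvec :: "int ^ 'm \<Rightarrow> real ^ 'm" where
  "rvec u = (\<chi> i. of_int (u $ i))"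

text \<open>The vectors of a fixed residue class, divided by their size, are dense.\<close>

lemma integral_approximation:
  fixes v0 :: "int ^ 'm" and a :: "real ^ 'm"
  assumes p: "p > 0"
  shows "(\<lambda>N. (1 / (of_int p * real (Suc N))) *\<^sub>R rvec (v0 + p *s (\<chi> i. \<lfloor>real (Suc N) * a $ i\<rfloor>))) \<longlonglongrightarrow> a"
proof (rule vec_tendstoI)
  fix i
  have lim: "(\<lambda>N. inverse (real (Suc N))) \<longlonglongrightarrow> 0" by (rule LIMSEQ_inverse_real_of_nat)
  have 1: "(\<lambda>N. of_int (v0 $ i) / of_int p * inverse (real (Suc N))) \<longlonglongrightarrow> 0"
    using tendsto_mult[OF tendsto_const lim, of "of_int (v0 $ i) / of_int p"] by simp
  have 2: "(\<lambda>N. of_int \<lfloor>real (Suc N) * a $ i\<rfloor> * inverse (real (Suc N)) - a $ i) \<longlonglongrightarrow> 0"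
  proof (rule Lim_null_comparison[OF _ lim], rule eventuallyI)
    fix N
    let ?x = "real (Suc N) * a $ i"
    have "of_int \<lfloor>?x\<rfloor> * inverse (real (Suc N)) - a $ i = (of_int \<lfloor>?x\<rfloor> - ?x) * inverse (real (Suc N))"
      by (simp add: field_simps)
    also have "norm \<dots> = \<bar>of_int \<lfloor>?x\<rfloor> - ?x\<bar> * inverse (real (Suc N))" by (simp add: abs_mult)
    also have "\<dots> \<le> 1 * inverse (real (Suc N))"
      by (intro mult_right_mono) (linarith, simp)
    finally show "norm (of_int \<lfloor>?x\<rfloor> * inverse (real (Suc N)) - a $ i) \<le> inverse (real (Suc N))" by simp
  qed
  have "(\<lambda>N. of_int (v0 $ i) / of_int p * inverse (real (Suc N)) + (of_int \<lfloor>real (Suc N) * a $ i\<rfloor> * inverse (real (Suc N)) - a $ i) + a $ i) \<longlonglongrightarrow> 0 + 0 + a $ i"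
    by (intro tendsto_add 1 2 tendsto_const)
  moreover have "((1 / (of_int p * real (Suc N))) *\<^sub>R rvec (v0 + p *s (\<chi> i. \<lfloor>real (Suc N) * a $ i\<rfloor>))) $ i
      = of_int (v0 $ i) / of_int p * inverse (real (Suc N)) + (of_int \<lfloor>real (Suc N) * a $ i\<rfloor> * inverse (real (Suc N)) - a $ i) + a $ i" for N
  proof -
    define t where "t = real (Suc N)"
    have "t > 0" by (simp add: t_def)
    then show ?thesis using p unfolding t_def[symmetric] by (simp add: rvec_def field_simps)
  qed
  ultimately show "(\<lambda>N. ((1 / (of_int p * real (Suc N))) *\<^sub>R rvec (v0 + p *s (\<chi> i. \<lfloor>real (Suc N) * a $ i\<rfloor>))) $ i) \<longlonglongrightarrow> a $ i"
    by (simp only: add_0)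
qed

section \<open>The period domain\<close>

lemma line_eq: "line \<omega> = range (\<lambda>t. t *s \<omega>)"
  unfolding line_def by (rule vec.span_singleton)

lemma in_line [simp]: "\<omega> \<in> line \<omega>"
  unfolding line_def by (simp add: vec.span_base)

lemma line_scale: "t \<noteq> 0 \<Longrightarrow> line (t *s \<omega>) = line \<omega>"
  unfolding line_eq
proof (intro equalityI subsetI)
  fix x assume t: "t \<noteq> 0" and "x \<in> range (\<lambda>s. s *s \<omega>)"
  then obtain s where "x = s *s \<omega>" by auto
  then have "x = (s / t) *s (t *s \<omega>)" using t by (simp add: vector_smult_assoc)
  then show "x \<in> range (\<lambda>s. s *s (t *s \<omega>))" by blast
qed (auto simp: vector_smult_assoc)

lemma line_eq_if_mem:
  assumes "w \<in> line \<omega>" "w \<noteq> 0"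
  shows "line w = line \<omega>"
proof -
  obtain t where "w = t *s \<omega>" using assms by (auto simp: line_eq)
  moreover have "t \<noteq> 0" using calculation assms by auto
  ultimately show ?thesis by (simp add: line_scale)
qed

lemma conj_vec_add: "conj_vec (u + v) = conj_vec u + conj_vec v"
  and conj_vec_diff: "conj_vec (u - v) = conj_vec u - conj_vec v"
  and conj_vec_scale: "conj_vec (t *s u) = cnj t *s conj_vec u"
  and conj_vec_cvec [simp]: "conj_vec (cvec x) = cvec x"
  by (simp_all add: conj_vec_def cvec_def vec_eq_iff)

text \<open>Up to a scalar, the period vectors are the vectors \<open>a + i b\<close> with \<open>a, b\<close> an orthonormal basis of a
  positive plane, see \<open>over_D_normal_form\<close>; \<open>frc a b\<close> is the complex conjugate.\<close>

definition fr :: "real ^ 'm \<Rightarrow> real ^ 'm \<Rightarrow> complex ^ 'm" where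
  "fr a b = cvec a + \<i> *s cvec b"

definition frc :: "real ^ 'm \<Rightarrow> real ^ 'm \<Rightarrow> complex ^ 'm" where
  "frc a b = cvec a - \<i> *s cvec b"

lemma fr_scale: "fr (r *\<^sub>R a) (r *\<^sub>R b) = of_real r *s fr a b"
  by (simp add: fr_def cvec_scale vec_eq_iff algebra_simps)

lemma conj_fr: "conj_vec (fr a b) = frc a b" "conj_vec (frc a b) = fr a b"
  by (simp_all add: fr_def frc_def conj_vec_add conj_vec_diff conj_vec_scale vec_eq_iff)

lemma topspace_proj_top: "topspace proj_top = line ` (- {0 :: complex ^ 'm})"
proof
  show "topspace proj_top \<subseteq> line ` (- {0 :: complex ^ 'm})"
    using openin_topspace[of "proj_top :: (complex ^ 'm) set topology"] unfolding openin_proj_top by blast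
  have "{\<omega> :: complex ^ 'm. \<omega> \<noteq> 0 \<and> line \<omega> \<in> line ` (- {0})} = - {0}" by auto
  then have "openin proj_top (line ` (- {0 :: complex ^ 'm}))"
    unfolding openin_proj_top by (simp add: open_Compl)
  then show "line ` (- {0 :: complex ^ 'm}) \<subseteq> topspace proj_top" by (rule openin_subset)
qed

lemma continuous_on_bil [continuous_intros]:
  fixes A :: "'a::real_normed_field ^ 'm ^ 'm"
  assumes "continuous_on S f" "continuous_on S g"
  shows "continuous_on S (\<lambda>x. bil A (f x) (g x))"
  unfolding bil_def by (intro continuous_intros assms)

lemma tendsto_bil [tendsto_intros]:
  fixes A :: "'a::real_normed_field ^ 'm ^ 'm"
  assumes "(f \<longlongrightarrow> a) F" "(g \<longlongrightarrow> b) F"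
  shows "((\<lambda>x. bil A (f x) (g x)) \<longlongrightarrow> bil A a b) F"
  unfolding bil_def by (intro tendsto_intros assms)

lemma continuous_on_vscale [continuous_intros]:
  fixes f :: "'b::topological_space \<Rightarrow> 'a::real_normed_field ^ 'm"
  assumes "continuous_on S t" "continuous_on S f"
  shows "continuous_on S (\<lambda>x. t x *s f x)"
  unfolding vector_scalar_mult_def by (intro continuous_intros assms)

lemma tendsto_vscale [tendsto_intros]:
  fixes f :: "'b \<Rightarrow> 'a::real_normed_field ^ 'm"
  assumes "(t \<longlongrightarrow> r) F" "(f \<longlongrightarrow> a) F"
  shows "((\<lambda>x. t x *s f x) \<longlongrightarrow> r *s a) F"
  unfolding vector_scalar_mult_def by (intro tendsto_intros assms)

lemma continuous_on_cvec [continuous_intros]: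
  "continuous_on S f \<Longrightarrow> continuous_on S (\<lambda>x. cvec (f x))"
  unfolding cvec_def by (intro continuous_intros)

lemma tendsto_cvec [tendsto_intros]:
  "(f \<longlongrightarrow> a) F \<Longrightarrow> ((\<lambda>x. cvec (f x)) \<longlongrightarrow> cvec a) F"
  unfolding cvec_def by (intro tendsto_intros)

lemma continuous_on_conj_vec [continuous_intros]:
  "continuous_on S f \<Longrightarrow> continuous_on S (\<lambda>x. conj_vec (f x))"
  unfolding conj_vec_def by (intro continuous_intros)

locale type_IV = lattice_2_n G n for G :: "int ^ 'm ^ 'm" and n +
  fixes D :: "(complex ^ 'm) set set"
  assumes D: "type_IV_domain G D"
begin

definition period_vector :: "complex ^ 'm \<Rightarrow> bool" where
  "period_vector \<omega> \<longleftrightarrow> C \<omega> \<omega> = 0 \<and> Re (C \<omega> (conj_vec \<omega>)) > 0"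

lemma period_vector_nonzero: "period_vector \<omega> \<Longrightarrow> \<omega> \<noteq> 0"
  by (auto simp: period_vector_def)

lemma period_points_eq: "period_points G = line ` {\<omega>. period_vector \<omega>}"
  by (simp add: period_points_def period_vector_def)

lemma C_conj_scale: "C (t *s \<omega>) (conj_vec (t *s \<omega>)) = of_real ((cmod t)\<^sup>2) * C \<omega> (conj_vec \<omega>)"
proof -
  have "C (t *s \<omega>) (conj_vec (t *s \<omega>)) = (t * cnj t) * C \<omega> (conj_vec \<omega>)"
    by (simp add: conj_vec_scale bil_scale_left bil_scale_right)
  then show ?thesis by (simp only: complex_norm_square)
qed

lemma Re_C_conj_scale: "Re (C (t *s \<omega>) (conj_vec (t *s \<omega>))) = (cmod t)\<^sup>2 * Re (C \<omega> (conj_vec \<omega>))"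
  unfolding C_conj_scale by simp

lemma period_vector_scale: "t \<noteq> 0 \<Longrightarrow> period_vector \<omega> \<Longrightarrow> period_vector (t *s \<omega>)"
  unfolding period_vector_def Re_C_conj_scale by (simp add: bil_scale_left bil_scale_right)

lemma period_vector_if_line:
  assumes "line \<omega> \<in> period_points G" "\<omega> \<noteq> 0"
  shows "period_vector \<omega>"
proof -
  obtain w where w: "line \<omega> = line w" "period_vector w" using assms by (auto simp: period_points_eq)
  then obtain t where "\<omega> = t *s w" using in_line[of \<omega>] by (auto simp: line_eq)
  then show ?thesis using w assms period_vector_scale by auto
qed

definition over_D :: "complex ^ 'm \<Rightarrow> bool" where
  "over_D \<omega> \<longleftrightarrow> \<omega> \<noteq> 0 \<and> line \<omega> \<in> D"

abbreviation periods :: "(complex ^ 'm) set topology" where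
  "periods \<equiv> subtopology proj_top (period_points G)"

lemma D_component: "D \<in> connected_components_of periods"
  using D by (simp add: type_IV_domain_def)

lemma topspace_periods: "topspace periods = period_points G"
  using period_vector_nonzero by (auto simp: topspace_subtopology topspace_proj_top period_points_eq)

lemma D_subset: "D \<subseteq> period_points G"
  using connected_components_of_subset[OF D_component] by (simp only: topspace_periods)

lemma over_D_period: "over_D \<omega> \<Longrightarrow> period_vector \<omega>"
  using D_subset period_vector_if_line by (auto simp: over_D_def)

lemma over_D_scale: "t \<noteq> 0 \<Longrightarrow> over_D (t *s \<omega>) \<longleftrightarrow> over_D \<omega>"
  by (simp add: over_D_def line_scale)

lemma D_lines:
  assumes "l \<in> D" "\<omega> \<in> l" "\<omega> \<noteq> 0"
  shows "l = line \<omega>" "over_D \<omega>"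
proof -
  obtain w where "l = line w" using assms(1) D_subset by (auto simp: period_points_eq)
  then show "l = line \<omega>" using assms line_eq_if_mem by blast
  then show "over_D \<omega>" using assms by (simp add: over_D_def)
qed

lemma D_line_obtain:
  assumes "l \<in> D" obtains \<omega> where "over_D \<omega>" "l = line \<omega>"
proof -
  obtain w where "l = line w" "period_vector w" using assms D_subset by (auto simp: period_points_eq)
  then show ?thesis using that assms period_vector_nonzero by (auto simp: over_D_def)
qed

lemma continuous_map_line:
  assumes f: "continuous_on S f" and p: "\<And>s. s \<in> S \<Longrightarrow> period_vector (f s)"
  shows "continuous_map (top_of_set S) periods (\<lambda>s. line (f s))"
  unfolding continuous_map_in_subtopology
proof
  show "(\<lambda>s. line (f s)) \<in> topspace (top_of_set S) \<rightarrow> period_points G"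
    using p by (auto simp: period_points_eq)
  show "continuous_map (top_of_set S) proj_top (\<lambda>s. line (f s))"
    unfolding continuous_map
  proof (intro conjI allI impI)
    show "(\<lambda>s. line (f s)) ` topspace (top_of_set S) \<subseteq> topspace proj_top"
      using p period_vector_nonzero by (auto simp: topspace_proj_top)
    fix U :: "(complex ^ 'm) set set" assume "openin proj_top U"
    then have "open {\<omega>. \<omega> \<noteq> 0 \<and> line \<omega> \<in> U}" by (simp add: openin_proj_top)
    then have "openin (top_of_set S) (S \<inter> f -` {\<omega>. \<omega> \<noteq> 0 \<and> line \<omega> \<in> U})"
      by (rule continuous_openin_preimage_gen[OF f])
    also have "S \<inter> f -` {\<omega>. \<omega> \<noteq> 0 \<and> line \<omega> \<in> U} = {x \<in> topspace (top_of_set S). line (f x) \<in> U}"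
      using p period_vector_nonzero by auto
    finally show "openin (top_of_set S) {x \<in> topspace (top_of_set S). line (f x) \<in> U}" .
  qed
qed

text \<open>Passing from vectors to lines is continuous, so the lines of the family form a connected set.\<close>

lemma over_D_connected:
  assumes S: "connected S" and f: "continuous_on S f" and p: "\<And>s. s \<in> S \<Longrightarrow> period_vector (f s)"
    and s0: "s0 \<in> S" "over_D (f s0)" and s: "s \<in> S"
  shows "over_D (f s)"
proof -
  have "connectedin periods ((\<lambda>s. line (f s)) ` S)"
    by (rule connectedin_continuous_map_image[OF continuous_map_line[OF f p]])
      (use S in \<open>auto simp: connectedin_subtopology\<close>)
  moreover have "\<not> disjnt D ((\<lambda>s. line (f s)) ` S)"
    using s0 by (auto simp: over_D_def disjnt_def)
  ultimately have "(\<lambda>s. line (f s)) ` S \<subseteq> D" by (rule connected_components_of_maximal[OF D_component])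
  then show ?thesis using s p period_vector_nonzero by (auto simp: over_D_def)
qed

subsection \<open>Frames\<close>

definition frame :: "real ^ 'm \<Rightarrow> real ^ 'm \<Rightarrow> real ^ 'm \<Rightarrow> bool" where
  "frame a b c \<longleftrightarrow> pos_frame a b \<and> B c a = 0 \<and> B c b = 0 \<and> B c c = - 1"

lemma C_fr:
  assumes "pos_frame a b"
  shows "C (fr a b) (fr a b) = 0" "C (fr a b) (frc a b) = 2" "C (frc a b) (fr a b) = 2" "C (frc a b) (frc a b) = 0"
  using assms B_commute[of b a]
  by (simp_all add: fr_def frc_def pos_frame_def bil_add_left bil_add_right bil_diff_left bil_diff_right
      bil_scale_left bil_scale_right bil_cvec)

lemma C_fr_cvec: "C (fr a b) (cvec x) = of_real (B a x) + \<i> * of_real (B b x)"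
  "C (cvec x) (fr a b) = of_real (B x a) + \<i> * of_real (B x b)"
  "C (frc a b) (cvec x) = of_real (B a x) - \<i> * of_real (B b x)"
  "C (cvec x) (frc a b) = of_real (B x a) - \<i> * of_real (B x b)"
  by (simp_all add: fr_def frc_def bil_add_left bil_add_right bil_diff_left bil_diff_right
      bil_scale_left bil_scale_right bil_cvec)

lemma period_vector_fr: "pos_frame a b \<Longrightarrow> period_vector (fr a b)"
  by (simp add: period_vector_def conj_fr C_fr)

text \<open>Isotropy says that the real and the imaginary part are orthogonal of equal norm.\<close>

lemma over_D_normal_form:
  assumes "over_D \<omega>"
  obtains t a b where "t \<noteq> 0" "\<omega> = t *s fr a b" "pos_frame a b" "over_D (fr a b)"
proof -
  define x y where "x = (\<chi> i. Re (\<omega> $ i))" and "y = (\<chi> i. Im (\<omega> $ i))"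
  have \<omega>: "\<omega> = fr x y"
    by (simp add: fr_def cvec_def x_def y_def vec_eq_iff complex_eq_iff)
  have CC: "C \<omega> \<omega> = of_real (B x x - B y y) + \<i> * of_real (2 * B x y)"
    using B_commute[of y x]
    by (simp add: \<omega> fr_def bil_add_left bil_add_right bil_scale_left bil_scale_right bil_cvec algebra_simps)
  have CD: "C \<omega> (conj_vec \<omega>) = of_real (B x x + B y y)"
    using B_commute[of y x]
    by (simp add: \<omega> conj_fr) (simp add: fr_def frc_def bil_add_left bil_diff_right bil_scale_left bil_scale_right bil_cvec algebra_simps)
  have p: "C \<omega> \<omega> = 0" "Re (C \<omega> (conj_vec \<omega>)) > 0"
    using over_D_period[OF assms] by (auto simp: period_vector_def)
  have e: "B x x = B y y" "B x y = 0" using p(1) unfolding CC by (simp_all add: complex_eq_iff)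
  have pos: "B x x > 0" using p(2) unfolding CD using e by simp
  define r where "r = sqrt (B x x)"
  have r: "r > 0" "r * r = B x x" using pos by (simp_all add: r_def)
  define a b where "a = (1 / r) *\<^sub>R x" and "b = (1 / r) *\<^sub>R y"
  have "pos_frame a b"
    using r pos e by (simp add: pos_frame_def a_def b_def bil_scaleR_left bil_scaleR_right)
  moreover have w: "\<omega> = of_real r *s fr a b"
    using r(1) by (simp add: \<omega> a_def b_def flip: fr_scale)
  moreover have "over_D (fr a b)" using assms w over_D_scale[of "of_real r" "fr a b"] r(1) by simp
  ultimately show ?thesis using that[of "of_real r" a b] r(1) by simp
qed

text \<open>The curve cut out of the domain by the complexification of the span of a frame, in the
  coordinate of the unit disc centred at the frame.\<close>

definition disc_curve :: "real ^ 'm \<Rightarrow> real ^ 'm \<Rightarrow> real ^ 'm \<Rightarrow> complex \<Rightarrow> complex ^ 'm" where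
  "disc_curve a b c z = fr a b + (2 * z) *s cvec c + z\<^sup>2 *s frc a b"

definition disc_vec :: "real ^ 'm \<Rightarrow> real ^ 'm \<Rightarrow> real ^ 'm \<Rightarrow> complex \<Rightarrow> complex ^ 'm" where
  "disc_vec a b c z = cvec c + z *s frc a b"

text \<open>The frame \<open>(move_a, move_b, move_c)\<close> at \<open>z\<close> is the image of \<open>(a, b, c)\<close> under an element of
  \<open>SO(2, 1)\<close> that moves the centre of the disc to \<open>z\<close>.  For real \<open>z\<close> it fixes \<open>b\<close> and is a boost in the
  plane of \<open>a\<close> and \<open>c\<close>, of rapidity \<open>2 artanh z\<close>.\<close>

definition move_a :: "real ^ 'm \<Rightarrow> real ^ 'm \<Rightarrow> real ^ 'm \<Rightarrow> complex \<Rightarrow> real ^ 'm" where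
  "move_a a b c z = (1 / (1 - (cmod z)\<^sup>2)) *\<^sub>R ((1 + Re (z\<^sup>2)) *\<^sub>R a + Im (z\<^sup>2) *\<^sub>R b + (2 * Re z) *\<^sub>R c)"

definition move_b :: "real ^ 'm \<Rightarrow> real ^ 'm \<Rightarrow> real ^ 'm \<Rightarrow> complex \<Rightarrow> real ^ 'm" where
  "move_b a b c z = (1 / (1 - (cmod z)\<^sup>2)) *\<^sub>R (Im (z\<^sup>2) *\<^sub>R a + (1 - Re (z\<^sup>2)) *\<^sub>R b + (2 * Im z) *\<^sub>R c)"

definition move_c :: "real ^ 'm \<Rightarrow> real ^ 'm \<Rightarrow> real ^ 'm \<Rightarrow> complex \<Rightarrow> real ^ 'm" where
  "move_c a b c z = (1 / (1 - (cmod z)\<^sup>2)) *\<^sub>R ((1 + (cmod z)\<^sup>2) *\<^sub>R c + (2 * Re z) *\<^sub>R a + (2 * Im z) *\<^sub>R b)"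

lemma one_minus_norm_pos: "cmod z < 1 \<Longrightarrow> 0 < 1 - (cmod z)\<^sup>2"
  by (simp add: power_less_one_iff abs_square_less_1)

lemma disc_curve_eq:
  assumes "cmod z < 1"
  shows "disc_curve a b c z = of_real (1 - (cmod z)\<^sup>2) *s fr (move_a a b c z) (move_b a b c z)"
proof -
  have "1 - (cmod z)\<^sup>2 \<noteq> 0" using one_minus_norm_pos[OF assms] by simp
  then have a: "(1 - (cmod z)\<^sup>2) *\<^sub>R move_a a b c z = (1 + Re (z\<^sup>2)) *\<^sub>R a + Im (z\<^sup>2) *\<^sub>R b + (2 * Re z) *\<^sub>R c"
    and b: "(1 - (cmod z)\<^sup>2) *\<^sub>R move_b a b c z = Im (z\<^sup>2) *\<^sub>R a + (1 - Re (z\<^sup>2)) *\<^sub>R b + (2 * Im z) *\<^sub>R c"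
    by (simp_all only: move_a_def move_b_def scaleR_scaleR) simp_all
  have "of_real (1 - (cmod z)\<^sup>2) *s fr (move_a a b c z) (move_b a b c z)
     = fr ((1 - (cmod z)\<^sup>2) *\<^sub>R move_a a b c z) ((1 - (cmod z)\<^sup>2) *\<^sub>R move_b a b c z)"
    by (simp only: fr_scale)
  also have "\<dots> = disc_curve a b c z"
    unfolding a b by (simp add: disc_curve_def fr_def frc_def cvec_def vec_eq_iff complex_eq_iff algebra_simps)
  finally show ?thesis by simp
qed

text \<open>Modulo the line of the point, the real third vector agrees with the holomorphic one.\<close>

lemma move_c_eq:
  assumes "cmod z < 1"
  shows "cvec (move_c a b c z) = disc_vec a b c z + (cnj z / of_real (1 - (cmod z)\<^sup>2)) *s disc_curve a b c z"
proof -
  let ?r = "1 - (cmod z)\<^sup>2"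
  have r: "?r \<noteq> 0" using one_minus_norm_pos[OF assms] by simp
  have zz: "(cmod z)\<^sup>2 = (Re z)\<^sup>2 + (Im z)\<^sup>2" by (simp add: cmod_power2)
  have "of_real ?r *s cvec (move_c a b c z) = cvec (?r *\<^sub>R move_c a b c z)" by (simp add: cvec_scale)
  also have "?r *\<^sub>R move_c a b c z = (1 + (cmod z)\<^sup>2) *\<^sub>R c + (2 * Re z) *\<^sub>R a + (2 * Im z) *\<^sub>R b"
    using r by (simp only: move_c_def scaleR_scaleR) simp
  also have "cvec \<dots> = of_real ?r *s disc_vec a b c z + cnj z *s disc_curve a b c z"
    unfolding zz
    by (simp add: disc_vec_def disc_curve_def fr_def frc_def cvec_def vec_eq_iff complex_eq_iff power2_eq_square algebra_simps)
  also have "\<dots> = of_real ?r *s (disc_vec a b c z + (cnj z / of_real ?r) *s disc_curve a b c z)"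
    using r by (simp only: vector_add_ldistrib vector_smult_assoc) (simp only: nonzero_mult_div_cancel_left times_divide_eq_right of_real_eq_0_iff not_False_eq_True)
  finally have e: "of_real ?r *s cvec (move_c a b c z) = of_real ?r *s (disc_vec a b c z + (cnj z / of_real ?r) *s disc_curve a b c z)" .
  have "(complex_of_real ?r) \<noteq> 0" using r by (simp only: of_real_eq_0_iff not_False_eq_True)
  then show ?thesis using e by (simp only: vector_mul_lcancel) simp
qed

lemma frame_move:
  assumes f: "frame a b c" and z: "cmod z < 1"
  shows "frame (move_a a b c z) (move_b a b c z) (move_c a b c z)"
proof -
  have r: "1 - (cmod z)\<^sup>2 > 0" by (rule one_minus_norm_pos[OF z])
  have g: "B a a = 1" "B b b = 1" "B a b = 0" "B b a = 0" "B c a = 0" "B a c = 0" "B c b = 0" "B b c = 0" "B c c = - 1"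
    using f B_commute[of b a] B_commute[of a c] B_commute[of b c] by (auto simp: frame_def pos_frame_def)
  have exp: "B (p *\<^sub>R (x1 *\<^sub>R a + y1 *\<^sub>R b + w1 *\<^sub>R c)) (p *\<^sub>R (x2 *\<^sub>R a + y2 *\<^sub>R b + w2 *\<^sub>R c)) = p\<^sup>2 * (x1 * x2 + y1 * y2 - w1 * w2)"
    for p x1 y1 w1 x2 y2 w2
    by (simp add: bil_add_left bil_add_right bil_scaleR_left bil_scaleR_right g power2_eq_square algebra_simps)
  define u v where "u = Re z" and "v = Im z"
  have q: "(cmod z)\<^sup>2 = u\<^sup>2 + v\<^sup>2" "Re (z\<^sup>2) = u\<^sup>2 - v\<^sup>2" "Im (z\<^sup>2) = 2 * u * v"
    by (simp_all add: cmod_power2 u_def v_def Re_power2 Im_power2)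
  have c: "move_c a b c z = (1 / (1 - (cmod z)\<^sup>2)) *\<^sub>R ((2 * Re z) *\<^sub>R a + (2 * Im z) *\<^sub>R b + (1 + (cmod z)\<^sup>2) *\<^sub>R c)"
    by (simp add: move_c_def algebra_simps)
  have r': "1 - (u\<^sup>2 + v\<^sup>2) \<noteq> 0" using r q by simp
  show ?thesis
    unfolding frame_def pos_frame_def c move_a_def move_b_def exp q
    unfolding u_def[symmetric] v_def[symmetric]
    using r' by (simp add: power_divide divide_simps) (simp add: power2_eq_square algebra_simps)
qed

lemma over_D_disc:
  assumes f: "frame a b c" and z: "cmod z < 1" "cmod w < 1"
  shows "over_D (disc_curve a b c z) \<longleftrightarrow> over_D (disc_curve a b c w)"
proof -
  have p: "period_vector (disc_curve a b c s)" if "s \<in> ball 0 1" for s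
  proof -
    have s: "cmod s < 1" using that by simp
    have "(complex_of_real (1 - (cmod s)\<^sup>2)) \<noteq> 0"
      using one_minus_norm_pos[OF s] by (metis less_irrefl of_real_eq_0_iff)
    then show ?thesis
      unfolding disc_curve_eq[OF s] using frame_move[OF f s]
      by (intro period_vector_scale period_vector_fr) (auto simp: frame_def)
  qed
  have cont: "continuous_on (ball 0 1) (disc_curve a b c)"
    unfolding disc_curve_def by (intro continuous_intros)
  show ?thesis
    using over_D_connected[OF connected_ball cont p, of z w] over_D_connected[OF connected_ball cont p, of w z] z by auto
qed

lemma over_D_move:
  assumes f: "frame a b c" and z: "cmod z < 1"
  shows "over_D (fr (move_a a b c z) (move_b a b c z)) \<longleftrightarrow> over_D (fr a b)"
proof -
  have "(complex_of_real (1 - (cmod z)\<^sup>2)) \<noteq> 0"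
    using one_minus_norm_pos[OF z] by (metis less_irrefl of_real_eq_0_iff)
  then have "over_D (fr (move_a a b c z) (move_b a b c z)) \<longleftrightarrow> over_D (disc_curve a b c z)"
    unfolding disc_curve_eq[OF z] by (rule over_D_scale[symmetric])
  also have "\<dots> \<longleftrightarrow> over_D (disc_curve a b c 0)" using over_D_disc[OF f z, of 0] by simp
  also have "disc_curve a b c 0 = fr a b" by (simp add: disc_curve_def)
  finally show ?thesis .
qed

subsection \<open>The domain and its complex conjugate\<close>

text \<open>Complex conjugation exchanges the two components: the sign of the imaginary part of
  \<open>(\<omega>, e1) (\<omega>, e2)\<^sup>*\<close> does not vanish on the periods, since positive planes project injectively to the
  plane of \<open>e1, e2\<close>, and it is reversed by conjugation.\<close>

lemma not_over_D_conj:
  assumes w: "over_D \<omega>" shows "\<not> over_D (conj_vec \<omega>)"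
proof
  assume wc: "over_D (conj_vec \<omega>)"
  obtain e1 e2 where e: "\<And>x. B x e1 = 0 \<Longrightarrow> B x e2 = 0 \<Longrightarrow> x \<noteq> 0 \<Longrightarrow> B x x < 0"
    using signature_basis by metis
  define \<sigma> where "\<sigma> \<omega> = Im (C \<omega> (cvec e1) * cnj (C \<omega> (cvec e2))) / Re (C \<omega> (conj_vec \<omega>))" for \<omega>
  have \<sigma>_scale: "\<sigma> (t *s \<omega>) = \<sigma> \<omega>" if "t \<noteq> 0" for t \<omega>
  proof -
    have t: "t * cnj t = of_real ((cmod t)\<^sup>2)" by (simp only: complex_norm_square)
    have "C (t *s \<omega>) (cvec e1) * cnj (C (t *s \<omega>) (cvec e2)) = (t * cnj t) * (C \<omega> (cvec e1) * cnj (C \<omega> (cvec e2)))"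
      by (simp add: bil_scale_left)
    moreover have "C (t *s \<omega>) (conj_vec (t *s \<omega>)) = (t * cnj t) * C \<omega> (conj_vec \<omega>)"
      by (simp add: conj_vec_scale bil_scale_left bil_scale_right)
    ultimately show ?thesis using that unfolding \<sigma>_def t by simp
  qed
  have \<sigma>_nz: "\<sigma> \<omega> \<noteq> 0" if v: "over_D \<omega>" for \<omega>
  proof -
    obtain t a b where t: "t \<noteq> 0" "\<omega> = t *s fr a b" "pos_frame a b" using over_D_normal_form[OF v] by metis
    have "Im (C (fr a b) (cvec e1) * cnj (C (fr a b) (cvec e2))) = B b e1 * B a e2 - B a e1 * B b e2"
      by (simp add: C_fr_cvec)
    moreover have "B a e1 * B b e2 - B b e1 * B a e2 \<noteq> 0"
      by (rule plane_not_in_complement) (use e t(3) in blast)+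
    ultimately have "\<sigma> (fr a b) \<noteq> 0"
      using C_fr[OF t(3)] by (auto simp: \<sigma>_def conj_fr)
    then show ?thesis using t \<sigma>_scale by simp
  qed
  have open_sets: "openin periods {l \<in> period_points G. \<exists>\<omega>\<in>l. \<omega> \<noteq> 0 \<and> s * \<sigma> \<omega> > 0}" for s :: real
  proof -
    let ?P = "{\<omega>. Re (C \<omega> (conj_vec \<omega>)) > 0}"
    let ?T = "{\<omega> \<in> ?P. s * \<sigma> \<omega> > 0}"
    have "open ?P" by (intro open_Collect_less continuous_intros)
    moreover have "continuous_on ?P (\<lambda>\<omega>. s * \<sigma> \<omega>)"
      unfolding \<sigma>_def by (intro continuous_intros) auto
    ultimately have "open (?P \<inter> (\<lambda>\<omega>. s * \<sigma> \<omega>) -` {0<..})"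
      by (intro continuous_open_preimage) auto
    moreover have "?P \<inter> (\<lambda>\<omega>. s * \<sigma> \<omega>) -` {0<..} = ?T" by auto
    ultimately have "open ?T" by (simp only:)
    have sc: "\<omega> \<in> ?T" if "t *s \<omega> \<in> ?T" for t \<omega>
    proof -
      have t: "t \<noteq> 0" using that by auto
      show ?thesis using that t \<sigma>_scale[OF t] unfolding mem_Collect_eq Re_C_conj_scale
        by (simp add: zero_less_mult_iff)
    qed
    have eq: "{\<omega>. \<omega> \<noteq> 0 \<and> line \<omega> \<in> line ` ?T} = ?T"
    proof (intro equalityI subsetI)
      fix \<omega> assume "\<omega> \<in> {\<omega>. \<omega> \<noteq> 0 \<and> line \<omega> \<in> line ` ?T}"
      then obtain w where "line \<omega> = line w" "w \<in> ?T" by blast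
      moreover obtain t where "w = t *s \<omega>" using calculation in_line[of w] by (auto simp: line_eq)
      ultimately show "\<omega> \<in> ?T" using sc by blast
    qed auto
    have "0 \<notin> ?T" by simp
    then have "line ` ?T \<subseteq> line ` (- {0})" by (intro image_mono) auto
    then have "openin proj_top (line ` ?T)"
      unfolding openin_proj_top eq using \<open>open ?T\<close> by blast
    then have "openin periods (period_points G \<inter> line ` ?T)" by (rule openin_subtopology_Int2)
    also have "period_points G \<inter> line ` ?T = {l \<in> period_points G. \<exists>\<omega>\<in>l. \<omega> \<noteq> 0 \<and> s * \<sigma> \<omega> > 0}"
    proof (intro equalityI subsetI)
      fix l assume "l \<in> period_points G \<inter> line ` ?T"
      then obtain w where "l \<in> period_points G" "l = line w" "w \<in> ?T" by blast
      then show "l \<in> {l \<in> period_points G. \<exists>\<omega>\<in>l. \<omega> \<noteq> 0 \<and> s * \<sigma> \<omega> > 0}"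
        using \<open>0 \<notin> ?T\<close> in_line[of w] by (intro CollectI conjI bexI[of _ w]) auto
    next
      fix l assume l: "l \<in> {l \<in> period_points G. \<exists>\<omega>\<in>l. \<omega> \<noteq> 0 \<and> s * \<sigma> \<omega> > 0}"
      then obtain \<omega> w where \<omega>: "\<omega> \<in> l" "\<omega> \<noteq> 0" "s * \<sigma> \<omega> > 0" and w: "l = line w"
        by (auto simp: period_points_eq)
      have "line \<omega> = l" using line_eq_if_mem[of \<omega> w] \<omega> w by simp
      moreover have "period_vector \<omega>" using period_vector_if_line l \<omega> calculation by blast
      ultimately show "l \<in> period_points G \<inter> line ` ?T" using l \<omega> by (auto simp: period_vector_def)
    qed
    finally show ?thesis .
  qed
  have conD: "connectedin periods D" by (rule connectedin_connected_components_of[OF D_component])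
  let ?E = "\<lambda>s::real. {l \<in> period_points G. \<exists>\<omega>\<in>l. \<omega> \<noteq> 0 \<and> s * \<sigma> \<omega> > 0}"
  have cover: "D \<subseteq> ?E 1 \<union> ?E (- 1)"
  proof
    fix l assume l: "l \<in> D"
    obtain w where w: "over_D w" "l = line w" by (rule D_line_obtain[OF l])
    then have "w \<in> l" "w \<noteq> 0" "\<sigma> w \<noteq> 0" using \<sigma>_nz by (auto simp: over_D_def)
    then have "(\<exists>\<omega>\<in>l. \<omega> \<noteq> 0 \<and> 1 * \<sigma> \<omega> > 0) \<or> (\<exists>\<omega>\<in>l. \<omega> \<noteq> 0 \<and> (- 1) * \<sigma> \<omega> > 0)"
      by (cases "\<sigma> w > 0") auto
    then show "l \<in> ?E 1 \<union> ?E (- 1)" using l D_subset by blast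
  qed
  have disj: "?E 1 \<inter> ?E (- 1) \<inter> D = {}"
  proof (rule ccontr)
    assume "?E 1 \<inter> ?E (- 1) \<inter> D \<noteq> {}"
    then obtain l w w' where l: "l \<in> D" and w: "w \<in> l" "w \<noteq> 0" "\<sigma> w > 0" and w': "w' \<in> l" "w' \<noteq> 0" "\<sigma> w' < 0" by auto
    have "w' \<in> line w" using D_lines[OF l w(1,2)] w' by simp
    then obtain t where "w' = t *s w" by (auto simp: line_eq)
    moreover have "t \<noteq> 0" using calculation w' by auto
    ultimately show False using \<sigma>_scale w w' by force
  qed
  have in_E: "line v \<in> ?E s" if "over_D v" "s * \<sigma> v > 0" for v s
  proof -
    have "v \<in> line v" "v \<noteq> 0" using that(1) by (auto simp: over_D_def)
    moreover have "line v \<in> period_points G" using that(1) D_subset by (auto simp: over_D_def)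
    ultimately show ?thesis using that(2) by blast
  qed
  have neg: "\<sigma> (conj_vec \<omega>) = - \<sigma> \<omega>"
  proof -
    obtain t a b where t: "t \<noteq> 0" "\<omega> = t *s fr a b" "pos_frame a b" using over_D_normal_form[OF w] by metis
    have "\<sigma> (conj_vec \<omega>) = \<sigma> (frc a b)" using t \<sigma>_scale[of "cnj t" "frc a b"] by (simp add: conj_vec_scale conj_fr)
    also have "\<dots> = - \<sigma> (fr a b)"
      using C_fr[OF t(3)] by (simp add: \<sigma>_def conj_fr C_fr_cvec) (simp add: field_simps)
    also have "\<sigma> (fr a b) = \<sigma> \<omega>" using t \<sigma>_scale by simp
    finally show ?thesis .
  qed
  have ne: "?E 1 \<inter> D \<noteq> {} \<and> ?E (- 1) \<inter> D \<noteq> {}"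
  proof (cases "\<sigma> \<omega> > 0")
    case True
    then have "line \<omega> \<in> ?E 1" "line (conj_vec \<omega>) \<in> ?E (- 1)" using in_E[OF w, of 1] in_E[OF wc, of "-1"] neg by auto
    then show ?thesis using w wc unfolding over_D_def by blast
  next
    case False
    then have "\<sigma> \<omega> < 0" using \<sigma>_nz[OF w] by simp
    then have "line \<omega> \<in> ?E (- 1)" "line (conj_vec \<omega>) \<in> ?E 1" using in_E[OF w, of "-1"] in_E[OF wc, of 1] neg by auto
    then show ?thesis using w wc unfolding over_D_def by blast
  qed
  show False
    using conD open_sets[of 1] open_sets[of "- 1"] cover disj ne unfolding connectedin by blast
qed

text \<open>Two frames of the same three-dimensional space.  The conic of isotropic lines in its
  complexification has two discs of period vectors, parametrised by \<open>disc_curve a b c\<close> and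
  \<open>disc_curve a (- b) c\<close>.\<close>

lemma frame_sides:
  assumes f: "frame a b c" and f': "frame a' b' c'"
    and span: "\<And>x. x \<in> {a', b', c'} \<Longrightarrow> x = B x a *\<^sub>R a + B x b *\<^sub>R b - B x c *\<^sub>R c"
  shows "\<exists>z \<alpha>. cmod z < 1 \<and> \<alpha> \<noteq> 0 \<and>
    (fr a' b' = \<alpha> *s disc_curve a b c z \<or> fr a' b' = \<alpha> *s disc_curve a (- b) c z)"
proof -
  have g: "B a a = 1" "B b b = 1" "B a b = 0" "B b a = 0" "B c a = 0" "B a c = 0" "B c b = 0" "B b c = 0" "B c c = - 1"
    using f B_commute[of b a] B_commute[of a c] B_commute[of b c] by (auto simp: frame_def pos_frame_def)
  have pf: "pos_frame a b" "pos_frame a' b'" using f f' by (auto simp: frame_def)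
  let ?w = "fr a b" and ?v = "frc a b"
  define \<alpha> \<beta> \<gamma> where "\<alpha> = C (fr a' b') ?v / 2" and "\<beta> = - C (fr a' b') (cvec c)" and "\<gamma> = C (fr a' b') ?w / 2"
  have cx: "cvec x = (C (cvec x) ?v / 2) *s ?w - C (cvec x) (cvec c) *s cvec c + (C (cvec x) ?w / 2) *s ?v" if "x \<in> {a', b', c'}" for x
  proof -
    have "cvec x = cvec (B x a *\<^sub>R a + B x b *\<^sub>R b - B x c *\<^sub>R c)" using span[OF that] by simp
    also have "\<dots> = (C (cvec x) ?v / 2) *s ?w - C (cvec x) (cvec c) *s cvec c + (C (cvec x) ?w / 2) *s ?v"
      unfolding C_fr_cvec bil_cvec unfolding fr_def frc_def by (simp add: cvec_def vec_eq_iff complex_eq_iff field_simps)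
    finally show ?thesis .
  qed
  have exp: "fr a' b' = \<alpha> *s ?w + \<beta> *s cvec c + \<gamma> *s ?v"
  proof -
    have "fr a' b' = cvec a' + \<i> *s cvec b'" by (simp add: fr_def)
    also have "\<dots> = ((C (cvec a') ?v / 2) *s ?w - C (cvec a') (cvec c) *s cvec c + (C (cvec a') ?w / 2) *s ?v)
       + \<i> *s ((C (cvec b') ?v / 2) *s ?w - C (cvec b') (cvec c) *s cvec c + (C (cvec b') ?w / 2) *s ?v)"
      using cx[of a'] cx[of b'] by simp
    also have "\<dots> = \<alpha> *s ?w + \<beta> *s cvec c + \<gamma> *s ?v"
      unfolding \<alpha>_def \<beta>_def \<gamma>_def fr_def[of a' b'] bil_add_left bil_scale_left
      by (simp add: vec_eq_iff algebra_simps add_divide_distrib)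
    finally show ?thesis .
  qed
  have cc: "C (cvec c) (cvec c) = - 1" "C (cvec c) ?w = 0" "C ?w (cvec c) = 0" "C (cvec c) ?v = 0" "C ?v (cvec c) = 0"
    by (simp_all add: bil_cvec C_fr_cvec g)
  have "0 = C (fr a' b') (fr a' b')" using C_fr[OF pf(2)] by simp
  also have "\<dots> = 4 * \<alpha> * \<gamma> - \<beta>\<^sup>2"
    unfolding exp bil_add_left bil_add_right bil_scale_left bil_scale_right C_fr[OF pf(1)] cc
    by (simp add: power2_eq_square algebra_simps)
  finally have iso: "\<beta>\<^sup>2 = 4 * \<alpha> * \<gamma>" by simp
  have "2 = C (fr a' b') (conj_vec (fr a' b'))" using C_fr[OF pf(2)] by (simp add: conj_fr)
  also have "conj_vec (fr a' b') = cnj \<alpha> *s ?v + cnj \<beta> *s cvec c + cnj \<gamma> *s ?w"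
    unfolding exp conj_vec_add conj_vec_scale conj_fr conj_vec_cvec by simp
  also have "C (fr a' b') \<dots> = 2 * (\<alpha> * cnj \<alpha>) - \<beta> * cnj \<beta> + 2 * (\<gamma> * cnj \<gamma>)"
    unfolding exp bil_add_left bil_add_right bil_scale_left bil_scale_right C_fr[OF pf(1)] cc
    by (simp add: algebra_simps)
  finally have nrm0: "2 = 2 * (\<alpha> * cnj \<alpha>) - \<beta> * cnj \<beta> + 2 * (\<gamma> * cnj \<gamma>)" .
  have nrm: "2 = 2 * (cmod \<alpha>)\<^sup>2 - (cmod \<beta>)\<^sup>2 + 2 * (cmod \<gamma>)\<^sup>2"
  proof -
    have "of_real 2 = (of_real (2 * (cmod \<alpha>)\<^sup>2 - (cmod \<beta>)\<^sup>2 + 2 * (cmod \<gamma>)\<^sup>2) :: complex)"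
      using nrm0 by (simp add: complex_norm_square flip: complex_norm_square)
    then show ?thesis using of_real_eq_iff by blast
  qed
  have nb: "(cmod \<beta>)\<^sup>2 = 4 * cmod \<alpha> * cmod \<gamma>"
    using arg_cong[OF iso, of cmod] by (simp add: norm_power norm_mult)
  have diff: "(cmod \<alpha> - cmod \<gamma>)\<^sup>2 = 1" using nrm nb by (simp add: power2_eq_square algebra_simps)
  have frc_neg: "fr a (- b) = ?v" "frc a (- b) = ?w" by (simp_all add: fr_def frc_def cvec_minus vec_eq_iff)
  show ?thesis
  proof (cases "cmod \<gamma> < cmod \<alpha>")
    case False
    then have lt: "cmod \<alpha> < cmod \<gamma>" using diff by (cases "cmod \<alpha> = cmod \<gamma>") auto
    then have g0: "\<gamma> \<noteq> 0" by auto
    define z where "z = \<beta> / (2 * \<gamma>)"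
    have z2: "z\<^sup>2 = \<alpha> / \<gamma>" using iso g0 by (simp add: z_def power_divide field_simps power2_eq_square)
    have "(cmod z)\<^sup>2 < 1" using arg_cong[OF z2, of cmod] lt g0 by (simp add: norm_power norm_divide)
    then have "cmod z < 1" by (simp add: abs_square_less_1)
    moreover have "fr a' b' = \<gamma> *s disc_curve a (- b) c z"
      unfolding exp disc_curve_def frc_neg z2 using g0 by (simp add: z_def vec_eq_iff field_simps)
    ultimately show ?thesis using g0 by blast
  next
    case True
    then have a0: "\<alpha> \<noteq> 0" by auto
    define z where "z = \<beta> / (2 * \<alpha>)"
    have z2: "z\<^sup>2 = \<gamma> / \<alpha>" using iso a0 by (simp add: z_def power_divide field_simps power2_eq_square)
    have "(cmod z)\<^sup>2 < 1" using arg_cong[OF z2, of cmod] True a0 by (simp add: norm_power norm_divide)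
    then have "cmod z < 1" by (simp add: abs_square_less_1)
    moreover have "fr a' b' = \<alpha> *s disc_curve a b c z"
      unfolding exp disc_curve_def z2 using a0 by (simp add: z_def vec_eq_iff field_simps)
    ultimately show ?thesis using a0 by blast
  qed
qed

lemma frame_conj: "frame a b c \<Longrightarrow> frame a (- b) c"
  by (auto simp: frame_def pos_frame_def bil_minus_left bil_minus_right)

lemma fr_minus: "fr a (- b) = frc a b" "frc a (- b) = fr a b"
  by (simp_all add: fr_def frc_def cvec_minus vec_eq_iff)

lemma conj_disc_curve: "conj_vec (disc_curve a (- b) c z) = disc_curve a b c (cnj z)"
  by (simp add: disc_curve_def conj_vec_add conj_vec_scale fr_minus conj_fr)

lemma over_D_sides:
  assumes f: "frame a b c" and D0: "over_D (fr a b)" and f': "frame a' b' c'"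
    and span: "\<And>x. x \<in> {a', b', c'} \<Longrightarrow> x = B x a *\<^sub>R a + B x b *\<^sub>R b - B x c *\<^sub>R c"
  shows "over_D (fr a' b') \<or> over_D (conj_vec (fr a' b'))"
proof -
  obtain z \<alpha> where z: "cmod z < 1" "\<alpha> \<noteq> 0" and
    alt: "fr a' b' = \<alpha> *s disc_curve a b c z \<or> fr a' b' = \<alpha> *s disc_curve a (- b) c z"
    using frame_sides[OF f f' span] by blast
  have D: "over_D (disc_curve a b c w)" if "cmod w < 1" for w
    using over_D_disc[OF f that, of 0] D0 by (simp add: disc_curve_def)
  from alt show ?thesis
  proof
    assume "fr a' b' = \<alpha> *s disc_curve a b c z"
    then show ?thesis using D[OF z(1)] z(2) by (simp add: over_D_scale)
  next
    assume "fr a' b' = \<alpha> *s disc_curve a (- b) c z"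
    then have "conj_vec (fr a' b') = cnj \<alpha> *s disc_curve a b c (cnj z)"
      by (simp add: conj_vec_scale conj_disc_curve)
    then show ?thesis using D[of "cnj z"] z by (simp add: over_D_scale)
  qed
qed

text \<open>A frame over the domain is, up to a rotation of the plane and the sign of \<open>c\<close>, a moved frame on
  the disc of any other frame of the same space.\<close>

lemma frame_on_disc:
  assumes f: "frame a b c" and D0: "over_D (fr a b)" and f': "frame a' b' c'" and D1: "over_D (fr a' b')"
    and span: "\<And>x. x \<in> {a', b', c'} \<Longrightarrow> x = B x a *\<^sub>R a + B x b *\<^sub>R b - B x c *\<^sub>R c"
  obtains z t where "cmod z < 1" "t \<noteq> 0" "cmod t = 1" "fr a' b' = t *s fr (move_a a b c z) (move_b a b c z)"
    "c' = move_c a b c z \<or> c' = - move_c a b c z"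
proof -
  have g: "B a a = 1" "B b b = 1" "B a b = 0" "B b a = 0" "B c a = 0" "B a c = 0" "B c b = 0" "B b c = 0" "B c c = - 1"
    using f B_commute[of b a] B_commute[of a c] B_commute[of b c] by (auto simp: frame_def pos_frame_def)
  have pf: "pos_frame a b" "pos_frame a' b'" using f f' by (auto simp: frame_def)
  have notc: "\<not> over_D (frc a b)" using not_over_D_conj[OF D0] by (simp add: conj_fr)
  obtain z \<alpha> where zl: "cmod z < 1" and a0: "\<alpha> \<noteq> 0" and
    alt: "fr a' b' = \<alpha> *s disc_curve a b c z \<or> fr a' b' = \<alpha> *s disc_curve a (- b) c z"
    using frame_sides[OF f f' span] by blast
  have "fr a' b' \<noteq> \<alpha> *s disc_curve a (- b) c z"
  proof
    assume "fr a' b' = \<alpha> *s disc_curve a (- b) c z"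
    then have "over_D (disc_curve a (- b) c z)" using D1 over_D_scale a0 by simp
    then have "over_D (disc_curve a (- b) c 0)" using over_D_disc[OF frame_conj[OF f] zl, of 0] by simp
    then show False using notc by (simp add: disc_curve_def fr_minus)
  qed
  then have "fr a' b' = \<alpha> *s disc_curve a b c z" using alt by blast
  then have eq: "fr a' b' = (\<alpha> * of_real (1 - (cmod z)\<^sup>2)) *s fr (move_a a b c z) (move_b a b c z)"
    unfolding disc_curve_eq[OF zl] by (simp only: vector_smult_assoc)
  define t where "t = \<alpha> * of_real (1 - (cmod z)\<^sup>2)"
  note eq = eq[folded t_def]
  have fm: "frame (move_a a b c z) (move_b a b c z) (move_c a b c z)" by (rule frame_move[OF f zl])
  then have pm: "pos_frame (move_a a b c z) (move_b a b c z)" by (simp add: frame_def)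
  have t0: "t \<noteq> 0" using a0 one_minus_norm_pos[OF zl] by (auto simp: t_def simp flip: of_real_power)
  have t1: "cmod t = 1"
  proof -
    have "2 = C (fr a' b') (conj_vec (fr a' b'))" using C_fr[OF pf(2)] by (simp add: conj_fr)
    also have "\<dots> = 2 * (t * cnj t)" unfolding eq conj_vec_scale conj_fr bil_scale_left bil_scale_right C_fr[OF pm] by simp
    finally have "t * cnj t = 1" by simp
    then have "complex_of_real ((cmod t)\<^sup>2) = 1" by (simp only: complex_norm_square)
    then have "(cmod t)\<^sup>2 = 1" by (simp only: of_real_eq_1_iff)
    then show ?thesis by (simp add: power2_eq_1_iff) (use norm_ge_zero[of t] in linarith)
  qed
  let ?C = "cvec (move_c a b c z)" and ?W = "fr (move_a a b c z) (move_b a b c z)" and ?V = "frc (move_a a b c z) (move_b a b c z)"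
  \<comment> \<open>both third vectors lie in the span of the frame and are orthogonal to the same plane\<close>
  have c'W: "C (cvec c') ?W = 0"
  proof -
    have "t * C (cvec c') ?W = C (cvec c') (fr a' b')" by (simp add: eq bil_scale_right)
    also have "\<dots> = 0" using f' by (simp add: C_fr_cvec frame_def)
    finally show ?thesis using t0 by simp
  qed
  have real0: "B c' (move_a a b c z) = 0" "B c' (move_b a b c z) = 0"
    using c'W by (simp_all add: C_fr_cvec complex_eq_iff)
  have mc: "B (move_c a b c z) x = 0" if "x \<in> {move_a a b c z, move_b a b c z}" for x
    using fm that by (auto simp: frame_def)
  define \<kappa> where "\<kappa> = B c' (move_c a b c z)"
  define y where "y = c' + \<kappa> *\<^sub>R move_c a b c z"
  have y1: "B y (move_a a b c z) = 0" "B y (move_b a b c z) = 0" "B y (move_c a b c z) = 0"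
    using real0 mc fm by (simp_all add: y_def bil_add_left bil_scaleR_left \<kappa>_def frame_def)
  have "y = 0"
  proof -
    have r: "1 - (cmod z)\<^sup>2 \<noteq> 0" using one_minus_norm_pos[OF zl] by simp
    define u v where "u = Re z" and "v = Im z"
    have q: "(cmod z)\<^sup>2 = u\<^sup>2 + v\<^sup>2" "Re (z\<^sup>2) = u\<^sup>2 - v\<^sup>2" "Im (z\<^sup>2) = 2 * u * v"
      by (simp_all add: cmod_power2 u_def v_def Re_power2 Im_power2)
    have e1: "(1 + (u\<^sup>2 - v\<^sup>2)) * B y a + (2 * u * v) * B y b + (2 * u) * B y c = 0"
      using y1(1) r unfolding move_a_def q u_def[symmetric] v_def[symmetric] by (simp add: bil_scaleR_right bil_add_right)
    have e2: "(2 * u * v) * B y a + (1 - (u\<^sup>2 - v\<^sup>2)) * B y b + (2 * v) * B y c = 0"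
      using y1(2) r unfolding move_b_def q u_def[symmetric] v_def[symmetric] by (simp add: bil_scaleR_right bil_add_right)
    have e3: "(1 + (u\<^sup>2 + v\<^sup>2)) * B y c + (2 * u) * B y a + (2 * v) * B y b = 0"
      using y1(3) r unfolding move_c_def q u_def[symmetric] v_def[symmetric] by (simp add: bil_scaleR_right bil_add_right)
    define X Y W where "X = B y a" and "Y = B y b" and "W = B y c"
    note e = e1[folded X_def Y_def W_def] e2[folded X_def Y_def W_def] e3[folded X_def Y_def W_def]
    have r': "1 - (u\<^sup>2 + v\<^sup>2) \<noteq> 0" using r q by simp
    \<comment> \<open>the inverse of the change of frame is the one of \<open>- z\<close>\<close>
    have "(1 - (u\<^sup>2 + v\<^sup>2))\<^sup>2 * W = (1 + (u\<^sup>2 + v\<^sup>2)) * ((1 + (u\<^sup>2 + v\<^sup>2)) * W + (2 * u) * X + (2 * v) * Y)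
       - 2 * u * ((1 + (u\<^sup>2 - v\<^sup>2)) * X + (2 * u * v) * Y + (2 * u) * W)
       - 2 * v * ((2 * u * v) * X + (1 - (u\<^sup>2 - v\<^sup>2)) * Y + (2 * v) * W)"
      by (simp add: power2_eq_square algebra_simps)
    then have W0: "W = 0" unfolding e using r' by simp
    have "(1 - (u\<^sup>2 + v\<^sup>2)) * (1 + (u\<^sup>2 + v\<^sup>2)) * X = (1 - (u\<^sup>2 - v\<^sup>2)) * ((1 + (u\<^sup>2 - v\<^sup>2)) * X + (2 * u * v) * Y + (2 * u) * W)
       - (2 * u * v) * ((2 * u * v) * X + (1 - (u\<^sup>2 - v\<^sup>2)) * Y + (2 * v) * W)"
      by (simp add: W0 power2_eq_square algebra_simps)
    moreover have "1 + (u\<^sup>2 + v\<^sup>2) \<noteq> 0" by (smt (verit) zero_le_power2)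
    ultimately have X0: "X = 0" unfolding e using r' by simp
    have "(1 - (u\<^sup>2 + v\<^sup>2)) * (1 + (u\<^sup>2 + v\<^sup>2)) * Y = (1 + (u\<^sup>2 - v\<^sup>2)) * ((2 * u * v) * X + (1 - (u\<^sup>2 - v\<^sup>2)) * Y + (2 * v) * W)
       - (2 * u * v) * ((1 + (u\<^sup>2 - v\<^sup>2)) * X + (2 * u * v) * Y + (2 * u) * W)"
      by (simp add: W0 power2_eq_square algebra_simps)
    then have Y0: "Y = 0" unfolding e using r' \<open>1 + (u\<^sup>2 + v\<^sup>2) \<noteq> 0\<close> by simp
    have "y = B y a *\<^sub>R a + B y b *\<^sub>R b - B y c *\<^sub>R c"
    proof -
      have 1: "c' = B c' a *\<^sub>R a + B c' b *\<^sub>R b - B c' c *\<^sub>R c" by (rule span) simp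
      have 2: "x = B x a *\<^sub>R a + B x b *\<^sub>R b - B x c *\<^sub>R c" if "x = p *\<^sub>R a + s *\<^sub>R b + w *\<^sub>R c" for x p s w
        unfolding that by (simp add: bil_add_left bil_scaleR_left g)
      have 3: "move_c a b c z = ((1 / (1 - (cmod z)\<^sup>2)) * (2 * Re z)) *\<^sub>R a + ((1 / (1 - (cmod z)\<^sup>2)) * (2 * Im z)) *\<^sub>R b + ((1 / (1 - (cmod z)\<^sup>2)) * (1 + (cmod z)\<^sup>2)) *\<^sub>R c"
        by (simp only: move_c_def scaleR_add_right scaleR_scaleR) simp
      have "y = (B c' a + \<kappa> * B (move_c a b c z) a) *\<^sub>R a + (B c' b + \<kappa> * B (move_c a b c z) b) *\<^sub>R b - (B c' c + \<kappa> * B (move_c a b c z) c) *\<^sub>R c"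
        unfolding y_def by (subst 1, subst (1) 2[OF 3]) (simp add: algebra_simps)
      moreover have "B y a = B c' a + \<kappa> * B (move_c a b c z) a" "B y b = B c' b + \<kappa> * B (move_c a b c z) b"
        "B y c = B c' c + \<kappa> * B (move_c a b c z) c"
        by (simp_all add: y_def bil_add_left bil_scaleR_left)
      ultimately show ?thesis by simp
    qed
    then show ?thesis using X0 Y0 W0 by (simp add: X_def Y_def W_def)
  qed
  then have c'e: "c' = (- \<kappa>) *\<^sub>R move_c a b c z" by (simp add: y_def eq_neg_iff_add_eq_0)
  have "- 1 = B c' c'" using f' by (simp add: frame_def)
  also have "\<dots> = - \<kappa>\<^sup>2" unfolding c'e using fm by (simp add: bil_minus_left bil_minus_right bil_scaleR_left bil_scaleR_right frame_def power2_eq_square)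
  finally have "\<kappa> = 1 \<or> \<kappa> = - 1" by (simp add: power2_eq_1_iff)
  then have "c' = move_c a b c z \<or> c' = - move_c a b c z" using c'e by auto
  then show ?thesis using that[OF zl t0 t1 eq] by blast
qed

end

section \<open>Reduction theory of ternary lattices\<close>

definition gramdet :: "'a::comm_ring_1 ^ 'm ^ 'm \<Rightarrow> 'a ^ 'm \<Rightarrow> 'a ^ 'm \<Rightarrow> 'a ^ 'm \<Rightarrow> 'a" where
  "gramdet A x y z = bil A x x * bil A y y * bil A z z + 2 * bil A x y * bil A x z * bil A y z
     - bil A x x * (bil A y z)\<^sup>2 - bil A y y * (bil A x z)\<^sup>2 - bil A z z * (bil A x y)\<^sup>2"

text \<open>A multiple of the dual basis vector of \<open>x\<close> in the span of \<open>x, y, z\<close>; it has integral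
  coefficients, so that no denominators arise except the Gram determinant.\<close>

definition dual :: "'a::comm_ring_1 ^ 'm ^ 'm \<Rightarrow> 'a ^ 'm \<Rightarrow> 'a ^ 'm \<Rightarrow> 'a ^ 'm \<Rightarrow> 'a ^ 'm" where
  "dual A x y z = (bil A y y * bil A z z - (bil A y z)\<^sup>2) *s x
     + (bil A x z * bil A y z - bil A x y * bil A z z) *s y + (bil A x y * bil A y z - bil A x z * bil A y y) *s z"

lemma dual_bil:
  assumes "transpose A = A"
  shows "bil A (dual A x y z) x = gramdet A x y z" "bil A (dual A x y z) y = 0" "bil A (dual A x y z) z = 0"
  using bil_commute[OF assms, of y x] bil_commute[OF assms, of z x] bil_commute[OF assms, of z y]
  unfolding dual_def gramdet_def bil_add_left bil_scale_left
  by (simp_all add: power2_eq_square algebra_simps)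

lemma gramdet_rotate:
  assumes "transpose A = A"
  shows "gramdet A y z x = gramdet A x y z"
  using bil_commute[OF assms, of y x] bil_commute[OF assms, of z x] bil_commute[OF assms, of z y]
  by (simp add: gramdet_def algebra_simps)

lemma gramdet_add:
  assumes "transpose A = A"
  shows "gramdet A x y (z + s *s x + t *s y) = gramdet A x y z"
  using bil_commute[OF assms, of y x] bil_commute[OF assms, of z x] bil_commute[OF assms, of z y]
  by (simp add: gramdet_def bil_add_left bil_add_right bil_scale_left bil_scale_right power2_eq_square algebra_simps)

text \<open>If the third basis vector cannot be shortened by adding integral multiples of the first two,
  its component in their plane has coordinates of absolute value at most 1/2 after a translation by the
  lattice, so it contributes at most \<open>3/4 q33\<close> to the norm \<open>q33\<close>.  The rest is the squared height \<open>\<delta> / e\<close>, with \<open>\<delta>\<close> and \<open>e\<close> the Gram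
  determinants of the three and of the first two vectors, and \<open>e \<ge> 3 / 4\<close>.\<close>

lemma reduced_form_bound:
  fixes q11 q12 q13 q22 q23 q33 :: real
  assumes q: "q11 \<ge> 1" "q22 \<ge> 1" "q11 \<le> q33" "q22 \<le> q33"
    and r: "2 * \<bar>q12\<bar> \<le> q11" "2 * \<bar>q12\<bar> \<le> q22"
    and min: "\<And>s t :: int. q33 \<le> q33 + (of_int s)\<^sup>2 * q11 + (of_int t)\<^sup>2 * q22 + 2 * of_int s * q13 + 2 * of_int t * q23 + 2 * of_int s * of_int t * q12"
  shows "q33 \<le> 16 / 3 * (q11 * q22 * q33 + 2 * q12 * q13 * q23 - q11 * q23\<^sup>2 - q22 * q13\<^sup>2 - q33 * q12\<^sup>2)"
proof -
  define \<delta> where "\<delta> = q11 * q22 * q33 + 2 * q12 * q13 * q23 - q11 * q23\<^sup>2 - q22 * q13\<^sup>2 - q33 * q12\<^sup>2"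
  define e where "e = q11 * q22 - q12\<^sup>2"
  have "(2 * \<bar>q12\<bar>) * (2 * \<bar>q12\<bar>) \<le> q11 * q22" using r q by (intro mult_mono) auto
  then have "4 * q12\<^sup>2 \<le> q11 * q22" by (simp add: power2_eq_square abs_mult_self_eq flip: abs_mult)
  moreover have "q11 * q22 \<ge> 1" using q mult_mono[of 1 q11 1 q22] by simp
  ultimately have e: "e \<ge> 3 / 4" unfolding e_def by linarith
  define X Y where "X = - (q13 * q22 - q23 * q12) / e" and "Y = - (q23 * q11 - q13 * q12) / e"
  have Xe: "X * e = - (q13 * q22 - q23 * q12)" and Ye: "Y * e = - (q23 * q11 - q13 * q12)"
    using e by (simp_all add: X_def Y_def)
  \<comment> \<open>\<open>- X\<close> and \<open>- Y\<close> are the coordinates of the projection to the plane of the first two vectors\<close>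
  define s t where "s = round X" and "t = round Y"
  define f g where "f = of_int s - X" and "g = of_int t - Y"
  have fg: "\<bar>f\<bar> \<le> 1 / 2" "\<bar>g\<bar> \<le> 1 / 2"
    unfolding f_def g_def s_def t_def by (rule of_int_round_abs_le)+
  have grad1: "X * q11 + q13 + Y * q12 = 0"
  proof -
    have "e * (X * q11 + q13 + Y * q12) = (X * e) * q11 + e * q13 + (Y * e) * q12" by (simp add: algebra_simps)
    also have "\<dots> = 0" unfolding Xe Ye unfolding e_def by (simp add: algebra_simps power2_eq_square)
    finally show ?thesis using e by simp
  qed
  have grad2: "Y * q22 + q23 + X * q12 = 0"
  proof -
    have "e * (Y * q22 + q23 + X * q12) = (Y * e) * q22 + e * q23 + (X * e) * q12" by (simp add: algebra_simps)
    also have "\<dots> = 0" unfolding Xe Ye unfolding e_def by (simp add: algebra_simps power2_eq_square)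
    finally show ?thesis using e by simp
  qed
  have val: "q33 + X * q13 + Y * q23 = \<delta> / e"
  proof -
    have "e * (q33 + X * q13 + Y * q23) = e * q33 + (X * e) * q13 + (Y * e) * q23" by (simp add: algebra_simps)
    also have "\<dots> = \<delta>" unfolding Xe Ye unfolding e_def \<delta>_def by (simp add: algebra_simps power2_eq_square)
    finally show ?thesis using e by (simp add: field_simps)
  qed
  have st: "of_int s = X + f" "of_int t = Y + g" by (simp_all add: f_def g_def)
  have "q33 \<le> q33 + (X + f)\<^sup>2 * q11 + (Y + g)\<^sup>2 * q22 + 2 * (X + f) * q13 + 2 * (Y + g) * q23 + 2 * (X + f) * (Y + g) * q12"
    using min[of s t] unfolding st .
  also have "\<dots> = (q33 + X * q13 + Y * q23) + (X + 2 * f) * (X * q11 + q13 + Y * q12) + (Y + 2 * g) * (Y * q22 + q23 + X * q12)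
      + (f\<^sup>2 * q11 + g\<^sup>2 * q22 + 2 * f * g * q12)"
    by (simp add: algebra_simps power2_eq_square)
  also have "\<dots> = \<delta> / e + (f\<^sup>2 * q11 + g\<^sup>2 * q22 + 2 * f * g * q12)" unfolding grad1 grad2 val by simp
  also have "\<dots> \<le> \<delta> / e + 3 / 4 * q33"
  proof -
    have "\<bar>f\<bar>\<^sup>2 \<le> (1 / 2)\<^sup>2" "\<bar>g\<bar>\<^sup>2 \<le> (1 / 2)\<^sup>2" using fg by (intro power_mono; simp)+
    then have "f\<^sup>2 \<le> 1 / 4" "g\<^sup>2 \<le> 1 / 4" by (simp_all add: power2_eq_square)
    then have 1: "f\<^sup>2 * q11 \<le> 1 / 4 * q33" "g\<^sup>2 * q22 \<le> 1 / 4 * q33"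
      using q by (intro mult_mono; simp)+
    have "\<bar>f * g\<bar> \<le> 1 / 2 * (1 / 2)" unfolding abs_mult using fg by (intro mult_mono) auto
    then have "\<bar>f * g\<bar> * \<bar>q12\<bar> \<le> 1 / 4 * (q33 / 2)" using r q by (intro mult_mono) auto
    then have "\<bar>f * g * q12\<bar> \<le> 1 / 8 * q33" unfolding abs_mult[of "f * g" q12] by simp
    then have "2 * f * g * q12 \<le> 1 / 4 * q33" by linarith
    with 1 show ?thesis by linarith
  qed
  finally have le: "q33 \<le> 4 * (\<delta> / e)" by simp
  have dpos: "\<delta> > 0"
  proof (rule ccontr)
    assume "\<not> \<delta> > 0"
    then have "\<delta> / e \<le> 0" using e by (intro divide_nonpos_pos) auto
    then show False using le q by linarith
  qed
  have "\<delta> / e \<le> \<delta> / (3 / 4)" using e dpos by (intro divide_left_mono) auto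
  then show ?thesis using le unfolding \<delta>_def[symmetric] by simp
qed

lemma finite_bounded_int_vectors: "finite {u :: int ^ 'm. \<forall>j. \<bar>u $ j\<bar> \<le> K}"
proof -
  have "{u :: int ^ 'm. \<forall>j. \<bar>u $ j\<bar> \<le> K} \<subseteq> vec_lambda ` (\<Pi>\<^sub>E j\<in>UNIV. {- K..K})"
  proof
    fix u :: "int ^ 'm" assume u: "u \<in> {u. \<forall>j. \<bar>u $ j\<bar> \<le> K}"
    have "u = vec_lambda (vec_nth u)" by simp
    moreover have "- K \<le> u $ j \<and> u $ j \<le> K" for j using u by (simp add: abs_le_iff minus_le_iff)
    ultimately show "u \<in> vec_lambda ` (\<Pi>\<^sub>E j\<in>UNIV. {- K..K})" by (intro image_eqI[of _ _ "vec_nth u"]) auto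
  qed
  then show ?thesis by (rule finite_subset) (intro finite_imageI finite_PiE; simp)
qed

lemma rvec_add: "rvec (x + y) = rvec x + rvec y"
  and rvec_diff: "rvec (x - y) = rvec x - rvec y"
  and rvec_scale: "rvec (k *s x) = of_int k *\<^sub>R rvec x"
  and rvec_eq_0_iff: "rvec x = 0 \<longleftrightarrow> x = 0"
  by (simp_all add: rvec_def vec_eq_iff)

lemma bil_rvec: "bil (real_gram G) (rvec x) (rvec y) = of_int (bil G x y)"
  unfolding rvec_def by (rule bil_map_of_int)

lemma in_span3:
  fixes a b c w :: "'a::real_vector"
  shows "w \<in> span {a, b, c} \<longleftrightarrow> (\<exists>p q r. w = p *\<^sub>R a + q *\<^sub>R b + r *\<^sub>R c)"
proof
  assume "w \<in> span {a, b, c}"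
  then obtain p where "w - p *\<^sub>R a \<in> span {b, c}" unfolding span_breakdown_eq by blast
  then obtain q where "w - p *\<^sub>R a - q *\<^sub>R b \<in> span {c}" unfolding span_breakdown_eq by blast
  then obtain r where "w - p *\<^sub>R a - q *\<^sub>R b - r *\<^sub>R c = 0" unfolding span_breakdown_eq[of _ c] by auto
  then have "w = p *\<^sub>R a + q *\<^sub>R b + r *\<^sub>R c" by (simp add: algebra_simps)
  then show "\<exists>p q r. w = p *\<^sub>R a + q *\<^sub>R b + r *\<^sub>R c" by blast
next
  assume "\<exists>p q r. w = p *\<^sub>R a + q *\<^sub>R b + r *\<^sub>R c"
  then show "w \<in> span {a, b, c}" by (elim exE) (simp add: span_add span_scale span_base)
qed

context lattice_2_n
begin

lemma sym_int: "transpose G = G"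
  using gram by (simp add: lattice_gram_def)

definition W :: "int ^ 'm \<Rightarrow> int ^ 'm \<Rightarrow> int ^ 'm \<Rightarrow> (real ^ 'm) set" where
  "W x y z = span {rvec x, rvec y, rvec z}"

lemma W_iff: "w \<in> W x y z \<longleftrightarrow> (\<exists>p q r. w = p *\<^sub>R rvec x + q *\<^sub>R rvec y + r *\<^sub>R rvec z)"
  unfolding W_def by (rule in_span3)

text \<open>Cramer's rule, free of denominators.\<close>

lemma W_dual:
  assumes "w \<in> W x y z"
  shows "of_int (gramdet G x y z) *\<^sub>R w = B w (rvec (dual G x y z)) *\<^sub>R rvec x
     + B w (rvec (dual G y z x)) *\<^sub>R rvec y + B w (rvec (dual G z x y)) *\<^sub>R rvec z"
proof -
  obtain p q r where w: "w = p *\<^sub>R rvec x + q *\<^sub>R rvec y + r *\<^sub>R rvec z" using assms W_iff by blast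
  note d = dual_bil[OF sym_int]
  have c: "Z u (dual G a b c) = Z (dual G a b c) u" for u a b c by (rule Z_commute)
  have g: "gramdet G y z x = gramdet G x y z" "gramdet G z x y = gramdet G x y z"
    using gramdet_rotate[OF sym_int] by metis+
  show ?thesis
    unfolding w by (simp add: bil_add_left bil_scaleR_left bil_rvec c d g algebra_simps)
qed

lemma gramdet_eq_0_if_zero: "gramdet G 0 y z = 0" "gramdet G x 0 z = 0" "gramdet G x y 0 = 0"
  by (simp_all add: gramdet_def)

lemma W_subset_if_gramdet:
  assumes nz: "gramdet G x y z \<noteq> 0" and sub: "{rvec x, rvec y, rvec z} \<subseteq> W a b c"
  shows "W x y z = W a b c"
proof -
  have d: "gramdet G y z x \<noteq> 0" "gramdet G z x y \<noteq> 0" using nz gramdet_rotate[OF sym_int] by metis+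
  note dd = dual_bil[OF sym_int]
  have key: "p = 0 \<and> q = 0 \<and> r = 0" if z0: "p *\<^sub>R rvec x + q *\<^sub>R rvec y + r *\<^sub>R rvec z = 0" for p q r
  proof -
    have "B (rvec u) (p *\<^sub>R rvec x + q *\<^sub>R rvec y + r *\<^sub>R rvec z) = 0" for u using z0 by simp
    from this[of "dual G x y z"] this[of "dual G y z x"] this[of "dual G z x y"] show ?thesis
      using nz d by (simp add: bil_add_right bil_scaleR_right bil_rvec dd)
  qed
  have ne: "rvec x \<noteq> rvec y" "rvec x \<noteq> rvec z" "rvec y \<noteq> rvec z"
    using key[of 1 "-1" 0] key[of 1 0 "-1"] key[of 0 1 "-1"] by auto
  have "independent {rvec x, rvec y, rvec z}"
  proof (rule independent_if_scalars_zero)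
    fix f v assume s: "(\<Sum>v\<in>{rvec x, rvec y, rvec z}. f v *\<^sub>R v) = 0" and v: "v \<in> {rvec x, rvec y, rvec z}"
    have "f (rvec x) *\<^sub>R rvec x + f (rvec y) *\<^sub>R rvec y + f (rvec z) *\<^sub>R rvec z = 0"
      using s ne by (simp add: algebra_simps)
    then show "f v = 0" using key v by blast
  qed simp
  moreover have "card {rvec x, rvec y, rvec z} = 3" using ne by simp
  moreover have "dim (W a b c) \<le> 3"
  proof -
    have "dim (W a b c) \<le> card {rvec a, rvec b, rvec c}"
      unfolding W_def dim_span by (rule dim_le_card') simp
    also have "\<dots> \<le> 3" by (simp add: card_insert_if)
    finally show ?thesis .
  qed
  ultimately have "W a b c \<subseteq> span {rvec x, rvec y, rvec z}"
    using card_ge_dim_independent[OF sub] by simp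
  moreover have "span {rvec x, rvec y, rvec z} \<subseteq> W a b c"
    using sub unfolding W_def by (rule span_minimal) (rule subspace_span)
  ultimately show ?thesis by (simp add: W_def)
qed

end

context type_IV
begin

lemma frame_values:
  assumes "frame a b c"
  shows "B a a = 1" "B b b = 1" "B c c = - 1" "B a b = 0" "B b a = 0" "B a c = 0" "B c a = 0" "B b c = 0" "B c b = 0"
  using assms B_commute[of b a] B_commute[of a c] B_commute[of b c] by (auto simp: frame_def pos_frame_def)

lemma frame_expand_W:
  assumes f: "frame a b c" and sub: "{a, b, c} \<subseteq> W x y z" and w: "w \<in> W x y z"
  shows "w = B w a *\<^sub>R a + B w b *\<^sub>R b - B w c *\<^sub>R c"
proof -
  note g = frame_values[OF f]
  have key: "p = 0 \<and> q = 0 \<and> r = 0" if z0: "p *\<^sub>R a + q *\<^sub>R b + r *\<^sub>R c = 0" for p q r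
  proof -
    have "B (p *\<^sub>R a + q *\<^sub>R b + r *\<^sub>R c) u = 0" for u using z0 by simp
    from this[of a] this[of b] this[of c] show ?thesis by (simp add: bil_add_left bil_scaleR_left g)
  qed
  have ne: "a \<noteq> b" "a \<noteq> c" "b \<noteq> c" using g by auto
  have "independent {a, b, c}"
  proof (rule independent_if_scalars_zero)
    fix h v assume s: "(\<Sum>v\<in>{a, b, c}. h v *\<^sub>R v) = 0" and v: "v \<in> {a, b, c}"
    have "h a *\<^sub>R a + h b *\<^sub>R b + h c *\<^sub>R c = 0" using s ne by (simp add: algebra_simps)
    then show "h v = 0" using key v by blast
  qed simp
  moreover have "card {a, b, c} = 3" using ne by simp
  moreover have "dim (W x y z) \<le> 3"
  proof -
    have "dim (W x y z) \<le> card {rvec x, rvec y, rvec z}"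
      unfolding W_def dim_span by (rule dim_le_card') simp
    also have "\<dots> \<le> 3" by (simp add: card_insert_if)
    finally show ?thesis .
  qed
  ultimately have "W x y z \<subseteq> span {a, b, c}"
    using card_ge_dim_independent[OF sub] by simp
  then obtain p q r where e: "w = p *\<^sub>R a + q *\<^sub>R b + r *\<^sub>R c" using w in_span3 by blast
  show ?thesis unfolding e by (simp add: bil_add_left bil_scaleR_left g)
qed

text \<open>The positive definite majorant of the form attached to a frame: the sign on \<open>c\<close> is switched.\<close>

definition Q :: "real ^ 'm \<Rightarrow> real ^ 'm \<Rightarrow> real ^ 'm \<Rightarrow> real ^ 'm \<Rightarrow> real ^ 'm \<Rightarrow> real" where
  "Q a b c x y = B x a * B y a + B x b * B y b + B x c * B y c"

lemma Q_add_left: "Q a b c (x + x') y = Q a b c x y + Q a b c x' y"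
  and Q_add_right: "Q a b c x (y + y') = Q a b c x y + Q a b c x y'"
  and Q_scale_left: "Q a b c (r *\<^sub>R x) y = r * Q a b c x y"
  and Q_scale_right: "Q a b c x (r *\<^sub>R y) = r * Q a b c x y"
  and Q_commute: "Q a b c x y = Q a b c y x"
  by (simp_all add: Q_def bil_add_left bil_scaleR_left algebra_simps)

lemma B_le_Q:
  assumes f: "frame a b c" and sub: "{a, b, c} \<subseteq> W x y z" and w: "w \<in> W x y z"
  shows "\<bar>B w w\<bar> \<le> Q a b c w w"
proof -
  have e: "B w v = B w a * B v a + B w b * B v b - B w c * B v c" for v
    by (subst frame_expand_W[OF f sub w])
       (simp add: bil_add_left bil_diff_left bil_scaleR_left B_commute[of v])
  have "B w w = (B w a)\<^sup>2 + (B w b)\<^sup>2 - (B w c)\<^sup>2" using e[of w] by (simp add: power2_eq_square)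
  moreover have "Q a b c w w = (B w a)\<^sup>2 + (B w b)\<^sup>2 + (B w c)\<^sup>2" by (simp add: Q_def power2_eq_square)
  moreover have "(B w a)\<^sup>2 \<ge> 0" "(B w b)\<^sup>2 \<ge> 0" "(B w c)\<^sup>2 \<ge> 0" by auto
  ultimately show ?thesis by linarith
qed

lemma B_frame_coordinates:
  assumes f: "frame a b c" and sub: "{a, b, c} \<subseteq> W x y z" and w: "w \<in> W x y z"
  shows "B w v = B w a * B v a + B w b * B v b - B w c * B v c"
  by (subst frame_expand_W[OF f sub w])
     (simp add: bil_add_left bil_diff_left bil_scaleR_left B_commute[of v])

text \<open>Changing the sign of one vector of the frame changes the sign of the Gram determinant.\<close>

lemma Q_gramdet:
  assumes f: "frame a b c" and sub: "{a, b, c} \<subseteq> W x y z" and u: "rvec u1 \<in> W x y z" "rvec u2 \<in> W x y z" "rvec u3 \<in> W x y z"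
  shows "Q a b c (rvec u1) (rvec u1) * Q a b c (rvec u2) (rvec u2) * Q a b c (rvec u3) (rvec u3)
    + 2 * Q a b c (rvec u1) (rvec u2) * Q a b c (rvec u1) (rvec u3) * Q a b c (rvec u2) (rvec u3)
    - Q a b c (rvec u1) (rvec u1) * (Q a b c (rvec u2) (rvec u3))\<^sup>2 - Q a b c (rvec u2) (rvec u2) * (Q a b c (rvec u1) (rvec u3))\<^sup>2
    - Q a b c (rvec u3) (rvec u3) * (Q a b c (rvec u1) (rvec u2))\<^sup>2 = - of_int (gramdet G u1 u2 u3)"
proof -
  have b: "real_of_int (Z v w) = B (rvec v) a * B (rvec w) a + B (rvec v) b * B (rvec w) b - B (rvec v) c * B (rvec w) c"
    if "rvec v \<in> W x y z" for v w
    using B_frame_coordinates[OF f sub that, of "rvec w"] by (simp add: bil_rvec)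
  show ?thesis
    unfolding gramdet_def Q_def of_int_diff of_int_add of_int_mult of_int_power of_int_numeral
      b[OF u(1)] b[OF u(2)] b[OF u(3)]
    by (simp add: power2_eq_square algebra_simps)
qed

text \<open>Minkowski reduction: a basis minimising the sum of the \<open>Q\<close>-norms is bounded in terms of the
  determinant alone, because no nonzero lattice vector is \<open>Q\<close>-shorter than 1.\<close>

lemma reduced_triple_exists:
  assumes f: "frame a b c" and sub: "{a, b, c} \<subseteq> W x y z"
    and nz: "gramdet G x y z \<noteq> 0"
    and aniso: "\<And>u. rvec u \<in> W x y z \<Longrightarrow> u \<noteq> 0 \<Longrightarrow> Z u u \<noteq> 0"
  shows "\<exists>u1 u2 u3. {rvec u1, rvec u2, rvec u3} \<subseteq> W x y z \<and> gramdet G u1 u2 u3 = gramdet G x y z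
    \<and> (\<forall>u\<in>{u1, u2, u3}. Q a b c (rvec u) (rvec u) \<le> 16 / 3 * \<bar>of_int (gramdet G x y z)\<bar>)"
proof -
  define \<delta> where "\<delta> = gramdet G x y z"
  define q where "q u v = Q a b c (rvec u) (rvec v)" for u v
  have q_nonneg: "q u u \<ge> 0" for u by (simp add: q_def Q_def)
  define \<U> where "\<U> = {(u1, u2, u3). {rvec u1, rvec u2, rvec u3} \<subseteq> W x y z \<and> gramdet G u1 u2 u3 = \<delta>}"
  define S where "S = (\<lambda>(u1, u2, u3). q u1 u1 + q u2 u2 + q u3 u3)"
  define V where "V = {u \<in> \<U>. S u \<le> S (x, y, z)}"
  have base: "(x, y, z) \<in> V"
    by (auto simp: V_def \<U>_def \<delta>_def W_def intro: span_base)
  have fin: "finite V"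
  proof -
    define M where "M = sqrt (S (x, y, z)) * (norm a + norm b + norm c)"
    have bd: "\<bar>u $ j\<bar> \<le> \<lceil>M\<rceil>" if u: "rvec u \<in> W x y z" and qs: "q u u \<le> S (x, y, z)" for u j
    proof -
      have le: "\<bar>B (rvec u) v\<bar> \<le> sqrt (S (x, y, z))" if "v \<in> {a, b, c}" for v
      proof -
        have "(B (rvec u) v)\<^sup>2 \<le> q u u" using that unfolding q_def Q_def by (auto simp: power2_eq_square)
        then have "(B (rvec u) v)\<^sup>2 \<le> S (x, y, z)" using qs by linarith
        then show ?thesis using real_le_rsqrt real_sqrt_abs real_sqrt_le_iff by metis
      qed
      have "rvec u $ j = B (rvec u) a * a $ j + B (rvec u) b * b $ j - B (rvec u) c * c $ j"
        by (subst frame_expand_W[OF f sub u]) simp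
      then have "\<bar>rvec u $ j\<bar> \<le> \<bar>B (rvec u) a\<bar> * \<bar>a $ j\<bar> + \<bar>B (rvec u) b\<bar> * \<bar>b $ j\<bar> + \<bar>B (rvec u) c\<bar> * \<bar>c $ j\<bar>"
        unfolding abs_mult[symmetric] by linarith
      also have "\<dots> \<le> sqrt (S (x, y, z)) * norm a + sqrt (S (x, y, z)) * norm b + sqrt (S (x, y, z)) * norm c"
        using le order_trans[OF q_nonneg[of u] qs] component_le_norm_cart[of a j] component_le_norm_cart[of b j] component_le_norm_cart[of c j]
        by (intro add_mono mult_mono) (auto intro: order_trans[OF abs_ge_zero])
      also have "\<dots> = M" by (simp add: M_def algebra_simps)
      finally have "real_of_int \<bar>u $ j\<bar> \<le> M" by (simp add: rvec_def)
      then show ?thesis by (metis ceiling_mono ceiling_of_int)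
    qed
    let ?F = "{u :: int ^ 'm. \<forall>j. \<bar>u $ j\<bar> \<le> \<lceil>M\<rceil>}"
    have "V \<subseteq> ?F \<times> ?F \<times> ?F"
    proof
      fix u assume u: "u \<in> V"
      obtain u1 u2 u3 where ue: "u = (u1, u2, u3)" by (cases u)
      have "q u1 u1 + q u2 u2 + q u3 u3 \<le> S (x, y, z)" using u ue by (simp add: V_def S_def)
      then have "q u1 u1 \<le> S (x, y, z)" "q u2 u2 \<le> S (x, y, z)" "q u3 u3 \<le> S (x, y, z)"
        using q_nonneg[of u1] q_nonneg[of u2] q_nonneg[of u3] by linarith+
      then show "u \<in> ?F \<times> ?F \<times> ?F" using bd u ue by (auto simp: V_def \<U>_def)
    qed
    then show ?thesis by (rule finite_subset) (intro finite_cartesian_product finite_bounded_int_vectors)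
  qed
  obtain u where uV: "u \<in> V" and umin: "\<And>v. v \<in> V \<Longrightarrow> S u \<le> S v"
    using fin base by (metis arg_min_if_finite(1) arg_min_least empty_iff)
  have umin': "S u \<le> S v" if "v \<in> \<U>" for v
    using umin[of v] uV that by (cases "S v \<le> S (x, y, z)") (auto simp: V_def)
  obtain u1 u2 u3 where ue: "u = (u1, u2, u3)" by (cases u)
  have uW: "rvec u1 \<in> W x y z" "rvec u2 \<in> W x y z" "rvec u3 \<in> W x y z" and ud: "gramdet G u1 u2 u3 = \<delta>"
    using uV ue by (auto simp: V_def \<U>_def)
  have W_comb: "rvec (w + s *s v + t *s v') \<in> W x y z" if "rvec w \<in> W x y z" "rvec v \<in> W x y z" "rvec v' \<in> W x y z" for w v v' s t
    using that unfolding W_def rvec_add rvec_scale by (intro span_add span_scale)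
  have rot: "gramdet G u2 u3 u1 = \<delta>" "gramdet G u3 u1 u2 = \<delta>" using ud gramdet_rotate[OF sym_int] by metis+
  have S_def': "S (v1, v2, v3) = q v1 v1 + q v2 v2 + q v3 v3" for v1 v2 v3 by (simp add: S_def)
  have m3: "q u3 u3 \<le> q (u3 + s *s u1 + t *s u2) (u3 + s *s u1 + t *s u2)" for s t
  proof -
    have "(u1, u2, u3 + s *s u1 + t *s u2) \<in> \<U>"
      using uW W_comb gramdet_add[OF sym_int, of u1 u2 u3 s t] ud by (simp add: \<U>_def)
    from umin'[OF this] show ?thesis by (simp add: ue S_def')
  qed
  have m1: "q u1 u1 \<le> q (u1 + s *s u2 + t *s u3) (u1 + s *s u2 + t *s u3)" for s t
  proof -
    have "gramdet G (u1 + s *s u2 + t *s u3) u2 u3 = \<delta>"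
      using gramdet_add[OF sym_int, of u2 u3 u1 s t] rot gramdet_rotate[OF sym_int] by metis
    then have "(u1 + s *s u2 + t *s u3, u2, u3) \<in> \<U>" using uW W_comb by (simp add: \<U>_def)
    from umin'[OF this] show ?thesis by (simp add: ue S_def')
  qed
  have m2: "q u2 u2 \<le> q (u2 + s *s u3 + t *s u1) (u2 + s *s u3 + t *s u1)" for s t
  proof -
    have "gramdet G u1 (u2 + s *s u3 + t *s u1) u3 = \<delta>"
      using gramdet_add[OF sym_int, of u3 u1 u2 s t] rot gramdet_rotate[OF sym_int] by metis
    then have "(u1, u2 + s *s u3 + t *s u1, u3) \<in> \<U>" using uW W_comb by (simp add: \<U>_def)
    from umin'[OF this] show ?thesis by (simp add: ue S_def')
  qed
  have ge1: "q v v \<ge> 1" if "rvec v \<in> W x y z" "v \<noteq> 0" for v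
  proof -
    have "\<bar>Z v v\<bar> \<ge> 1" using aniso[OF that] by linarith
    then have "1 \<le> \<bar>B (rvec v) (rvec v)\<bar>" by (simp add: bil_rvec flip: of_int_abs)
    then show ?thesis using B_le_Q[OF f sub that(1)] by (simp add: q_def)
  qed
  have "u1 \<noteq> 0" "u2 \<noteq> 0" "u3 \<noteq> 0"
    using ud nz gramdet_eq_0_if_zero unfolding \<delta>_def by metis+
  then have one: "q u1 u1 \<ge> 1" "q u2 u2 \<ge> 1" "q u3 u3 \<ge> 1" using ge1 uW by auto
  have qexp: "q (w + s *s v + t *s v') (w + s *s v + t *s v') = q w w + (of_int s)\<^sup>2 * q v v + (of_int t)\<^sup>2 * q v' v'
      + 2 * of_int s * q v w + 2 * of_int t * q v' w + 2 * of_int s * of_int t * q v v'" for w v v' s t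
    unfolding q_def rvec_add rvec_scale Q_add_left Q_add_right Q_scale_left Q_scale_right
    using Q_commute[of a b c "rvec w" "rvec v"] Q_commute[of a b c "rvec w" "rvec v'"] Q_commute[of a b c "rvec v'" "rvec v"]
    by (simp add: power2_eq_square algebra_simps)
  have two: "2 * \<bar>q v w\<bar> \<le> q v v" if "\<And>s t. q w w \<le> q (w + s *s v + t *s v') (w + s *s v + t *s v')" for v v' w
    using that[of 1 0] that[of "- 1" 0] unfolding qexp by auto
  have two': "2 * \<bar>q v' w\<bar> \<le> q v' v'" if "\<And>s t. q w w \<le> q (w + s *s v + t *s v') (w + s *s v + t *s v')" for v v' w
    using that[of 0 1] that[of 0 "- 1"] unfolding qexp by auto
  have qc: "q v w = q w v" for v w unfolding q_def by (rule Q_commute)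
  have bound: "q w3 w3 \<le> 16 / 3 * \<bar>of_int \<delta>\<bar>"
    if w: "rvec w1 \<in> W x y z" "rvec w2 \<in> W x y z" "rvec w3 \<in> W x y z" "q w1 w1 \<ge> 1" "q w2 w2 \<ge> 1" "q w1 w1 \<le> q w3 w3" "q w2 w2 \<le> q w3 w3"
      and r: "2 * \<bar>q w1 w2\<bar> \<le> q w1 w1" "2 * \<bar>q w1 w2\<bar> \<le> q w2 w2"
      and m: "\<And>s t. q w3 w3 \<le> q (w3 + s *s w1 + t *s w2) (w3 + s *s w1 + t *s w2)"
      and g: "gramdet G w1 w2 w3 = \<delta>" for w1 w2 w3
  proof -
    have "q w3 w3 \<le> 16 / 3 * (q w1 w1 * q w2 w2 * q w3 w3 + 2 * q w1 w2 * q w1 w3 * q w2 w3 - q w1 w1 * (q w2 w3)\<^sup>2 - q w2 w2 * (q w1 w3)\<^sup>2 - q w3 w3 * (q w1 w2)\<^sup>2)"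
      by (rule reduced_form_bound[OF w(4-7) r]) (use m in \<open>simp add: qexp\<close>)
    also have "\<dots> = 16 / 3 * (- of_int \<delta>)"
      using Q_gramdet[OF f sub w(1-3)] g by (simp add: q_def)
    also have "\<dots> \<le> 16 / 3 * \<bar>of_int \<delta>\<bar>" by (intro mult_left_mono) auto
    finally show ?thesis .
  qed
  have r12: "2 * \<bar>q u1 u2\<bar> \<le> q u1 u1" "2 * \<bar>q u1 u2\<bar> \<le> q u2 u2"
    using two'[OF m2] two[OF m1] qc[of u2 u1] by auto
  have r23: "2 * \<bar>q u2 u3\<bar> \<le> q u2 u2" "2 * \<bar>q u2 u3\<bar> \<le> q u3 u3"
    using two'[OF m3] two[OF m2] qc[of u2 u3] by auto
  have r31: "2 * \<bar>q u3 u1\<bar> \<le> q u3 u3" "2 * \<bar>q u3 u1\<bar> \<le> q u1 u1"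
    using two'[OF m1] two[OF m3] qc[of u3 u1] by auto
  have "q v v \<le> 16 / 3 * \<bar>of_int \<delta>\<bar>" if "v \<in> {u1, u2, u3}" for v
  proof -
    consider "q u1 u1 \<le> q u3 u3 \<and> q u2 u2 \<le> q u3 u3" | "q u1 u1 \<le> q u2 u2 \<and> q u3 u3 \<le> q u2 u2"
      | "q u2 u2 \<le> q u1 u1 \<and> q u3 u3 \<le> q u1 u1" by linarith
    then show ?thesis
    proof cases
      case 1
      then have "q u3 u3 \<le> 16 / 3 * \<bar>of_int \<delta>\<bar>" using bound[OF uW(1) uW(2) uW(3) one(1) one(2) _ _ r12 m3 ud] by blast
      then show ?thesis using 1 that by auto
    next
      case 2
      then have "q u2 u2 \<le> 16 / 3 * \<bar>of_int \<delta>\<bar>" using bound[OF uW(3) uW(1) uW(2) one(3) one(1) _ _ r31 m2 rot(2)] by blast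
      then show ?thesis using 2 that by auto
    next
      case 3
      then have "q u1 u1 \<le> 16 / 3 * \<bar>of_int \<delta>\<bar>" using bound[OF uW(2) uW(3) uW(1) one(2) one(3) _ _ r23 m1 rot(1)] by blast
      then show ?thesis using 3 that by auto
    qed
  qed
  then show ?thesis using uW ud unfolding q_def \<delta>_def by blast
qed

end

section \<open>Compactness of the quotient of an anisotropic curve\<close>

lemma map_matrix_of_int_mult:
  "map_matrix of_int (M ** N) = (map_matrix of_int M ** map_matrix of_int N :: 'a::comm_ring_1 ^ 'm ^ 'm)"
  by (simp add: map_matrix_def matrix_matrix_mult_def vec_eq_iff)

lemma map_matrix_of_int_transpose:
  "map_matrix f (transpose M) = transpose (map_matrix f M)"
  by (simp add: map_matrix_def Finite_Cartesian_Product.transpose_def vec_eq_iff)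

lemma bil_matrix_mult:
  fixes A :: "'a::comm_ring_1 ^ 'b ^ 'b" and g :: "'a ^ 'c ^ 'b"
  shows "bil A (g *v u) (g *v v) = bil (transpose g ** A ** g) u v"
proof -
  have tr: "(M *v w) $ i = (\<Sum>k\<in>UNIV. M $ i $ k * w $ k)" for M :: "'a ^ 'b ^ 'c" and w i
    by (simp add: matrix_vector_mult_def)
  have "bil A (g *v u) (g *v v) = (\<Sum>k\<in>UNIV. (\<Sum>i\<in>UNIV. g $ k $ i * u $ i) * (A *v (g *v v)) $ k)"
    by (simp add: bil_matrix_vector matrix_vector_mult_def[of g u])
  also have "\<dots> = (\<Sum>i\<in>UNIV. u $ i * (\<Sum>k\<in>UNIV. transpose g $ i $ k * (A *v (g *v v)) $ k))"
    by (simp add: sum_distrib_left sum_distrib_right Finite_Cartesian_Product.transpose_def) (subst sum.swap, simp add: mult_ac)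
  also have "\<dots> = bil (transpose g ** A ** g) u v"
    unfolding bil_matrix_vector matrix_vector_mul_assoc[symmetric] tr[of "Finite_Cartesian_Product.transpose g"] ..
  finally show ?thesis .
qed

lemma bil_axis: "bil A (axis i 1) (axis j 1) = A $ i $ j"
  by (simp add: bil_def axis_def if_distrib[of "\<lambda>x. x * _"] if_distrib[of "\<lambda>x. _ * x"] cong: if_cong)

lemma O_lattice_gram:
  assumes "g \<in> O_lattice G"
  shows "transpose g ** G ** g = G"
  using assms unfolding O_lattice_def bil_matrix_mult by (simp add: vec_eq_iff) (metis bil_axis)

definition ract :: "int ^ 'm ^ 'm \<Rightarrow> real ^ 'm \<Rightarrow> real ^ 'm" where
  "ract g v = map_matrix of_int g *v v"

lemma act_cvec: "act g (cvec v) = cvec (ract g v)"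
  by (simp add: act_def ract_def cvec_def matrix_vector_mult_def map_matrix_def vec_eq_iff)

lemma act_add: "act g (u + v) = act g u + act g v"
  and act_diff: "act g (u - v) = act g u - act g v"
  and act_scale: "act g (t *s u) = t *s act g u"
  by (simp_all add: act_def matrix_vector_right_distrib matrix_vector_mult_diff_distrib vector_scalar_commute)

lemma act_fr: "act g (fr a b) = fr (ract g a) (ract g b)"
  by (simp add: fr_def act_add act_scale act_cvec)

lemma act_conj_vec: "act g (conj_vec u) = conj_vec (act g u)"
  by (simp add: act_def conj_vec_def matrix_vector_mult_def map_matrix_def vec_eq_iff)

lemma act_mult: "act (g ** h) u = act g (act h u)"
  by (simp add: act_def map_matrix_of_int_mult matrix_vector_mul_assoc)

lemma act_one [simp]: "act (mat 1) u = u"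
proof -
  have "map_matrix of_int (mat 1 :: int ^ 'a ^ 'a) = (mat 1 :: complex ^ 'a ^ 'a)"
    by (simp add: map_matrix_def mat_def vec_eq_iff)
  then show ?thesis by (simp add: act_def)
qed

lemma continuous_on_act: "continuous_on S (act g)"
  unfolding act_def by (rule linear_continuous_on) (rule matrix_vector_mul_bounded_linear)

lemma ract_int_matrix_eq:
  assumes "\<And>v. ract g v = ract h v" shows "g = h"
proof -
  have "map_matrix real_of_int g = map_matrix real_of_int h"
    using assms unfolding ract_def by (simp add: matrix_eq)
  then show ?thesis by (simp add: map_matrix_def vec_eq_iff)
qed

lemma ract_mult: "ract (g ** h) u = ract g (ract h u)"
  by (simp add: ract_def map_matrix_of_int_mult matrix_vector_mul_assoc)

lemma ract_one [simp]: "ract (mat 1) u = u"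
proof -
  have "map_matrix of_int (mat 1 :: int ^ 'a ^ 'a) = (mat 1 :: real ^ 'a ^ 'a)"
    by (simp add: map_matrix_def mat_def vec_eq_iff)
  then show ?thesis by (simp add: ract_def)
qed

lemma ract_rvec: "ract g (rvec u) = rvec (g *v u)"
  by (simp add: ract_def rvec_def map_matrix_def matrix_vector_mult_def vec_eq_iff)

context type_IV
begin

lemma O_isometry:
  assumes "g \<in> O_lattice G"
  shows "C (act g u) (act g v) = C u v" "B (ract g x) (ract g y) = B x y"
proof -
  have e1: "map_matrix of_int (transpose g ** G ** g) = cpx_gram G" and e2: "map_matrix of_int (transpose g ** G ** g) = real_gram G"
    by (simp_all only: O_lattice_gram[OF assms])
  show "C (act g u) (act g v) = C u v"
    unfolding act_def bil_matrix_mult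
    using e1 by (simp only: map_matrix_of_int_mult map_matrix_of_int_transpose)
  show "B (ract g x) (ract g y) = B x y"
    unfolding ract_def bil_matrix_mult
    using e2 by (simp only: map_matrix_of_int_mult map_matrix_of_int_transpose)
qed

lemma O_period_vector: "g \<in> O_lattice G \<Longrightarrow> period_vector \<omega> \<Longrightarrow> period_vector (act g \<omega>)"
  by (simp add: period_vector_def O_isometry flip: act_conj_vec)

lemma conj_period_vector: "period_vector \<omega> \<Longrightarrow> period_vector (conj_vec \<omega>)"
proof -
  assume p: "period_vector \<omega>"
  have cc: "conj_vec (conj_vec \<omega>) = \<omega>" by (simp add: conj_vec_def vec_eq_iff)
  have "C (conj_vec \<omega>) (conj_vec \<omega>) = cnj (C \<omega> \<omega>)"
    by (simp add: bil_def conj_vec_def map_matrix_def)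
  then show ?thesis using p C_commute[of "conj_vec \<omega>" \<omega>] by (simp add: period_vector_def cc)
qed

text \<open>A continuous self-map of the periods maps a connected component into one component.  Multiples
  are only mapped to multiples with an unspecified factor in \<open>lin\<close> so that conjugate linear maps are
  covered.\<close>

lemma semilinear_preserves_D:
  fixes h :: "complex ^ 'm \<Rightarrow> complex ^ 'm"
  assumes cont: "continuous_on UNIV h" and per: "\<And>\<omega>. period_vector \<omega> \<Longrightarrow> period_vector (h \<omega>)"
    and lin: "\<And>t \<omega>. t \<noteq> 0 \<Longrightarrow> \<exists>t'. t' \<noteq> 0 \<and> h (t *s \<omega>) = t' *s h \<omega>"
    and 0: "over_D \<omega>0" "over_D (h \<omega>0)" and \<omega>: "over_D \<omega>"
  shows "over_D (h \<omega>)"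
proof -
  define H where "H l = line (h (SOME w. w \<in> l \<and> w \<noteq> 0))" for l
  have H: "H (line w) = line (h w)" if "w \<noteq> 0" for w
  proof -
    define v where "v = (SOME v. v \<in> line w \<and> v \<noteq> 0)"
    have v: "v \<in> line w \<and> v \<noteq> 0" unfolding v_def by (rule someI[of _ w]) (use that in simp)
    then obtain t where "v = t *s w" by (auto simp: line_eq)
    moreover have "t \<noteq> 0" using v calculation by auto
    ultimately obtain t' where "t' \<noteq> 0" "h v = t' *s h w" using lin[of t w] by blast
    then have "line (h v) = line (h w)" using line_scale by metis
    then show ?thesis unfolding H_def v_def .
  qed
  have nz: "h w \<noteq> 0" if "period_vector w" for w using per[OF that] by (rule period_vector_nonzero)
  have contH: "continuous_map periods periods H"
    unfolding continuous_map
  proof (intro conjI allI impI)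
    show "H ` topspace periods \<subseteq> topspace periods"
      unfolding topspace_periods unfolding period_points_eq using H per period_vector_nonzero by auto
    fix U assume "openin periods U"
    then obtain V where V: "openin proj_top V" "U = V \<inter> period_points G" unfolding openin_subtopology by blast
    define T where "T = {\<omega>. \<omega> \<noteq> 0 \<and> h \<omega> \<noteq> 0 \<and> line (h \<omega>) \<in> V}"
    have "open (h -` {\<omega>. \<omega> \<noteq> 0 \<and> line \<omega> \<in> V})"
      using V(1) cont by (intro open_vimage) (auto simp: openin_proj_top)
    then have "open ((- {0}) \<inter> h -` {\<omega>. \<omega> \<noteq> 0 \<and> line \<omega> \<in> V})" by (intro open_Int) (auto simp: open_Compl)
    also have "(- {0}) \<inter> h -` {\<omega>. \<omega> \<noteq> 0 \<and> line \<omega> \<in> V} = T" by (auto simp: T_def)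
    finally have oT: "open T" .
    have sat: "w \<in> T" if "v \<in> T" "line w = line v" "w \<noteq> 0" for v w
    proof -
      have "w \<in> line v" using that in_line by metis
      then obtain t where t: "w = t *s v" by (auto simp: line_eq)
      then have "t \<noteq> 0" using that by auto
      then obtain t' where "t' \<noteq> 0" "h w = t' *s h v" using lin[of t v] t by auto
      then show ?thesis using that by (auto simp: T_def line_scale)
    qed
    have Tnz: "w \<noteq> 0" if "w \<in> T" for w using that by (simp add: T_def)
    have "{\<omega>. \<omega> \<noteq> 0 \<and> line \<omega> \<in> line ` T} = T"
    proof (intro equalityI subsetI)
      fix w assume "w \<in> {\<omega>. \<omega> \<noteq> 0 \<and> line \<omega> \<in> line ` T}"
      then obtain v where "v \<in> T" "line w = line v" "w \<noteq> 0" by blast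
      then show "w \<in> T" by (rule sat)
    qed (use Tnz in blast)
    then have "open {\<omega>. \<omega> \<noteq> 0 \<and> line \<omega> \<in> line ` T}" using oT by (simp only:)
    then have "openin proj_top (line ` T)" unfolding openin_proj_top using Tnz by blast
    then have "openin periods (period_points G \<inter> line ` T)" by (rule openin_subtopology_Int2)
    also have "period_points G \<inter> line ` T = {l \<in> topspace periods. H l \<in> U}"
      unfolding topspace_periods
    proof (intro equalityI subsetI)
      fix l assume "l \<in> period_points G \<inter> line ` T"
      then obtain w where w: "l \<in> period_points G" "l = line w" "w \<in> T" by blast
      then have "period_vector w" using period_vector_if_line by (auto simp: T_def)
      then show "l \<in> {l \<in> period_points G. H l \<in> U}"
        using w H[of w] V(2) per by (auto simp: T_def period_points_eq)
    next
      fix l assume l: "l \<in> {l \<in> period_points G. H l \<in> U}"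
      then obtain w where w: "l = line w" "period_vector w" by (auto simp: period_points_eq)
      then have "w \<in> T" using l H[of w] V(2) nz period_vector_nonzero by (auto simp: T_def)
      then show "l \<in> period_points G \<inter> line ` T" using l w by blast
    qed
    finally show "openin periods {l \<in> topspace periods. H l \<in> U}" .
  qed
  have "connectedin periods (H ` D)"
    by (rule connectedin_continuous_map_image[OF contH connectedin_connected_components_of[OF D_component]])
  moreover have "\<not> disjnt D (H ` D)"
  proof -
    have "line (h \<omega>0) \<in> D" "H (line \<omega>0) = line (h \<omega>0)" "line \<omega>0 \<in> D" using 0 H by (auto simp: over_D_def)
    then show ?thesis unfolding disjnt_def by (metis IntI empty_iff imageI)
  qed
  ultimately have "H ` D \<subseteq> D" by (rule connected_components_of_maximal[OF D_component])
  then show ?thesis using \<omega> H nz[OF over_D_period[OF \<omega>]] by (auto simp: over_D_def)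
qed

lemma act_preserves_D:
  assumes g: "g \<in> O_lattice G" and "over_D \<omega>0" "over_D (act g \<omega>0)" "over_D \<omega>"
  shows "over_D (act g \<omega>)"
  by (rule semilinear_preserves_D[OF continuous_on_act O_period_vector[OF g] _ assms(2-4)]) (auto simp: act_scale)

lemma conj_act_preserves_D:
  assumes g: "g \<in> O_lattice G" and "over_D \<omega>0" "over_D (conj_vec (act g \<omega>0))" "over_D \<omega>"
  shows "over_D (conj_vec (act g \<omega>))"
  by (rule semilinear_preserves_D[where h = "\<lambda>\<omega>. conj_vec (act g \<omega>)", OF _ _ _ assms(2-4)])
     (auto intro!: continuous_on_conj_vec continuous_on_act conj_period_vector O_period_vector[OF g] exI[of _ "cnj _"] simp: act_scale conj_vec_scale)

lemma O_plus_carrierI: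
  assumes g: "g \<in> O_lattice G" and h: "h \<in> O_lattice G" "g ** h = mat 1" "h ** g = mat 1"
    and \<omega>: "over_D \<omega>" "over_D (act g \<omega>)"
  shows "g \<in> carrier (O_plus G D)"
proof -
  have l: "act k ` line w = line (act k w)" for k :: "int ^ 'm ^ 'm" and w by (auto simp: line_eq act_scale image_image)
  have "over_D (act h (act g \<omega>))" using \<omega> h by (simp add: act_mult[symmetric])
  then have hD: "over_D (act h w)" if "over_D w" for w using act_preserves_D[OF h(1) \<omega>(2) _ that] by blast
  have gD: "over_D (act g w)" if "over_D w" for w by (rule act_preserves_D[OF g \<omega> that])
  have "(\<lambda>l. act g ` l) ` D = D"
  proof (intro equalityI subsetI)
    fix l assume "l \<in> (\<lambda>l. act g ` l) ` D"
    then obtain l' where l': "l' \<in> D" "l = act g ` l'" by blast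
    obtain w where w: "over_D w" "l' = line w" by (rule D_line_obtain[OF l'(1)])
    then show "l \<in> D" using gD[of w] l l' by (simp add: over_D_def)
  next
    fix l assume l': "l \<in> D"
    obtain w where w: "over_D w" "l = line w" by (rule D_line_obtain[OF l'])
    then have "line (act h w) \<in> D" using hD by (auto simp: over_D_def)
    moreover have "act g ` line (act h w) = l" using w h by (simp add: l act_mult[symmetric])
    ultimately show "l \<in> (\<lambda>l. act g ` l) ` D" by blast
  qed
  then show ?thesis using g by (simp add: O_plus_def)
qed

lemma O_plus_over_D:
  assumes "g \<in> carrier (O_plus G D)" "over_D \<omega>"
  shows "g \<in> O_lattice G" "over_D (act g \<omega>)"
proof -
  show g: "g \<in> O_lattice G" using assms by (simp add: O_plus_def)
  have l: "act k ` line w = line (act k w)" for k :: "int ^ 'm ^ 'm" and w by (auto simp: line_eq act_scale image_image)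
  have "line \<omega> \<in> D" using assms(2) by (simp add: over_D_def)
  then have "act g ` line \<omega> \<in> (\<lambda>l. act g ` l) ` D" by (rule imageI)
  also have "(\<lambda>l. act g ` l) ` D = D" using assms(1) by (simp add: O_plus_def)
  finally have "line (act g \<omega>) \<in> D" unfolding l .
  then show "over_D (act g \<omega>)"
    using O_period_vector[OF g over_D_period[OF assms(2)]] period_vector_nonzero by (auto simp: over_D_def)
qed

subsection \<open>Isometries carrying one reduced triple to another\<close>

text \<open>The map that carries \<open>x, y, z\<close> to \<open>x', y', z'\<close> and is the identity on their complement.\<close>

definition transport :: "int ^ 'm \<Rightarrow> int ^ 'm \<Rightarrow> int ^ 'm \<Rightarrow> int ^ 'm \<Rightarrow> int ^ 'm \<Rightarrow> int ^ 'm \<Rightarrow> real ^ 'm \<Rightarrow> real ^ 'm" where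
  "transport x y z x' y' z' v = v + (1 / of_int (gramdet G x y z)) *\<^sub>R
     (B v (rvec (dual G x y z)) *\<^sub>R (rvec x' - rvec x) + B v (rvec (dual G y z x)) *\<^sub>R (rvec y' - rvec y)
      + B v (rvec (dual G z x y)) *\<^sub>R (rvec z' - rvec z))"

definition perpW :: "int ^ 'm \<Rightarrow> int ^ 'm \<Rightarrow> int ^ 'm \<Rightarrow> real ^ 'm \<Rightarrow> bool" where
  "perpW x y z v \<longleftrightarrow> B v (rvec x) = 0 \<and> B v (rvec y) = 0 \<and> B v (rvec z) = 0"

lemma perpW_iff: "perpW x y z v \<longleftrightarrow> (\<forall>w\<in>W x y z. B v w = 0)"
proof
  assume "perpW x y z v"
  then show "\<forall>w\<in>W x y z. B v w = 0"
    by (auto simp: W_iff perpW_def bil_add_right bil_scaleR_right)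
next
  assume "\<forall>w\<in>W x y z. B v w = 0"
  moreover have "{rvec x, rvec y, rvec z} \<subseteq> W x y z" unfolding W_def by (rule span_superset)
  ultimately show "perpW x y z v" by (simp add: perpW_def)
qed

lemma gramdet_rot: "gramdet G y z x = gramdet G x y z" "gramdet G z x y = gramdet G x y z"
  using gramdet_rotate[OF sym_int] by metis+

lemma rvec_dual_W: "rvec (dual G x y z) \<in> W x y z" "rvec (dual G y z x) \<in> W x y z" "rvec (dual G z x y) \<in> W x y z"
  unfolding dual_def rvec_add rvec_scale W_def by (intro span_add span_scale span_base; simp)+

lemma transport_split:
  assumes nz: "gramdet G x y z \<noteq> 0" and p: "perpW x y z v"
  shows "transport x y z x' y' z' (v + (p *\<^sub>R rvec x + q *\<^sub>R rvec y + r *\<^sub>R rvec z))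
    = v + (p *\<^sub>R rvec x' + q *\<^sub>R rvec y' + r *\<^sub>R rvec z')"
proof -
  have v0: "B v (rvec (dual G x y z)) = 0" "B v (rvec (dual G y z x)) = 0" "B v (rvec (dual G z x y)) = 0"
    using p rvec_dual_W[where x = x and y = y and z = z] unfolding perpW_iff by auto
  have c: "Z u (dual G a b c) = Z (dual G a b c) u" for u a b c by (rule Z_commute)
  have nz': "(of_int (gramdet G x y z) :: real) \<noteq> 0" using nz by simp
  show ?thesis
    unfolding transport_def
    using nz' by (simp add: bil_add_left bil_scaleR_left bil_rvec c dual_bil[OF sym_int] gramdet_rot v0 scaleR_add_right)
      (simp add: algebra_simps)
qed

lemma split_obtain:
  assumes nz: "gramdet G x y z \<noteq> 0"
  obtains v' p q r where "v = v' + (p *\<^sub>R rvec x + q *\<^sub>R rvec y + r *\<^sub>R rvec z)" "perpW x y z v'"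
proof -
  let ?d = "of_int (gramdet G x y z) :: real"
  have nz': "?d \<noteq> 0" using nz by simp
  define p q r where "p = B v (rvec (dual G x y z)) / ?d" and "q = B v (rvec (dual G y z x)) / ?d" and "r = B v (rvec (dual G z x y)) / ?d"
  define w where "w = p *\<^sub>R rvec x + q *\<^sub>R rvec y + r *\<^sub>R rvec z"
  have "B w u = B v u" if u: "u \<in> W x y z" for u
  proof -
    have "?d * B v u = B v (?d *\<^sub>R u)" by (simp add: bil_scaleR_right)
    also have "\<dots> = B v (B u (rvec (dual G x y z)) *\<^sub>R rvec x + B u (rvec (dual G y z x)) *\<^sub>R rvec y + B u (rvec (dual G z x y)) *\<^sub>R rvec z)"
      unfolding W_dual[OF u] ..
    finally have 1: "?d * B v u = B u (rvec (dual G x y z)) * B v (rvec x) + B u (rvec (dual G y z x)) * B v (rvec y) + B u (rvec (dual G z x y)) * B v (rvec z)"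
      by (simp add: bil_add_right bil_scaleR_right)
    obtain i j k where u': "u = i *\<^sub>R rvec x + j *\<^sub>R rvec y + k *\<^sub>R rvec z" using u W_iff by blast
    have c: "Z u (dual G a b c) = Z (dual G a b c) u" for u a b c by (rule Z_commute)
    have "?d * B v u = B v (?d *\<^sub>R u)" by (simp add: bil_scaleR_right)
    have gx: "Z x x * gramdet G x y z = 0 + Z x x * gramdet G x y z" by simp
    have dx: "?d * B v (rvec t) = B v (rvec (dual G x y z)) * B (rvec x) (rvec t) + B v (rvec (dual G y z x)) * B (rvec y) (rvec t) + B v (rvec (dual G z x y)) * B (rvec z) (rvec t)"
      if "t \<in> {x, y, z}" for t
    proof -
      have "gramdet G x y z *s t = Z x t *s dual G x y z + Z y t *s dual G y z x + Z z t *s dual G z x y"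
      proof -
        have "gramdet G x y z *s x = Z x x *s dual G x y z + Z y x *s dual G y z x + Z z x *s dual G z x y"
          "gramdet G x y z *s y = Z x y *s dual G x y z + Z y y *s dual G y z x + Z z y *s dual G z x y"
          "gramdet G x y z *s z = Z x z *s dual G x y z + Z y z *s dual G y z x + Z z z *s dual G z x y"
          using Z_commute[of y x] Z_commute[of z x] Z_commute[of z y]
          by (simp_all add: dual_def gramdet_def vec_eq_iff power2_eq_square algebra_simps)
        then show ?thesis using that by blast
      qed
      then have "rvec (gramdet G x y z *s t) = rvec (Z x t *s dual G x y z + Z y t *s dual G y z x + Z z t *s dual G z x y)" by simp
      then have e: "?d *\<^sub>R rvec t = B (rvec x) (rvec t) *\<^sub>R rvec (dual G x y z) + B (rvec y) (rvec t) *\<^sub>R rvec (dual G y z x) + B (rvec z) (rvec t) *\<^sub>R rvec (dual G z x y)"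
        by (simp add: rvec_add rvec_scale bil_rvec)
      have "?d * B v (rvec t) = B v (?d *\<^sub>R rvec t)" by (simp add: bil_scaleR_right)
      then show ?thesis unfolding e by (simp add: bil_add_right bil_scaleR_right mult.commute)
    qed
    have "?d * B v u = i * (?d * B v (rvec x)) + j * (?d * B v (rvec y)) + k * (?d * B v (rvec z))"
      by (simp add: u' bil_add_right bil_scaleR_right algebra_simps)
    also have "\<dots> = B v (rvec (dual G x y z)) * B (rvec x) u + B v (rvec (dual G y z x)) * B (rvec y) u + B v (rvec (dual G z x y)) * B (rvec z) u"
      using dx[of x] dx[of y] dx[of z] by (simp add: u' bil_add_right bil_scaleR_right algebra_simps)
    also have "\<dots> = ?d * B w u"
      using nz' by (simp add: w_def p_def q_def r_def bil_add_left bil_scaleR_left distrib_left)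
    finally show ?thesis using nz' by simp
  qed
  then have "perpW x y z (v - w)" by (simp add: perpW_iff bil_diff_left)
  moreover have "v = (v - w) + (p *\<^sub>R rvec x + q *\<^sub>R rvec y + r *\<^sub>R rvec z)" by (simp add: w_def)
  ultimately show ?thesis using that by blast
qed

text \<open>Equal Gram matrices make the transport an isometry; congruence modulo the Gram determinant, the
  only denominator in it, makes it integral.\<close>

definition same_type :: "int ^ 'm \<Rightarrow> int ^ 'm \<Rightarrow> int ^ 'm \<Rightarrow> int ^ 'm \<Rightarrow> int ^ 'm \<Rightarrow> int ^ 'm \<Rightarrow> bool" where
  "same_type x y z x' y' z' \<longleftrightarrow> gramdet G x y z \<noteq> 0 \<and> W x y z = W x' y' z'
     \<and> Z x x = Z x' x' \<and> Z y y = Z y' y' \<and> Z z z = Z z' z' \<and> Z x y = Z x' y' \<and> Z x z = Z x' z' \<and> Z y z = Z y' z'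
     \<and> (\<forall>i. gramdet G x y z dvd x' $ i - x $ i \<and> gramdet G x y z dvd y' $ i - y $ i \<and> gramdet G x y z dvd z' $ i - z $ i)"

lemma same_type_gramdet: "same_type x y z x' y' z' \<Longrightarrow> gramdet G x' y' z' = gramdet G x y z"
  by (simp add: same_type_def gramdet_def)

lemma same_type_sym: "same_type x y z x' y' z' \<Longrightarrow> same_type x' y' z' x y z"
  using same_type_gramdet[of x y z x' y' z'] unfolding same_type_def by (simp add: dvd_diff_commute)

lemma same_type_perp: "same_type x y z x' y' z' \<Longrightarrow> perpW x' y' z' v \<longleftrightarrow> perpW x y z v"
  by (simp add: perpW_iff same_type_def)

lemma transport_isometry:
  assumes s: "same_type x y z x' y' z'"
  shows "B (transport x y z x' y' z' u) (transport x y z x' y' z' v) = B u v"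
proof -
  have nz: "gramdet G x y z \<noteq> 0" using s by (simp add: same_type_def)
  obtain u' p q r where u: "u = u' + (p *\<^sub>R rvec x + q *\<^sub>R rvec y + r *\<^sub>R rvec z)" and pu: "perpW x y z u'"
    by (rule split_obtain[OF nz])
  obtain v' i j k where v: "v = v' + (i *\<^sub>R rvec x + j *\<^sub>R rvec y + k *\<^sub>R rvec z)" and pv: "perpW x y z v'"
    by (rule split_obtain[OF nz])
  have "B u' (rvec x) = 0" "B u' (rvec y) = 0" "B u' (rvec z) = 0" "B u' (rvec x') = 0" "B u' (rvec y') = 0" "B u' (rvec z') = 0"
    using pu same_type_perp[OF s] by (auto simp: perpW_def)
  moreover have "B (rvec x) v' = 0" "B (rvec y) v' = 0" "B (rvec z) v' = 0" "B (rvec x') v' = 0" "B (rvec y') v' = 0" "B (rvec z') v' = 0"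
    using pv same_type_perp[OF s] B_commute[of _ v'] by (auto simp: perpW_def)
  moreover have "Z x x = Z x' x'" "Z y y = Z y' y'" "Z z z = Z z' z'" "Z x y = Z x' y'" "Z x z = Z x' z'" "Z y z = Z y' z'"
     "Z y x = Z y' x'" "Z z x = Z z' x'" "Z z y = Z z' y'"
    using s Z_commute[of y x] Z_commute[of z x] Z_commute[of z y] Z_commute[of y' x'] Z_commute[of z' x'] Z_commute[of z' y']
    by (auto simp: same_type_def)
  ultimately show ?thesis
    unfolding u v transport_split[OF nz pu] transport_split[OF nz pv]
    by (simp add: bil_add_left bil_add_right bil_scaleR_left bil_scaleR_right bil_rvec)
qed

lemma transport_comp:
  assumes s: "same_type x y z x' y' z'"
  shows "transport x' y' z' x'' y'' z'' (transport x y z x' y' z' v) = transport x y z x'' y'' z'' v"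
proof -
  have nz: "gramdet G x y z \<noteq> 0" "gramdet G x' y' z' \<noteq> 0"
    using s same_type_gramdet[OF s] by (auto simp: same_type_def)
  obtain v' i j k where v: "v = v' + (i *\<^sub>R rvec x + j *\<^sub>R rvec y + k *\<^sub>R rvec z)" and pv: "perpW x y z v'"
    by (rule split_obtain[OF nz(1)])
  have pv': "perpW x' y' z' v'" using pv same_type_perp[OF s] by simp
  show ?thesis unfolding v transport_split[OF nz(1) pv] transport_split[OF nz(2) pv'] ..
qed

lemma transport_same [simp]: "transport x y z x y z v = v"
  by (simp add: transport_def)

lemma transport_integral:
  assumes s: "same_type x y z x' y' z'"
  shows "\<exists>g. \<forall>v. ract g v = transport x y z x' y' z' v"
proof -
  let ?d = "gramdet G x y z"
  have nz: "?d \<noteq> 0" using s by (simp add: same_type_def)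
  have "\<exists>w. \<forall>i. u' $ i - u $ i = ?d * w $ i" if "\<forall>i. ?d dvd u' $ i - u $ i" for u u' :: "int ^ 'm"
    by (rule exI[of _ "\<chi> i. (u' $ i - u $ i) div ?d"]) (use that in simp)
  then obtain w1 w2 w3 where w: "\<And>i. x' $ i - x $ i = ?d * w1 $ i" "\<And>i. y' $ i - y $ i = ?d * w2 $ i" "\<And>i. z' $ i - z $ i = ?d * w3 $ i"
    using s unfolding same_type_def by metis
  define g :: "int ^ 'm ^ 'm" where "g = (\<chi> k l. (if k = l then 1 else 0) + Z (axis l 1) (dual G x y z) * w1 $ k
     + Z (axis l 1) (dual G y z x) * w2 $ k + Z (axis l 1) (dual G z x y) * w3 $ k)"
  have rw: "rvec u' - rvec u = of_int ?d *\<^sub>R rvec w" if "\<And>i. u' $ i - u $ i = ?d * w $ i" for u u' w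
    using that by (simp add: rvec_def vec_eq_iff flip: of_int_diff of_int_mult)
  have ax: "axis l 1 = rvec (axis l 1)" for l by (simp add: rvec_def axis_def vec_eq_iff)
  have "ract g v = transport x y z x' y' z' v" for v
  proof -
    have sumv: "(\<Sum>l\<in>UNIV. real_of_int (Z (axis l 1) d) * v $ l) = B v (rvec d)" for d
    proof -
      have "B v (rvec d) = B (\<Sum>l\<in>UNIV. v $ l *s axis l 1) (rvec d)" by (simp add: basis_expansion)
      also have "\<dots> = (\<Sum>l\<in>UNIV. v $ l * B (axis l 1) (rvec d))" by (simp add: bil_sum_left bil_scale_left)
      finally show ?thesis by (simp add: mult.commute ax bil_rvec)
    qed
    have "(ract g v) $ k = transport x y z x' y' z' v $ k" for k
    proof -
      have "(ract g v) $ k = (\<Sum>l\<in>UNIV. of_int (g $ k $ l) * v $ l)"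
        by (simp add: ract_def map_matrix_def matrix_vector_mult_def)
      also have "\<dots> = (\<Sum>l\<in>UNIV. (if k = l then v $ l else 0) + (of_int (Z (axis l 1) (dual G x y z)) * v $ l) * of_int (w1 $ k)
          + (of_int (Z (axis l 1) (dual G y z x)) * v $ l) * of_int (w2 $ k) + (of_int (Z (axis l 1) (dual G z x y)) * v $ l) * of_int (w3 $ k))"
        by (intro sum.cong refl) (simp add: g_def algebra_simps)
      also have "\<dots> = v $ k + B v (rvec (dual G x y z)) * of_int (w1 $ k) + B v (rvec (dual G y z x)) * of_int (w2 $ k) + B v (rvec (dual G z x y)) * of_int (w3 $ k)"
        by (simp add: sum.distrib sumv flip: sum_distrib_right)
      also have "\<dots> = transport x y z x' y' z' v $ k"
        using nz by (simp add: transport_def rw[OF w(1)] rw[OF w(2)] rw[OF w(3)] field_simps) (simp add: rvec_def)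
      finally show ?thesis .
    qed
    then show ?thesis by (simp add: vec_eq_iff)
  qed
  then show ?thesis by blast
qed

text \<open>The integral matrix of the transport.\<close>

definition transporter :: "int ^ 'm \<Rightarrow> int ^ 'm \<Rightarrow> int ^ 'm \<Rightarrow> int ^ 'm \<Rightarrow> int ^ 'm \<Rightarrow> int ^ 'm \<Rightarrow> int ^ 'm ^ 'm" where
  "transporter x y z x' y' z' = (SOME g. \<forall>v. ract g v = transport x y z x' y' z' v)"

lemma ract_transporter:
  assumes "same_type x y z x' y' z'"
  shows "ract (transporter x y z x' y' z') v = transport x y z x' y' z' v"
  using someI_ex[OF transport_integral[OF assms]] unfolding transporter_def by blast

lemma transporter_comp:
  assumes s: "same_type x y z x' y' z'" "same_type x' y' z' x'' y'' z''" "same_type x y z x'' y'' z''"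
  shows "transporter x' y' z' x'' y'' z'' ** transporter x y z x' y' z' = transporter x y z x'' y'' z''"
  by (rule ract_int_matrix_eq) (simp add: ract_mult ract_transporter s transport_comp)

lemma transporter_inverse:
  assumes s: "same_type x y z x' y' z'"
  shows "transporter x' y' z' x y z ** transporter x y z x' y' z' = mat 1"
  by (rule ract_int_matrix_eq) (simp add: ract_mult ract_transporter s same_type_sym[OF s] transport_comp)

lemma transporter_O:
  assumes s: "same_type x y z x' y' z'"
  shows "transporter x y z x' y' z' \<in> O_lattice G"
proof -
  let ?g = "transporter x y z x' y' z'"
  have "invertible ?g"
    unfolding invertible_def using transporter_inverse[OF s] transporter_inverse[OF same_type_sym[OF s]] by blast
  moreover have "Z (?g *v u) (?g *v v) = Z u v" for u v
  proof -
    have "real_of_int (Z (?g *v u) (?g *v v)) = B (ract ?g (rvec u)) (ract ?g (rvec v))"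
      by (simp add: ract_rvec bil_rvec)
    also have "\<dots> = of_int (Z u v)"
      unfolding ract_transporter[OF s] transport_isometry[OF s] by (rule bil_rvec)
    finally show ?thesis by simp
  qed
  ultimately show ?thesis by (simp add: O_lattice_def)
qed

end

lemma finite_representatives:
  assumes "finite (\<kappa> ` X)"
  shows "\<exists>Y\<subseteq>X. finite Y \<and> (\<forall>x\<in>X. \<exists>y\<in>Y. \<kappa> x = \<kappa> y)"
proof -
  define Y where "Y = (\<lambda>k. SOME x. x \<in> X \<and> \<kappa> x = k) ` (\<kappa> ` X)"
  have ch: "(SOME y. y \<in> X \<and> \<kappa> y = \<kappa> x) \<in> X \<and> \<kappa> (SOME y. y \<in> X \<and> \<kappa> y = \<kappa> x) = \<kappa> x" if "x \<in> X" for x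
    using someI[of "\<lambda>y. y \<in> X \<and> \<kappa> y = \<kappa> x" x] that by simp
  have "Y \<subseteq> X" using ch by (auto simp: Y_def)
  moreover have "\<exists>y\<in>Y. \<kappa> x = \<kappa> y" if "x \<in> X" for x
  proof (rule bexI)
    show "\<kappa> x = \<kappa> (SOME y. y \<in> X \<and> \<kappa> y = \<kappa> x)" using ch[OF that] by simp
    show "(SOME y. y \<in> X \<and> \<kappa> y = \<kappa> x) \<in> Y" unfolding Y_def using that by (intro imageI)
  qed
  ultimately show ?thesis using assms by (auto simp: Y_def)
qed

text \<open>A finite set of representatives for a relation is refined by a finite invariant that is measured
  relative to the representative.\<close>

lemma finite_representatives_refine:
  assumes Y: "Y \<subseteq> X" "finite Y" "\<And>x. x \<in> X \<Longrightarrow> \<exists>y\<in>Y. R x y"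
    and fin: "\<And>y. y \<in> Y \<Longrightarrow> finite (\<kappa> y ` {x \<in> X. R x y})"
    and R': "\<And>y x x'. y \<in> Y \<Longrightarrow> x \<in> X \<Longrightarrow> x' \<in> X \<Longrightarrow> R x y \<Longrightarrow> R x' y \<Longrightarrow> \<kappa> y x = \<kappa> y x' \<Longrightarrow> R' x x'"
  shows "\<exists>Y'\<subseteq>X. finite Y' \<and> (\<forall>x\<in>X. \<exists>y\<in>Y'. R' x y)"
proof -
  have "\<forall>y\<in>Y. \<exists>Z. Z \<subseteq> {x \<in> X. R x y} \<and> finite Z \<and> (\<forall>x\<in>{x \<in> X. R x y}. \<exists>z\<in>Z. \<kappa> y x = \<kappa> y z)"
    by (intro ballI finite_representatives fin)
  from bchoice[OF this] obtain Z where Z0: "\<forall>y\<in>Y. Z y \<subseteq> {x \<in> X. R x y} \<and> finite (Z y) \<and> (\<forall>x\<in>{x \<in> X. R x y}. \<exists>z\<in>Z y. \<kappa> y x = \<kappa> y z)" ..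
  have Z: "\<And>y. y \<in> Y \<Longrightarrow> Z y \<subseteq> {x \<in> X. R x y}" "\<And>y. y \<in> Y \<Longrightarrow> finite (Z y)"
    "\<And>y x. y \<in> Y \<Longrightarrow> x \<in> X \<Longrightarrow> R x y \<Longrightarrow> \<exists>z\<in>Z y. \<kappa> y x = \<kappa> y z" using Z0 by blast+
  show ?thesis
  proof (intro exI[of _ "\<Union>y\<in>Y. Z y"] conjI ballI)
    show "(\<Union>y\<in>Y. Z y) \<subseteq> X" using Z(1) by blast
    show "finite (\<Union>y\<in>Y. Z y)" using Y(2) Z(2) by blast
    fix x assume x: "x \<in> X"
    then obtain y where y: "y \<in> Y" "R x y" using Y(3) by blast
    then obtain z where z: "z \<in> Z y" "\<kappa> y x = \<kappa> y z" using Z(3) x by blast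
    then have "z \<in> X" "R z y" using Z(1) y by blast+
    then have "R' x z" using R'[OF y(1) x _ y(2) _ z(2)] by blast
    then show "\<exists>y\<in>\<Union>y\<in>Y. Z y. R' x y" using y z by blast
  qed
qed

context type_IV
begin

text \<open>Every lattice vector in the span is a rational combination of the three vectors.\<close>

lemma anisotropic_W:
  assumes an: "anisotropic_triple x y z" and nz: "gramdet G x y z \<noteq> 0" and u: "rvec u \<in> W x y z" "u \<noteq> 0"
  shows "Z u u \<noteq> 0"
proof
  assume 0: "Z u u = 0"
  let ?d = "gramdet G x y z"
  define i j k where "i = Z u (dual G x y z)" and "j = Z u (dual G y z x)" and "k = Z u (dual G z x y)"
  have "rvec (?d *s u) = rvec (i *s x + j *s y + k *s z)"
    using W_dual[OF u(1)] by (simp add: rvec_add rvec_scale bil_rvec i_def j_def k_def)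
  then have "rvec (?d *s u - (i *s x + j *s y + k *s z)) = 0" by (simp add: rvec_diff)
  then have e: "?d *s u = i *s x + j *s y + k *s z" by (simp only: rvec_eq_0_iff eq_iff_diff_eq_0[symmetric])
  have "Z (i *s x + j *s y + k *s z) (i *s x + j *s y + k *s z) = ?d * (?d * Z u u)"
    unfolding e[symmetric] by (simp add: bil_scale_left bil_scale_right)
  then have "Z (i *s x + j *s y + k *s z) (i *s x + j *s y + k *s z) = 0" unfolding 0 by simp
  then have "i = 0 \<and> j = 0 \<and> k = 0" by (rule an[unfolded anisotropic_triple_def, rule_format])
  then have "?d *s u = 0" using e by simp
  then show False using nz u(2) by simp
qed

lemma frame_ract:
  assumes g: "g \<in> O_lattice G" and f: "frame a b c"
  shows "frame (ract g a) (ract g b) (ract g c)"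
  using f unfolding frame_def pos_frame_def O_isometry(2)[OF g] .

lemma transport_W:
  assumes s: "same_type x y z x' y' z'" and w: "w \<in> W x y z"
  shows "transport x y z x' y' z' w \<in> W x y z"
proof -
  have nz: "gramdet G x y z \<noteq> 0" using s by (simp add: same_type_def)
  obtain p q r where e: "w = p *\<^sub>R rvec x + q *\<^sub>R rvec y + r *\<^sub>R rvec z" using w W_iff by blast
  have "perpW x y z 0" by (simp add: perpW_def)
  from transport_split[OF nz this, of x' y' z' p q r] have "transport x y z x' y' z' w = p *\<^sub>R rvec x' + q *\<^sub>R rvec y' + r *\<^sub>R rvec z'"
    by (simp add: e)
  then have "transport x y z x' y' z' w \<in> W x' y' z'" using W_iff by blast
  then show ?thesis using s by (simp add: same_type_def)
qed

lemma transport_perp: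
  assumes s: "same_type x y z x' y' z'" and v: "perpW x y z v"
  shows "transport x y z x' y' z' v = v"
proof -
  have "gramdet G x y z \<noteq> 0" using s unfolding same_type_def by (rule conjunct1)
  from transport_split[OF this v, of x' y' z' 0 0 0] show ?thesis by simp
qed

lemma transport_basis:
  assumes s: "same_type x y z x' y' z'"
  shows "transport x y z x' y' z' (rvec x) = rvec x'" "transport x y z x' y' z' (rvec y) = rvec y'" "transport x y z x' y' z' (rvec z) = rvec z'"
proof -
  have nz: "gramdet G x y z \<noteq> 0" using s by (simp add: same_type_def)
  have p: "perpW x y z 0" by (simp add: perpW_def)
  show "transport x y z x' y' z' (rvec x) = rvec x'" "transport x y z x' y' z' (rvec y) = rvec y'" "transport x y z x' y' z' (rvec z) = rvec z'"
    using transport_split[OF nz p, of x' y' z' 1 0 0] transport_split[OF nz p, of x' y' z' 0 1 0] transport_split[OF nz p, of x' y' z' 0 0 1] by simp_all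
qed

text \<open>A vector of the span is controlled by its products with a basis.\<close>

lemma W_norm_bound:
  assumes nz: "gramdet G x y z \<noteq> 0"
  shows "\<exists>K. \<forall>w\<in>W x y z. (\<forall>u\<in>{x, y, z}. \<bar>B w (rvec u)\<bar> \<le> s) \<longrightarrow> norm w \<le> K"
proof -
  define m :: "int ^ 'm \<Rightarrow> int ^ 'm \<Rightarrow> int ^ 'm \<Rightarrow> real" where "m x y z = \<bar>of_int (Z y y * Z z z - (Z y z)\<^sup>2)\<bar> * s
    + \<bar>of_int (Z x z * Z y z - Z x y * Z z z)\<bar> * s + \<bar>of_int (Z x y * Z y z - Z x z * Z y y)\<bar> * s" for x y z
  have m: "\<bar>B w (rvec (dual G x y z))\<bar> \<le> m x y z"
    if "\<bar>B w (rvec x)\<bar> \<le> s" "\<bar>B w (rvec y)\<bar> \<le> s" "\<bar>B w (rvec z)\<bar> \<le> s" for w x y z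
  proof -
    have "B w (rvec (dual G x y z)) = of_int (Z y y * Z z z - (Z y z)\<^sup>2) * B w (rvec x)
      + of_int (Z x z * Z y z - Z x y * Z z z) * B w (rvec y) + of_int (Z x y * Z y z - Z x z * Z y y) * B w (rvec z)"
      unfolding dual_def rvec_add rvec_scale bil_add_right bil_scaleR_right ..
    also have "\<bar>\<dots>\<bar> \<le> m x y z"
    proof -
      have tri: "\<bar>i * p + j * q + k * t\<bar> \<le> \<bar>i\<bar> * s + \<bar>j\<bar> * s + \<bar>k\<bar> * s"
        if "\<bar>p\<bar> \<le> s" "\<bar>q\<bar> \<le> s" "\<bar>t\<bar> \<le> s" for i j k p q t :: real
      proof -
        have "\<bar>i * p\<bar> \<le> \<bar>i\<bar> * s" "\<bar>j * q\<bar> \<le> \<bar>j\<bar> * s" "\<bar>k * t\<bar> \<le> \<bar>k\<bar> * s"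
          unfolding abs_mult using that by (intro mult_left_mono; simp)+
        then show ?thesis by linarith
      qed
      show ?thesis unfolding m_def by (rule tri[OF that])
    qed
    finally show ?thesis .
  qed
  let ?d = "real_of_int (gramdet G x y z)"
  define K where "K = (m x y z * norm (rvec x) + m y z x * norm (rvec y) + m z x y * norm (rvec z)) / \<bar>?d\<bar>"
  have "norm w \<le> K" if w: "w \<in> W x y z" and s: "\<forall>u\<in>{x, y, z}. \<bar>B w (rvec u)\<bar> \<le> s" for w
  proof -
    have "\<bar>?d\<bar> * norm w = norm (?d *\<^sub>R w)" by simp
    also have "\<dots> \<le> norm (B w (rvec (dual G x y z)) *\<^sub>R rvec x) + norm (B w (rvec (dual G y z x)) *\<^sub>R rvec y) + norm (B w (rvec (dual G z x y)) *\<^sub>R rvec z)"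
      unfolding W_dual[OF w] by (intro order_trans[OF norm_triangle_ineq] add_mono norm_triangle_ineq order_refl)
    also have "\<dots> \<le> m x y z * norm (rvec x) + m y z x * norm (rvec y) + m z x y * norm (rvec z)"
      unfolding norm_scaleR using s by (intro add_mono mult_right_mono m) auto
    finally show ?thesis using nz by (simp add: K_def field_simps)
  qed
  then show ?thesis by (intro exI[of _ K]) simp
qed

text \<open>Godement's criterion for the curve attached to an anisotropic ternary sublattice: a group
  commensurable with its integral isometries moves every frame into a bounded set.  Frames whose
  reduced bases have the same Gram matrix and agree modulo the determinant are related by an
  integral isometry; two further finite invariants force it to preserve the domain and to lie in the
  given group.\<close>

lemma compact_quotient:
  assumes an: "anisotropic_triple x y z" and nz: "gramdet G x y z \<noteq> 0"
    and sg: "subgroup \<Gamma> (O_plus G D)" and fin: "finite (rcosets\<^bsub>O_plus G D\<^esub> \<Gamma>)"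
  shows "\<exists>K. \<forall>a b c. frame a b c \<and> {a, b, c} \<subseteq> W x y z \<and> over_D (fr a b) \<longrightarrow>
    (\<exists>g\<in>\<Gamma>. norm (ract g a) \<le> K \<and> norm (ract g b) \<le> K \<and> norm (ract g c) \<le> K \<and> {ract g a, ract g b, ract g c} \<subseteq> W x y z
       \<and> (\<forall>v. perpW x y z v \<longrightarrow> ract g v = v))"
proof -
  \<comment> \<open>the bound from reduction theory; \<open>r1, r2, r3\<close> below is a reduced triple for each frame\<close>
  define \<delta> where "\<delta> = gramdet G x y z"
  define C0 :: real where "C0 = 16 / 3 * \<bar>of_int \<delta>\<bar>"
  define X where "X = {(a, b, c). frame a b c \<and> {a, b, c} \<subseteq> W x y z \<and> over_D (fr a b)}"
  define P where "P = (\<lambda>(a, b, c) (u1, u2, u3). {rvec u1, rvec u2, rvec u3} \<subseteq> W x y z \<and> gramdet G u1 u2 u3 = \<delta>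
      \<and> (\<forall>u\<in>{u1, u2, u3}. Q a b c (rvec u) (rvec u) \<le> C0))"
  have "\<forall>\<phi>\<in>X. \<exists>u. P \<phi> u"
  proof
    fix \<phi> assume \<phi>X: "\<phi> \<in> X"
    obtain a b c where \<phi>: "\<phi> = (a, b, c)" by (cases \<phi>)
    then have "frame a b c" "{a, b, c} \<subseteq> W x y z" using \<phi>X by (auto simp: X_def)
    from reduced_triple_exists[OF this nz anisotropic_W[OF an nz]] obtain u1 u2 u3 where
      "{rvec u1, rvec u2, rvec u3} \<subseteq> W x y z \<and> gramdet G u1 u2 u3 = \<delta> \<and> (\<forall>u\<in>{u1, u2, u3}. Q a b c (rvec u) (rvec u) \<le> C0)"
      unfolding \<delta>_def C0_def by blast
    then have "P \<phi> (u1, u2, u3)" unfolding \<phi> P_def by simp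
    then show "\<exists>u. P \<phi> u" by blast
  qed
  from bchoice[OF this] obtain rr where rr: "\<forall>\<phi>\<in>X. P \<phi> (rr \<phi>)" ..
  define r1 r2 r3 where "r1 \<phi> = fst (rr \<phi>)" and "r2 \<phi> = fst (snd (rr \<phi>))" and "r3 \<phi> = snd (snd (rr \<phi>))" for \<phi>
  have r: "{rvec (r1 (a, b, c)), rvec (r2 (a, b, c)), rvec (r3 (a, b, c))} \<subseteq> W x y z
      \<and> gramdet G (r1 (a, b, c)) (r2 (a, b, c)) (r3 (a, b, c)) = \<delta> \<and> (\<forall>u\<in>{r1 (a, b, c), r2 (a, b, c), r3 (a, b, c)}. Q a b c (rvec u) (rvec u) \<le> C0)"
    if "(a, b, c) \<in> X" for a b c
  proof -
    have "P (a, b, c) (r1 (a, b, c), r2 (a, b, c), r3 (a, b, c))" using rr that by (simp add: r1_def r2_def r3_def)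
    then show ?thesis by (simp add: P_def)
  qed
  have \<delta>nz: "\<delta> \<noteq> 0" using nz by (simp add: \<delta>_def)
  have Wr: "W (r1 \<phi>) (r2 \<phi>) (r3 \<phi>) = W x y z" if "\<phi> \<in> X" for \<phi>
    using that r by (cases \<phi>) (auto intro!: W_subset_if_gramdet simp: \<delta>nz)
  have gr: "gramdet G (r1 \<phi>) (r2 \<phi>) (r3 \<phi>) = \<delta>" if "\<phi> \<in> X" for \<phi>
    using that r by (cases \<phi>) auto
  define \<mu> :: "int ^ 'm \<Rightarrow> int ^ 'm" where "\<mu> u = (\<chi> i. u $ i mod \<delta>)" for u
  define \<kappa> where "\<kappa> \<phi> = ((Z (r1 \<phi>) (r1 \<phi>), Z (r2 \<phi>) (r2 \<phi>), Z (r3 \<phi>) (r3 \<phi>)), (Z (r1 \<phi>) (r2 \<phi>), Z (r1 \<phi>) (r3 \<phi>), Z (r2 \<phi>) (r3 \<phi>)),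
      (\<mu> (r1 \<phi>), \<mu> (r2 \<phi>), \<mu> (r3 \<phi>)))" for \<phi>
  have \<kappa>_same: "same_type (r1 \<phi>) (r2 \<phi>) (r3 \<phi>) (r1 \<psi>) (r2 \<psi>) (r3 \<psi>)" if "\<phi> \<in> X" "\<psi> \<in> X" "\<kappa> \<phi> = \<kappa> \<psi>" for \<phi> \<psi>
  proof -
    have "\<delta> dvd v $ i - u $ i" if "\<mu> u = \<mu> v" for u v :: "int ^ 'm" and i
    proof -
      have "v $ i mod \<delta> = u $ i mod \<delta>" using that by (simp add: \<mu>_def vec_eq_iff)
      then show ?thesis by (simp add: mod_eq_dvd_iff)
    qed
    then show ?thesis
      using that Wr gr \<delta>nz unfolding same_type_def \<kappa>_def by simp
  qed
  have fin\<kappa>: "finite (\<kappa> ` X)"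
  proof -
    define K where "K = \<lceil>C0\<rceil>"
    have bd: "\<bar>Z u v\<bar> \<le> K" if \<phi>: "(a, b, c) \<in> X" and u: "u \<in> {r1 (a, b, c), r2 (a, b, c), r3 (a, b, c)}" and v: "v \<in> {r1 (a, b, c), r2 (a, b, c), r3 (a, b, c)}" for a b c u v
    proof -
      have f: "frame a b c" "{a, b, c} \<subseteq> W x y z" using \<phi> by (auto simp: X_def)
      have uW: "rvec u \<in> W x y z" using r[OF \<phi>] u by auto
      have q: "Q a b c (rvec u) (rvec u) \<le> C0" "Q a b c (rvec v) (rvec v) \<le> C0" using r[OF \<phi>] u v by blast+
      have am: "\<bar>s * t\<bar> \<le> (s * s + t * t) / 2" for s t :: real
        using sum_squares_bound[of "\<bar>s\<bar>" "\<bar>t\<bar>"] by (simp add: power2_eq_square abs_mult)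
      have "real_of_int (Z u v) = B (rvec u) a * B (rvec v) a + B (rvec u) b * B (rvec v) b - B (rvec u) c * B (rvec v) c"
        using B_frame_coordinates[OF f uW, of "rvec v"] by (simp add: bil_rvec)
      also have "\<bar>\<dots>\<bar> \<le> (Q a b c (rvec u) (rvec u) + Q a b c (rvec v) (rvec v)) / 2"
      proof -
        have tri: "\<bar>p + q - t\<bar> \<le> P + P' + P''" if "\<bar>p\<bar> \<le> P" "\<bar>q\<bar> \<le> P'" "\<bar>t\<bar> \<le> P''" for p q t P P' P'' :: real
          using that by linarith
        show ?thesis
          by (rule order_trans[OF tri[OF am am am]]) (simp add: Q_def field_simps)
      qed
      also have "\<dots> \<le> C0" using q by simp
      finally have "real_of_int \<bar>Z u v\<bar> \<le> C0" by simp
      then show ?thesis unfolding K_def by (metis ceiling_mono ceiling_of_int)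
    qed
    let ?I = "{- K..K}" and ?F = "{u :: int ^ 'm. \<forall>j. \<bar>u $ j\<bar> \<le> \<bar>\<delta>\<bar>}"
    have "\<mu> u \<in> ?F" for u
      using abs_mod_less[OF \<delta>nz] by (simp add: \<mu>_def less_imp_le)
    then have \<mu>F: "\<mu> u \<in> ?F" for u .
    have I: "Z u v \<in> ?I" if "\<phi> \<in> X" "u \<in> {r1 \<phi>, r2 \<phi>, r3 \<phi>}" "v \<in> {r1 \<phi>, r2 \<phi>, r3 \<phi>}" for \<phi> u v
    proof -
      obtain a b c where \<phi>: "\<phi> = (a, b, c)" by (cases \<phi>)
      have "\<bar>Z u v\<bar> \<le> K" by (rule bd[of a b c]) (use that \<phi> in auto)
      then show ?thesis by (simp add: abs_le_iff)
    qed
    have "\<kappa> ` X \<subseteq> (?I \<times> ?I \<times> ?I) \<times> (?I \<times> ?I \<times> ?I) \<times> (?F \<times> ?F \<times> ?F)"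
      unfolding \<kappa>_def by (intro image_subsetI SigmaI \<mu>F I) auto
    then show ?thesis by (rule finite_subset) (intro finite_cartesian_product finite_bounded_int_vectors finite_atLeastAtMost_int)
  qed
  define T where "T \<phi> \<psi> = transporter (r1 \<phi>) (r2 \<phi>) (r3 \<phi>) (r1 \<psi>) (r2 \<psi>) (r3 \<psi>)" for \<phi> \<psi>
  have T_comp: "T \<psi> \<theta> ** T \<phi> \<psi> = T \<phi> \<theta>" if "\<phi> \<in> X" "\<psi> \<in> X" "\<theta> \<in> X" "\<kappa> \<phi> = \<kappa> \<psi>" "\<kappa> \<psi> = \<kappa> \<theta>" for \<phi> \<psi> \<theta>
    unfolding T_def by (intro transporter_comp \<kappa>_same) (use that in auto)
  have T_inv: "T \<psi> \<phi> ** T \<phi> \<psi> = mat 1" if "\<phi> \<in> X" "\<psi> \<in> X" "\<kappa> \<phi> = \<kappa> \<psi>" for \<phi> \<psi>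
    unfolding T_def by (intro transporter_inverse \<kappa>_same) (use that in auto)
  have T_O: "T \<phi> \<psi> \<in> O_lattice G" if "\<phi> \<in> X" "\<psi> \<in> X" "\<kappa> \<phi> = \<kappa> \<psi>" for \<phi> \<psi>
    unfolding T_def by (intro transporter_O \<kappa>_same) (use that in auto)
  have T_act: "ract (T \<phi> \<psi>) v = transport (r1 \<phi>) (r2 \<phi>) (r3 \<phi>) (r1 \<psi>) (r2 \<psi>) (r3 \<psi>) v" if "\<phi> \<in> X" "\<psi> \<in> X" "\<kappa> \<phi> = \<kappa> \<psi>" for \<phi> \<psi> v
    unfolding T_def by (intro ract_transporter \<kappa>_same) (use that in auto)
  have T_W: "ract (T \<phi> \<psi>) v \<in> W x y z" if "\<phi> \<in> X" "\<psi> \<in> X" "\<kappa> \<phi> = \<kappa> \<psi>" "v \<in> W x y z" for \<phi> \<psi> v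
    unfolding T_act[OF that(1-3)] using transport_W[OF \<kappa>_same[OF that(1-3)]] Wr[OF that(1)] that(4) by simp
  define w where "w = (\<lambda>(a, b, c :: real ^ 'm). fr a b :: complex ^ 'm)"
  have wD: "over_D (w \<phi>)" if "\<phi> \<in> X" for \<phi> using that by (auto simp: X_def w_def)
  have sides: "over_D (act (T \<phi> \<psi>) (w \<phi>)) \<or> over_D (conj_vec (act (T \<phi> \<psi>) (w \<phi>)))" if "\<phi> \<in> X" "\<psi> \<in> X" "\<kappa> \<phi> = \<kappa> \<psi>" for \<phi> \<psi>
  proof -
    obtain a b c where \<phi>: "\<phi> = (a, b, c)" by (cases \<phi>)
    have f: "frame a b c" "{a, b, c} \<subseteq> W x y z" "over_D (fr a b)" using that(1) by (auto simp: X_def \<phi>)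
    let ?g = "T \<phi> \<psi>"
    have "over_D (fr (ract ?g a) (ract ?g b)) \<or> over_D (conj_vec (fr (ract ?g a) (ract ?g b)))"
    proof (rule over_D_sides[OF f(1,3) frame_ract[OF T_O[OF that] f(1)]])
      fix v assume "v \<in> {ract ?g a, ract ?g b, ract ?g c}"
      then have "v \<in> W x y z" using T_W[OF that] f(2) by auto
      then show "v = B v a *\<^sub>R a + B v b *\<^sub>R b - B v c *\<^sub>R c" by (rule frame_expand_W[OF f(1,2)])
    qed
    then show ?thesis by (simp add: w_def \<phi> act_fr)
  qed
  have cc: "conj_vec (conj_vec u) = u" for u :: "complex ^ 'm" by (simp add: conj_vec_def vec_eq_iff)
  \<comment> \<open>first refinement: the transport may exchange the domain with its conjugate, but the composite
     of two transports that both do so does not\<close>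
  define R2 where "R2 \<phi> \<psi> \<longleftrightarrow> \<kappa> \<phi> = \<kappa> \<psi> \<and> (\<forall>\<eta>. over_D \<eta> \<longrightarrow> over_D (act (T \<phi> \<psi>) \<eta>))" for \<phi> \<psi>
  obtain Y1 where Y1: "Y1 \<subseteq> X" "finite Y1" "\<And>\<phi>. \<phi> \<in> X \<Longrightarrow> \<exists>\<psi>\<in>Y1. \<kappa> \<phi> = \<kappa> \<psi>"
    using finite_representatives[OF fin\<kappa>] by blast
  have "\<exists>Y2\<subseteq>X. finite Y2 \<and> (\<forall>\<phi>\<in>X. \<exists>\<psi>\<in>Y2. R2 \<phi> \<psi>)"
  proof (rule finite_representatives_refine[OF Y1, where \<kappa> = "\<lambda>\<psi> \<phi>. over_D (act (T \<phi> \<psi>) (w \<phi>))"])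
    fix \<psi> show "finite ((\<lambda>\<phi>. over_D (act (T \<phi> \<psi>) (w \<phi>))) ` {\<phi> \<in> X. \<kappa> \<phi> = \<kappa> \<psi>})" by (rule finite)
  next
    fix \<psi> \<phi> \<phi>' assume \<psi>: "\<psi> \<in> Y1" and \<phi>: "\<phi> \<in> X" "\<kappa> \<phi> = \<kappa> \<psi>" and \<phi>': "\<phi>' \<in> X" "\<kappa> \<phi>' = \<kappa> \<psi>"
      and same: "over_D (act (T \<phi> \<psi>) (w \<phi>)) = over_D (act (T \<phi>' \<psi>) (w \<phi>'))"
    have \<psi>X: "\<psi> \<in> X" using \<psi> Y1 by blast
    note e = T_O[OF \<phi>(1) \<psi>X \<phi>(2)] and e' = T_O[OF \<phi>'(1) \<psi>X \<phi>'(2)] and i' = T_O[OF \<psi>X \<phi>'(1) \<phi>'(2)[symmetric]]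
    have comp: "act (T \<phi> \<phi>') \<eta> = act (T \<psi> \<phi>') (act (T \<phi> \<psi>) \<eta>)" for \<eta>
      using T_comp[OF \<phi>(1) \<psi>X \<phi>'(1) \<phi>(2) \<phi>'(2)[symmetric]] by (simp add: act_mult[symmetric])
    have return: "act (T \<psi> \<phi>') (act (T \<phi>' \<psi>) \<eta>) = \<eta>" for \<eta>
      using T_inv[OF \<phi>'(1) \<psi>X \<phi>'(2)] by (simp add: act_mult[symmetric])
    have "over_D (act (T \<phi> \<phi>') \<eta>)" if \<eta>: "over_D \<eta>" for \<eta>
    proof (cases "over_D (act (T \<phi> \<psi>) (w \<phi>))")
      case True
      have "over_D (act (T \<phi> \<psi>) \<eta>)" by (rule act_preserves_D[OF e wD[OF \<phi>(1)] True \<eta>])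
      moreover have "over_D (act (T \<psi> \<phi>') (act (T \<phi>' \<psi>) (w \<phi>')))" using wD[OF \<phi>'(1)] by (simp add: return)
      ultimately show ?thesis unfolding comp using act_preserves_D[OF i'] True same by blast
    next
      case False
      then have "over_D (conj_vec (act (T \<phi> \<psi>) (w \<phi>)))" "over_D (conj_vec (act (T \<phi>' \<psi>) (w \<phi>')))"
        using sides[OF \<phi>(1) \<psi>X \<phi>(2)] sides[OF \<phi>'(1) \<psi>X \<phi>'(2)] same by auto
      note c = this
      have 1: "over_D (conj_vec (act (T \<phi> \<psi>) \<eta>))" by (rule conj_act_preserves_D[OF e wD[OF \<phi>(1)] c(1) \<eta>])
      have "over_D (conj_vec (act (T \<psi> \<phi>') (conj_vec (act (T \<phi>' \<psi>) (w \<phi>')))))"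
        using wD[OF \<phi>'(1)] by (simp add: act_conj_vec cc return)
      from conj_act_preserves_D[OF i' c(2) this 1] show ?thesis by (simp add: act_conj_vec cc comp)
    qed
    then show "R2 \<phi> \<phi>'" using \<phi> \<phi>' by (simp add: R2_def)
  qed
  then obtain Y2 where Y2: "Y2 \<subseteq> X" "finite Y2" "\<And>\<phi>. \<phi> \<in> X \<Longrightarrow> \<exists>\<psi>\<in>Y2. R2 \<phi> \<psi>" by blast
  have carr: "T \<psi> \<phi> \<in> carrier (O_plus G D)" if "\<phi> \<in> X" "\<psi> \<in> X" "R2 \<phi> \<psi>" for \<phi> \<psi>
  proof -
    have \<kappa>: "\<kappa> \<phi> = \<kappa> \<psi>" using that(3) by (simp add: R2_def)
    show ?thesis
    proof (rule O_plus_carrierI[OF T_O[OF that(2,1) \<kappa>[symmetric]] T_O[OF that(1,2) \<kappa>] T_inv[OF that(1,2) \<kappa>] T_inv[OF that(2,1) \<kappa>[symmetric]]])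
      show "over_D (act (T \<phi> \<psi>) (w \<phi>))" using that(3) wD[OF that(1)] by (simp add: R2_def)
      show "over_D (act (T \<psi> \<phi>) (act (T \<phi> \<psi>) (w \<phi>)))"
        using T_inv[OF that(1,2) \<kappa>] wD[OF that(1)] by (simp add: act_mult[symmetric])
    qed
  qed
  have "\<exists>Y3\<subseteq>X. finite Y3 \<and> (\<forall>\<phi>\<in>X. \<exists>\<psi>\<in>Y3. \<kappa> \<phi> = \<kappa> \<psi> \<and> T \<phi> \<psi> \<in> \<Gamma>)"
  proof (rule finite_representatives_refine[OF Y2, where \<kappa> = "\<lambda>\<psi> \<phi>. \<Gamma> #>\<^bsub>O_plus G D\<^esub> T \<psi> \<phi>"])
    fix \<psi> assume "\<psi> \<in> Y2"
    then have "(\<lambda>\<phi>. \<Gamma> #>\<^bsub>O_plus G D\<^esub> T \<psi> \<phi>) ` {\<phi> \<in> X. R2 \<phi> \<psi>} \<subseteq> rcosets\<^bsub>O_plus G D\<^esub> \<Gamma>"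
      using carr Y2(1) unfolding RCOSETS_def by blast
    then show "finite ((\<lambda>\<phi>. \<Gamma> #>\<^bsub>O_plus G D\<^esub> T \<psi> \<phi>) ` {\<phi> \<in> X. R2 \<phi> \<psi>})" using fin by (rule finite_subset)
  next
    fix \<psi> \<phi> \<phi>' assume \<psi>: "\<psi> \<in> Y2" and \<phi>: "\<phi> \<in> X" "R2 \<phi> \<psi>" and \<phi>': "\<phi>' \<in> X" "R2 \<phi>' \<psi>"
      and same: "\<Gamma> #>\<^bsub>O_plus G D\<^esub> T \<psi> \<phi> = \<Gamma> #>\<^bsub>O_plus G D\<^esub> T \<psi> \<phi>'"
    have \<psi>X: "\<psi> \<in> X" using \<psi> Y2 by blast
    have \<kappa>: "\<kappa> \<phi> = \<kappa> \<psi>" "\<kappa> \<phi>' = \<kappa> \<psi>" using \<phi> \<phi>' by (auto simp: R2_def)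
    have one: "mat 1 \<in> \<Gamma>" using subgroup.one_closed[OF sg] by (simp add: O_plus_def)
    have "T \<psi> \<phi>' \<in> \<Gamma> #>\<^bsub>O_plus G D\<^esub> T \<psi> \<phi>'"
      unfolding r_coset_def using one by (intro UN_I[of "mat 1"]) (auto simp: O_plus_def)
    then obtain h where h: "h \<in> \<Gamma>" "T \<psi> \<phi>' = h ** T \<psi> \<phi>"
      unfolding same[symmetric] unfolding r_coset_def by (auto simp: O_plus_def)
    have "T \<phi> \<phi>' = T \<psi> \<phi>' ** T \<phi> \<psi>" by (rule T_comp[OF \<phi>(1) \<psi>X \<phi>'(1) \<kappa>(1) \<kappa>(2)[symmetric], symmetric])
    also have "\<dots> = h"
      unfolding h(2) matrix_mul_assoc[symmetric] T_inv[OF \<phi>(1) \<psi>X \<kappa>(1)] by (rule matrix_mul_rid)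
    finally have "T \<phi> \<phi>' \<in> \<Gamma>" using h(1) by (simp only:)
    then show "\<kappa> \<phi> = \<kappa> \<phi>' \<and> T \<phi> \<phi>' \<in> \<Gamma>" using \<kappa> by (simp only:)
  qed
  then obtain Y3 where Y3: "Y3 \<subseteq> X" "finite Y3" "\<And>\<phi>. \<phi> \<in> X \<Longrightarrow> \<exists>\<psi>\<in>Y3. \<kappa> \<phi> = \<kappa> \<psi> \<and> T \<phi> \<psi> \<in> \<Gamma>" by blast
  have "\<forall>\<psi>\<in>X. \<exists>K. \<forall>v\<in>W x y z. (\<forall>u\<in>{r1 \<psi>, r2 \<psi>, r3 \<psi>}. \<bar>B v (rvec u)\<bar> \<le> sqrt C0) \<longrightarrow> norm v \<le> K"
  proof
    fix \<psi> assume \<psi>: "\<psi> \<in> X"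
    show "\<exists>K. \<forall>v\<in>W x y z. (\<forall>u\<in>{r1 \<psi>, r2 \<psi>, r3 \<psi>}. \<bar>B v (rvec u)\<bar> \<le> sqrt C0) \<longrightarrow> norm v \<le> K"
      using W_norm_bound[of "r1 \<psi>" "r2 \<psi>" "r3 \<psi>" "sqrt C0"] gr[OF \<psi>] \<delta>nz Wr[OF \<psi>] by simp
  qed
  from bchoice[OF this] obtain K where "\<forall>\<psi>\<in>X. \<forall>v\<in>W x y z. (\<forall>u\<in>{r1 \<psi>, r2 \<psi>, r3 \<psi>}. \<bar>B v (rvec u)\<bar> \<le> sqrt C0) \<longrightarrow> norm v \<le> K \<psi>" ..
  then have K: "\<And>\<psi> v. \<psi> \<in> X \<Longrightarrow> v \<in> W x y z \<Longrightarrow> (\<forall>u\<in>{r1 \<psi>, r2 \<psi>, r3 \<psi>}. \<bar>B v (rvec u)\<bar> \<le> sqrt C0) \<Longrightarrow> norm v \<le> K \<psi>" by blast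
  show ?thesis
  proof (intro exI[of _ "Max (insert 0 (K ` Y3))"] allI impI)
    fix a b c assume f: "frame a b c \<and> {a, b, c} \<subseteq> W x y z \<and> over_D (fr a b)"
    define \<phi> where "\<phi> = (a, b, c)"
    have \<phi>: "\<phi> \<in> X" using f by (auto simp: \<phi>_def X_def)
    obtain \<psi> where \<psi>: "\<psi> \<in> Y3" "\<kappa> \<phi> = \<kappa> \<psi>" "T \<phi> \<psi> \<in> \<Gamma>" using Y3(3)[OF \<phi>] by blast
    have \<psi>X: "\<psi> \<in> X" using \<psi> Y3 by blast
    let ?g = "T \<phi> \<psi>"
    note st = \<kappa>_same[OF \<phi> \<psi>X \<psi>(2)]
    have basis: "ract ?g (rvec (r1 \<phi>)) = rvec (r1 \<psi>)" "ract ?g (rvec (r2 \<phi>)) = rvec (r2 \<psi>)" "ract ?g (rvec (r3 \<phi>)) = rvec (r3 \<psi>)"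
      unfolding T_act[OF \<phi> \<psi>X \<psi>(2)] by (rule transport_basis[OF st])+
    have sm: "\<bar>B v (rvec u)\<bar> \<le> sqrt C0" if "v \<in> {a, b, c}" "u \<in> {r1 \<phi>, r2 \<phi>, r3 \<phi>}" for u v
    proof -
      have "(B v (rvec u))\<^sup>2 \<le> Q a b c (rvec u) (rvec u)"
        using that(1) B_commute[of v "rvec u"] unfolding Q_def by (auto simp: power2_eq_square)
      also have "\<dots> \<le> C0" using r[of a b c] \<phi> that(2) unfolding \<phi>_def by blast
      finally show ?thesis using real_le_rsqrt real_sqrt_abs real_sqrt_le_iff by metis
    qed
    have bound: "norm (ract ?g v) \<le> Max (insert 0 (K ` Y3))" if v: "v \<in> {a, b, c}" for v
    proof -
      have "norm (ract ?g v) \<le> K \<psi>"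
      proof (rule K[OF \<psi>X])
        show "ract ?g v \<in> W x y z" using T_W[OF \<phi> \<psi>X \<psi>(2)] f v by auto
        show "\<forall>u\<in>{r1 \<psi>, r2 \<psi>, r3 \<psi>}. \<bar>B (ract ?g v) (rvec u)\<bar> \<le> sqrt C0"
        proof -
          have "B (ract ?g v) (rvec (r1 \<psi>)) = B v (rvec (r1 \<phi>))" "B (ract ?g v) (rvec (r2 \<psi>)) = B v (rvec (r2 \<phi>))"
            "B (ract ?g v) (rvec (r3 \<psi>)) = B v (rvec (r3 \<phi>))"
            unfolding basis[symmetric] by (rule O_isometry(2)[OF T_O[OF \<phi> \<psi>X \<psi>(2)]])+
          then show ?thesis using sm[OF v] by simp
        qed
      qed
      also have "\<dots> \<le> Max (insert 0 (K ` Y3))" using \<psi>(1) Y3(2) by (intro Max_ge) auto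
      finally show ?thesis .
    qed
    have perp: "ract ?g v = v" if "perpW x y z v" for v
    proof -
      have "perpW (r1 \<phi>) (r2 \<phi>) (r3 \<phi>) v" using that Wr[OF \<phi>] by (simp add: perpW_iff)
      then show ?thesis unfolding T_act[OF \<phi> \<psi>X \<psi>(2)] by (rule transport_perp[OF st])
    qed
    show "\<exists>g\<in>\<Gamma>. norm (ract g a) \<le> Max (insert 0 (K ` Y3)) \<and> norm (ract g b) \<le> Max (insert 0 (K ` Y3)) \<and> norm (ract g c) \<le> Max (insert 0 (K ` Y3))
       \<and> {ract g a, ract g b, ract g c} \<subseteq> W x y z \<and> (\<forall>v. perpW x y z v \<longrightarrow> ract g v = v)"
      
    proof (intro bexI[of _ ?g] conjI allI impI)
      show "{ract ?g a, ract ?g b, ract ?g c} \<subseteq> W x y z" using T_W[OF \<phi> \<psi>X \<psi>(2)] f by simp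
      show "ract ?g v = v" if "perpW x y z v" for v by (rule perp[OF that])
      show "?g \<in> \<Gamma>" by (rule \<psi>(3))
      show "norm (ract ?g a) \<le> Max (insert 0 (K ` Y3))" by (rule bound) (rule insertI1)
      show "norm (ract ?g b) \<le> Max (insert 0 (K ` Y3))" by (rule bound) blast
      show "norm (ract ?g c) \<le> Max (insert 0 (K ` Y3))" by (rule bound) blast
    qed
  qed
qed

subsection \<open>Nearby frames\<close>

text \<open>Membership in the domain is an open and closed condition on the oriented positive planes.\<close>

lemma over_D_near:
  assumes pf: "pos_frame a b"
  obtains \<epsilon> where "\<epsilon> > 0" "\<And>a' b'. pos_frame a' b' \<Longrightarrow> dist (a', b') (a, b) < \<epsilon> \<Longrightarrow> over_D (fr a' b') \<longleftrightarrow> over_D (fr a b)"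
proof -
  \<comment> \<open>Gram--Schmidt retracts a neighbourhood onto the pairs of orthonormal positive vectors\<close>
  define y where "y p = B (fst p) (fst p) *\<^sub>R snd p - B (fst p) (snd p) *\<^sub>R fst p" for p :: "(real ^ 'm) \<times> (real ^ 'm)"
  define f where "f p = fr ((1 / sqrt (B (fst p) (fst p))) *\<^sub>R fst p) ((1 / sqrt (B (y p) (y p))) *\<^sub>R y p)" for p
  define U where "U = {p. B (fst p) (fst p) > 0} \<inter> {p. B (y p) (y p) > 0}"
  have oU: "open U"
    unfolding U_def y_def by (intro open_Int open_Collect_less continuous_intros)
  have fid: "f (a', b') = fr a' b'" and inU: "(a', b') \<in> U" if "pos_frame a' b'" for a' b'
    using that by (auto simp: f_def U_def y_def pos_frame_def)
  obtain \<epsilon> where \<epsilon>: "\<epsilon> > 0" "ball (a, b) \<epsilon> \<subseteq> U"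
    using oU inU[OF pf] unfolding open_contains_ball by blast
  have cont: "continuous_on (ball (a, b) \<epsilon>) f"
  proof (rule continuous_on_subset[OF _ \<epsilon>(2)])
    have y: "continuous_on U y" unfolding y_def by (intro continuous_intros)
    show "continuous_on U f"
      unfolding f_def fr_def by (intro continuous_intros y) (auto simp: U_def)
  qed
  have per: "period_vector (f p)" if "p \<in> ball (a, b) \<epsilon>" for p
  proof -
    have pos: "B (fst p) (fst p) > 0" "B (y p) (y p) > 0" using that \<epsilon>(2) by (auto simp: U_def)
    have "B (fst p) (y p) = 0"
      by (simp add: y_def bil_diff_right bil_scaleR_right)
    then show ?thesis
      unfolding f_def using pos by (intro period_vector_fr) (simp add: pos_frame_def bil_scaleR_left bil_scaleR_right)
  qed
  have "over_D (fr a' b') \<longleftrightarrow> over_D (fr a b)" if "pos_frame a' b'" "dist (a', b') (a, b) < \<epsilon>" for a' b'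
  proof -
    have m: "(a', b') \<in> ball (a, b) \<epsilon>" "(a, b) \<in> ball (a, b) \<epsilon>" using that \<epsilon>(1) by (auto simp: dist_commute)
    have c: "over_D (f q)" if "p \<in> ball (a, b) \<epsilon>" "q \<in> ball (a, b) \<epsilon>" "over_D (f p)" for p q
      by (rule over_D_connected[OF connected_ball cont per that(1,3,2)])
    show ?thesis
      using c[OF m] c[OF m(2,1)] unfolding fid[OF that(1)] fid[OF pf] by (rule iffI)
  qed
  then show ?thesis by (rule that[OF \<epsilon>(1)])
qed

end

section \<open>Sections as multilinear functions\<close>

lemma pairing_scale_slots:
  "pairing d A T (\<lambda>p. r p *s u p) = (\<Prod>p<d. r p) * pairing d A T u"
  by (simp add: pairing_def vector_scalar_commute prod.distrib sum_distrib_left mult.left_commute)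

lemma tendsto_matrix_vector [tendsto_intros]:
  fixes A :: "complex ^ 'm ^ 'm"
  assumes "(f \<longlongrightarrow> l) F"
  shows "((\<lambda>x. A *v f x) \<longlongrightarrow> A *v l) F"
  unfolding matrix_vector_mult_def by (intro tendsto_intros assms)

lemma tendsto_pairing:
  assumes "\<And>x. length x = d \<Longrightarrow> ((\<lambda>N. T N x) \<longlongrightarrow> T0 x) F" "\<And>p. p < d \<Longrightarrow> ((\<lambda>N. u N p) \<longlongrightarrow> u0 p) F"
  shows "((\<lambda>N. pairing d A (T N) (u N)) \<longlongrightarrow> pairing d A T0 u0) F"
  unfolding pairing_def by (intro tendsto_intros tendsto_prod assms) auto

lemma holomorphic_on_matrix_vector:
  assumes "\<And>i. (\<lambda>z. f z $ i) holomorphic_on S"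
  shows "(\<lambda>z. (A *v f z) $ i) holomorphic_on S"
  unfolding matrix_vector_mult_def by (auto intro!: holomorphic_intros assms)

lemma holomorphic_on_pairing:
  assumes "\<And>x. (\<lambda>z. T z x) holomorphic_on S" "\<And>p i. (\<lambda>z. u z p $ i) holomorphic_on S"
  shows "(\<lambda>z. pairing d A (T z) (u z)) holomorphic_on S"
  unfolding pairing_def by (intro holomorphic_intros assms holomorphic_on_matrix_vector)

lemma bounded_linear_vscale_left: "bounded_linear (\<lambda>t::complex. t *s (v :: complex ^ 'm))"
  by (rule linear_conv_bounded_linear[THEN iffD1], rule linearI) (simp_all add: vec_eq_iff algebra_simps)

lemma tensor_coset_mem: "T \<in> tensor_coset d W R T"
  unfolding tensor_coset_def
  by (rule image_eqI[OF _ tensor.subspace_0[OF subspace_tensor_null]]) simp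

lemma tensor_coset_null:
  assumes "T \<in> tensor_null d W R"
  shows "tensor_coset d W R T = tensor_null d W R"
proof (intro equalityI subsetI)
  fix X assume "X \<in> tensor_coset d W R T"
  then show "X \<in> tensor_null d W R"
    using assms tensor.subspace_add[OF subspace_tensor_null] by (auto simp: tensor_coset_def)
next
  fix X assume "X \<in> tensor_null d W R"
  then have "X - T \<in> tensor_null d W R" using assms tensor.subspace_diff[OF subspace_tensor_null] by blast
  then show "X \<in> tensor_coset d W R T" unfolding tensor_coset_def by (rule image_eqI[rotated]) simp
qed

lemma tensor_coset_zero: "tensor_coset d W R 0 = tensor_null d W R"
  by (rule tensor_coset_null[OF tensor.subspace_0[OF subspace_tensor_null]])

text \<open>In the applications \<open>v\<close> moves with the point of a disc, and the remaining arguments \<open>y\<close> are fixed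
  vectors orthogonal to the disc.\<close>

definition slots :: "nat set \<Rightarrow> complex ^ 'm \<Rightarrow> (nat \<Rightarrow> real ^ 'm) \<Rightarrow> nat \<Rightarrow> complex ^ 'm" where
  "slots S v y p = (if p \<in> S then v else cvec (y p))"

context type_IV
begin

lemma perp_line: "v \<in> perp G (line \<omega>) \<longleftrightarrow> C v \<omega> = 0"
proof
  assume "v \<in> perp G (line \<omega>)"
  then show "C v \<omega> = 0" using in_line[of \<omega>] unfolding perp_def by blast
qed (auto simp: perp_def line_eq bil_scale_right)

lemma line_subset_perp: "over_D \<omega> \<Longrightarrow> line \<omega> \<subseteq> perp G (line \<omega>)"
proof
  fix v assume "over_D \<omega>" "v \<in> line \<omega>"
  then obtain t where "v = t *s \<omega>" "C \<omega> \<omega> = 0" using over_D_period by (auto simp: line_eq period_vector_def)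
  then show "v \<in> perp G (line \<omega>)" by (simp add: perp_line bil_scale_left)
qed

lemma subspace_perp: "vec.subspace (perp G (line \<omega>))"
  by (auto simp: vec.subspace_def perp_line bil_add_left bil_scale_left)

text \<open>The negative basis projects to a basis of the quotient of \<open>\<omega>\<^sup>\<bottom>\<close> by the line of \<open>\<omega>\<close>.\<close>

lemma perp_expand:
  assumes pf: "pos_frame a b" and c: "neg_basis a b c" and w: "C w (fr a b) = 0"
  shows "w + (\<Sum>k<n. C w (cvec (c k)) *s cvec (c k)) = C w (cvec a) *s fr a b"
proof -
  define x y where "x = (\<chi> i. Re (w $ i))" and "y = (\<chi> i. Im (w $ i))"
  have we: "w = cvec x + \<i> *s cvec y" by (simp add: cvec_def x_def y_def vec_eq_iff complex_eq_iff)
  have ex: "cvec v + (\<Sum>k<n. C (cvec v) (cvec (c k)) *s cvec (c k)) = C (cvec v) (cvec a) *s cvec a + C (cvec v) (cvec b) *s cvec b" for v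
  proof -
    have "cvec v = cvec (B v a *\<^sub>R a + B v b *\<^sub>R b - (\<Sum>k<n. B v (c k) *\<^sub>R c k))"
      using neg_basis_expand[OF pf c, of v] by simp
    then show ?thesis unfolding bil_cvec cvec_add cvec_diff cvec_scale cvec_sum by (simp add: algebra_simps)
  qed
  have "w + (\<Sum>k<n. C w (cvec (c k)) *s cvec (c k))
      = (cvec x + (\<Sum>k<n. C (cvec x) (cvec (c k)) *s cvec (c k))) + \<i> *s (cvec y + (\<Sum>k<n. C (cvec y) (cvec (c k)) *s cvec (c k)))"
    unfolding we bil_add_left bil_scale_left
    by (simp add: vec_eq_iff sum.distrib sum_distrib_left algebra_simps)
  also have "\<dots> = C w (cvec a) *s cvec a + C w (cvec b) *s cvec b"
    unfolding ex we bil_add_left bil_scale_left by (simp add: vec_eq_iff algebra_simps)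
  also have "C w (cvec b) = \<i> * C w (cvec a)"
  proof -
    have "C w (cvec a) + \<i> * C w (cvec b) = 0" using w by (simp add: fr_def bil_add_right bil_scale_right)
    then have "\<i> * (C w (cvec a) + \<i> * C w (cvec b)) = 0" by simp
    then show ?thesis by (simp add: algebra_simps)
  qed
  also have "C w (cvec a) *s cvec a + (\<i> * C w (cvec a)) *s cvec b = C w (cvec a) *s fr a b"
    by (simp add: fr_def vec_eq_iff algebra_simps)
  finally show ?thesis .
qed

lemma disc_perp:
  assumes f: "frame a b c"
  shows "C (disc_curve a b c z) (disc_vec a b c z) = 0"
    "B y a = 0 \<Longrightarrow> B y b = 0 \<Longrightarrow> B y c = 0 \<Longrightarrow> C (disc_curve a b c z) (cvec y) = 0"
proof -
  note g = frame_values[OF f]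
  have pf: "pos_frame a b" using f by (simp add: frame_def)
  show "C (disc_curve a b c z) (disc_vec a b c z) = 0"
    unfolding disc_curve_def disc_vec_def bil_add_left bil_add_right bil_scale_left bil_scale_right C_fr[OF pf] C_fr_cvec bil_cvec g
    by simp
  assume "B y a = 0" "B y b = 0" "B y c = 0"
  then show "C (disc_curve a b c z) (cvec y) = 0"
    using B_commute[of a y] B_commute[of b y] B_commute[of c y]
    unfolding disc_curve_def bil_add_left bil_scale_left C_fr_cvec bil_cvec by simp
qed

lemma disc_has_derivative:
  "(disc_curve a b c has_derivative (\<lambda>h. h *s (2 *s cvec c + (2 * z) *s frc a b))) (at z)"
proof -
  have 1: "((\<lambda>z. (2 * z) *s cvec c) has_derivative (\<lambda>h. (2 * h) *s cvec c)) (at z)"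
    by (rule bounded_linear.has_derivative[OF bounded_linear_vscale_left]) (auto intro!: derivative_eq_intros)
  have 2: "((\<lambda>z. z\<^sup>2 *s frc a b) has_derivative (\<lambda>h. (2 * z * h) *s frc a b)) (at z)"
    by (rule bounded_linear.has_derivative[OF bounded_linear_vscale_left]) (auto intro!: derivative_eq_intros)
  have "((\<lambda>z. fr a b + (2 * z) *s cvec c + z\<^sup>2 *s frc a b) has_derivative (\<lambda>h. 0 + (2 * h) *s cvec c + (2 * z * h) *s frc a b)) (at z)"
    by (intro has_derivative_add 1 2 has_derivative_const)
  moreover have "(\<lambda>h. 0 + (2 * h) *s cvec c + (2 * z * h) *s frc a b) = (\<lambda>h. h *s (2 *s cvec c + (2 * z) *s frc a b))"
    by (simp add: fun_eq_iff vec_eq_iff algebra_simps)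
  ultimately show ?thesis unfolding disc_curve_def[abs_def] by simp
qed

end

locale modular_section = type_IV G n D for G :: "int ^ 'm ^ 'm" and n D +
  fixes lam :: "nat list" and k :: int and \<Gamma> :: "(int ^ 'm ^ 'm) set"
    and s :: "(complex ^ 'm) set \<Rightarrow> complex ^ 'm \<Rightarrow> 'm tensor set"
  assumes n3: "n \<ge> 3" and sg: "subgroup \<Gamma> (O_plus G D)" and fin: "finite (rcosets\<^bsub>O_plus G D\<^esub> \<Gamma>)"
    and s: "s \<in> modular_forms G D lam k \<Gamma>"
begin

abbreviation d :: nat where "d \<equiv> sum_list lam"
abbreviation A :: "complex ^ 'm ^ 'm" where "A \<equiv> cpx_gram G"

lemma section_fibre:
  assumes "over_D \<omega>"
  obtains T where "T \<in> traceless A d (perp G (line \<omega>)) (line \<omega>)"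
    "s (line \<omega>) \<omega> = tensor_coset d (perp G (line \<omega>)) (line \<omega>) (young_c lam T)"
proof -
  have l: "line \<omega> \<in> D" "\<omega> \<in> line \<omega> - {0}" using assms by (auto simp: over_D_def)
  have "s (line \<omega>) \<in> Ek_fibre G lam k (line \<omega>)" using s l by (auto simp: modular_forms_def)
  then have "s (line \<omega>) \<omega> \<in> E_fibre G lam (line \<omega>)" using l by (auto simp: Ek_fibre_def PiE_iff)
  then show ?thesis using that unfolding E_fibre_def orth_rep_def by blast
qed

lemma section_homogeneous:
  assumes "over_D \<omega>" "t \<noteq> 0"
  shows "s (line \<omega>) (t *s \<omega>) = tscale (t powi (- k)) ` s (line \<omega>) \<omega>"
proof -
  have l: "line \<omega> \<in> D" "\<omega> \<in> line \<omega> - {0}" using assms by (auto simp: over_D_def)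
  have "s (line \<omega>) \<in> Ek_fibre G lam k (line \<omega>)" using s l by (auto simp: modular_forms_def)
  then show ?thesis using l assms(2) unfolding Ek_fibre_def by blast
qed

text \<open>The image of a line under \<open>g\<close> is the line of the image, so that invariance can be stated on
  the vectors of the cone.\<close>

lemma section_equivariant:
  assumes "over_D \<omega>" "g \<in> \<Gamma>"
  shows "s (line (act g \<omega>)) (act g \<omega>) = tensor_map (map_matrix of_int g) ` s (line \<omega>) \<omega>"
proof -
  have l: "line \<omega> \<in> D" "\<omega> \<in> line \<omega> - {0}" using assms by (auto simp: over_D_def)
  have e: "act g ` line \<omega> = line (act g \<omega>)" by (auto simp: line_eq act_scale image_image)
  have "\<forall>g\<in>\<Gamma>. \<forall>l\<in>D. \<forall>\<omega>\<in>l - {0}. s (act g ` l) (act g \<omega>) = tensor_map (map_matrix of_int g) ` s l \<omega>"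
    using s by (simp add: modular_forms_def)
  then show ?thesis using l assms(2) unfolding e[symmetric] by blast
qed

lemma local_lift:
  assumes "over_D \<omega>0"
  obtains U T where "open U" "\<omega>0 \<in> U" "\<And>x. holomorphic_several_on (\<lambda>\<omega>. T \<omega> x) U"
    "\<And>\<omega>. over_D \<omega> \<Longrightarrow> \<omega> \<in> U \<Longrightarrow> T \<omega> \<in> tensor_power d (perp G (line \<omega>))"
    "\<And>\<omega>. over_D \<omega> \<Longrightarrow> \<omega> \<in> U \<Longrightarrow> s (line \<omega>) \<omega> = tensor_coset d (perp G (line \<omega>)) (line \<omega>) (T \<omega>)"
proof -
  have hs: "holomorphic_section G D lam s" using s by (simp add: modular_forms_def)
  have "\<omega>0 \<in> \<Union>D - {0}" using assms by (auto simp: over_D_def intro!: bexI[of _ "line \<omega>0"])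
  then have "\<exists>U T. open U \<and> \<omega>0 \<in> U \<and> (\<forall>x. holomorphic_several_on (\<lambda>\<omega>. T \<omega> x) U) \<and>
      (\<forall>l\<in>D. \<forall>\<omega>\<in>l - {0}. \<omega> \<in> U \<longrightarrow> T \<omega> \<in> tensor_power d (perp G l) \<and> s l \<omega> = tensor_coset d (perp G l) l (T \<omega>))"
    by (rule bspec[OF hs[unfolded holomorphic_section_def]])
  then obtain U T where UT: "open U" "\<omega>0 \<in> U" "\<forall>x. holomorphic_several_on (\<lambda>\<omega>. T \<omega> x) U"
    "\<forall>l\<in>D. \<forall>\<omega>\<in>l - {0}. \<omega> \<in> U \<longrightarrow> T \<omega> \<in> tensor_power d (perp G l) \<and> s l \<omega> = tensor_coset d (perp G l) l (T \<omega>)"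
    by (elim exE conjE)
  have "T \<omega> \<in> tensor_power d (perp G (line \<omega>)) \<and> s (line \<omega>) \<omega> = tensor_coset d (perp G (line \<omega>)) (line \<omega>) (T \<omega>)"
    if "over_D \<omega>" "\<omega> \<in> U" for \<omega>
  proof -
    have "line \<omega> \<in> D" "\<omega> \<in> line \<omega> - {0}" using that by (auto simp: over_D_def)
    then show ?thesis using UT(4) that(2) by blast
  qed
  then show ?thesis using that[OF UT(1,2)] UT(3) by blast
qed

text \<open>The value of the section at \<open>\<omega>\<close>, contracted with vectors of \<open>\<omega>\<^sup>\<bottom>\<close>; this does not depend on
  the representative of the coset.\<close>

definition F :: "complex ^ 'm \<Rightarrow> (nat \<Rightarrow> complex ^ 'm) \<Rightarrow> complex" where
  "F \<omega> u = pairing d A (SOME T. T \<in> s (line \<omega>) \<omega>) u"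

definition perp_args :: "complex ^ 'm \<Rightarrow> (nat \<Rightarrow> complex ^ 'm) \<Rightarrow> bool" where
  "perp_args \<omega> u \<longleftrightarrow> (\<forall>p<d. C \<omega> (u p) = 0)"

lemma F_coset:
  assumes e: "s (line \<omega>) \<omega> = tensor_coset d (perp G (line \<omega>)) (line \<omega>) T0"
    and T: "T \<in> s (line \<omega>) \<omega>" and u: "perp_args \<omega> u"
  shows "F \<omega> u = pairing d A T u"
proof -
  have z: "pairing d A N u = 0" if "N \<in> tensor_null d (perp G (line \<omega>)) (line \<omega>)" for N
    using that by (rule pairing_null) (use u in \<open>auto simp: line_eq bil_scale_left perp_args_def\<close>)
  have "pairing d A X u = pairing d A T0 u" if "X \<in> s (line \<omega>) \<omega>" for X
    using that z unfolding e tensor_coset_def by (auto simp: pairing_add)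
  moreover have "(SOME T. T \<in> s (line \<omega>) \<omega>) \<in> s (line \<omega>) \<omega>" by (rule someI[of "\<lambda>T. T \<in> s (line \<omega>) \<omega>", OF T])
  ultimately show ?thesis using T by (simp add: F_def)
qed

lemma F_mem:
  assumes \<omega>: "over_D \<omega>" and T: "T \<in> s (line \<omega>) \<omega>" and u: "perp_args \<omega> u"
  shows "F \<omega> u = pairing d A T u"
proof -
  obtain T' where "s (line \<omega>) \<omega> = tensor_coset d (perp G (line \<omega>)) (line \<omega>) (young_c lam T')"
    by (rule section_fibre[OF \<omega>])
  from F_coset[OF this T u] show ?thesis .
qed

lemma F_lift:
  assumes "over_D \<omega>" "s (line \<omega>) \<omega> = tensor_coset d (perp G (line \<omega>)) (line \<omega>) T" "perp_args \<omega> u"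
  shows "F \<omega> u = pairing d A T u"
proof (rule F_coset[OF assms(2) _ assms(3)])
  show "T \<in> s (line \<omega>) \<omega>" unfolding assms(2) by (rule tensor_coset_mem)
qed

lemma representative:
  assumes "over_D \<omega>"
  obtains T where "T \<in> tensor_power d (perp G (line \<omega>))" "s (line \<omega>) \<omega> = tensor_coset d (perp G (line \<omega>)) (line \<omega>) T"
  by (rule local_lift[OF assms]) (use assms that in blast)

lemma F_scale_slots:
  assumes "over_D \<omega>" "perp_args \<omega> u"
  shows "F \<omega> (\<lambda>p. r p *s u p) = (\<Prod>p<d. r p) * F \<omega> u"
proof -
  obtain T where T: "s (line \<omega>) \<omega> = tensor_coset d (perp G (line \<omega>)) (line \<omega>) T" using representative[OF assms(1)] by metis
  have "perp_args \<omega> (\<lambda>p. r p *s u p)" using assms(2) by (simp add: perp_args_def bil_scale_right)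
  then show ?thesis using F_lift[OF assms(1) T] assms(2) by (simp add: pairing_scale_slots)
qed

text \<open>Vectors of \<open>\<omega>\<^sup>\<bottom>\<close> that differ by multiples of \<open>\<omega>\<close> give the same functional on \<open>\<omega>\<^sup>\<bottom>\<close>.\<close>

lemma F_cong_line:
  assumes "over_D \<omega>" "perp_args \<omega> u" "perp_args \<omega> u'" "\<And>p. p < d \<Longrightarrow> \<exists>t. u p = u' p + t *s \<omega>"
  shows "F \<omega> u = F \<omega> u'"
proof -
  obtain T where T: "T \<in> tensor_power d (perp G (line \<omega>))" "s (line \<omega>) \<omega> = tensor_coset d (perp G (line \<omega>)) (line \<omega>) T"
    using representative[OF assms(1)] by metis
  have "pairing d A T u = pairing d A T u'"
  proof (rule pairing_eq_if_bil_eq[OF T(1)])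
    fix p w assume p: "p < d" and w: "w \<in> perp G (line \<omega>)"
    obtain t where t: "u p = u' p + t *s \<omega>" using assms(4)[OF p] by blast
    show "C w (u p) = C w (u' p)" using w by (simp add: t perp_line bil_add_right bil_scale_right)
  qed
  then show ?thesis using F_lift[OF assms(1) T(2)] assms by simp
qed

lemma F_cong: "(\<And>p. p < d \<Longrightarrow> u p = u' p) \<Longrightarrow> F \<omega> u = F \<omega> u'"
  unfolding F_def by (rule pairing_cong)

lemma F_homogeneous:
  assumes \<omega>: "over_D \<omega>" and t: "t \<noteq> 0" and u: "perp_args \<omega> u"
  shows "F (t *s \<omega>) u = t powi (- k) * F \<omega> u"
proof -
  obtain T where T: "s (line \<omega>) \<omega> = tensor_coset d (perp G (line \<omega>)) (line \<omega>) T" using representative[OF \<omega>] by metis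
  have Tm: "T \<in> s (line \<omega>) \<omega>" unfolding T by (rule tensor_coset_mem)
  have "tscale (t powi (- k)) T \<in> s (line (t *s \<omega>)) (t *s \<omega>)"
    unfolding line_scale[OF t] section_homogeneous[OF \<omega> t] using Tm by blast
  moreover have "over_D (t *s \<omega>)" using \<omega> t by (simp add: over_D_scale)
  moreover have "perp_args (t *s \<omega>) u" using u by (simp add: perp_args_def bil_scale_left)
  ultimately have "F (t *s \<omega>) u = pairing d A (tscale (t powi (- k)) T) u" using F_mem by blast
  then show ?thesis using F_lift[OF \<omega> T u] by (simp add: pairing_tscale)
qed

lemma Gamma_O: "g \<in> \<Gamma> \<Longrightarrow> g \<in> carrier (O_plus G D)"
  using subgroup.subset[OF sg] by blast

lemma F_equivariant:
  assumes \<omega>: "over_D \<omega>" and g: "g \<in> \<Gamma>" and u: "perp_args \<omega> u"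
  shows "F (act g \<omega>) (\<lambda>p. act g (u p)) = F \<omega> u"
proof -
  note gO = O_plus_over_D[OF Gamma_O[OF g] \<omega>]
  obtain T where T: "s (line \<omega>) \<omega> = tensor_coset d (perp G (line \<omega>)) (line \<omega>) T" using representative[OF \<omega>] by metis
  have Tm: "T \<in> s (line \<omega>) \<omega>" unfolding T by (rule tensor_coset_mem)
  have "tensor_map (map_matrix of_int g) T \<in> s (line (act g \<omega>)) (act g \<omega>)"
    unfolding section_equivariant[OF \<omega> g] using Tm by blast
  moreover have "perp_args (act g \<omega>) (\<lambda>p. act g (u p))" using u by (simp add: perp_args_def O_isometry[OF gO(1)])
  ultimately have "F (act g \<omega>) (\<lambda>p. act g (u p)) = pairing d A (tensor_map (map_matrix of_int g) T) (\<lambda>p. act g (u p))"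
    using F_mem[OF gO(2)] by blast
  also have "\<dots> = pairing d A T u"
    unfolding act_def
  proof (rule pairing_tensor_map)
    have "map_matrix of_int (transpose g ** G ** g) = cpx_gram G" by (simp only: O_lattice_gram[OF gO(1)])
    then show "transpose (map_matrix complex_of_int g) ** A ** map_matrix complex_of_int g = A"
      by (simp only: map_matrix_of_int_mult map_matrix_of_int_transpose)
  qed
  finally show ?thesis using F_lift[OF \<omega> T u] by simp
qed

lemma holomorphic_several_imp_isCont:
  assumes "holomorphic_several_on f U" "x \<in> U"
  shows "isCont f x"
proof -
  obtain f' where "(f has_derivative f') (at x)" using assms unfolding holomorphic_several_on_def by blast
  then show ?thesis by (rule has_derivative_continuous)
qed

lemma F_tendsto:
  assumes \<omega>: "over_D \<omega>" and u: "perp_args \<omega> u"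
    and w: "(w \<longlongrightarrow> \<omega>) sequentially" and v: "\<And>p. p < d \<Longrightarrow> ((\<lambda>N. v N p) \<longlongrightarrow> u p) sequentially"
    and ev: "eventually (\<lambda>N. over_D (w N) \<and> perp_args (w N) (v N)) sequentially"
  shows "(\<lambda>N. F (w N) (v N)) \<longlonglongrightarrow> F \<omega> u"
proof -
  obtain U T where U: "open U" "\<omega> \<in> U" "\<And>x. holomorphic_several_on (\<lambda>\<omega>. T \<omega> x) U"
    "\<And>\<omega>. over_D \<omega> \<Longrightarrow> \<omega> \<in> U \<Longrightarrow> s (line \<omega>) \<omega> = tensor_coset d (perp G (line \<omega>)) (line \<omega>) (T \<omega>)"
    using local_lift[OF \<omega>] by metis
  have "eventually (\<lambda>N. w N \<in> U) sequentially" using w U(1,2) by (rule topological_tendstoD)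
  then have evl: "eventually (\<lambda>N. pairing d A (T (w N)) (v N) = F (w N) (v N)) sequentially"
    using ev by eventually_elim (use F_lift U(4) in auto)
  have lim: "(\<lambda>N. pairing d A (T (w N)) (v N)) \<longlonglongrightarrow> pairing d A (T \<omega>) u"
    by (rule tendsto_pairing)
       (auto intro!: isCont_tendsto_compose[OF holomorphic_several_imp_isCont[OF U(3) U(2)] w] v)
  have e: "pairing d A (T \<omega>) u = F \<omega> u" using F_lift[OF \<omega> U(4)[OF \<omega> U(2)] u] by simp
  show ?thesis using Lim_transform_eventually[OF lim evl] unfolding e .
qed

lemma disc_over_D:
  assumes f: "frame a b c" and D0: "over_D (fr a b)" and z: "cmod z < 1"
  shows "over_D (disc_curve a b c z)"
  using over_D_disc[OF f z, of 0] D0 by (simp add: disc_curve_def)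

definition orth_to :: "real ^ 'm \<Rightarrow> real ^ 'm \<Rightarrow> real ^ 'm \<Rightarrow> (nat \<Rightarrow> real ^ 'm) \<Rightarrow> bool" where
  "orth_to a b c y \<longleftrightarrow> (\<forall>p. B (y p) a = 0 \<and> B (y p) b = 0 \<and> B (y p) c = 0)"

lemma perp_args_disc:
  assumes f: "frame a b c" and y: "orth_to a b c y"
  shows "perp_args (disc_curve a b c z) (slots S (disc_vec a b c z) y)"
  using disc_perp[OF f] y by (simp add: perp_args_def slots_def orth_to_def)

lemma perp_args_fr:
  assumes f: "frame a b c" and y: "orth_to a b c y"
  shows "perp_args (fr a b) (slots S (cvec c) y)"
  using perp_args_disc[OF f y, of 0 S] by (simp add: disc_curve_def disc_vec_def)

text \<open>Locally, a holomorphic lift of the section is paired with arguments polynomial in the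
  coordinate.\<close>

lemma F_disc_holomorphic:
  assumes f: "frame a b c" and D0: "over_D (fr a b)" and y: "orth_to a b c y"
  shows "(\<lambda>z. F (disc_curve a b c z) (slots S (disc_vec a b c z) y)) holomorphic_on ball 0 1"
  unfolding holomorphic_on_def
proof
  fix z0 :: complex assume "z0 \<in> ball 0 1"
  then have z0: "cmod z0 < 1" by simp
  obtain U T where U: "open U" "disc_curve a b c z0 \<in> U" "\<And>x. holomorphic_several_on (\<lambda>\<omega>. T \<omega> x) U"
    "\<And>\<omega>. over_D \<omega> \<Longrightarrow> \<omega> \<in> U \<Longrightarrow> s (line \<omega>) \<omega> = tensor_coset d (perp G (line \<omega>)) (line \<omega>) (T \<omega>)"
    using local_lift[OF disc_over_D[OF f D0 z0]] by metis
  define V where "V = ball 0 1 \<inter> disc_curve a b c -` U"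
  have cont: "continuous_on UNIV (disc_curve a b c)"
    unfolding disc_curve_def[abs_def] by (intro continuous_intros)
  have oV: "open V" unfolding V_def by (intro open_Int open_ball open_vimage U cont)
  have zV: "z0 \<in> V" using z0 U(2) by (simp add: V_def)
  have T: "(\<lambda>z. T (disc_curve a b c z) x) holomorphic_on V" for x
    unfolding holomorphic_on_def
  proof
    fix z assume z: "z \<in> V"
    let ?w = "2 *s cvec c + (2 * z) *s frc a b"
    obtain f' where f': "((\<lambda>\<omega>. T \<omega> x) has_derivative f') (at (disc_curve a b c z))" "\<And>r v. f' (r *s v) = r * f' v"
      using U(3)[of x] z unfolding holomorphic_several_on_def V_def by blast
    have "((\<lambda>z. T (disc_curve a b c z) x) has_derivative (\<lambda>h. f' (h *s ?w))) (at z)"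
      by (rule has_derivative_compose[OF disc_has_derivative f'(1)])
    moreover have "(\<lambda>h. f' (h *s ?w)) = (*) (f' ?w)" by (rule ext) (simp only: f'(2) mult.commute)
    ultimately have "((\<lambda>z. T (disc_curve a b c z) x) has_field_derivative f' ?w) (at z)"
      by (simp only: has_field_derivative_def)
    then show "(\<lambda>z. T (disc_curve a b c z) x) field_differentiable at z within V"
      by (metis field_differentiable_at_within field_differentiable_def)
  qed
  have sl: "(\<lambda>z. slots S (disc_vec a b c z) y p $ i) holomorphic_on V" for p i
    by (cases "p \<in> S") (auto simp: slots_def disc_vec_def intro!: holomorphic_intros)
  have "(\<lambda>z. pairing d A (T (disc_curve a b c z)) (slots S (disc_vec a b c z) y)) holomorphic_on V"
    by (rule holomorphic_on_pairing[OF T sl])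
  moreover have "pairing d A (T (disc_curve a b c z)) (slots S (disc_vec a b c z) y) = F (disc_curve a b c z) (slots S (disc_vec a b c z) y)" if "z \<in> V" for z
  proof -
    have z: "cmod z < 1" "disc_curve a b c z \<in> U" using that by (auto simp: V_def)
    note o = disc_over_D[OF f D0 z(1)]
    show ?thesis using F_lift[OF o U(4)[OF o z(2)] perp_args_disc[OF f y]] by simp
  qed
  ultimately have "(\<lambda>z. F (disc_curve a b c z) (slots S (disc_vec a b c z) y)) holomorphic_on V"
    by (rule holomorphic_transform)
  then have "(\<lambda>z. F (disc_curve a b c z) (slots S (disc_vec a b c z) y)) field_differentiable at z0"
    using oV zV by (rule holomorphic_on_imp_differentiable_at)
  then show "(\<lambda>z. F (disc_curve a b c z) (slots S (disc_vec a b c z) y)) field_differentiable at z0 within ball 0 1"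
    by (rule field_differentiable_at_within)
qed

text \<open>Homogeneity produces the factor, and the holomorphic third vector may be replaced by the real one
  because they agree modulo the point.\<close>

lemma F_disc_move:
  assumes f: "frame a b c" and D0: "over_D (fr a b)" and y: "orth_to a b c y" and z: "cmod z < 1"
  shows "F (disc_curve a b c z) (slots S (disc_vec a b c z) y)
    = of_real (1 - (cmod z)\<^sup>2) powi (- k) * F (fr (move_a a b c z) (move_b a b c z)) (slots S (cvec (move_c a b c z)) y)"
    and "orth_to (move_a a b c z) (move_b a b c z) (move_c a b c z) y"
proof -
  let ?r = "complex_of_real (1 - (cmod z)\<^sup>2)"
  have r: "?r \<noteq> 0" using one_minus_norm_pos[OF z] by (metis less_irrefl of_real_eq_0_iff)
  note fm = frame_move[OF f z]
  show y': "orth_to (move_a a b c z) (move_b a b c z) (move_c a b c z) y"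
    using y by (simp add: orth_to_def move_a_def move_b_def move_c_def bil_scaleR_right bil_add_right)
  have D1: "over_D (fr (move_a a b c z) (move_b a b c z))" using over_D_move[OF f z] D0 by simp
  have pa: "perp_args (fr (move_a a b c z) (move_b a b c z)) (slots S (cvec (move_c a b c z)) y)"
    by (rule perp_args_fr[OF fm y'])
  then have pa': "perp_args (disc_curve a b c z) (slots S (cvec (move_c a b c z)) y)"
    unfolding disc_curve_eq[OF z] perp_args_def bil_scale_left by simp
  have "F (disc_curve a b c z) (slots S (disc_vec a b c z) y) = F (disc_curve a b c z) (slots S (cvec (move_c a b c z)) y)"
  proof (rule F_cong_line[symmetric, OF disc_over_D[OF f D0 z] pa' perp_args_disc[OF f y]])
    fix p
    show "\<exists>t. slots S (cvec (move_c a b c z)) y p = slots S (disc_vec a b c z) y p + t *s disc_curve a b c z"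
    proof (cases "p \<in> S")
      case True
      then show ?thesis using move_c_eq[OF z, of a b c] by (auto simp: slots_def)
    next
      case False
      then show ?thesis by (intro exI[of _ 0]) (simp add: slots_def)
    qed
  qed
  also have "\<dots> = ?r powi (- k) * F (fr (move_a a b c z) (move_b a b c z)) (slots S (cvec (move_c a b c z)) y)"
    unfolding disc_curve_eq[OF z] by (rule F_homogeneous[OF D1 r pa])
  finally show "F (disc_curve a b c z) (slots S (disc_vec a b c z) y)
    = ?r powi (- k) * F (fr (move_a a b c z) (move_b a b c z)) (slots S (cvec (move_c a b c z)) y)" .
qed

text \<open>The pairings with the negative basis are the coordinates of the fibre.\<close>

lemma section_zero_at:
  assumes D0: "over_D (fr a b)" and pf: "pos_frame a b" and c: "neg_basis a b c"
    and van: "\<And>I. (\<forall>p<d. I p < n) \<Longrightarrow> F (fr a b) (\<lambda>p. cvec (c (I p))) = 0"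
  shows "s (line (fr a b)) (fr a b) = tensor_null d (perp G (line (fr a b))) (line (fr a b))"
proof -
  let ?w = "fr a b"
  obtain T where T: "T \<in> tensor_power d (perp G (line ?w))" "s (line ?w) ?w = tensor_coset d (perp G (line ?w)) (line ?w) T"
    using representative[OF D0] by metis
  have cw: "C (cvec (c k)) ?w = 0" "C ?w (cvec (c k)) = 0" if "k < n" for k
    using c that C_commute[of ?w "cvec (c k)"] by (simp_all add: neg_basis_def C_fr_cvec)
  have "T \<in> tensor_null d (perp G (line ?w)) (line ?w)"
  proof (rule tensor_null_if_pairings_vanish[OF T(1) subspace_perp line_subset_perp[OF D0], where A = A and n = n and c = "\<lambda>k. cvec (c k)"])
    show "cvec (c k) \<in> perp G (line ?w)" if "k < n" for k using cw(1)[OF that] by (simp add: perp_line)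
    show "w + (\<Sum>k<n. C w (cvec (c k)) *s cvec (c k)) \<in> line ?w" if "w \<in> perp G (line ?w)" for w
    proof -
      have "C w ?w = 0" using that by (simp only: perp_line)
      then show ?thesis unfolding perp_expand[OF pf c \<open>C w ?w = 0\<close>] line_eq by blast
    qed
    show "pairing d A T (\<lambda>p. cvec (c (I p))) = 0" if I: "\<forall>p<d. I p < n" for I
    proof -
      have "perp_args ?w (\<lambda>p. cvec (c (I p)))" using cw(2) I by (simp add: perp_args_def)
      then show ?thesis using F_lift[OF D0 T(2)] van[OF I] by simp
    qed
  qed
  then show ?thesis unfolding T(2) by (rule tensor_coset_null)
qed

end

section \<open>The maximum principle\<close>

lemma tendsto_fr [tendsto_intros]:
  assumes "(f \<longlongrightarrow> a) F" "(g \<longlongrightarrow> b) F"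
  shows "((\<lambda>x. fr (f x) (g x)) \<longlongrightarrow> fr a b) F"
  unfolding fr_def by (intro tendsto_intros assms)

lemma tendsto_slots:
  assumes "(f \<longlongrightarrow> a) F" "\<And>p. ((\<lambda>x. g x p) \<longlongrightarrow> y p) F"
  shows "((\<lambda>x. slots S (cvec (f x)) (g x) p) \<longlongrightarrow> slots S (cvec a) y p) F"
  unfolding slots_def using assms by (cases "p \<in> S") (auto intro: tendsto_cvec)

context type_IV
begin

lemma tendsto_B: "(f \<longlongrightarrow> a) F \<Longrightarrow> (g \<longlongrightarrow> b) F \<Longrightarrow> ((\<lambda>x. B (f x) (g x)) \<longlongrightarrow> B a b) F"
  by (rule tendsto_bil)

lemma frame_limit:
  assumes "f \<longlonglongrightarrow> a" "g \<longlonglongrightarrow> b" "h \<longlonglongrightarrow> c" and fr: "\<And>N. frame (f N) (g N) (h N)"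
  shows "frame a b c"
proof -
  have lim: "B x y = r" if "u \<longlonglongrightarrow> x" "v \<longlonglongrightarrow> y" "\<And>N. B (u N) (v N) = r" for u v x y r
    using LIMSEQ_unique[OF tendsto_B[OF that(1,2)]] that(3) by simp
  show ?thesis
    unfolding frame_def pos_frame_def
    by (intro conjI lim[OF assms(1,1)] lim[OF assms(2,2)] lim[OF assms(1,2)] lim[OF assms(3,1)] lim[OF assms(3,2)] lim[OF assms(3,3)] frame_values[OF fr])
qed

lemma over_D_limit:
  assumes lim: "f \<longlonglongrightarrow> a" "g \<longlonglongrightarrow> b" and pf: "pos_frame a b" "eventually (\<lambda>N. pos_frame (f N) (g N)) sequentially"
  shows "eventually (\<lambda>N. over_D (fr (f N) (g N)) \<longleftrightarrow> over_D (fr a b)) sequentially"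
proof -
  obtain \<epsilon> where \<epsilon>: "\<epsilon> > 0" "\<And>a' b'. pos_frame a' b' \<Longrightarrow> dist (a', b') (a, b) < \<epsilon> \<Longrightarrow> over_D (fr a' b') \<longleftrightarrow> over_D (fr a b)"
    using over_D_near[OF pf(1)] by metis
  have "eventually (\<lambda>N. dist (f N, g N) (a, b) < \<epsilon>) sequentially"
    by (rule tendstoD[OF tendsto_Pair[OF lim] \<epsilon>(1)])
  then show ?thesis using pf(2) by eventually_elim (rule \<epsilon>(2))
qed

text \<open>The condition \<open>over_D\<close> is closed on frames by \<open>over_D_near\<close>.\<close>

lemma compact_frames:
  "compact {(a, b, c). frame a b c \<and> {a, b, c} \<subseteq> W x y z \<and> over_D (fr a b) \<and> norm a \<le> K \<and> norm b \<le> K \<and> norm c \<le> K}"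
    (is "compact ?S")
  unfolding compact_eq_bounded_closed
proof
  have "?S \<subseteq> cball 0 K \<times> cball 0 K \<times> cball 0 K" by auto
  then show "bounded ?S" by (rule bounded_subset[rotated]) (intro bounded_Times bounded_cball)
  show "closed ?S"
    unfolding closed_sequential_limits
  proof (intro allI impI)
    fix q l assume q: "(\<forall>n. q n \<in> ?S) \<and> q \<longlonglongrightarrow> l"
    obtain a b c where l: "l = (a, b, c)" by (cases l)
    define f g h where "f N = fst (q N)" and "g N = fst (snd (q N))" and "h N = snd (snd (q N))" for N
    have lim: "f \<longlonglongrightarrow> a" "g \<longlonglongrightarrow> b" "h \<longlonglongrightarrow> c"
      unfolding f_def g_def h_def using q l
      by (auto intro: tendsto_eq_intros)
    have qs: "frame (f N) (g N) (h N)" "{f N, g N, h N} \<subseteq> W x y z" "over_D (fr (f N) (g N))"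
      "norm (f N) \<le> K" "norm (g N) \<le> K" "norm (h N) \<le> K" for N
    proof -
      have "q N \<in> ?S" "q N = (f N, g N, h N)" using q by (simp_all add: f_def g_def h_def)
      then show "frame (f N) (g N) (h N)" "{f N, g N, h N} \<subseteq> W x y z" "over_D (fr (f N) (g N))"
        "norm (f N) \<le> K" "norm (g N) \<le> K" "norm (h N) \<le> K" by auto
    qed
    have fr: "frame a b c" by (rule frame_limit[OF lim qs(1)])
    have cl: "closed (W x y z)" unfolding W_def by (rule closed_subspace[OF subspace_span])
    have "{a, b, c} \<subseteq> W x y z"
      using closed_sequentially[OF cl _ lim(1)] closed_sequentially[OF cl _ lim(2)] closed_sequentially[OF cl _ lim(3)] qs(2) by auto
    moreover have "over_D (fr a b)"
    proof -
      have "eventually (\<lambda>N. over_D (fr (f N) (g N)) \<longleftrightarrow> over_D (fr a b)) sequentially"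
        by (rule over_D_limit[OF lim(1,2)]) (use fr qs(1) in \<open>auto simp: frame_def\<close>)
      then have "eventually (\<lambda>N::nat. over_D (fr a b)) sequentially" using qs(3) by simp
      then show ?thesis by simp
    qed
    moreover have "norm a \<le> K" "norm b \<le> K" "norm c \<le> K"
      using Lim_bounded[OF tendsto_norm[OF lim(1)], of 0 K] Lim_bounded[OF tendsto_norm[OF lim(2)], of 0 K] Lim_bounded[OF tendsto_norm[OF lim(3)], of 0 K] qs
      by auto
    ultimately show "l \<in> ?S" using fr l by simp
  qed
qed

lemma move_W:
  assumes "{a, b, c} \<subseteq> W x y z"
  shows "{move_a a b c t, move_b a b c t, move_c a b c t} \<subseteq> W x y z"
proof -
  have s: "a \<in> span {rvec x, rvec y, rvec z}" "b \<in> span {rvec x, rvec y, rvec z}" "c \<in> span {rvec x, rvec y, rvec z}"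
    using assms by (auto simp: W_def)
  show ?thesis
    unfolding W_def move_a_def move_b_def move_c_def
    by (intro insert_subsetI empty_subsetI span_add span_scale s)
qed

end

context modular_section
begin

text \<open>Replacing \<open>c\<close> by \<open>- c\<close> changes \<open>F\<close> by a sign, which is the price for the sign left open in
  \<open>frame_on_disc\<close>.\<close>

lemma F_neg:
  assumes "frame a b c" "over_D (fr a b)" "orth_to a b c y"
  shows "cmod (F (fr a b) (slots S (cvec (- c)) y)) = cmod (F (fr a b) (slots S (cvec c) y))"
proof -
  have "F (fr a b) (slots S (cvec (- c)) y) = F (fr a b) (\<lambda>p. (if p \<in> S then - 1 else 1) *s slots S (cvec c) y p)"
    by (rule F_cong) (simp add: slots_def cvec_minus vec_eq_iff)
  also have "\<dots> = (\<Prod>p<d. if p \<in> S then - 1 else 1) * F (fr a b) (slots S (cvec c) y)"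
    by (rule F_scale_slots[OF assms(2) perp_args_fr[OF assms(1,3)]])
  also have "cmod \<dots> = (\<Prod>p<d. 1) * cmod (F (fr a b) (slots S (cvec c) y))"
    unfolding norm_mult prod_norm[symmetric] by (simp add: if_distrib cong: if_cong)
  finally show ?thesis by simp
qed

text \<open>The maximum principle on the disc of an anisotropic sublattice.  The absolute value of \<open>F\<close> is a
  continuous function on the frames of its span, invariant under a part of \<open>\<Gamma>\<close> with compact quotient, so
  it has a maximum.  For \<open>k < 0\<close> the disc is centred at a maximal frame; for \<open>k = 0\<close> it is centred at
  the given one, and a maximal frame appears at some point \<open>z1\<close> of it.\<close>

lemma F_rational:
  assumes an: "anisotropic_triple x y z" and nz: "gramdet G x y z \<noteq> 0"
    and f: "frame a b c" and sub: "{a, b, c} \<subseteq> W x y z" and D0: "over_D (fr a b)" and v: "\<And>p. perpW x y z (v p)"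
  shows "k < 0 \<Longrightarrow> F (fr a b) (slots S (cvec c) v) = 0"
    and "k = 0 \<Longrightarrow> cmod t < 1 \<Longrightarrow>
      F (fr (move_a a b c t) (move_b a b c t)) (slots S (cvec (move_c a b c t)) v) = F (fr a b) (slots S (cvec c) v)"
proof -
  define X where "X = {(a, b, c). frame a b c \<and> {a, b, c} \<subseteq> W x y z \<and> over_D (fr a b)}"
  define H where "H = (\<lambda>(a, b, c). cmod (F (fr a b) (slots S (cvec c) v)))"
  have orth: "orth_to a b c v" if "(a, b, c) \<in> X" for a b c
    using v that by (auto simp: perpW_iff orth_to_def X_def)
  obtain K where K: "\<And>a b c. (a, b, c) \<in> X \<Longrightarrow> \<exists>g\<in>\<Gamma>. norm (ract g a) \<le> K \<and> norm (ract g b) \<le> K \<and> norm (ract g c) \<le> K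
      \<and> {ract g a, ract g b, ract g c} \<subseteq> W x y z \<and> (\<forall>v. perpW x y z v \<longrightarrow> ract g v = v)"
    using compact_quotient[OF an nz sg fin] unfolding X_def by blast
  define S0 where "S0 = {(a, b, c). frame a b c \<and> {a, b, c} \<subseteq> W x y z \<and> over_D (fr a b) \<and> norm a \<le> K \<and> norm b \<le> K \<and> norm c \<le> K}"
  have move: "\<exists>\<psi>\<in>S0. H \<psi> = H \<phi>" if \<phi>X: "\<phi> \<in> X" for \<phi>
  proof -
    obtain a b c where \<phi>: "\<phi> = (a, b, c)" by (cases \<phi>)
    have X: "(a, b, c) \<in> X" using \<phi>X \<phi> by simp
    then have fr: "frame a b c" and o: "over_D (fr a b)" by (auto simp: X_def)
    obtain g where g: "g \<in> \<Gamma>" "norm (ract g a) \<le> K \<and> norm (ract g b) \<le> K \<and> norm (ract g c) \<le> K"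
      "{ract g a, ract g b, ract g c} \<subseteq> W x y z" "\<forall>v. perpW x y z v \<longrightarrow> ract g v = v" using K[OF X] by blast
    note gO = O_plus_over_D[OF Gamma_O[OF g(1)] o]
    have "F (act g (fr a b)) (\<lambda>p. act g (slots S (cvec c) v p)) = F (fr a b) (slots S (cvec c) v)"
      by (rule F_equivariant[OF o g(1) perp_args_fr[OF fr orth[OF X]]])
    moreover have "(\<lambda>p. act g (slots S (cvec c) v p)) = slots S (cvec (ract g c)) v"
      using g(4) v by (auto simp: slots_def fun_eq_iff act_cvec)
    ultimately have "H (ract g a, ract g b, ract g c) = H \<phi>" by (simp add: H_def \<phi> act_fr)
    moreover have "(ract g a, ract g b, ract g c) \<in> S0"
      using frame_ract[OF gO(1) fr] g(2,3) gO(2) by (simp add: S0_def act_fr)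
    ultimately show ?thesis by blast
  qed
  have abc: "(a, b, c) \<in> X" using f sub D0 by (simp add: X_def)
  then have "S0 \<noteq> {}" using move by blast
  have comp: "compact S0" unfolding S0_def by (rule compact_frames)
  have S0X: "\<phi> \<in> X" if "\<phi> \<in> S0" for \<phi> using that by (auto simp: S0_def X_def)
  have cont: "continuous_on S0 H"
    unfolding continuous_on_sequentially
  proof (intro allI ballI impI)
    fix q l assume l0: "l \<in> S0" and q: "(\<forall>n. q n \<in> S0) \<and> q \<longlonglongrightarrow> l"
    obtain a b c where l: "l = (a, b, c)" by (cases l)
    define f g h where "f N = fst (q N)" and "g N = fst (snd (q N))" and "h N = snd (snd (q N))" for N
    have qe: "q N = (f N, g N, h N)" for N by (simp add: f_def g_def h_def)
    have lim: "f \<longlonglongrightarrow> a" "g \<longlonglongrightarrow> b" "h \<longlonglongrightarrow> c"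
      unfolding f_def g_def h_def using q l by (auto intro: tendsto_eq_intros)
    have qX: "(f N, g N, h N) \<in> X" for N using q S0X qe by metis
    have lX: "(a, b, c) \<in> X" using l0 S0X l by simp
    have "(\<lambda>N. F (fr (f N) (g N)) (slots S (cvec (h N)) v)) \<longlonglongrightarrow> F (fr a b) (slots S (cvec c) v)"
    proof (rule F_tendsto)
      show "over_D (fr a b)" "perp_args (fr a b) (slots S (cvec c) v)"
        using lX perp_args_fr[OF _ orth[OF lX]] by (auto simp: X_def)
      show "(\<lambda>N. fr (f N) (g N)) \<longlonglongrightarrow> fr a b" by (intro tendsto_intros lim)
      show "(\<lambda>N. slots S (cvec (h N)) v p) \<longlonglongrightarrow> slots S (cvec c) v p" for p
        by (intro tendsto_slots lim tendsto_const)
      show "eventually (\<lambda>N. over_D (fr (f N) (g N)) \<and> perp_args (fr (f N) (g N)) (slots S (cvec (h N)) v)) sequentially"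
        using qX perp_args_fr[OF _ orth[OF qX]] by (intro always_eventually) (auto simp: X_def)
    qed
    then have "(\<lambda>N. cmod (F (fr (f N) (g N)) (slots S (cvec (h N)) v))) \<longlonglongrightarrow> cmod (F (fr a b) (slots S (cvec c) v))"
      by (rule tendsto_norm)
    then show "(H \<circ> q) \<longlonglongrightarrow> H l" by (simp add: H_def comp_def qe l)
  qed
  obtain \<psi> where \<psi>: "\<psi> \<in> S0" "\<And>\<phi>. \<phi> \<in> S0 \<Longrightarrow> H \<phi> \<le> H \<psi>"
    using continuous_attains_sup[OF comp \<open>S0 \<noteq> {}\<close> cont] by blast
  obtain a1 b1 c1 where \<psi>e: "\<psi> = (a1, b1, c1)" by (cases \<psi>)
  have \<psi>X: "(a1, b1, c1) \<in> X" using S0X[OF \<psi>(1)] \<psi>e by simp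
  define M where "M = H (a1, b1, c1)"
  have max: "H \<phi> \<le> M" if \<phi>X: "\<phi> \<in> X" for \<phi>
  proof -
    obtain \<chi>' where c: "\<chi>' \<in> S0" "H \<chi>' = H \<phi>" using move[OF \<phi>X] by (rule bexE)
    show ?thesis using \<psi>(2)[OF c(1)] unfolding c(2) \<psi>e M_def .
  qed
  have M0: "M \<ge> 0" by (simp add: M_def H_def)
  have moveX: "(move_a a b c t, move_b a b c t, move_c a b c t) \<in> X" if "(a, b, c) \<in> X" "cmod t < 1" for a b c t
    using that frame_move over_D_move move_W[of a b c x y z t] by (simp add: X_def)
  define \<Phi> where "\<Phi> a b c t = F (disc_curve a b c t) (slots S (disc_vec a b c t) v)" for a b c t
  have \<Phi>_move: "\<Phi> a b c t = of_real (1 - (cmod t)\<^sup>2) powi (- k) * F (fr (move_a a b c t) (move_b a b c t)) (slots S (cvec (move_c a b c t)) v)"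
    if "(a, b, c) \<in> X" "cmod t < 1" for a b c t
    unfolding \<Phi>_def using that by (intro F_disc_move(1) orth) (auto simp: X_def)
  have \<Phi>_hol: "\<Phi> a b c holomorphic_on ball 0 1" if "(a, b, c) \<in> X" for a b c
    unfolding \<Phi>_def[abs_def] using that by (intro F_disc_holomorphic orth) (auto simp: X_def)
  have \<Phi>_bound: "cmod (\<Phi> a b c t) \<le> (1 - (cmod t)\<^sup>2) powi (- k) * M" if "(a, b, c) \<in> X" "cmod t < 1" for a b c t
  proof -
    have r: "1 - (cmod t)\<^sup>2 > 0" by (rule one_minus_norm_pos[OF that(2)])
    have "cmod (\<Phi> a b c t) = \<bar>1 - (cmod t)\<^sup>2\<bar> powi (- k) * H (move_a a b c t, move_b a b c t, move_c a b c t)"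
      unfolding \<Phi>_move[OF that] norm_mult norm_power_int norm_of_real by (simp add: H_def)
    also have "\<dots> \<le> (1 - (cmod t)\<^sup>2) powi (- k) * M"
      unfolding abs_of_pos[OF r] using r by (intro mult_left_mono max moveX that) (simp add: zero_le_power_int)
    finally show ?thesis .
  qed
  have \<Phi>0: "\<Phi> a b c 0 = F (fr a b) (slots S (cvec c) v)" for a b c
    by (simp add: \<Phi>_def disc_curve_def disc_vec_def)
  show "F (fr a b) (slots S (cvec c) v) = 0" if k: "k < 0"
  proof -
    have sub: "cball 0 (1 / 2) \<subseteq> ball (0 :: complex) 1" by auto
    have hol: "\<Phi> a1 b1 c1 holomorphic_on cball 0 (1 / 2)" by (rule holomorphic_on_subset[OF \<Phi>_hol[OF \<psi>X] sub])
    have bd: "cmod (\<Phi> a1 b1 c1 \<tau>) \<le> 3 / 4 * M" if "\<tau> \<in> frontier (cball 0 (1 / 2))" for \<tau>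
    proof -
      have t: "cmod \<tau> = 1 / 2" using that by (simp add: frontier_cball)
      have "cmod (\<Phi> a1 b1 c1 \<tau>) \<le> (1 - (cmod \<tau>)\<^sup>2) powi (- k) * M" by (rule \<Phi>_bound[OF \<psi>X]) (simp add: t)
      moreover have "(1 - (cmod \<tau>)\<^sup>2) powi (- k) \<le> 3 / 4"
      proof -
        have j: "- k = int (Suc (nat (- k - 1)))" using k by simp
        have "(3 / 4 :: real) ^ Suc m \<le> 3 / 4" for m using power_le_one[of "3 / 4 :: real" m] by simp
        moreover have "1 - (cmod \<tau>)\<^sup>2 = 3 / 4" unfolding t by (simp add: power2_eq_square)
        ultimately show ?thesis by (subst j, simp only: power_int_of_nat)
      qed
      ultimately show ?thesis by (rule order_trans[OF _ mult_right_mono[OF _ M0]])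
    qed
    have "cmod (\<Phi> a1 b1 c1 0) \<le> 3 / 4 * M"
      by (rule maximum_modulus_frontier[OF holomorphic_on_subset[OF hol interior_subset] _ bounded_cball bd])
         (simp_all add: holomorphic_on_imp_continuous_on[OF hol])
    then have "M \<le> 3 / 4 * M" by (simp add: \<Phi>0 M_def H_def)
    then have "H (a, b, c) \<le> 0" using max[OF abc] M0 by linarith
    then show ?thesis by (simp add: H_def)
  qed
  show "F (fr (move_a a b c t) (move_b a b c t)) (slots S (cvec (move_c a b c t)) v) = F (fr a b) (slots S (cvec c) v)"
    if k: "k = 0" and t: "cmod t < 1"
  proof -
    have f1: "frame a1 b1 c1" "{a1, b1, c1} \<subseteq> W x y z" "over_D (fr a1 b1)" using \<psi>X by (auto simp: X_def)
    have sp: "\<And>w. w \<in> {a1, b1, c1} \<Longrightarrow> w = B w a *\<^sub>R a + B w b *\<^sub>R b - B w c *\<^sub>R c"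
      using frame_expand_W[OF f sub] f1(2) by blast
    obtain z1 r where z1: "cmod z1 < 1" "r \<noteq> 0" "cmod r = 1" "fr a1 b1 = r *s fr (move_a a b c z1) (move_b a b c z1)"
      "c1 = move_c a b c z1 \<or> c1 = - move_c a b c z1"
      using frame_on_disc[OF f D0 f1(1,3) sp] by metis
    note mX = moveX[OF abc z1(1)]
    have fm: "frame (move_a a b c z1) (move_b a b c z1) (move_c a b c z1)" and om: "over_D (fr (move_a a b c z1) (move_b a b c z1))"
      using mX by (auto simp: X_def)
    have pa: "perp_args (fr (move_a a b c z1) (move_b a b c z1)) (slots S (cvec c1) v)"
    proof -
      have "perp_args (fr a1 b1) (slots S (cvec c1) v)" by (rule perp_args_fr[OF f1(1) orth[OF \<psi>X]])
      then show ?thesis using z1(2) unfolding z1(4) perp_args_def bil_scale_left by simp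
    qed
    have "M = cmod (F (fr (move_a a b c z1) (move_b a b c z1)) (slots S (cvec c1) v))"
      using F_homogeneous[OF om z1(2) pa] unfolding z1(4)[symmetric] k by (simp add: M_def H_def)
    also have "\<dots> = cmod (F (fr (move_a a b c z1) (move_b a b c z1)) (slots S (cvec (move_c a b c z1)) v))"
      using z1(5) F_neg[OF fm om orth[OF mX]] by auto
    also have "\<dots> = cmod (\<Phi> a b c z1)" using \<Phi>_move[OF abc z1(1)] k by simp
    finally have Mz: "M = cmod (\<Phi> a b c z1)" .
    have "\<Phi> a b c constant_on ball 0 1"
    proof (rule maximum_modulus_principle[OF \<Phi>_hol[OF abc] open_ball connected_ball open_ball subset_refl, of z1])
      show "z1 \<in> ball 0 1" using z1(1) by simp
      show "cmod (\<Phi> a b c w) \<le> cmod (\<Phi> a b c z1)" if "w \<in> ball 0 1" for w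
        using \<Phi>_bound[OF abc, of w] that unfolding Mz[symmetric] k by simp
    qed
    then have "\<Phi> a b c t = \<Phi> a b c 0" using t unfolding constant_on_def by (metis mem_ball_0 norm_zero zero_less_one)
    then show ?thesis using \<Phi>_move[OF abc t] k \<Phi>0 by simp
  qed
qed

end

section \<open>Density of the anisotropic curves\<close>

lemma gramdet_scaleR:
  fixes A :: "real ^ 'm ^ 'm"
  shows "gramdet A (r *\<^sub>R x) (r *\<^sub>R y) (r *\<^sub>R z) = r ^ 6 * gramdet A x y z"
  unfolding gramdet_def bil_scaleR_left bil_scaleR_right by (simp add: power2_eq_square power_def algebra_simps numeral_eq_Suc)

lemma gramdet_rvec: "gramdet (real_gram G) (rvec x) (rvec y) (rvec z) = of_int (gramdet G x y z)"
  by (simp add: gramdet_def bil_rvec)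

context type_IV
begin

text \<open>Approximate the vectors of the frame by lattice vectors in the residue classes of
  \<open>anisotropic_residues\<close> and orthonormalise.  The Gram--Schmidt process keeps the real span of the
  lattice vectors.\<close>

lemma frame_approximation:
  assumes n: "n \<ge> 3" and f: "frame a b c" and D0: "over_D (fr a b)"
  obtains u v w x y z where "u \<longlonglongrightarrow> a" "v \<longlonglongrightarrow> b" "w \<longlonglongrightarrow> c"
    "eventually (\<lambda>N. frame (u N) (v N) (w N) \<and> {u N, v N, w N} \<subseteq> W (x N) (y N) (z N) \<and> anisotropic_triple (x N) (y N) (z N)
      \<and> gramdet G (x N) (y N) (z N) \<noteq> 0 \<and> over_D (fr (u N) (v N))) sequentially"
proof -
  note g = frame_values[OF f]
  obtain p v1 v2 v3 where p: "p > 0" and an: "\<And>w1 w2 w3. anisotropic_triple (v1 + p *s w1) (v2 + p *s w2) (v3 + p *s w3)"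
    by (rule anisotropic_residues[OF n]) blast
  define x y z where "x N = v1 + p *s (\<chi> i. \<lfloor>real (Suc N) * a $ i\<rfloor>)" and "y N = v2 + p *s (\<chi> i. \<lfloor>real (Suc N) * b $ i\<rfloor>)"
    and "z N = v3 + p *s (\<chi> i. \<lfloor>real (Suc N) * c $ i\<rfloor>)" for N
  define t where "t N = 1 / (of_int p * real (Suc N))" for N
  define \<xi> \<eta> \<zeta> where "\<xi> N = t N *\<^sub>R rvec (x N)" and "\<eta> N = t N *\<^sub>R rvec (y N)" and "\<zeta> N = t N *\<^sub>R rvec (z N)" for N
  have lim: "\<xi> \<longlonglongrightarrow> a" "\<eta> \<longlonglongrightarrow> b" "\<zeta> \<longlonglongrightarrow> c"
    unfolding \<xi>_def \<eta>_def \<zeta>_def t_def x_def y_def z_def by (rule integral_approximation[OF p])+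
  define u where "u N = (1 / sqrt (B (\<xi> N) (\<xi> N))) *\<^sub>R \<xi> N" for N
  define v' where "v' N = \<eta> N - B (\<eta> N) (u N) *\<^sub>R u N" for N
  define v where "v N = (1 / sqrt (B (v' N) (v' N))) *\<^sub>R v' N" for N
  define w' where "w' N = \<zeta> N - B (\<zeta> N) (u N) *\<^sub>R u N - B (\<zeta> N) (v N) *\<^sub>R v N" for N
  define w where "w N = (1 / sqrt (- B (w' N) (w' N))) *\<^sub>R w' N" for N
  have B\<xi>: "(\<lambda>N. B (\<xi> N) (\<xi> N)) \<longlonglongrightarrow> 1" using tendsto_B[OF lim(1,1)] by (simp add: g)
  have u: "u \<longlonglongrightarrow> a"
    unfolding u_def[abs_def] using tendsto_scaleR[OF tendsto_divide[OF tendsto_const tendsto_real_sqrt[OF B\<xi>]] lim(1), of 1] by simp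
  have v': "v' \<longlonglongrightarrow> b"
    unfolding v'_def[abs_def] using tendsto_diff[OF lim(2) tendsto_scaleR[OF tendsto_B[OF lim(2) u] u]] by (simp add: g)
  have Bv: "(\<lambda>N. B (v' N) (v' N)) \<longlonglongrightarrow> 1" using tendsto_B[OF v' v'] by (simp add: g)
  have v: "v \<longlonglongrightarrow> b"
    unfolding v_def[abs_def] using tendsto_scaleR[OF tendsto_divide[OF tendsto_const tendsto_real_sqrt[OF Bv]] v', of 1] by simp
  have w': "w' \<longlonglongrightarrow> c"
    unfolding w'_def[abs_def]
    using tendsto_diff[OF tendsto_diff[OF lim(3) tendsto_scaleR[OF tendsto_B[OF lim(3) u] u]] tendsto_scaleR[OF tendsto_B[OF lim(3) v] v]]
    by (simp add: g)
  have Bw: "(\<lambda>N. - B (w' N) (w' N)) \<longlonglongrightarrow> 1" using tendsto_minus[OF tendsto_B[OF w' w']] by (simp add: g)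
  have w: "w \<longlonglongrightarrow> c"
    unfolding w_def[abs_def] using tendsto_scaleR[OF tendsto_divide[OF tendsto_const tendsto_real_sqrt[OF Bw]] w', of 1] by simp
  have e: "eventually (\<lambda>N. B (\<xi> N) (\<xi> N) > 0) sequentially" "eventually (\<lambda>N. B (v' N) (v' N) > 0) sequentially"
    "eventually (\<lambda>N. - B (w' N) (w' N) > 0) sequentially"
    using order_tendstoD(1)[OF B\<xi>, of 0] order_tendstoD(1)[OF Bv, of 0] order_tendstoD(1)[OF Bw, of 0] by simp_all
  have fr: "eventually (\<lambda>N. frame (u N) (v N) (w N)) sequentially"
    using e
  proof eventually_elim
    case (elim N)
    have uu: "B (u N) (u N) = 1"
      unfolding u_def using elim(1) by (simp add: bil_scaleR_left bil_scaleR_right)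
    have v'u: "B (v' N) (u N) = 0" by (simp add: v'_def bil_diff_left bil_scaleR_left uu)
    have vu: "B (v N) (u N) = 0" by (simp add: v_def bil_scaleR_left v'u)
    have vv: "B (v N) (v N) = 1"
      unfolding v_def using elim(2) by (simp add: bil_scaleR_left bil_scaleR_right)
    have uv: "B (u N) (v N) = 0" using vu B_commute by metis
    have "B (w' N) (u N) = 0" "B (w' N) (v N) = 0"
      by (simp_all add: w'_def bil_diff_left bil_scaleR_left uu vu uv vv)
    then have "B (w N) (u N) = 0" "B (w N) (v N) = 0" by (simp_all add: w_def bil_scaleR_left)
    moreover have "B (w N) (w N) = - 1"
      unfolding w_def using elim(3) by (simp add: bil_scaleR_left bil_scaleR_right)
    ultimately show ?case by (simp add: frame_def pos_frame_def uu vv uv)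
  qed
  have sub: "{u N, v N, w N} \<subseteq> W (x N) (y N) (z N)" for N
  proof -
    have "\<xi> N \<in> W (x N) (y N) (z N)" "\<eta> N \<in> W (x N) (y N) (z N)" "\<zeta> N \<in> W (x N) (y N) (z N)"
      unfolding \<xi>_def \<eta>_def \<zeta>_def W_def by (auto intro: span_scale span_base)
    then show ?thesis unfolding w_def w'_def v_def v'_def u_def W_def
      by (intro insert_subsetI empty_subsetI span_scale span_diff) auto
  qed
  have "(\<lambda>N. gramdet (real_gram G) (\<xi> N) (\<eta> N) (\<zeta> N)) \<longlonglongrightarrow> gramdet (real_gram G) a b c"
    unfolding gramdet_def by (intro tendsto_intros lim)
  moreover have "gramdet (real_gram G) a b c = - 1" by (simp add: gramdet_def g)
  ultimately have "eventually (\<lambda>N. gramdet (real_gram G) (\<xi> N) (\<eta> N) (\<zeta> N) \<noteq> 0) sequentially"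
    by (intro tendsto_imp_eventually_ne) auto
  then have gd: "eventually (\<lambda>N. gramdet G (x N) (y N) (z N) \<noteq> 0) sequentially"
    by eventually_elim (auto simp: \<xi>_def \<eta>_def \<zeta>_def gramdet_scaleR gramdet_rvec)
  have "eventually (\<lambda>N. over_D (fr (u N) (v N)) \<longleftrightarrow> over_D (fr a b)) sequentially"
  proof (rule over_D_limit[OF u v])
    show "pos_frame a b" using f by (simp add: frame_def)
    show "eventually (\<lambda>N. pos_frame (u N) (v N)) sequentially" using fr by eventually_elim (simp add: frame_def)
  qed
  then have "eventually (\<lambda>N. frame (u N) (v N) (w N) \<and> {u N, v N, w N} \<subseteq> W (x N) (y N) (z N) \<and> anisotropic_triple (x N) (y N) (z N)
      \<and> gramdet G (x N) (y N) (z N) \<noteq> 0 \<and> over_D (fr (u N) (v N))) sequentially"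
    using fr gd
  proof eventually_elim
    case (elim N)
    have "anisotropic_triple (x N) (y N) (z N)" unfolding x_def y_def z_def by (rule an)
    then show ?case using elim sub[of N] D0 by blast
  qed
  then show ?thesis by (rule that[OF u v w])
qed

end

context modular_section
begin

text \<open>Both conclusions are closed conditions on the frame, so they pass from the anisotropic
  rational curves to all of them.\<close>

lemma F_all_frames:
  assumes f: "frame a b c" and D0: "over_D (fr a b)" and y: "orth_to a b c y"
  shows "k < 0 \<Longrightarrow> F (fr a b) (slots S (cvec c) y) = 0"
    and "k = 0 \<Longrightarrow> cmod t < 1 \<Longrightarrow>
      F (fr (move_a a b c t) (move_b a b c t)) (slots S (cvec (move_c a b c t)) y) = F (fr a b) (slots S (cvec c) y)"
proof -
  obtain u v w p q r where lim: "u \<longlonglongrightarrow> a" "v \<longlonglongrightarrow> b" "w \<longlonglongrightarrow> c" and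
    ev: "eventually (\<lambda>N. frame (u N) (v N) (w N) \<and> {u N, v N, w N} \<subseteq> W (p N) (q N) (r N) \<and> anisotropic_triple (p N) (q N) (r N)
      \<and> gramdet G (p N) (q N) (r N) \<noteq> 0 \<and> over_D (fr (u N) (v N))) sequentially"
    by (rule frame_approximation[OF n3 f D0])
  \<comment> \<open>the fixed arguments are projected to the complement of the approximating frame\<close>
  define Y where "Y N j = y j - B (y j) (u N) *\<^sub>R u N - B (y j) (v N) *\<^sub>R v N + B (y j) (w N) *\<^sub>R w N" for N j
  have yo: "B (y j) a = 0" "B (y j) b = 0" "B (y j) c = 0" for j using y by (auto simp: orth_to_def)
  have Ylim: "(\<lambda>N. Y N j) \<longlonglongrightarrow> y j" for j
  proof -
    have "(\<lambda>N. Y N j) \<longlonglongrightarrow> y j - B (y j) a *\<^sub>R a - B (y j) b *\<^sub>R b + B (y j) c *\<^sub>R c"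
      unfolding Y_def by (intro tendsto_intros lim)
    then show ?thesis by (simp add: yo)
  qed
  have Yperp: "perpW (p N) (q N) (r N) (Y N j)" and Yorth: "orth_to (u N) (v N) (w N) (Y N)"
    if fN: "frame (u N) (v N) (w N)" and sub: "{u N, v N, w N} \<subseteq> W (p N) (q N) (r N)" for N j
  proof -
    note g = frame_values[OF fN]
    have o: "B (Y N j) (u N) = 0" "B (Y N j) (v N) = 0" "B (Y N j) (w N) = 0" for j
      by (simp_all add: Y_def bil_add_left bil_diff_left bil_scaleR_left g)
    then show "orth_to (u N) (v N) (w N) (Y N)" by (simp add: orth_to_def)
    have "B (Y N j) x = 0" if x: "x \<in> W (p N) (q N) (r N)" for x
      by (subst frame_expand_W[OF fN sub x]) (simp add: bil_add_right bil_diff_right bil_scaleR_right o)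
    then show "perpW (p N) (q N) (r N) (Y N j)" by (simp add: perpW_iff)
  qed
  have lim1: "(\<lambda>N. F (fr (u N) (v N)) (slots S (cvec (w N)) (Y N))) \<longlonglongrightarrow> F (fr a b) (slots S (cvec c) y)"
  proof (rule F_tendsto[OF D0 perp_args_fr[OF f y]])
    show "(\<lambda>N. fr (u N) (v N)) \<longlonglongrightarrow> fr a b" by (intro tendsto_intros lim)
    show "(\<lambda>N. slots S (cvec (w N)) (Y N) j) \<longlonglongrightarrow> slots S (cvec c) y j" for j
      by (intro tendsto_slots lim Ylim)
    show "eventually (\<lambda>N. over_D (fr (u N) (v N)) \<and> perp_args (fr (u N) (v N)) (slots S (cvec (w N)) (Y N))) sequentially"
      using ev by eventually_elim (use perp_args_fr Yorth in blast)
  qed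
  show "F (fr a b) (slots S (cvec c) y) = 0" if k: "k < 0"
  proof -
    have "eventually (\<lambda>N. F (fr (u N) (v N)) (slots S (cvec (w N)) (Y N)) = 0) sequentially"
      using ev
    proof eventually_elim
      case (elim N)
      then show ?case using k by (intro F_rational(1)[of "p N" "q N" "r N"] Yperp) auto
    qed
    then have "(\<lambda>N. F (fr (u N) (v N)) (slots S (cvec (w N)) (Y N))) \<longlonglongrightarrow> 0" by (rule tendsto_eventually)
    then show ?thesis using lim1 LIMSEQ_unique by blast
  qed
  show "F (fr (move_a a b c t) (move_b a b c t)) (slots S (cvec (move_c a b c t)) y) = F (fr a b) (slots S (cvec c) y)"
    if k: "k = 0" and t: "cmod t < 1"
  proof -
    have D1: "over_D (fr (move_a a b c t) (move_b a b c t))" using over_D_move[OF f t] D0 by simp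
    have "(\<lambda>N. F (fr (move_a (u N) (v N) (w N) t) (move_b (u N) (v N) (w N) t)) (slots S (cvec (move_c (u N) (v N) (w N) t)) (Y N)))
      \<longlonglongrightarrow> F (fr (move_a a b c t) (move_b a b c t)) (slots S (cvec (move_c a b c t)) y)"
    proof (rule F_tendsto[OF D1 perp_args_fr[OF frame_move[OF f t] F_disc_move(2)[OF f D0 y t]]])
      show "(\<lambda>N. fr (move_a (u N) (v N) (w N) t) (move_b (u N) (v N) (w N) t)) \<longlonglongrightarrow> fr (move_a a b c t) (move_b a b c t)"
        unfolding move_a_def move_b_def by (intro tendsto_intros lim)
      show "(\<lambda>N. slots S (cvec (move_c (u N) (v N) (w N) t)) (Y N) j) \<longlonglongrightarrow> slots S (cvec (move_c a b c t)) y j" for j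
      proof (rule tendsto_slots[OF _ Ylim])
        show "(\<lambda>N. move_c (u N) (v N) (w N) t) \<longlonglongrightarrow> move_c a b c t"
          unfolding move_c_def by (intro tendsto_intros lim)
      qed
      show "eventually (\<lambda>N. over_D (fr (move_a (u N) (v N) (w N) t) (move_b (u N) (v N) (w N) t))
        \<and> perp_args (fr (move_a (u N) (v N) (w N) t) (move_b (u N) (v N) (w N) t)) (slots S (cvec (move_c (u N) (v N) (w N) t)) (Y N))) sequentially"
        using ev
      proof eventually_elim
        case (elim N)
        then have fN: "frame (u N) (v N) (w N)" and oN: "over_D (fr (u N) (v N))" and yN: "orth_to (u N) (v N) (w N) (Y N)"
          using Yorth by blast+
        show ?case
          using over_D_move[OF fN t] oN perp_args_fr[OF frame_move[OF fN t] F_disc_move(2)[OF fN oN yN t]] by simp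
      qed
    qed
    moreover have "eventually (\<lambda>N. F (fr (u N) (v N)) (slots S (cvec (w N)) (Y N))
       = F (fr (move_a (u N) (v N) (w N) t) (move_b (u N) (v N) (w N) t)) (slots S (cvec (move_c (u N) (v N) (w N) t)) (Y N))) sequentially"
      using ev
    proof eventually_elim
      case (elim N)
      then show ?case using k t by (intro F_rational(2)[of "p N" "q N" "r N", symmetric] Yperp) auto
    qed
    ultimately show ?thesis by (rule LIMSEQ_unique[OF _ Lim_transform_eventually[OF lim1]])
  qed
qed

end

section \<open>Rotations from boosts\<close>

lemma prod_add_expand:
  fixes f g :: "'i \<Rightarrow> 'b::comm_semiring_1"
  assumes "finite A"
  shows "(\<Prod>p\<in>A. f p + g p) = (\<Sum>S\<in>Pow A. \<Prod>p\<in>A. if p \<in> S then g p else f p)"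
  using assms
proof (induction A rule: finite_induct)
  case (insert a A)
  let ?P = "\<lambda>A S. \<Prod>p\<in>A. if p \<in> S then g p else f p"
  have inj: "inj_on (insert a) (Pow A)" using insert.hyps(2) by (auto simp: inj_on_def)
  have disj: "Pow A \<inter> insert a ` Pow A = {}" using insert.hyps(2) by auto
  have "sum (?P (insert a A)) (Pow (insert a A)) = sum (?P (insert a A)) (Pow A) + sum (?P (insert a A)) (insert a ` Pow A)"
    unfolding Pow_insert using insert.hyps(1) disj by (intro sum.union_disjoint) auto
  also have "sum (?P (insert a A)) (Pow A) = (\<Sum>S\<in>Pow A. f a * ?P A S)"
    using insert.hyps by (intro sum.cong refl) auto
  also have "sum (?P (insert a A)) (insert a ` Pow A) = (\<Sum>S\<in>Pow A. ?P (insert a A) (insert a S))"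
    unfolding sum.reindex[OF inj] comp_def ..
  also have "\<dots> = (\<Sum>S\<in>Pow A. g a * ?P A S)"
  proof (intro sum.cong refl)
    fix S assume "S \<in> Pow A"
    have "?P A (insert a S) = ?P A S" using insert.hyps by (intro prod.cong) auto
    then show "?P (insert a A) (insert a S) = g a * ?P A S" using insert.hyps by simp
  qed
  also have "(\<Sum>S\<in>Pow A. f a * ?P A S) + (\<Sum>S\<in>Pow A. g a * ?P A S) = (f a + g a) * sum (?P A) (Pow A)"
    by (simp add: sum_distrib_left distrib_right sum.distrib)
  finally show ?case using insert by simp
qed simp

lemma pairing_expand:
  "pairing d A T (\<lambda>p. v p + r p *s w) = (\<Sum>S\<in>Pow {..<d}. (\<Prod>p<d. if p \<in> S then r p else 1) * pairing d A T (\<lambda>p. if p \<in> S then w else v p))"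
proof -
  have "(\<Prod>p<d. (A *v (v p + r p *s w)) $ (x ! p))
      = (\<Sum>S\<in>Pow {..<d}. (\<Prod>p<d. if p \<in> S then r p else 1) * (\<Prod>p<d. (A *v (if p \<in> S then w else v p)) $ (x ! p)))" for x
    unfolding prod.distrib[symmetric] matrix_vector_right_distrib vector_scalar_commute vector_add_component vector_smult_component
    by (subst prod_add_expand) (auto intro!: sum.cong prod.cong)
  then show ?thesis
    unfolding pairing_def by (simp add: sum_distrib_left sum.swap[of _ "Pow {..<d}"] mult.left_commute)
qed

lemma pairing_has_derivative:
  assumes "\<And>p i. ((\<lambda>z. u z p $ i) has_field_derivative u' p $ i) (at z0)"
  shows "((\<lambda>z. pairing d A T (u z)) has_field_derivative (\<Sum>p<d. pairing d A T ((u z0)(p := u' p)))) (at z0)"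
proof -
  have 1: "((\<lambda>z. (A *v u z p) $ i) has_field_derivative (A *v u' p) $ i) (at z0)" for p i
    unfolding matrix_vector_mult_def vec_lambda_beta by (intro DERIV_sum DERIV_cmult assms)
  have 2: "((\<lambda>z. \<Prod>p<d. (A *v u z p) $ (x ! p)) has_field_derivative
      (\<Sum>p<d. (\<Prod>q<d. (A *v ((u z0)(p := u' p)) q) $ (x ! q)))) (at z0)" for x
  proof -
    have "(A *v u' p) $ (x ! p) * (\<Prod>q\<in>{..<d} - {p}. (A *v u z0 q) $ (x ! q)) = (\<Prod>q<d. (A *v ((u z0)(p := u' p)) q) $ (x ! q))"
      if "p < d" for p
      using that by (subst prod.remove[of _ p]) (auto intro!: prod.cong)
    then show ?thesis
      by (intro DERIV_cong[OF has_field_derivative_prod[where f = "\<lambda>p z. (A *v u z p) $ (x ! p)", OF 1]] sum.cong refl) simp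
  qed
  have "((\<lambda>z. \<Sum>x | length x = d. T x * (\<Prod>p<d. (A *v u z p) $ (x ! p))) has_field_derivative
      (\<Sum>x | length x = d. T x * (\<Sum>p<d. (\<Prod>q<d. (A *v ((u z0)(p := u' p)) q) $ (x ! q))))) (at z0)"
    by (intro DERIV_sum DERIV_cmult 2)
  moreover have "(\<Sum>x | length x = d. T x * (\<Sum>p<d. (\<Prod>q<d. (A *v ((u z0)(p := u' p)) q) $ (x ! q))))
      = (\<Sum>p<d. pairing d A T ((u z0)(p := u' p)))"
    unfolding pairing_def sum_distrib_left by (rule sum.swap)
  ultimately show ?thesis unfolding pairing_def[of d A T "u _"] by simp
qed

context modular_section
begin

text \<open>Multilinear expansion in a direction \<open>c\<close>, which reduces general arguments to those of \<open>slots\<close>.\<close>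

lemma F_expand:
  assumes o: "over_D (fr a b)" and y: "\<And>p. B (y p) a = 0 \<and> B (y p) b = 0" and c: "B c a = 0" "B c b = 0"
  shows "F (fr a b) (\<lambda>p. cvec (y p + r p *\<^sub>R c))
    = (\<Sum>S\<in>Pow {..<d}. (\<Prod>p<d. if p \<in> S then of_real (r p) else 1) * F (fr a b) (slots S (cvec c) y))"
proof -
  obtain T where T: "s (line (fr a b)) (fr a b) = tensor_coset d (perp G (line (fr a b))) (line (fr a b)) T"
    using representative[OF o] by metis
  have z: "B a (y p) = 0" "B b (y p) = 0" "B a c = 0" "B b c = 0" for p
    using y[of p] c by (metis B_commute)+
  have 1: "perp_args (fr a b) (\<lambda>p. cvec (y p + r p *\<^sub>R c))" "perp_args (fr a b) (slots S (cvec c) y)" for S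
    using z by (auto simp: perp_args_def slots_def C_fr_cvec bil_add_right bil_scaleR_right)
  have "slots S (cvec c) y = (\<lambda>p. if p \<in> S then cvec c else cvec (y p))" for S by (simp add: slots_def fun_eq_iff)
  then show ?thesis
    unfolding F_lift[OF o T 1(1)] F_lift[OF o T 1(2)] unfolding cvec_add cvec_scale by (simp only: pairing_expand)
qed

lemma F_boost:
  assumes k: "k = 0" and f: "frame a b c" and o: "over_D (fr a b)" and u: "\<And>p. B (u p) a = 0 \<and> B (u p) b = 0" and t: "cmod t < 1"
  shows "F (fr (move_a a b c t) (move_b a b c t)) (\<lambda>p. cvec (u p + B (u p) c *\<^sub>R (c - move_c a b c t))) = F (fr a b) (\<lambda>p. cvec (u p))"
proof -
  note g = frame_values[OF f] and fm = frame_move[OF f t]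
  note gm = frame_values[OF fm]
  define y where "y p = u p + B (u p) c *\<^sub>R c" for p
  have y: "orth_to a b c y" by (simp add: orth_to_def y_def bil_add_left bil_scaleR_left g u)
  have ym: "orth_to (move_a a b c t) (move_b a b c t) (move_c a b c t) y" by (rule F_disc_move(2)[OF f o y t])
  have om: "over_D (fr (move_a a b c t) (move_b a b c t))" using over_D_move[OF f t] o by simp
  have "F (fr (move_a a b c t) (move_b a b c t)) (\<lambda>p. cvec (y p + (- B (u p) c) *\<^sub>R move_c a b c t))
      = (\<Sum>S\<in>Pow {..<d}. (\<Prod>p<d. if p \<in> S then of_real (- B (u p) c) else 1)
          * F (fr (move_a a b c t) (move_b a b c t)) (slots S (cvec (move_c a b c t)) y))"
    by (rule F_expand[OF om]) (use ym gm in \<open>auto simp: orth_to_def\<close>)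
  also have "\<dots> = (\<Sum>S\<in>Pow {..<d}. (\<Prod>p<d. if p \<in> S then of_real (- B (u p) c) else 1) * F (fr a b) (slots S (cvec c) y))"
    by (simp only: F_all_frames(2)[OF f o y k t])
  also have "\<dots> = F (fr a b) (\<lambda>p. cvec (y p + (- B (u p) c) *\<^sub>R c))"
    by (rule F_expand[OF o, symmetric]) (use y g in \<open>auto simp: orth_to_def\<close>)
  finally show ?thesis by (simp add: y_def algebra_simps)
qed

text \<open>The boost that carries \<open>x\<close> to \<open>y\<close>.  With \<open>h = (x, y)\<close>, the unit vector orthogonal to \<open>x\<close> in the
  plane of \<open>x, y\<close> is \<open>c = (y - h x) / \<sigma>\<close>, where \<open>\<sigma>\<^sup>2 = h\<^sup>2 - 1\<close>.  The parameter of the boost is the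
  hyperbolic half-angle tangent \<open>\<sigma> / (1 + h)\<close>.  The formula in the statement is that of the boost on the
  complement of \<open>x\<close>, where it is the reflection in \<open>x + y\<close>.\<close>

lemma F_transvection:
  assumes k: "k = 0" and x: "pos_frame x b" and y: "pos_frame y b" and xy: "B x y > 1" and o: "over_D (fr x b)"
    and u: "\<And>p. B (u p) x = 0 \<and> B (u p) b = 0"
  shows "over_D (fr y b)"
    and "F (fr y b) (\<lambda>p. cvec (u p - (B (u p) y / (1 + B x y)) *\<^sub>R (x + y))) = F (fr x b) (\<lambda>p. cvec (u p))"
proof -
  define h where "h = B x y"
  define \<sigma> where "\<sigma> = sqrt (h\<^sup>2 - 1)"
  have h1: "h > 1" using xy by (simp add: h_def)
  have h2: "h\<^sup>2 - 1 > 0" using h1 by (simp add: one_less_power)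
  have \<sigma>: "\<sigma> > 0" "\<sigma>\<^sup>2 = h\<^sup>2 - 1" using h2 by (simp_all add: \<sigma>_def)
  define c where "c = (1 / \<sigma>) *\<^sub>R (y - h *\<^sub>R x)"
  define t where "t = \<sigma> / (1 + h)"
  have b: "B x x = 1" "B y y = 1" "B b b = 1" "B x b = 0" "B y b = 0" "B b x = 0" "B b y = 0" "B x y = h" "B y x = h"
    using x y B_commute[of b x] B_commute[of b y] B_commute[of y x] by (auto simp: pos_frame_def h_def)
  have cc: "B c c = - 1"
  proof -
    have "B c c = (1 - h\<^sup>2) / \<sigma>\<^sup>2"
      by (simp add: c_def bil_diff_left bil_diff_right bil_scaleR_left bil_scaleR_right b power2_eq_square)
    also have "1 - h\<^sup>2 = - \<sigma>\<^sup>2" by (simp add: \<sigma>)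
    finally show ?thesis using \<sigma>(1) by simp
  qed
  have f: "frame x b c"
    unfolding frame_def using x cc by (simp add: c_def bil_diff_left bil_scaleR_left b)
  have t2: "t\<^sup>2 = (h - 1) / (h + 1)"
  proof -
    have "t\<^sup>2 = ((h - 1) * (h + 1)) / ((h + 1) * (h + 1))"
      unfolding t_def power_divide \<sigma>(2) by (simp add: power2_eq_square algebra_simps)
    then show ?thesis using h1 by simp
  qed
  have "t\<^sup>2 < 1\<^sup>2" using h1 by (simp add: t2 field_simps)
  then have t1: "\<bar>t\<bar> < 1" using power2_less_imp_less[of "\<bar>t\<bar>" 1] by simp
  then have T: "cmod (of_real t) < 1" by simp
  have r: "1 - t\<^sup>2 = 2 / (h + 1)" "1 + t\<^sup>2 = 2 * h / (h + 1)" using h1 by (simp_all add: t2 field_simps)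
  have nz: "1 - t\<^sup>2 \<noteq> 0" unfolding r using h1 by simp
  have q: "(1 + t\<^sup>2) / (1 - t\<^sup>2) = h" "2 * t / (1 - t\<^sup>2) = \<sigma>" unfolding r using h1 by (simp_all add: t_def field_simps)
  have ma: "move_a x b c (of_real t) = y"
  proof -
    have "move_a x b c (of_real t) = ((1 + t\<^sup>2) / (1 - t\<^sup>2)) *\<^sub>R x + (2 * t / (1 - t\<^sup>2)) *\<^sub>R c"
      by (simp add: move_a_def scaleR_add_right flip: of_real_power)
    then show ?thesis using \<sigma>(1) by (simp add: q c_def)
  qed
  have mb: "move_b x b c (of_real t) = b"
    using nz by (simp add: move_b_def flip: of_real_power)
  have mc: "move_c x b c (of_real t) = h *\<^sub>R c + \<sigma> *\<^sub>R x"
  proof -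
    have "move_c x b c (of_real t) = ((1 + t\<^sup>2) / (1 - t\<^sup>2)) *\<^sub>R c + (2 * t / (1 - t\<^sup>2)) *\<^sub>R x"
      by (simp add: move_c_def scaleR_add_right)
    then show ?thesis by (simp add: q)
  qed
  show "over_D (fr y b)" using over_D_move[OF f T] o by (simp add: ma mb)
  have "B v c *\<^sub>R (c - move_c x b c (of_real t)) = - ((B v y / (1 + B x y)) *\<^sub>R (x + y))" if v: "B v x = 0" for v
  proof -
    have "B v c = B v y / \<sigma>" using v by (simp add: c_def bil_diff_right bil_scaleR_right)
    moreover have "c - move_c x b c (of_real t) = - (\<sigma> / (1 + h)) *\<^sub>R (x + y)"
    proof -
      have "\<sigma> *\<^sub>R (c - move_c x b c (of_real t)) = (1 - h) *\<^sub>R (y - h *\<^sub>R x) - (\<sigma> * \<sigma>) *\<^sub>R x"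
        unfolding mc unfolding c_def using \<sigma>(1) by (simp add: algebra_simps)
      also have "\<sigma> * \<sigma> = (h - 1) * (h + 1)" using \<sigma>(2) by (simp add: power2_eq_square algebra_simps)
      also have "(1 - h) *\<^sub>R (y - h *\<^sub>R x) - ((h - 1) * (h + 1)) *\<^sub>R x = (1 - h) *\<^sub>R (x + y)"
        by (simp add: algebra_simps)
      also have "1 - h = \<sigma> * - (\<sigma> / (1 + h))"
        using h1 \<sigma>(2) by (simp add: power2_eq_square field_simps)
      finally have "\<sigma> *\<^sub>R (c - move_c x b c (of_real t)) = \<sigma> *\<^sub>R (- (\<sigma> / (1 + h)) *\<^sub>R (x + y))" by simp
      then show ?thesis using \<sigma>(1) by (simp only: scaleR_cancel_left) simp
    qed
    ultimately show ?thesis using \<sigma>(1) by (simp add: b)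
  qed
  then have "(\<lambda>p. cvec (u p + B (u p) c *\<^sub>R (c - move_c x b c (of_real t)))) = (\<lambda>p. cvec (u p - (B (u p) y / (1 + B x y)) *\<^sub>R (x + y)))"
    using u by (simp add: fun_eq_iff)
  then show "F (fr y b) (\<lambda>p. cvec (u p - (B (u p) y / (1 + B x y)) *\<^sub>R (x + y))) = F (fr x b) (\<lambda>p. cvec (u p))"
    using F_boost[where u = u, OF k f o u T] by (simp only: ma mb)
qed

text \<open>Holonomy of a geodesic triangle in a hyperbolic plane: with \<open>\<sigma>\<^sup>2 = h\<^sup>2 - 1\<close>, the boosts along the sides of the
  triangle with vertices \<open>a\<close>, \<open>h a + \<sigma> e1\<close>, \<open>h a + \<sigma> e2\<close> compose to the rotation in the
  plane of \<open>e1, e2\<close> whose cosine is \<open>2 h / (1 + h\<^sup>2)\<close>.\<close>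

lemma F_rotation:
  assumes k: "k = 0" and f1: "frame a b e1" and f2: "frame a b e2" and e: "B e1 e2 = 0" and o: "over_D (fr a b)"
    and y: "\<And>p. B (y p) a = 0 \<and> B (y p) b = 0 \<and> B (y p) e1 = 0 \<and> B (y p) e2 = 0" and h: "h > 1"
  shows "F (fr a b) (\<lambda>p. cvec (y p + ((2 * h * \<alpha> p + (h\<^sup>2 - 1) * \<beta> p) / (1 + h\<^sup>2)) *\<^sub>R e1
      + ((2 * h * \<beta> p - (h\<^sup>2 - 1) * \<alpha> p) / (1 + h\<^sup>2)) *\<^sub>R e2))
    = F (fr a b) (\<lambda>p. cvec (y p + \<alpha> p *\<^sub>R e1 + \<beta> p *\<^sub>R e2))"
proof -
  define \<sigma> where "\<sigma> = sqrt (h\<^sup>2 - 1)"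
  have h2: "h\<^sup>2 > 1" using h by (simp add: one_less_power)
  have \<sigma>: "\<sigma> * \<sigma> = h\<^sup>2 - 1" using h2 by (simp add: \<sigma>_def flip: power2_eq_square)
  note g1 = frame_values[OF f1] and g2 = frame_values[OF f2]
  have e': "B e2 e1 = 0" using e B_commute by metis
  note bs = bil_add_left bil_add_right bil_diff_left bil_diff_right bil_scaleR_left bil_scaleR_right g1 g2 e e' y
  define x1 x2 where "x1 = h *\<^sub>R a + \<sigma> *\<^sub>R e1" and "x2 = h *\<^sub>R a + \<sigma> *\<^sub>R e2"
  have p0: "pos_frame a b" using f1 by (simp add: frame_def)
  have hh: "h * h - \<sigma> * \<sigma> = 1" by (simp add: \<sigma> power2_eq_square)
  have p1: "pos_frame x1 b" and p2: "pos_frame x2 b"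
    using hh by (simp_all add: pos_frame_def x1_def x2_def bs)
  have B01: "B a x1 = h" and B12: "B x1 x2 = h\<^sup>2" and B20: "B x2 a = h"
    by (simp_all add: x1_def x2_def bs power2_eq_square)
  define v0 where "v0 p = y p + \<alpha> p *\<^sub>R e1 + \<beta> p *\<^sub>R e2" for p
  define v1 where "v1 p = v0 p - (B (v0 p) x1 / (1 + h)) *\<^sub>R (a + x1)" for p
  define v2 where "v2 p = v1 p - (B (v1 p) x2 / (1 + h\<^sup>2)) *\<^sub>R (x1 + x2)" for p
  define v3 where "v3 p = v2 p - (B (v2 p) a / (1 + h)) *\<^sub>R (x2 + a)" for p
  have h0: "1 + h \<noteq> 0" "1 + h\<^sup>2 \<noteq> 0" using h by (auto simp: add_nonneg_eq_0_iff)
  have 1: "v1 p = y p + (\<alpha> p * \<sigma>) *\<^sub>R a + (\<alpha> p * h) *\<^sub>R e1 + \<beta> p *\<^sub>R e2" for p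
  proof -
    have "B (v0 p) x1 = - \<sigma> * \<alpha> p" by (simp add: v0_def x1_def bs)
    then have "v1 p = y p + (\<sigma> * \<alpha> p / (1 + h) * (1 + h)) *\<^sub>R a + (\<alpha> p + \<alpha> p * (\<sigma> * \<sigma>) / (1 + h)) *\<^sub>R e1 + \<beta> p *\<^sub>R e2"
      by (simp add: v1_def v0_def x1_def algebra_simps add_divide_distrib)
    moreover have "\<sigma> * \<alpha> p / (1 + h) * (1 + h) = \<alpha> p * \<sigma>" using h0 by simp
    moreover have "\<alpha> p + \<alpha> p * (\<sigma> * \<sigma>) / (1 + h) = \<alpha> p * h"
      unfolding \<sigma> using h0 by (simp add: field_simps power2_eq_square)
    ultimately show ?thesis by simp
  qed
  \<comment> \<open>\<open>v1, v2, v3\<close> are the arguments transported along the three sides\<close>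
  define m where "m p = \<sigma> * (\<alpha> p * h - \<beta> p) / (1 + h\<^sup>2)" for p
  have 2: "v2 p = y p + (\<alpha> p * \<sigma> - 2 * h * m p) *\<^sub>R a + (\<alpha> p * h - m p * \<sigma>) *\<^sub>R e1 + (\<beta> p - m p * \<sigma>) *\<^sub>R e2" for p
  proof -
    have "B (v1 p) x2 = \<sigma> * (\<alpha> p * h - \<beta> p)" by (simp add: 1 x2_def bs algebra_simps)
    then have "v2 p = v1 p - m p *\<^sub>R (x1 + x2)" by (simp add: v2_def m_def)
    then show ?thesis by (simp add: 1 x1_def x2_def vec_eq_iff algebra_simps)
  qed
  have 3: "v3 p = y p + ((2 * h * \<alpha> p + (h\<^sup>2 - 1) * \<beta> p) / (1 + h\<^sup>2)) *\<^sub>R e1 + ((2 * h * \<beta> p - (h\<^sup>2 - 1) * \<alpha> p) / (1 + h\<^sup>2)) *\<^sub>R e2" for p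
  proof -
    define q where "q = (\<alpha> p * \<sigma> - 2 * h * m p) / (1 + h)"
    have "B (v2 p) a = \<alpha> p * \<sigma> - 2 * h * m p" by (simp add: 2 bs)
    then have "v3 p = v2 p - q *\<^sub>R (x2 + a)" by (simp add: v3_def q_def)
    then have v3: "v3 p = y p + (\<alpha> p * \<sigma> - 2 * h * m p - q * (1 + h)) *\<^sub>R a + (\<alpha> p * h - m p * \<sigma>) *\<^sub>R e1 + (\<beta> p - m p * \<sigma> - q * \<sigma>) *\<^sub>R e2"
      by (simp add: 2 x2_def vec_eq_iff algebra_simps)
    have ms: "m p * \<sigma> = (h\<^sup>2 - 1) * (\<alpha> p * h - \<beta> p) / (1 + h\<^sup>2)"
      unfolding \<sigma>[symmetric] by (simp add: m_def)
    have c0: "\<alpha> p * \<sigma> - 2 * h * m p - q * (1 + h) = 0" using h0 by (simp add: q_def)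
    have c1: "\<alpha> p * h - m p * \<sigma> = (2 * h * \<alpha> p + (h\<^sup>2 - 1) * \<beta> p) / (1 + h\<^sup>2)"
      unfolding ms using h0(2) by (simp add: field_simps)
    have "q * \<sigma> = (\<alpha> p * (\<sigma> * \<sigma>) - 2 * h * (m p * \<sigma>)) / (1 + h)" by (simp add: q_def algebra_simps)
    also have "\<dots> = ((h - 1) * (h + 1) * (\<alpha> p - 2 * h * ((\<alpha> p * h - \<beta> p) / (1 + h\<^sup>2)))) / (1 + h)"
      unfolding ms \<sigma> by (simp add: algebra_simps power2_eq_square add_divide_distrib diff_divide_distrib)
    also have "\<dots> = (h - 1) * (\<alpha> p - 2 * h * ((\<alpha> p * h - \<beta> p) / (1 + h\<^sup>2)))" using h0(1) by (simp add: add.commute)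
    finally have qs: "q * \<sigma> = (h - 1) * (\<alpha> p - 2 * h * ((\<alpha> p * h - \<beta> p) / (1 + h\<^sup>2)))" .
    have c2: "\<beta> p - m p * \<sigma> - q * \<sigma> = (2 * h * \<beta> p - (h\<^sup>2 - 1) * \<alpha> p) / (1 + h\<^sup>2)"
    proof -
      define w where "w = (\<alpha> p * h - \<beta> p) / (1 + h\<^sup>2)"
      have w: "w * (1 + h\<^sup>2) = \<alpha> p * h - \<beta> p" using h0(2) by (simp add: w_def)
      have mq: "m p * \<sigma> = (h\<^sup>2 - 1) * w" "q * \<sigma> = (h - 1) * (\<alpha> p - 2 * h * w)" by (simp_all add: ms qs w_def)
      have "(\<beta> p - m p * \<sigma> - q * \<sigma>) * (1 + h\<^sup>2)
          = \<beta> p * (1 + h\<^sup>2) - (h\<^sup>2 - 1) * (w * (1 + h\<^sup>2)) - (h - 1) * (\<alpha> p * (1 + h\<^sup>2) - 2 * h * (w * (1 + h\<^sup>2)))"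
        unfolding mq by (simp add: algebra_simps)
      also have "\<dots> = 2 * h * \<beta> p - (h\<^sup>2 - 1) * \<alpha> p"
        unfolding w by (simp add: algebra_simps power2_eq_square)
      finally have "(\<beta> p - m p * \<sigma> - q * \<sigma>) * (1 + h\<^sup>2) = 2 * h * \<beta> p - (h\<^sup>2 - 1) * \<alpha> p" .
      then show ?thesis using h0(2) by (simp add: eq_divide_eq)
    qed
    show ?thesis unfolding v3 c0 c1 c2 by simp
  qed
  have u0: "B (v0 p) a = 0 \<and> B (v0 p) b = 0" for p by (simp add: v0_def bs)
  have u1: "B (v1 p) x1 = 0 \<and> B (v1 p) b = 0" for p by (simp add: 1 x1_def bs algebra_simps)
  have u2: "B (v2 p) x2 = 0 \<and> B (v2 p) b = 0" for p
  proof
    show "B (v2 p) b = 0" by (simp add: 2 bs)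
    have "B (v1 p) x2 * (1 + h\<^sup>2) = B (v1 p) x2 * (1 + B x1 x2)" by (simp add: B12)
    moreover have "B (x1 + x2) x2 = 1 + h\<^sup>2" using p2 by (simp add: bil_add_left B12 pos_frame_def)
    ultimately show "B (v2 p) x2 = 0" using h0(2) by (simp add: v2_def bil_diff_left bil_scaleR_left)
  qed
  have t1: "F (fr x1 b) (\<lambda>p. cvec (v1 p)) = F (fr a b) (\<lambda>p. cvec (v0 p))" and o1: "over_D (fr x1 b)"
    using F_transvection[where u = v0, OF k p0 p1 _ o u0] h unfolding v1_def B01 by auto
  have t2: "F (fr x2 b) (\<lambda>p. cvec (v2 p)) = F (fr x1 b) (\<lambda>p. cvec (v1 p))" and o2: "over_D (fr x2 b)"
    using F_transvection[where u = v1, OF k p1 p2 _ o1 u1] h2 unfolding v2_def B12 by auto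
  have t3: "F (fr a b) (\<lambda>p. cvec (v3 p)) = F (fr x2 b) (\<lambda>p. cvec (v2 p))"
    using F_transvection(2)[where u = v2, OF k p2 p0 _ o2 u2] h unfolding v3_def B20 by auto
  show ?thesis using t1 t2 t3 unfolding 3 v0_def by simp
qed

text \<open>The derivative at the identity of the invariance under rotations.  Since the point \<open>a + i b\<close> is
  fixed by them, only the arguments of a fixed tensor have to be differentiated.\<close>

lemma rotation_invariance:
  assumes k: "k = 0" and o: "over_D (fr a b)" and pf: "pos_frame a b" and c: "neg_basis a b c"
    and j: "j < n" and l: "l < n" "j \<noteq> l" and I: "\<forall>r<d. I r < n"
  shows "(\<Sum>p<d. if I p = j then F (fr a b) (\<lambda>r. cvec (c ((I(p := l)) r))) else 0)
    = (\<Sum>p<d. if I p = l then F (fr a b) (\<lambda>r. cvec (c ((I(p := j)) r))) else 0)"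
proof -
  let ?w = "fr a b"
  obtain T where T: "s (line ?w) ?w = tensor_coset d (perp G (line ?w)) (line ?w) T"
    using representative[OF o] by metis
  have cb: "B (c r) a = 0" "B (c r) b = 0" if "r < n" for r using c that by (auto simp: neg_basis_def)
  have cc: "B (c r) (c q) = (if r = q then - 1 else 0)" if "r < n" "q < n" for r q using c that by (auto simp: neg_basis_def)
  have cw: "C ?w (cvec (c r)) = 0" if "r < n" for r
    using cb[OF that] B_commute[of a "c r"] B_commute[of b "c r"] by (simp add: C_fr_cvec)
  have lift: "F ?w u = pairing d A T u" if "\<And>p. p < d \<Longrightarrow> C ?w (u p) = 0" for u
    by (rule F_lift[OF o T]) (use that in \<open>simp add: perp_args_def\<close>)
  define U where "U z p = (if I p = j then cos z *s cvec (c j) - sin z *s cvec (c l)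
      else if I p = l then sin z *s cvec (c j) + cos z *s cvec (c l) else cvec (c (I p)))" for z :: complex and p
  define U' where "U' p = (if I p = j then - cvec (c l) else if I p = l then cvec (c j) else 0)" for p
  define f where "f z = pairing d A T (U z)" for z
  have U0: "U 0 = (\<lambda>p. cvec (c (I p)))" by (simp add: U_def fun_eq_iff)
  have const: "f (of_real \<theta>) = f 0" if \<theta>: "0 < \<theta>" "\<theta> < pi / 2" for \<theta>
  proof -
    \<comment> \<open>the size of the triangle whose holonomy is the rotation by \<open>\<theta>\<close>\<close>
    define h where "h = (1 + sin \<theta>) / cos \<theta>"
    have cs: "cos \<theta> > 0" "sin \<theta> > 0" "sin \<theta> < 1"
      using \<theta> cos_gt_zero sin_gt_zero2 sin_monotone_2pi[of \<theta> "pi / 2"] by auto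
    have "cos \<theta> < 1 + sin \<theta>" using cs(2) cos_le_one[of \<theta>] by linarith
    then have h1: "h > 1" using cs(1) by (simp add: h_def)
    have "h\<^sup>2 = (1 + sin \<theta>)\<^sup>2 / ((1 - sin \<theta>) * (1 + sin \<theta>))"
      unfolding h_def power_divide cos_squared_eq by (simp add: power2_eq_square algebra_simps)
    also have "\<dots> = (1 + sin \<theta>) / (1 - sin \<theta>)" using cs by (simp add: power2_eq_square)
    finally have hq: "h\<^sup>2 = (1 + sin \<theta>) / (1 - sin \<theta>)" .
    have 1: "1 + h\<^sup>2 = 2 / (1 - sin \<theta>)" "h\<^sup>2 - 1 = 2 * sin \<theta> / (1 - sin \<theta>)"
      using cs unfolding hq by (simp_all add: field_simps)
    have S: "(h\<^sup>2 - 1) / (1 + h\<^sup>2) = sin \<theta>" unfolding 1 using cs by simp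
    have Co: "2 * h / (1 + h\<^sup>2) = cos \<theta>"
    proof -
      have "2 * h / (1 + h\<^sup>2) = (1 - sin \<theta>) * (1 + sin \<theta>) / cos \<theta>" unfolding 1 using cs by (simp add: h_def field_simps)
      also have "(1 - sin \<theta>) * (1 + sin \<theta>) = cos \<theta> * cos \<theta>" using cos_squared_eq[of \<theta>] by (simp add: power2_eq_square algebra_simps)
      finally show ?thesis using cs by simp
    qed
    define \<alpha> \<beta> :: "nat \<Rightarrow> real" where "\<alpha> p = (if I p = j then 1 else 0)" and "\<beta> p = (if I p = l then 1 else 0)" for p
    define y where "y p = (if p < d \<and> I p \<noteq> j \<and> I p \<noteq> l then c (I p) else 0)" for p
    have fr: "frame a b (c j)" "frame a b (c l)" using pf cb cc j l by (simp_all add: frame_def)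
    have y: "B (y p) a = 0 \<and> B (y p) b = 0 \<and> B (y p) (c j) = 0 \<and> B (y p) (c l) = 0" for p
      using I cb cc j l by (simp add: y_def)
    have jl: "B (c j) (c l) = 0" using cc j l by simp
    have co: "(2 * h * x + (h\<^sup>2 - 1) * x') / (1 + h\<^sup>2) = cos \<theta> * x + sin \<theta> * x'"
      "(2 * h * x - (h\<^sup>2 - 1) * x') / (1 + h\<^sup>2) = cos \<theta> * x - sin \<theta> * x'" for x x'
      unfolding S[symmetric] Co[symmetric] times_divide_eq_left
      by (rule add_divide_distrib, rule diff_divide_distrib)
    have eq: "F ?w (\<lambda>p. cvec (y p + (cos \<theta> * \<alpha> p + sin \<theta> * \<beta> p) *\<^sub>R c j + (cos \<theta> * \<beta> p - sin \<theta> * \<alpha> p) *\<^sub>R c l))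
        = F ?w (\<lambda>p. cvec (y p + \<alpha> p *\<^sub>R c j + \<beta> p *\<^sub>R c l))"
      using F_rotation[where y = y and \<alpha> = \<alpha> and \<beta> = \<beta>, OF k fr jl o y h1]
      by (simp only: co)
    have Uw: "C ?w (U z p) = 0" if "p < d" for z p
      using I that j l by (simp add: U_def bil_add_right bil_diff_right bil_scale_right cw)
    have "F ?w (U (of_real \<theta>)) = F ?w (U 0)"
    proof -
      have "F ?w (U (of_real \<theta>)) = F ?w (\<lambda>p. cvec (y p + (cos \<theta> * \<alpha> p + sin \<theta> * \<beta> p) *\<^sub>R c j + (cos \<theta> * \<beta> p - sin \<theta> * \<alpha> p) *\<^sub>R c l))"
        by (rule F_cong) (use l in \<open>auto simp: U_def y_def \<alpha>_def \<beta>_def cvec_add cvec_diff cvec_scale cos_of_real sin_of_real cvec_minus\<close>)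
      also have "\<dots> = F ?w (U 0)"
        unfolding eq by (rule F_cong) (use l in \<open>auto simp: U_def y_def \<alpha>_def \<beta>_def cvec_add\<close>)
      finally show ?thesis .
    qed
    then show ?thesis using lift[OF Uw] by (simp add: f_def)
  qed
  have "(f has_field_derivative (\<Sum>p<d. pairing d A T ((U 0)(p := U' p)))) (at 0)"
    unfolding f_def[abs_def]
  proof (rule pairing_has_derivative)
    fix p i
    show "((\<lambda>z. U z p $ i) has_field_derivative U' p $ i) (at 0)"
      unfolding U_def U'_def by (auto intro!: derivative_eq_intros)
  qed
  then have D: "((\<lambda>z. (f z - f 0) / (z - 0)) \<longlongrightarrow> (\<Sum>p<d. pairing d A T ((U 0)(p := U' p)))) (at 0)"
    by (simp only: has_field_derivative_iff)
  have g: "filterlim (\<lambda>N. complex_of_real (1 / real (Suc N))) (at 0) sequentially"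
    unfolding filterlim_at
  proof
    show "eventually (\<lambda>N. complex_of_real (1 / real (Suc N)) \<in> UNIV \<and> complex_of_real (1 / real (Suc N)) \<noteq> 0) sequentially"
      by (intro always_eventually) (auto simp del: of_nat_Suc)
    show "(\<lambda>N. complex_of_real (1 / real (Suc N))) \<longlonglongrightarrow> 0"
      using tendsto_of_real[OF LIMSEQ_inverse_real_of_nat, where 'a = complex] by (simp add: inverse_eq_divide)
  qed
  have "(\<lambda>N. (f (complex_of_real (1 / real (Suc N))) - f 0) / (complex_of_real (1 / real (Suc N)) - 0)) \<longlonglongrightarrow> (\<Sum>p<d. pairing d A T ((U 0)(p := U' p)))"
    by (rule filterlim_compose[OF D g])
  moreover have "f (complex_of_real (1 / real (Suc N))) = f 0" for N
  proof (rule const)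
    show "0 < 1 / real (Suc N)" by simp
    have "1 / real (Suc N) \<le> 1" by simp
    also have "1 < pi / 2" using pi_gt3 by simp
    finally show "1 / real (Suc N) < pi / 2" .
  qed
  ultimately have "(\<lambda>N. 0 :: complex) \<longlonglongrightarrow> (\<Sum>p<d. pairing d A T ((U 0)(p := U' p)))" by simp
  then have zero: "(\<Sum>p<d. pairing d A T ((U 0)(p := U' p))) = 0" using LIMSEQ_unique tendsto_const by blast
  have slot: "pairing d A T ((U 0)(p := U' p))
      = (if I p = l then F ?w (\<lambda>r. cvec (c ((I(p := j)) r))) else 0) - (if I p = j then F ?w (\<lambda>r. cvec (c ((I(p := l)) r))) else 0)"
    if p: "p < d" for p
  proof -
    have up: "(U 0)(p := cvec (c m)) = (\<lambda>r. cvec (c ((I(p := m)) r)))" for m by (simp add: U0 fun_eq_iff)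
    have F: "F ?w (\<lambda>r. cvec (c ((I(p := m)) r))) = pairing d A T ((U 0)(p := cvec (c m)))" if "m < n" for m
      unfolding up by (rule lift) (use I that cw in simp)
    have sc: "pairing d A T ((U 0)(p := r *s v)) = r * pairing d A T ((U 0)(p := v))" for r v
    proof -
      have "pairing d A T ((U 0)(p := r *s v)) = pairing d A T (\<lambda>q. (if q = p then r else 1) *s ((U 0)(p := v)) q)"
        by (rule pairing_cong) simp
      also have "\<dots> = (\<Prod>q<d. if q = p then r else 1) * pairing d A T ((U 0)(p := v))"
        by (rule pairing_scale_slots)
      finally show ?thesis using p by simp
    qed
    show ?thesis
      using sc[of "- 1" "cvec (c l)"] sc[of 0 0] F[OF j] F[OF l(1)] l(2) by (auto simp: U'_def)
  qed
  show ?thesis using zero by (simp add: slot sum_subtractf)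
qed

end

section \<open>Traces and alternating sums\<close>

text \<open>These two rules split a product over slots at given positions.\<close>

lemma prod_append:
  "(\<Prod>p<length xs + length ys. f p ((xs @ ys) ! p)) = (\<Prod>p<length xs. f p (xs ! p)) * (\<Prod>p<length ys. f (length xs + p) (ys ! p))"
  for f :: "nat \<Rightarrow> 'x \<Rightarrow> 'y::comm_monoid_mult"
proof (induction xs arbitrary: f)
  case (Cons x xs)
  then show ?case using Cons[of "\<lambda>p. f (Suc p)"] by (simp add: prod.lessThan_Suc_shift mult.assoc del: prod.lessThan_Suc)
qed simp

lemma prod_Cons:
  "(\<Prod>p<length (x # xs). f p ((x # xs) ! p)) = f 0 x * (\<Prod>p<length xs. f (Suc p) (xs ! p))"
  for f :: "nat \<Rightarrow> 'x \<Rightarrow> 'y::comm_monoid_mult"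
  using prod_append[of f "[x]" xs] by simp

lemma contraction_add: "contraction A i j (T + T') = contraction A i j T + contraction A i j T'"
  by (simp add: contraction_def fun_eq_iff distrib_left sum.distrib)

lemma contraction_tscale: "contraction A i j (tscale r T) = tscale r (contraction A i j T)"
  by (simp add: contraction_def tscale_def fun_eq_iff sum_distrib_left mult.left_commute)

lemma contraction_zero: "contraction A i j 0 = 0"
  by (simp add: contraction_def fun_eq_iff)

lemma contraction_pure:
  assumes "length xs = i" "length ys = j - i - 1" "i < j" "length x = i + length ys + length zs"
  shows "contraction A i j (pure (xs @ a # ys @ b # zs)) x = bil A a b * pure (xs @ ys @ zs) x"
proof -
  define x1 x2 x3 where "x1 = take i x" and "x2 = take (j - i - 1) (drop i x)" and "x3 = drop (j - 1) x"
  have l: "length x1 = length xs" "length x2 = length ys" using assms by (auto simp: x1_def x2_def)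
  have "drop (j - 1) x = drop (j - i - 1) (drop i x)" using assms(3) by simp
  then have x: "x = x1 @ x2 @ x3" unfolding x1_def x2_def x3_def by (simp only: append_take_drop_id)
  have "pure (xs @ a # ys @ b # zs) (x1 @ [p] @ x2 @ [q] @ x3) = pure xs x1 * (a $ p * (pure ys x2 * (b $ q * pure zs x3)))" for p q
    using l by (simp add: pure_append pure_Cons)
  moreover have "pure (xs @ ys @ zs) x = pure xs x1 * (pure ys x2 * pure zs x3)"
    unfolding x using l by (simp add: pure_append)
  ultimately show ?thesis
    unfolding contraction_def bil_def x1_def[symmetric] x2_def[symmetric] x3_def[symmetric]
    by (simp add: sum_distrib_left sum_distrib_right mult_ac)
qed

text \<open>On the quotient \<open>W / R\<close>, contraction is the trace over an orthonormal basis; the sign comes from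
  \<open>(c k, c k) = -1\<close>.  The last argument lists the slots other than \<open>i\<close> and \<open>j\<close>.\<close>

lemma contraction_trace:
  fixes c :: "nat \<Rightarrow> complex ^ 'm"
  assumes T: "T \<in> tensor_power d W" and ij: "i < j" "j < d"
    and parseval: "\<And>v w. v \<in> W \<Longrightarrow> w \<in> W \<Longrightarrow> (\<Sum>k<n. bil A v (c k) * bil A w (c k)) = - bil A v w"
  shows "(\<Sum>k<n. pairing d A T (u(i := c k, j := c k)))
    = - pairing (d - 2) A (contraction A i j T) (\<lambda>q. if q < i then u q else if q < j - 1 then u (q + 1) else u (q + 2))"
  using T unfolding tensor_power_def
proof (induction rule: tensor.span_induct)
  case base
  show ?case
    by (auto simp: tensor.subspace_def pairing_add pairing_tscale contraction_zero contraction_add contraction_tscale sum.distrib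
        simp flip: sum_distrib_left)
next
  case (step T)
  then obtain v where v: "T = pure v" "length v = d" "set v \<subseteq> W" by blast
  define xs ys zs where "xs = take i v" and "ys = take (j - i - 1) (drop (Suc i) v)" and "zs = drop (Suc j) v"
  have l: "length xs = i" "length ys = j - i - 1" "length zs = d - j - 1" using v ij by (auto simp: xs_def ys_def zs_def)
  have ve: "v = xs @ v ! i # ys @ v ! j # zs"
  proof -
    have "v = take i v @ v ! i # drop (Suc i) v" using ij v(2) by (intro id_take_nth_drop) simp
    also have "drop (Suc i) v = ys @ drop (j - i - 1) (drop (Suc i) v)" unfolding ys_def by (rule append_take_drop_id[symmetric])
    also have "drop (j - i - 1) (drop (Suc i) v) = drop j v" using ij by simp
    also have "drop j v = v ! j # zs" unfolding zs_def using ij v(2) by (intro Cons_nth_drop_Suc[symmetric]) simp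
    finally show ?thesis unfolding xs_def .
  qed
  let ?u = "\<lambda>q. if q < i then u q else if q < j - 1 then u (q + 1) else u (q + 2)"
  define X where "X = (\<Prod>p<i. bil A (xs ! p) (u p))"
  define Y where "Y = (\<Prod>p<length ys. bil A (ys ! p) (u (Suc i + p)))"
  define Z where "Z = (\<Prod>p<length zs. bil A (zs ! p) (u (Suc j + p)))"
  have dd: "d = length xs + length (v ! i # ys @ v ! j # zs)" using l ij by simp
  have big: "pairing d A T (u(i := w, j := w)) = X * (bil A (v ! i) w * (Y * (bil A (v ! j) w * Z)))" for w
  proof -
    let ?U = "u(i := w, j := w)"
    have "pairing d A T ?U = (\<Prod>p<length xs + length (v ! i # ys @ v ! j # zs). bil A ((xs @ (v ! i # ys @ v ! j # zs)) ! p) (?U p))"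
      unfolding v(1) pairing_pure[OF v(2)] dd[symmetric] ve[symmetric] ..
    also have "\<dots> = (\<Prod>p<length xs. bil A (xs ! p) (?U p)) * (\<Prod>p<length (v ! i # ys @ v ! j # zs). bil A ((v ! i # ys @ v ! j # zs) ! p) (?U (length xs + p)))"
      by (rule prod_append)
    also have "(\<Prod>p<length xs. bil A (xs ! p) (?U p)) = X"
      unfolding X_def using l ij by (intro prod.cong) auto
    also have "(\<Prod>p<length (v ! i # ys @ v ! j # zs). bil A ((v ! i # ys @ v ! j # zs) ! p) (?U (length xs + p)))
        = bil A (v ! i) (?U (length xs + 0)) * (\<Prod>p<length (ys @ v ! j # zs). bil A ((ys @ v ! j # zs) ! p) (?U (length xs + Suc p)))"
      by (rule prod_Cons)
    also have "?U (length xs + 0) = w" using l(1) ij by simp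
    also have "(\<Prod>p<length (ys @ v ! j # zs). bil A ((ys @ v ! j # zs) ! p) (?U (length xs + Suc p)))
        = (\<Prod>p<length ys + length (v ! j # zs). bil A ((ys @ v ! j # zs) ! p) (?U (Suc i + p)))"
      by (simp only: length_append l(1) add_Suc_shift)
    also have "(\<Prod>p<length ys + length (v ! j # zs). bil A ((ys @ v ! j # zs) ! p) (?U (Suc i + p)))
        = (\<Prod>p<length ys. bil A (ys ! p) (?U (Suc i + p))) * (\<Prod>p<length (v ! j # zs). bil A ((v ! j # zs) ! p) (?U (Suc i + (length ys + p))))"
      by (rule prod_append)
    also have "(\<Prod>p<length ys. bil A (ys ! p) (?U (Suc i + p))) = Y"
      unfolding Y_def using l ij by (intro prod.cong) auto
    also have "(\<Prod>p<length (v ! j # zs). bil A ((v ! j # zs) ! p) (?U (Suc i + (length ys + p)))) = bil A (v ! j) w * Z"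
    proof -
      have "Suc i + length ys = j" using l ij by simp
      then have "Suc i + (length ys + p) = j + p" for p by simp
      then have "(\<Prod>p<length (v ! j # zs). bil A ((v ! j # zs) ! p) (?U (Suc i + (length ys + p)))) = bil A (v ! j) (?U (j + 0)) * (\<Prod>p<length zs. bil A (zs ! p) (?U (j + Suc p)))"
        by (simp only:) (rule prod_Cons)
      also have "?U (j + 0) = w" by simp
      also have "(\<Prod>p<length zs. bil A (zs ! p) (?U (j + Suc p))) = Z"
        unfolding Z_def using ij by (intro prod.cong) auto
      finally show ?thesis .
    qed
    finally show ?thesis .
  qed
  have small: "pairing (d - 2) A (contraction A i j T) ?u = bil A (v ! i) (v ! j) * (X * (Y * Z))"
  proof -
    have Te: "T = pure (xs @ v ! i # ys @ v ! j # zs)" unfolding v(1) by (rule arg_cong[OF ve])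
    have len: "length (xs @ ys @ zs) = d - 2" using l ij by simp
    have "pairing (d - 2) A (contraction A i j T) ?u = pairing (d - 2) A (tscale (bil A (v ! i) (v ! j)) (pure (xs @ ys @ zs))) ?u"
      unfolding pairing_def
    proof (intro sum.cong refl arg_cong2[where f = "(*)"])
      fix x :: "'m list" assume "x \<in> {x. length x = d - 2}"
      then have "length x = i + length ys + length zs" using l ij by simp
      then show "contraction A i j T x = tscale (bil A (v ! i) (v ! j)) (pure (xs @ ys @ zs)) x"
        unfolding Te contraction_pure[OF l(1,2) ij(1) \<open>length x = _\<close>] tscale_def by simp
    qed
    also have "\<dots> = bil A (v ! i) (v ! j) * (\<Prod>p<d - 2. bil A ((xs @ ys @ zs) ! p) (?u p))"
      unfolding pairing_tscale pairing_pure[OF len] ..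
    also have "(\<Prod>p<d - 2. bil A ((xs @ ys @ zs) ! p) (?u p)) = (\<Prod>p<length xs + length (ys @ zs). bil A ((xs @ ys @ zs) ! p) (?u p))"
      unfolding len[symmetric] length_append ..
    also have "(\<Prod>p<length xs + length (ys @ zs). bil A ((xs @ ys @ zs) ! p) (?u p))
        = (\<Prod>p<length xs. bil A (xs ! p) (?u p)) * (\<Prod>p<length (ys @ zs). bil A ((ys @ zs) ! p) (?u (length xs + p)))"
      by (rule prod_append)
    also have "(\<Prod>p<length xs. bil A (xs ! p) (?u p)) = X"
      unfolding X_def using l ij by (intro prod.cong) auto
    also have "(\<Prod>p<length (ys @ zs). bil A ((ys @ zs) ! p) (?u (length xs + p)))
        = (\<Prod>p<length ys. bil A (ys ! p) (?u (length xs + p))) * (\<Prod>p<length zs. bil A (zs ! p) (?u (length xs + (length ys + p))))"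
      unfolding length_append by (rule prod_append)
    also have "(\<Prod>p<length ys. bil A (ys ! p) (?u (length xs + p))) = Y"
      unfolding Y_def using l ij by (intro prod.cong) auto
    also have "(\<Prod>p<length zs. bil A (zs ! p) (?u (length xs + (length ys + p)))) = Z"
      unfolding Z_def using l ij by (intro prod.cong) auto
    finally show ?thesis .
  qed
  have in_W: "v ! i \<in> W" "v ! j \<in> W" using v ij by auto
  have "(\<Sum>k<n. pairing d A T (u(i := c k, j := c k))) = (\<Sum>k<n. (X * (Y * Z)) * (bil A (v ! i) (c k) * bil A (v ! j) (c k)))"
    unfolding big by (intro sum.cong refl) (simp add: mult_ac)
  also have "\<dots> = (X * (Y * Z)) * - bil A (v ! i) (v ! j)"
    unfolding sum_distrib_left[symmetric] parseval[OF in_W] ..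
  finally show ?case unfolding small mult_minus_right mult.commute[of "bil A (v ! i) (v ! j)"] .
qed

lemma traceless_trace:
  fixes c :: "nat \<Rightarrow> complex ^ 'm"
  assumes T: "T \<in> traceless A d W R" and pq: "p < d" "q < d" "p \<noteq> q"
    and parseval: "\<And>v w. v \<in> W \<Longrightarrow> w \<in> W \<Longrightarrow> (\<Sum>k<n. bil A v (c k) * bil A w (c k)) = - bil A v w"
    and u: "\<And>r x. r < d \<Longrightarrow> x \<in> R \<Longrightarrow> bil A x (u r) = 0"
  shows "(\<Sum>k<n. pairing d A T (u(p := c k, q := c k))) = 0"
proof -
  have main: "(\<Sum>k<n. pairing d A T (u(i := c k, j := c k))) = 0" if ij: "i < j" "j < d" for i j
  proof -
    have 1: "T \<in> tensor_power d W" "contraction A i j T \<in> tensor_null (d - 2) W R" using T ij by (auto simp: traceless_def)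
    have "pairing (d - 2) A (contraction A i j T) (\<lambda>q. if q < i then u q else if q < j - 1 then u (q + 1) else u (q + 2)) = 0"
      by (rule pairing_null[OF 1(2)]) (use u ij in auto)
    then show ?thesis using contraction_trace[OF 1(1) ij parseval, where u = u] by simp
  qed
  show ?thesis
  proof (cases "p < q")
    case False
    then have "q < p" using pq by simp
    then show ?thesis using main[of q p] pq by (simp add: fun_upd_twist)
  qed (use main pq in simp)
qed

lemma fun_upd_comp_permutes:
  assumes "\<pi> permutes S"
  shows "f(p := x) \<circ> \<pi> = (f \<circ> \<pi>)(inv_into UNIV \<pi> p := x)"
proof
  fix r
  have "r = inv_into UNIV \<pi> p \<longleftrightarrow> \<pi> r = p" using permutes_inv_eq[OF assms, of p r] by auto
  then show "(f(p := x) \<circ> \<pi>) r = ((f \<circ> \<pi>)(inv_into UNIV \<pi> p := x)) r" by simp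
qed

text \<open>A transposition in the row group fixes the row sum, by a change of summation index, and changes
  the sign of the alternating sum.  The factors \<open>\<sigma>\<close> in between only conjugate it to another
  transposition.\<close>

lemma alternating_young_sum:
  fixes P :: "(nat \<Rightarrow> 'x) \<Rightarrow> complex"
  assumes s: "slot_swap x y \<in> row_subgroup lam" and xy: "x < sum_list lam" "y < sum_list lam" "x \<noteq> y"
  shows "(\<Sum>\<pi> | \<pi> permutes {..<sum_list lam}. of_int (sign \<pi>) *
      (\<Sum>\<sigma>\<in>col_subgroup lam. of_int (sign \<sigma>) * (\<Sum>\<tau>\<in>row_subgroup lam. P (u \<circ> \<pi> \<circ> \<sigma> \<circ> \<tau>)))) = 0"
proof -
  let ?S = "{..<sum_list lam}" and ?s = "slot_swap x y"
  define H where "H \<sigma> \<tau> = (\<Sum>\<pi> | \<pi> permutes ?S. of_int (sign \<pi>) * P (u \<circ> \<pi> \<circ> \<sigma> \<circ> \<tau>))" for \<sigma> \<tau> :: "nat \<Rightarrow> nat"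
  have fin: "finite (row_subgroup lam)" "finite (col_subgroup lam)"
    by (rule finite_subset[OF _ finite_permutations[OF finite_lessThan]], auto simp: row_subgroup_def col_subgroup_def)+
  have neg: "H \<sigma> (?s \<circ> \<tau>) = - H \<sigma> \<tau>" if \<sigma>: "\<sigma> permutes ?S" for \<sigma> \<tau>
  proof -
    define s' where "s' = slot_swap (\<sigma> x) (\<sigma> y)"
    have s': "s' permutes ?S" unfolding s'_def using permutes_in_image[OF \<sigma>] xy by (intro permutes_swap_id) auto
    have sg: "sign (\<pi> \<circ> s') = - sign \<pi>" if "\<pi> permutes ?S" for \<pi>
    proof -
      have "\<sigma> x \<noteq> \<sigma> y" using \<sigma> xy(3) by (metis permutes_inv_eq)
      then have "sign s' = - 1" by (simp add: s'_def sign_swap_id)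
      moreover have "permutation \<pi>" "permutation s'" using that s' by (auto intro: permutes_imp_permutation[OF finite_lessThan])
      ultimately show ?thesis by (simp add: sign_compose)
    qed
    have comm: "\<sigma> \<circ> ?s = s' \<circ> \<sigma>"
      using permutes_inj[OF \<sigma>] by (auto simp: s'_def fun_eq_iff Transposition.transpose_def inj_eq)
    have "u \<circ> \<pi> \<circ> \<sigma> \<circ> (?s \<circ> \<tau>) = u \<circ> (\<pi> \<circ> s') \<circ> \<sigma> \<circ> \<tau>" for \<pi>
      using comm by (metis comp_assoc)
    then have "H \<sigma> (?s \<circ> \<tau>) = (\<Sum>\<pi> | \<pi> permutes ?S. - (of_int (sign (\<pi> \<circ> s')) * P (u \<circ> (\<pi> \<circ> s') \<circ> \<sigma> \<circ> \<tau>)))"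
      unfolding H_def by (intro sum.cong refl) (simp add: sg)
    also have "\<dots> = - (\<Sum>\<pi> | \<pi> permutes ?S. of_int (sign (\<pi> \<circ> s')) * P (u \<circ> (\<pi> \<circ> s') \<circ> \<sigma> \<circ> \<tau>))"
      by (rule sum_negf)
    also have "(\<Sum>\<pi> | \<pi> permutes ?S. of_int (sign (\<pi> \<circ> s')) * P (u \<circ> (\<pi> \<circ> s') \<circ> \<sigma> \<circ> \<tau>)) = H \<sigma> \<tau>"
      unfolding H_def by (rule sum_permutations_compose_right[OF s', symmetric])
    finally show ?thesis .
  qed
  have row: "(\<Sum>\<tau>\<in>row_subgroup lam. H \<sigma> \<tau>) = 0" if "\<sigma> permutes ?S" for \<sigma>
  proof -
    have closed: "?s \<circ> \<tau> \<in> row_subgroup lam" if "\<tau> \<in> row_subgroup lam" for \<tau>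
    proof -
      have t: "\<tau> permutes ?S" "\<And>p. p < sum_list lam \<Longrightarrow> fst (col_tableau lam ! \<tau> p) = fst (col_tableau lam ! p)"
        using that by (auto simp: row_subgroup_def)
      have t': "?s permutes ?S" "\<And>p. p < sum_list lam \<Longrightarrow> fst (col_tableau lam ! ?s p) = fst (col_tableau lam ! p)"
        using s by (auto simp: row_subgroup_def)
      have "\<tau> p < sum_list lam" if "p < sum_list lam" for p using permutes_in_image[OF t(1), of p] that by simp
      then show ?thesis using t t' permutes_compose[OF t(1) t'(1)] by (simp add: row_subgroup_def)
    qed
    have "(\<Sum>\<tau>\<in>row_subgroup lam. H \<sigma> (?s \<circ> \<tau>)) = (\<Sum>\<tau>\<in>row_subgroup lam. H \<sigma> \<tau>)"
    proof (rule sum.reindex_bij_betw[of "\<lambda>\<tau>. ?s \<circ> \<tau>"])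
      show "bij_betw (\<lambda>\<tau>. ?s \<circ> \<tau>) (row_subgroup lam) (row_subgroup lam)"
        by (rule bij_betw_byWitness[where f' = "\<lambda>\<tau>. ?s \<circ> \<tau>"]) (use closed in \<open>auto simp: fun_eq_iff\<close>)
    qed
    then show ?thesis unfolding neg[OF that] sum_negf by simp
  qed
  have "(\<Sum>\<pi> | \<pi> permutes ?S. of_int (sign \<pi>) * (\<Sum>\<sigma>\<in>col_subgroup lam. of_int (sign \<sigma>) * (\<Sum>\<tau>\<in>row_subgroup lam. P (u \<circ> \<pi> \<circ> \<sigma> \<circ> \<tau>))))
      = (\<Sum>\<pi> | \<pi> permutes ?S. \<Sum>\<sigma>\<in>col_subgroup lam. of_int (sign \<sigma>) * (\<Sum>\<tau>\<in>row_subgroup lam. of_int (sign \<pi>) * P (u \<circ> \<pi> \<circ> \<sigma> \<circ> \<tau>)))"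
    by (simp add: sum_distrib_left mult.left_commute)
  also have "\<dots> = (\<Sum>\<sigma>\<in>col_subgroup lam. \<Sum>\<pi> | \<pi> permutes ?S. of_int (sign \<sigma>) * (\<Sum>\<tau>\<in>row_subgroup lam. of_int (sign \<pi>) * P (u \<circ> \<pi> \<circ> \<sigma> \<circ> \<tau>)))"
    by (rule sum.swap)
  also have "\<dots> = (\<Sum>\<sigma>\<in>col_subgroup lam. of_int (sign \<sigma>) * (\<Sum>\<tau>\<in>row_subgroup lam. H \<sigma> \<tau>))"
  proof (intro sum.cong refl)
    fix \<sigma>
    show "(\<Sum>\<pi> | \<pi> permutes ?S. of_int (sign \<sigma>) * (\<Sum>\<tau>\<in>row_subgroup lam. of_int (sign \<pi>) * P (u \<circ> \<pi> \<circ> \<sigma> \<circ> \<tau>)))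
        = of_int (sign \<sigma>) * (\<Sum>\<tau>\<in>row_subgroup lam. H \<sigma> \<tau>)"
      unfolding H_def by (subst sum.swap) (rule sum_distrib_left[symmetric])
  qed
  also have "\<dots> = 0" using row by (intro sum.neutral) (auto simp: col_subgroup_def)
  finally show ?thesis .
qed

text \<open>Counting the cells by columns and by rows.\<close>

lemma length_col_tableau: "length (col_tableau lam) = sum_list lam"
proof -
  define M where "M = Max (set (0 # lam))"
  have M: "lam ! i \<le> M" if "i < length lam" for i unfolding M_def using that by (intro Max_ge) auto
  have "length (col_tableau lam) = (\<Sum>j<M. transposed lam j)"
    by (simp add: col_tableau_def length_concat comp_def M_def interv_sum_list_conv_sum_set_nat atLeast0LessThan del: set_simps)
  also have "\<dots> = (\<Sum>j<M. \<Sum>i<length lam. if j < lam ! i then 1 else 0)"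
    by (intro sum.cong refl) (auto simp: transposed_def sum.If_cases intro!: arg_cong[where f = card])
  also have "\<dots> = (\<Sum>i<length lam. \<Sum>j<M. if j < lam ! i then 1 else 0)" by (rule sum.swap)
  also have "\<dots> = (\<Sum>i<length lam. lam ! i)"
  proof (intro sum.cong refl)
    fix i assume "i \<in> {..<length lam}"
    then have "{..<M} \<inter> {j. j < lam ! i} = {..<lam ! i}" using M[of i] by auto
    then show "(\<Sum>j<M. if j < lam ! i then 1 else 0) = lam ! i" by (simp add: sum.If_cases)
  qed
  finally show ?thesis by (simp add: sum_list_sum_nth atLeast0LessThan)
qed

lemma row_transposition_exists:
  assumes sorted: "sorted_wrt (\<ge>) lam" and i: "i < length lam" "lam ! i \<ge> 2"
  obtains x y where "slot_swap x y \<in> row_subgroup lam" "x < sum_list lam" "y < sum_list lam" "x \<noteq> y"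
proof -
  have "(i, j) \<in> set (col_tableau lam)" if j: "j < 2" for j
  proof -
    have "{..i} \<subseteq> {i'. i' < length lam \<and> j < lam ! i'}"
    proof
      fix i' assume "i' \<in> {..i}"
      then have "lam ! i' \<ge> lam ! i" "i' < length lam" using sorted i(1) by (auto simp: sorted_wrt_iff_nth_less le_less)
      then show "i' \<in> {i'. i' < length lam \<and> j < lam ! i'}" using i(2) j by simp
    qed
    then have "card {..i} \<le> transposed lam j" unfolding transposed_def by (intro card_mono) auto
    then have "i < transposed lam j" by simp
    moreover have "lam ! i \<le> Max (set (0 # lam))" using i(1) by (intro Max_ge) auto
    then have "j < Max (set (0 # lam))" using i(2) j by simp
    ultimately show ?thesis by (auto simp: col_tableau_def simp del: set_simps intro!: bexI[of _ j])
  qed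
  from this[of 0] this[of 1] obtain x y where xy: "x < sum_list lam" "col_tableau lam ! x = (i, 0)" "y < sum_list lam" "col_tableau lam ! y = (i, 1)"
    by (auto simp: in_set_conv_nth length_col_tableau)
  have "slot_swap x y permutes {..<sum_list lam}" using xy by (intro permutes_swap_id) auto
  then have "slot_swap x y \<in> row_subgroup lam" using xy by (auto simp: row_subgroup_def Transposition.transpose_def)
  moreover have "x \<noteq> y" using xy by auto
  ultimately show ?thesis using that xy by blast
qed

lemma antisymmetric_permute:
  assumes anti: "antisymmetric_in d n {..<d} \<Phi>" and \<pi>: "\<pi> permutes {..<d}" and I: "\<forall>r<d. I r < n"
  shows "\<Phi> (I \<circ> \<pi>) = of_int (sign \<pi>) * \<Phi> I"
  using \<pi> finite_lessThan I
proof (induction \<pi> arbitrary: I rule: permutes_induct)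
  case (swap a b p)
  have I': "\<forall>r<d. (I \<circ> slot_swap a b) r < n" using swap by (auto simp: Transposition.transpose_def)
  have "\<Phi> (I \<circ> (slot_swap a b \<circ> p)) = of_int (sign p) * \<Phi> (I \<circ> slot_swap a b)"
    using swap.IH[OF I'] by (simp only: comp_assoc)
  also have "\<Phi> (I \<circ> slot_swap a b) = - \<Phi> I" using anti swap by (simp add: antisymmetric_in_def)
  also have "sign (slot_swap a b \<circ> p) = - sign p"
    using swap by (subst sign_compose) (auto intro: permutes_imp_permutation permutation_swap_id simp: sign_swap_id)
  then have "of_int (sign p) * - \<Phi> I = of_int (sign (slot_swap a b \<circ> p)) * \<Phi> I" by simp
  finally show ?case .
qed simp

context modular_section
begin

lemma parseval:
  assumes pf: "pos_frame a b" and c: "neg_basis a b c"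
    and v: "v \<in> perp G (line (fr a b))" and w: "w \<in> perp G (line (fr a b))"
  shows "(\<Sum>k<n. C v (cvec (c k)) * C w (cvec (c k))) = - C v w"
proof -
  have v0: "C v (fr a b) = 0" and w0: "C w (fr a b) = 0" using v w by (simp_all only: perp_line)
  have "C w (v + (\<Sum>k<n. C v (cvec (c k)) *s cvec (c k))) = 0"
    unfolding perp_expand[OF pf c v0] by (simp add: bil_scale_right w0)
  then show ?thesis using C_commute[of w v]
    by (simp add: bil_add_right bil_sum_right bil_scale_right add_eq_0_iff)
qed

lemma F_young:
  assumes o: "over_D \<omega>"
  obtains T where "T \<in> traceless A d (perp G (line \<omega>)) (line \<omega>)"
    "\<And>u. perp_args \<omega> u \<Longrightarrow> F \<omega> u = (\<Sum>\<sigma>\<in>col_subgroup lam. of_int (sign \<sigma>) * (\<Sum>\<tau>\<in>row_subgroup lam. pairing d A T (u \<circ> \<sigma> \<circ> \<tau>)))"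
proof -
  obtain T where T: "T \<in> traceless A d (perp G (line \<omega>)) (line \<omega>)"
    "s (line \<omega>) \<omega> = tensor_coset d (perp G (line \<omega>)) (line \<omega>) (young_c lam T)"
    by (rule section_fibre[OF o])
  show ?thesis by (rule that[OF T(1)]) (simp only: F_lift[OF o T(2)] pairing_young_c)
qed

lemma perp_args_basis:
  assumes "neg_basis a b c" "\<forall>r<d. I r < n"
  shows "perp_args (fr a b) (\<lambda>r. cvec (c (I r)))"
  unfolding perp_args_def
proof (intro allI impI)
  fix r assume "r < d"
  then have "B (c (I r)) a = 0" "B (c (I r)) b = 0" using assms by (auto simp: neg_basis_def)
  then show "C (fr a b) (cvec (c (I r))) = 0" using B_commute[of a "c (I r)"] B_commute[of b "c (I r)"] by (simp add: C_fr_cvec)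
qed

lemma F_trace:
  assumes o: "over_D (fr a b)" and pf: "pos_frame a b" and c: "neg_basis a b c"
    and pq: "p < d" "q < d" "p \<noteq> q" and I: "\<forall>r<d. I r < n"
  shows "(\<Sum>k<n. F (fr a b) (\<lambda>r. cvec (c ((I(p := k, q := k)) r)))) = 0"
proof -
  let ?w = "fr a b"
  obtain T where T: "T \<in> traceless A d (perp G (line ?w)) (line ?w)"
    "\<And>u. perp_args ?w u \<Longrightarrow> F ?w u = (\<Sum>\<sigma>\<in>col_subgroup lam. of_int (sign \<sigma>) * (\<Sum>\<tau>\<in>row_subgroup lam. pairing d A T (u \<circ> \<sigma> \<circ> \<tau>)))"
    by (rule F_young[OF o]) blast
  have cw: "C ?w (cvec (c r)) = 0" if "r < n" for r
    using c that B_commute[of a "c r"] B_commute[of b "c r"] by (simp add: C_fr_cvec neg_basis_def)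
  have zero: "(\<Sum>k<n. pairing d A T ((\<lambda>r. cvec (c ((I(p := k, q := k)) r))) \<circ> \<sigma> \<circ> \<tau>)) = 0"
    if \<sigma>: "\<sigma> permutes {..<d}" and \<tau>: "\<tau> permutes {..<d}" for \<sigma> \<tau>
  proof -
    define \<pi> where "\<pi> = \<sigma> \<circ> \<tau>"
    have \<pi>: "\<pi> permutes {..<d}" unfolding \<pi>_def by (rule permutes_compose[OF \<tau> \<sigma>])
    define p' q' where "p' = inv_into UNIV \<pi> p" and "q' = inv_into UNIV \<pi> q"
    have i: "inv_into UNIV \<pi> permutes {..<d}" by (rule permutes_inv[OF \<pi>])
    have pq': "p' < d" "q' < d" "p' \<noteq> q'"
      using permutes_in_image[OF i, of p] permutes_in_image[OF i, of q] pq permutes_inverses(1)[OF \<pi>]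
      by (auto simp: p'_def q'_def) (metis)
    have "(\<lambda>r. cvec (c ((I(p := k, q := k)) r))) \<circ> \<sigma> \<circ> \<tau> = ((\<lambda>r. cvec (c (I r))) \<circ> \<pi>)(p' := cvec (c k), q' := cvec (c k))" for k
    proof -
      have "(\<lambda>r. cvec (c ((I(p := k, q := k)) r))) = (\<lambda>r. cvec (c (I r)))(p := cvec (c k), q := cvec (c k))" by (simp add: fun_eq_iff)
      then show ?thesis unfolding comp_assoc \<pi>_def[symmetric] p'_def q'_def
        by (simp only: fun_upd_comp_permutes[OF \<pi>])
    qed
    moreover have "(\<Sum>k<n. pairing d A T (((\<lambda>r. cvec (c (I r))) \<circ> \<pi>)(p' := cvec (c k), q' := cvec (c k)))) = 0"
    proof (rule traceless_trace[OF T(1) pq', where c = "\<lambda>k. cvec (c k)"])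
      show "(\<Sum>k<n. C v (cvec (c k)) * C w (cvec (c k))) = - C v w"
        if "v \<in> perp G (line ?w)" "w \<in> perp G (line ?w)" for v w by (rule parseval[OF pf c that])
      fix r x assume r: "r < d" and x: "x \<in> line ?w"
      have "\<pi> r < d" using permutes_in_image[OF \<pi>, of r] r by simp
      then have "I (\<pi> r) < n" using I by blast
      then show "C x (((\<lambda>r. cvec (c (I r))) \<circ> \<pi>) r) = 0" using x cw by (auto simp: line_eq bil_scale_left)
    qed
    ultimately show ?thesis by simp
  qed
  have "(\<Sum>k<n. F ?w (\<lambda>r. cvec (c ((I(p := k, q := k)) r))))
      = (\<Sum>k<n. \<Sum>\<sigma>\<in>col_subgroup lam. of_int (sign \<sigma>) * (\<Sum>\<tau>\<in>row_subgroup lam. pairing d A T ((\<lambda>r. cvec (c ((I(p := k, q := k)) r))) \<circ> \<sigma> \<circ> \<tau>)))"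
    by (intro sum.cong refl T(2) perp_args_basis[OF c]) (use I in auto)
  also have "\<dots> = (\<Sum>\<sigma>\<in>col_subgroup lam. \<Sum>k<n. of_int (sign \<sigma>) * (\<Sum>\<tau>\<in>row_subgroup lam. pairing d A T ((\<lambda>r. cvec (c ((I(p := k, q := k)) r))) \<circ> \<sigma> \<circ> \<tau>)))"
    by (rule sum.swap)
  also have "\<dots> = (\<Sum>\<sigma>\<in>col_subgroup lam. of_int (sign \<sigma>) * (\<Sum>\<tau>\<in>row_subgroup lam. \<Sum>k<n. pairing d A T ((\<lambda>r. cvec (c ((I(p := k, q := k)) r))) \<circ> \<sigma> \<circ> \<tau>)))"
    unfolding sum_distrib_left[symmetric] by (intro sum.cong refl arg_cong2[where f = "(*)"] sum.swap)
  also have "\<dots> = 0" using zero by (intro sum.neutral ballI) (simp add: row_subgroup_def col_subgroup_def)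
  finally show ?thesis .
qed

lemma F_alternating:
  assumes o: "over_D (fr a b)" and c: "neg_basis a b c" and I: "\<forall>r<d. I r < n"
    and lam: "sorted_wrt (\<ge>) lam" "i < length lam" "lam ! i \<ge> 2"
  shows "(\<Sum>\<pi> | \<pi> permutes {..<d}. of_int (sign \<pi>) * F (fr a b) (\<lambda>r. cvec (c (I (\<pi> r))))) = 0"
proof -
  let ?w = "fr a b"
  obtain T where T: "T \<in> traceless A d (perp G (line ?w)) (line ?w)"
    "\<And>u. perp_args ?w u \<Longrightarrow> F ?w u = (\<Sum>\<sigma>\<in>col_subgroup lam. of_int (sign \<sigma>) * (\<Sum>\<tau>\<in>row_subgroup lam. pairing d A T (u \<circ> \<sigma> \<circ> \<tau>)))"
    by (rule F_young[OF o]) blast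
  obtain x y where xy: "slot_swap x y \<in> row_subgroup lam" "x < d" "y < d" "x \<noteq> y"
    by (rule row_transposition_exists[OF lam])
  have "F ?w (\<lambda>r. cvec (c (I (\<pi> r)))) = (\<Sum>\<sigma>\<in>col_subgroup lam. of_int (sign \<sigma>) * (\<Sum>\<tau>\<in>row_subgroup lam. pairing d A T ((\<lambda>r. cvec (c (I r))) \<circ> \<pi> \<circ> \<sigma> \<circ> \<tau>)))"
    if "\<pi> permutes {..<d}" for \<pi>
  proof -
    have "\<forall>r<d. (I \<circ> \<pi>) r < n" using I permutes_in_image[OF that] by simp
    then have "perp_args ?w (\<lambda>r. cvec (c ((I \<circ> \<pi>) r)))" by (rule perp_args_basis[OF c])
    from T(2)[OF this] show ?thesis by (simp add: comp_def)
  qed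
  then have "(\<Sum>\<pi> | \<pi> permutes {..<d}. of_int (sign \<pi>) * F ?w (\<lambda>r. cvec (c (I (\<pi> r)))))
      = (\<Sum>\<pi> | \<pi> permutes {..<d}. of_int (sign \<pi>) * (\<Sum>\<sigma>\<in>col_subgroup lam. of_int (sign \<sigma>) * (\<Sum>\<tau>\<in>row_subgroup lam. pairing d A T ((\<lambda>r. cvec (c (I r))) \<circ> \<pi> \<circ> \<sigma> \<circ> \<tau>))))"
    by (intro sum.cong refl) simp
  also have "\<dots> = 0" by (rule alternating_young_sum[OF xy])
  finally show ?thesis .
qed

text \<open>The set \<open>M\<close> collects the three properties of the coordinates that are stable under differences
  and under permutations of the slots: tracelessness, rotation invariance and, in degree \<open>n\<close>, vanishing
  of the alternating part.\<close>

lemma F_vanishes_weight_0: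
  assumes k: "k = 0" and o: "over_D (fr a b)" and pf: "pos_frame a b" and c: "neg_basis a b c"
    and lam: "partition_of_length n lam" "lam \<noteq> replicate n 0" "lam \<noteq> replicate n 1" and I0: "\<forall>r<d. I0 r < n"
  shows "F (fr a b) (\<lambda>r. cvec (c (I0 r))) = 0"
proof -
  have len: "length lam = n" and sorted: "sorted_wrt (\<ge>) lam" using lam(1) by (auto simp: partition_of_length_def)
  have d0: "d > 0"
  proof (rule ccontr)
    assume "\<not> d > 0"
    then have "\<forall>x\<in>set lam. x = 0" by simp
    then show False using lam(2) len by (metis replicate_length_same)
  qed
  have big: "\<exists>i<length lam. lam ! i \<ge> 2" if "d = n"
  proof (rule ccontr)
    assume "\<not> ?thesis"
    then have le: "lam ! i \<le> 1" if "i < n" for i using that len by (auto simp: not_le)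
    have "(\<Sum>i<n. 1 - lam ! i) = (\<Sum>i<n. 1) - (\<Sum>i<n. lam ! i)" using le by (intro sum_subtractf_nat) auto
    also have "\<dots> = 0" using \<open>d = n\<close> len by (simp add: sum_list_sum_nth atLeast0LessThan)
    finally have "lam ! i = 1" if "i < n" for i using that le[OF that] by (simp add: le_antisym)
    then have "lam = replicate n 1" using len by (simp add: list_eq_iff_nth_eq)
    then show False using lam(3) by simp
  qed
  define ok where "ok I \<longleftrightarrow> (\<forall>r<d. I r < n)" for I :: "nat \<Rightarrow> nat"
  define M1 where "M1 \<Phi> \<longleftrightarrow> (\<forall>p q I. p < d \<longrightarrow> q < d \<longrightarrow> p \<noteq> q \<longrightarrow> ok I \<longrightarrow> (\<Sum>k<n. \<Phi> (I(p := k, q := k))) = 0)"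
    for \<Phi> :: "(nat \<Rightarrow> nat) \<Rightarrow> complex"
  define M2 where "M2 \<Phi> \<longleftrightarrow> (\<forall>x y I. x < n \<longrightarrow> y < n \<longrightarrow> x \<noteq> y \<longrightarrow> ok I \<longrightarrow>
      (\<Sum>p<d. if I p = x then \<Phi> (I(p := y)) else 0) = (\<Sum>p<d. if I p = y then \<Phi> (I(p := x)) else 0))"
    for \<Phi> :: "(nat \<Rightarrow> nat) \<Rightarrow> complex"
  define M3 where "M3 \<Phi> \<longleftrightarrow> (d = n \<longrightarrow> (\<forall>I. ok I \<longrightarrow> (\<Sum>\<pi> | \<pi> permutes {..<d}. of_int (sign \<pi>) * \<Phi> (I \<circ> \<pi>)) = 0))"
    for \<Phi> :: "(nat \<Rightarrow> nat) \<Rightarrow> complex"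
  define M where "M = {\<Phi>. M1 \<Phi> \<and> M2 \<Phi> \<and> M3 \<Phi>}"
  have okD: "\<forall>r<d. I r < n \<Longrightarrow> ok I" and ok_range: "ok I \<Longrightarrow> \<forall>r<d. I r < n" for I by (simp_all only: ok_def)
  have M_I: "\<Phi> \<in> M" if
    "\<And>I p q. p < d \<Longrightarrow> q < d \<Longrightarrow> p \<noteq> q \<Longrightarrow> \<forall>r<d. I r < n \<Longrightarrow> (\<Sum>k<n. \<Phi> (I(p := k, q := k))) = 0"
    "\<And>I x y. x < n \<Longrightarrow> y < n \<Longrightarrow> x \<noteq> y \<Longrightarrow> \<forall>r<d. I r < n \<Longrightarrow>
        (\<Sum>p<d. if I p = x then \<Phi> (I(p := y)) else 0) = (\<Sum>p<d. if I p = y then \<Phi> (I(p := x)) else 0)"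
    "\<And>I. d = n \<Longrightarrow> \<forall>r<d. I r < n \<Longrightarrow> (\<Sum>\<pi> | \<pi> permutes {..<d}. of_int (sign \<pi>) * \<Phi> (I \<circ> \<pi>)) = 0" for \<Phi>
  proof -
    have "M1 \<Phi>" unfolding M1_def by (intro allI impI that(1) ok_range)
    moreover have "M2 \<Phi>" unfolding M2_def by (intro allI impI that(2) ok_range)
    moreover have "M3 \<Phi>" unfolding M3_def by (intro allI impI that(3) ok_range)
    ultimately show ?thesis by (simp add: M_def)
  qed
  have M_trace: "(\<Sum>k<n. \<Phi> (I(p := k, q := k))) = 0" if m: "\<Phi> \<in> M" and h: "p < d" "q < d" "p \<noteq> q" "\<forall>r<d. I r < n" for \<Phi> I p q
  proof -
    have "M1 \<Phi>" using m by (simp add: M_def)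
    then show ?thesis unfolding M1_def using h(1-3) okD[OF h(4)] by (elim allE impE)
  qed
  have M_rot: "(\<Sum>p<d. if I p = x then \<Phi> (I(p := y)) else 0) = (\<Sum>p<d. if I p = y then \<Phi> (I(p := x)) else 0)"
    if m: "\<Phi> \<in> M" and h: "x < n" "y < n" "x \<noteq> y" "\<forall>r<d. I r < n" for \<Phi> I x y
  proof -
    have "M2 \<Phi>" using m by (simp add: M_def)
    then show ?thesis unfolding M2_def using h(1-3) okD[OF h(4)] by (elim allE impE)
  qed
  have M_alt: "(\<Sum>\<pi> | \<pi> permutes {..<d}. of_int (sign \<pi>) * \<Phi> (I \<circ> \<pi>)) = 0" if m: "\<Phi> \<in> M" and h: "d = n" "\<forall>r<d. I r < n" for \<Phi> I
  proof -
    have "M3 \<Phi>" using m by (simp add: M_def)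
    then show ?thesis unfolding M3_def using h(1) okD[OF h(2)] by (elim allE impE)
  qed
  have "(\<lambda>I. F (fr a b) (\<lambda>r. cvec (c (I r)))) I0 = 0"
  proof (rule invariants_vanish[where M = M and d = d and n = n and ?\<Phi>0.0 = "\<lambda>I. F (fr a b) (\<lambda>r. cvec (c (I r)))" and ?I0.0 = I0])
    show "(\<lambda>I. \<Phi> I - \<Psi> I) \<in> M" if m: "\<Phi> \<in> M" "\<Psi> \<in> M" for \<Phi> \<Psi>
    proof (rule M_I)
      fix I p q assume "p < d" "q < d" "p \<noteq> q" "\<forall>r<d. I r < n"
      then show "(\<Sum>k<n. \<Phi> (I(p := k, q := k)) - \<Psi> (I(p := k, q := k))) = 0"
        using M_trace[OF m(1)] M_trace[OF m(2)] by (simp add: sum_subtractf)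
    next
      fix I x y assume xy: "x < n" "y < n" "x \<noteq> y" "\<forall>r<d. I r < n"
      have e: "(\<Sum>p<d. if I p = z then \<Phi> (I(p := w)) - \<Psi> (I(p := w)) else 0)
          = (\<Sum>p<d. if I p = z then \<Phi> (I(p := w)) else 0) - (\<Sum>p<d. if I p = z then \<Psi> (I(p := w)) else 0)" for z w
        unfolding sum_subtractf[symmetric] by (intro sum.cong refl) simp
      show "(\<Sum>p<d. if I p = x then \<Phi> (I(p := y)) - \<Psi> (I(p := y)) else 0) = (\<Sum>p<d. if I p = y then \<Phi> (I(p := x)) - \<Psi> (I(p := x)) else 0)"
        unfolding e M_rot[OF m(1) xy] M_rot[OF m(2) xy] ..
    next
      fix I assume "d = n" "\<forall>r<d. I r < n"
      then show "(\<Sum>\<pi> | \<pi> permutes {..<d}. of_int (sign \<pi>) * (\<Phi> (I \<circ> \<pi>) - \<Psi> (I \<circ> \<pi>))) = 0"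
        using M_alt[OF m(1)] M_alt[OF m(2)] by (simp add: right_diff_distrib sum_subtractf)
    qed
    show "(\<lambda>I. \<Phi> (I \<circ> slot_swap u v)) \<in> M" if m: "\<Phi> \<in> M" and uv: "u < d" "v < d" for \<Phi> u v
    proof (rule M_I)
      let ?s = "slot_swap u v"
      have s: "?s permutes {..<d}" using uv by (intro permutes_swap_id) auto
      have sd: "?s p < d \<longleftrightarrow> p < d" for p using permutes_in_image[OF s, of p] by simp
      have upd: "f(p := z) \<circ> ?s = (f \<circ> ?s)(?s p := z)" for f :: "nat \<Rightarrow> nat" and p z
        using fun_upd_comp_permutes[OF s, of f p z] by (simp add: inv_unique_comp[of ?s ?s])
      {
        fix I p q assume "p < d" "q < d" "p \<noteq> q" "\<forall>r<d. I r < n"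
        moreover from this have "?s p \<noteq> ?s q" using permutes_inj[OF s] by (simp only: inj_eq) simp
        moreover have "\<forall>r<d. (I \<circ> ?s) r < n" using \<open>\<forall>r<d. I r < n\<close> sd by simp
        ultimately show "(\<Sum>k<n. \<Phi> (I(p := k, q := k) \<circ> ?s)) = 0"
          unfolding upd using M_trace[OF m, of "?s p" "?s q" "I \<circ> ?s"] sd by simp
      next
        fix I x y assume xy: "x < n" "y < n" "x \<noteq> y" "\<forall>r<d. I r < n"
        have e: "(\<Sum>p<d. if I p = z then \<Phi> (I(p := w) \<circ> ?s) else 0) = (\<Sum>p<d. if (I \<circ> ?s) p = z then \<Phi> ((I \<circ> ?s)(p := w)) else 0)" for z w
          unfolding upd using sum.permute[OF s, of "\<lambda>p. if (I \<circ> ?s) p = z then \<Phi> ((I \<circ> ?s)(p := w)) else 0"] by (simp add: comp_def)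
        have "\<forall>r<d. (I \<circ> ?s) r < n" using xy(4) sd by simp
        then show "(\<Sum>p<d. if I p = x then \<Phi> (I(p := y) \<circ> ?s) else 0) = (\<Sum>p<d. if I p = y then \<Phi> (I(p := x) \<circ> ?s) else 0)"
          unfolding e by (rule M_rot[OF m xy(1,2,3)])
      next
        fix I assume dn: "d = n" "\<forall>r<d. I r < n"
        let ?f = "\<lambda>\<pi>. of_int (sign \<pi>) * \<Phi> (I \<circ> \<pi>)"
        have "(\<Sum>\<pi> | \<pi> permutes {..<d}. of_int (sign \<pi>) * \<Phi> (I \<circ> \<pi> \<circ> ?s)) = (\<Sum>\<pi> | \<pi> permutes {..<d}. of_int (sign ?s) * ?f (\<pi> \<circ> ?s))"
        proof (intro sum.cong refl)
          fix \<pi> assume "\<pi> \<in> {\<pi>. \<pi> permutes {..<d}}"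
          then have "permutation \<pi>" by (auto intro: permutes_imp_permutation)
          then have "sign (\<pi> \<circ> ?s) = sign \<pi> * sign ?s" by (intro sign_compose permutation_swap_id)
          then have "of_int (sign ?s) * of_int (sign (\<pi> \<circ> ?s)) = (of_int (sign \<pi>) :: complex)"
            by (simp add: sign_swap_id)
          then show "of_int (sign \<pi>) * \<Phi> (I \<circ> \<pi> \<circ> ?s) = of_int (sign ?s) * ?f (\<pi> \<circ> ?s)" by (simp add: comp_assoc mult.assoc[symmetric])
        qed
        also have "\<dots> = of_int (sign ?s) * (\<Sum>\<pi> | \<pi> permutes {..<d}. ?f (\<pi> \<circ> ?s))" by (rule sum_distrib_left[symmetric])
        also have "(\<Sum>\<pi> | \<pi> permutes {..<d}. ?f (\<pi> \<circ> ?s)) = (\<Sum>\<pi> | \<pi> permutes {..<d}. ?f \<pi>)"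
          by (rule sum_permutations_compose_right[OF s, symmetric])
        also have "\<dots> = 0" by (rule M_alt[OF m dn])
        finally show "(\<Sum>\<pi> | \<pi> permutes {..<d}. of_int (sign \<pi>) * \<Phi> (I \<circ> \<pi> \<circ> ?s)) = 0" by (simp only: mult_zero_right)
      }
    qed
    show "(\<Sum>q\<in>{..<d} - {p}. \<Phi> (I \<circ> slot_swap p q)) = - (of_nat n - 1) * \<Phi> I"
      if m: "\<Phi> \<in> M" and p: "p < d" "\<forall>r<d. I r < n" for \<Phi> p I
      by (rule sum_transpose_from_rotation_invariance[OF M_trace[OF m] M_rot[OF m] p])
    show "\<Phi> I = 0" if m: "\<Phi> \<in> M" and dn: "d = n" and anti: "antisymmetric_in d n {..<d} \<Phi>" and I: "\<forall>r<d. I r < n" for \<Phi> I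
    proof -
      have "(\<Sum>\<pi> | \<pi> permutes {..<d}. of_int (sign \<pi>) * \<Phi> (I \<circ> \<pi>)) = (\<Sum>\<pi> | \<pi> permutes {..<d}. \<Phi> I)"
      proof (intro sum.cong refl)
        fix \<pi> assume "\<pi> \<in> {\<pi>. \<pi> permutes {..<d}}"
        then have "\<Phi> (I \<circ> \<pi>) = of_int (sign \<pi>) * \<Phi> I" by (intro antisymmetric_permute[OF anti _ I]) simp
        then show "of_int (sign \<pi>) * \<Phi> (I \<circ> \<pi>) = \<Phi> I" by (simp add: sign_def)
      qed
      also have "\<dots> = of_nat (fact d) * \<Phi> I" by (simp add: card_permutations[of "{..<d}" d])
      finally show ?thesis using M_alt[OF m dn I] by simp
    qed
    show "d > 0" by (rule d0)
    show "\<forall>r<d. I0 r < n" by (rule I0)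
    show "(\<lambda>I. F (fr a b) (\<lambda>r. cvec (c (I r)))) \<in> M"
    proof (rule M_I)
      show "(\<Sum>k<n. F (fr a b) (\<lambda>r. cvec (c ((I(p := k, q := k)) r)))) = 0" if "p < d" "q < d" "p \<noteq> q" "\<forall>r<d. I r < n" for I p q
        by (rule F_trace[OF o pf c that])
      show "(\<Sum>p<d. if I p = x then F (fr a b) (\<lambda>r. cvec (c ((I(p := y)) r))) else 0) = (\<Sum>p<d. if I p = y then F (fr a b) (\<lambda>r. cvec (c ((I(p := x)) r))) else 0)"
        if "x < n" "y < n" "x \<noteq> y" "\<forall>r<d. I r < n" for I x y
        by (rule rotation_invariance[OF k o pf c that])
      show "(\<Sum>\<pi> | \<pi> permutes {..<d}. of_int (sign \<pi>) * F (fr a b) (\<lambda>r. cvec (c ((I \<circ> \<pi>) r)))) = 0"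
        if dn: "d = n" and I: "\<forall>r<d. I r < n" for I
      proof -
        obtain i where "i < length lam" "lam ! i \<ge> 2" using big[OF dn] by blast
        from F_alternating[OF o c I sorted this] show ?thesis by (simp add: comp_def)
      qed
    qed
  qed
  then show ?thesis .
qed

end

section \<open>The zero section and the vanishing theorem\<close>

lemma tscale_tensor_null:
  assumes "r \<noteq> 0"
  shows "tscale r ` tensor_null d W R = tensor_null d W R"
proof (intro equalityI subsetI)
  fix T assume T: "T \<in> tensor_null d W R"
  have "T = tscale r (tscale (1 / r) T)" using assms by (simp add: tscale_def)
  then show "T \<in> tscale r ` tensor_null d W R" using tensor.subspace_scale[OF subspace_tensor_null T] by blast
qed (auto intro: tensor.subspace_scale[OF subspace_tensor_null])

lemma tensor_map_pure: "tensor_map M (pure v) = pure (map ((*v) M) v)"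
proof
  fix x
  show "tensor_map M (pure v) x = pure (map ((*v) M) v) x"
  proof (cases "length x = length v")
    case True
    then have "tensor_map M (pure v) x = (\<Sum>y | length y = length v. \<Prod>p<length v. M $ (x ! p) $ (y ! p) * v ! p $ (y ! p))"
      unfolding tensor_map_def pure_def by (intro sum.cong) (auto simp: prod.distrib)
    also have "\<dots> = (\<Prod>p<length v. \<Sum>a\<in>UNIV. M $ (x ! p) $ a * v ! p $ a)"
      by (rule sum_lists_prod_UNIV[where f = "\<lambda>p a. M $ (x ! p) $ a * v ! p $ a"])
    finally show ?thesis using True by (simp add: pure_def matrix_vector_mult_def)
  qed (simp add: tensor_map_def pure_def)
qed

text \<open>A left inverse of the matrix is needed to pull back the factor in \<open>R\<close> of a generator.\<close>

lemma tensor_map_null: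
  fixes M N :: "complex ^ 'm ^ 'm"
  assumes N: "\<And>w. N *v (M *v w) = w"
  shows "tensor_map M ` tensor_null d W R = tensor_null d ((*v) M ` W) ((*v) M ` R)"
proof -
  interpret module_hom tscale tscale "tensor_map M :: 'm tensor \<Rightarrow> 'm tensor"
    by (intro module_hom.intro tensor.module_axioms module_hom_axioms.intro)
       (simp_all add: tensor_map_def tscale_def fun_eq_iff distrib_left sum.distrib sum_distrib_left mult.left_commute)
  have "tensor_map M ` {pure v | v. length v = d \<and> set v \<subseteq> W \<and> set v \<inter> R \<noteq> {}}
      = {pure v | v. length v = d \<and> set v \<subseteq> (*v) M ` W \<and> set v \<inter> (*v) M ` R \<noteq> {}}" (is "_ ` ?X = ?Y")
  proof (intro equalityI subsetI)
    fix T assume "T \<in> tensor_map M ` ?X"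
    then obtain v where v: "T = tensor_map M (pure v)" "length v = d" "set v \<subseteq> W" "set v \<inter> R \<noteq> {}" by auto
    then have "T = pure (map ((*v) M) v)" by (simp add: tensor_map_pure)
    moreover have "length (map ((*v) M) v) = d" "set (map ((*v) M) v) \<subseteq> (*v) M ` W" "set (map ((*v) M) v) \<inter> (*v) M ` R \<noteq> {}"
      using v by auto
    ultimately show "T \<in> ?Y" by blast
  next
    fix T assume "T \<in> ?Y"
    then obtain v where v: "T = pure v" "length v = d" "set v \<subseteq> (*v) M ` W" "set v \<inter> (*v) M ` R \<noteq> {}" by auto
    define w where "w = map ((*v) N) v"
    have "map ((*v) M) w = v"
      unfolding w_def map_map by (rule map_idI) (use v(3) in \<open>auto simp: N\<close>)
    then have "T = tensor_map M (pure w)" by (simp add: v(1) tensor_map_pure)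
    moreover have "length w = d" "set w \<subseteq> W" using v(2,3) by (auto simp: w_def N)
    moreover have "set w \<inter> R \<noteq> {}"
    proof -
      obtain r where "r \<in> R" "M *v r \<in> set v" using v(4) by auto
      then have "r \<in> set w" unfolding w_def set_map using N by (metis imageI)
      then show ?thesis using \<open>r \<in> R\<close> by blast
    qed
    ultimately show "T \<in> tensor_map M ` ?X" by blast
  qed
  then show ?thesis unfolding tensor_null_def span_image[symmetric] by simp
qed

lemma young_c_zero: "young_c lam 0 = 0"
proof -
  have p: "tensor_perm \<sigma> 0 = 0" for \<sigma> by (simp add: tensor_perm_def fun_eq_iff)
  have a: "young_a lam 0 = 0" unfolding young_a_def p by (rule sum.neutral_const)
  show ?thesis unfolding young_c_def a young_b_def p by (simp add: tscale_def fun_eq_iff sum_fun_apply)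
qed

lemma zero_in_E_fibre: "tensor_coset (sum_list lam) (perp G l) l 0 \<in> E_fibre G lam l"
proof -
  have "0 \<in> traceless (cpx_gram G) (sum_list lam) (perp G l) l"
    unfolding traceless_def tensor_power_def
    by (auto simp: contraction_zero intro: tensor.span_zero tensor.subspace_0[OF subspace_tensor_null])
  then have "tensor_coset (sum_list lam) (perp G l) l (young_c lam 0) \<in> E_fibre G lam l"
    unfolding E_fibre_def orth_rep_def by (rule imageI)
  then show ?thesis by (simp only: young_c_zero)
qed

context type_IV
begin

lemma zero_section_at:
  assumes "over_D \<omega>"
  shows "zero_section G D lam (line \<omega>) \<omega> = tensor_null (sum_list lam) (perp G (line \<omega>)) (line \<omega>)"
  using assms by (simp add: zero_section_def over_D_def tensor_coset_zero)

lemma zero_section_modular: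
  assumes sg: "subgroup \<Gamma> (O_plus G D)"
  shows "zero_section G D lam \<in> modular_forms G D lam k \<Gamma>"
  unfolding modular_forms_def
proof (intro CollectI conjI ballI)
  show "zero_section G D lam \<in> (\<Pi>\<^sub>E l\<in>D. Ek_fibre G lam k l)"
  proof (intro PiE_I)
    fix l assume l: "l \<in> D"
    obtain \<omega>0 where \<omega>0: "over_D \<omega>0" "l = line \<omega>0" by (rule D_line_obtain[OF l])
    have z: "zero_section G D lam l = (\<lambda>\<omega>\<in>l - {0}. tensor_null (sum_list lam) (perp G l) l)"
      using l by (simp add: zero_section_def tensor_coset_zero)
    have n: "tensor_null (sum_list lam) (perp G l) l \<in> E_fibre G lam l"
      using zero_in_E_fibre by (simp only: tensor_coset_zero)
    have "t *s \<omega> \<in> l - {0}" if "\<omega> \<in> l - {0}" "t \<noteq> 0" for t \<omega>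
    proof -
      have "l = range (\<lambda>t. t *s \<omega>)" using D_lines(1)[OF l, of \<omega>] that by (simp only: line_eq) simp
      then show ?thesis using that by auto
    qed
    then show "zero_section G D lam l \<in> Ek_fibre G lam k l"
      unfolding Ek_fibre_def z using n by (auto simp: tscale_tensor_null)
  qed (simp add: zero_section_def)
  show "holomorphic_section G D lam (zero_section G D lam)"
    unfolding holomorphic_section_def
  proof (intro ballI exI conjI allI impI)
    show "holomorphic_several_on (\<lambda>\<omega>. (\<lambda>_. 0) \<omega> x) UNIV" for x :: "'m list"
      unfolding holomorphic_several_on_def by (intro ballI exI[of _ "\<lambda>_. 0"] conjI) auto
    show "(\<lambda>_. 0) \<omega> \<in> tensor_power (sum_list lam) (perp G l)" for \<omega> :: "complex ^ 'm" and l
      unfolding tensor_power_def by (rule tensor.span_zero)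
    show "zero_section G D lam l \<omega> = tensor_coset (sum_list lam) (perp G l) l ((\<lambda>_. 0) \<omega>)"
      if "l \<in> D" "\<omega> \<in> l - {0}" for l \<omega>
      using that by (simp add: zero_section_def)
  qed auto
  fix g l \<omega> assume g: "g \<in> \<Gamma>" and l: "l \<in> D" and \<omega>: "\<omega> \<in> l - {0}"
  have lo: "l = line \<omega>" "over_D \<omega>" using D_lines[OF l] \<omega> by auto
  note gO = O_plus_over_D[OF subsetD[OF subgroup.subset[OF sg] g] lo(2)]
  obtain h where h: "g ** h = mat 1" "h ** g = mat 1" using gO(1) by (auto simp: O_lattice_def invertible_def)
  have hg: "act h (act g v) = v" "act g (act h v) = v" for v by (simp_all add: h act_mult[symmetric])
  have e: "act g ` line \<omega> = line (act g \<omega>)" by (auto simp: line_eq act_scale image_image)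
  have p: "act g ` perp G (line \<omega>) = perp G (line (act g \<omega>))"
  proof (intro equalityI subsetI)
    fix v assume "v \<in> perp G (line (act g \<omega>))"
    then have "C (act g (act h v)) (act g \<omega>) = 0" by (simp add: perp_line hg)
    then have "act h v \<in> perp G (line \<omega>)" by (simp add: perp_line O_isometry[OF gO(1)])
    then show "v \<in> act g ` perp G (line \<omega>)" using hg(2) by (metis imageI)
  qed (auto simp: perp_line O_isometry[OF gO(1)])
  have "tensor_map (map_matrix of_int g) ` tensor_null (sum_list lam) (perp G (line \<omega>)) (line \<omega>)
      = tensor_null (sum_list lam) ((*v) (map_matrix of_int g) ` perp G (line \<omega>)) ((*v) (map_matrix of_int g) ` line \<omega>)"
    by (rule tensor_map_null[where N = "map_matrix of_int h"]) (use hg(1) in \<open>simp add: act_def\<close>)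
  also have "(*v) (map_matrix of_int g) = act g" by (simp add: act_def fun_eq_iff)
  finally show "zero_section G D lam (act g ` l) (act g \<omega>) = tensor_map (map_matrix of_int g) ` zero_section G D lam l \<omega>"
    unfolding lo(1) e p by (simp only: zero_section_at[OF lo(2)] zero_section_at[OF gO(2)])
qed

end

context modular_section
begin

text \<open>Every point of the cone is a multiple of some \<open>a + i b\<close>; off the cone, sections have the
  value \<open>undefined\<close>.\<close>

lemma section_eq_zero:
  assumes van: "\<And>a b c I. over_D (fr a b) \<Longrightarrow> pos_frame a b \<Longrightarrow> neg_basis a b c \<Longrightarrow> \<forall>p<d. I p < n
    \<Longrightarrow> F (fr a b) (\<lambda>p. cvec (c (I p))) = 0"
  shows "s = zero_section G D lam"
proof -
  have fibre: "s (line \<omega>) \<omega> = tensor_null d (perp G (line \<omega>)) (line \<omega>)" if \<omega>: "over_D \<omega>" for \<omega>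
  proof -
    obtain t a b where t: "t \<noteq> 0" "\<omega> = t *s fr a b" and ab: "pos_frame a b" "over_D (fr a b)"
      by (rule over_D_normal_form[OF \<omega>])
    obtain c where c: "neg_basis a b c" by (rule neg_basis_exists[OF ab(1)])
    have "s (line (fr a b)) (fr a b) = tensor_null d (perp G (line (fr a b))) (line (fr a b))"
      by (rule section_zero_at[OF ab(2,1) c van[OF ab(2,1) c]])
    then show ?thesis
      unfolding t(2) line_scale[OF t(1)] section_homogeneous[OF ab(2) t(1)] using t(1) by (simp add: tscale_tensor_null)
  qed
  have sE: "s \<in> (\<Pi>\<^sub>E l\<in>D. Ek_fibre G lam k l)" using s by (simp add: modular_forms_def)
  show ?thesis
  proof (rule ext, rule ext)
    fix l \<omega>
    show "s l \<omega> = zero_section G D lam l \<omega>"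
    proof (cases "l \<in> D")
      case l: True
      then have "s l \<in> Ek_fibre G lam k l" using sE by (rule PiE_mem[rotated])
      then have sl: "s l \<in> (l - {0}) \<rightarrow>\<^sub>E E_fibre G lam l" by (simp add: Ek_fibre_def)
      show ?thesis
      proof (cases "\<omega> \<in> l - {0}")
        case True
        then have "l = line \<omega>" "over_D \<omega>" using D_lines[OF l] by auto
        then show ?thesis using fibre zero_section_at by simp
      next
        case False
        then have "s l \<omega> = undefined" using sl by (rule PiE_arb[rotated])
        then show ?thesis using l False by (auto simp: zero_section_def)
      qed
    next
      case False
      then have "s l = undefined" using sE by (rule PiE_arb[rotated])
      then show ?thesis using False by (simp add: zero_section_def)
    qed
  qed
qed

text \<open>Only the first vector of the basis has to play the role of \<open>c\<close>; the others are orthogonal to the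
  disc.\<close>

lemma F_vanishes_negative_weight:
  assumes k: "k < 0" and o: "over_D (fr a b)" and pf: "pos_frame a b" and c: "neg_basis a b c" and I: "\<forall>p<d. I p < n"
  shows "F (fr a b) (\<lambda>p. cvec (c (I p))) = 0"
proof -
  define y where "y p = (if p < d \<and> I p \<noteq> 0 then c (I p) else 0)" for p
  have cb: "B (c r) a = 0" "B (c r) b = 0" "B (c r) (c q) = (if r = q then - 1 else 0)" if "r < n" "q < n" for r q
    using c that by (auto simp: neg_basis_def)
  have n0: "0 < n" using n3 by simp
  have f: "frame a b (c 0)" using pf cb[OF n0 n0] by (simp add: frame_def)
  have y: "orth_to a b (c 0) y" using I cb n0 by (simp add: orth_to_def y_def)
  have "F (fr a b) (\<lambda>p. cvec (c (I p))) = F (fr a b) (slots {p. I p = 0} (cvec (c 0)) y)"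
    by (rule F_cong) (simp add: slots_def y_def)
  then show ?thesis using F_all_frames(1)[OF f o y k] by simp
qed

end

theorem proposition4p4:
  fixes G :: "int ^ 'm ^ 'm" and n :: nat and D :: "(complex ^ 'm) set set"
    and \<Gamma> :: "(int ^ 'm ^ 'm) set" and lam :: "nat list"
  assumes "lattice_gram G"
    and "has_signature G 2 n"
    and "n \<ge> 3"
    and "type_IV_domain G D"
    and "subgroup \<Gamma> (O_plus G D)"
    and "finite (rcosets\<^bsub>O_plus G D\<^esub> \<Gamma>)"
    and "partition_of_length n lam"
    and "transposed lam 0 + transposed lam 1 \<le> n"
  shows "(\<forall>k::int. k < 0 \<longrightarrow> modular_forms G D lam k \<Gamma> = {zero_section G D lam})
       \<and> (lam \<noteq> replicate n 0 \<and> lam \<noteq> replicate n 1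
            \<longrightarrow> modular_forms G D lam 0 \<Gamma> = {zero_section G D lam})"
proof -
  interpret type_IV G n D using assms(1,2,4) by unfold_locales
  have sec: "modular_section G n D lam k \<Gamma> s" if "s \<in> modular_forms G D lam k \<Gamma>" for k s
    by (intro modular_section.intro type_IV_axioms modular_section_axioms.intro assms(3,5,6) that)
  show ?thesis
  proof (intro conjI allI impI)
    fix k :: int assume k: "k < 0"
    have "s = zero_section G D lam" if "s \<in> modular_forms G D lam k \<Gamma>" for s
    proof -
      interpret modular_section G n D lam k \<Gamma> s by (rule sec[OF that])
      show ?thesis by (rule section_eq_zero) (rule F_vanishes_negative_weight[OF k])
    qed
    then show "modular_forms G D lam k \<Gamma> = {zero_section G D lam}" using zero_section_modular[OF assms(5)] by blast
  next
    assume lam: "lam \<noteq> replicate n 0 \<and> lam \<noteq> replicate n 1"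
    have "s = zero_section G D lam" if "s \<in> modular_forms G D lam 0 \<Gamma>" for s
    proof -
      interpret modular_section G n D lam 0 \<Gamma> s by (rule sec[OF that])
      show ?thesis
        by (rule section_eq_zero) (rule F_vanishes_weight_0[OF refl _ _ _ assms(7) conjunct1[OF lam] conjunct2[OF lam]])
    qed
    then show "modular_forms G D lam 0 \<Gamma> = {zero_section G D lam}" using zero_section_modular[OF assms(5)] by blast
  qed
qed

end
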